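(* Assume that the coefficients satisfy assumptions (i)-(v) and that the space $\mathcal V$ satisfies assumptions (a)-(b), all listed in the context. Then a strongly continuous analytic semigroup $(\boldsymbol T_2(t))_{t\ge0}$ in $L^2(\Omega;\mathbb C^m)$ can be associated with the form $\mathfrak a$ (i.e., $-\boldsymbol{\mathcal A}_{\mathcal V}$ generates such a semigroup, where $\boldsymbol{\mathcal A}_{\mathcal V}$ is the operator associated with $\mathfrak a$), and it satisfies $$\|\boldsymbol T_2(t)\|_{\mathcal L(L^2(\Omega;\mathbb C^m))}\le e^{C_\gamma\left(\kappa_W+\frac{(\kappa_B+\kappa_C)^2}{4}\right)t},\qquad t\in[0,\infty).$$
   Context: Notation. $\Omega\subseteq\mathbb R^d$ is an open set, $d,m\in\mathbb N$. $(\cdot,\cdot)$ and $|\cdot|$ are the Euclidean (Hermitian, linear in the first entry) inner product and norm on $\mathbb R^n$ or $\mathbb C^n$. For a real square matrix $M$, $M_S=\frac12(M+M^T)$; for a symmetric matrix $M$, $\lambda_M$ is its minimum eigenvalue. For a $d\times d$ matrix $Q=(q_{hk})$ and $\theta^1,\dots,\theta^d\in\mathbb C^m$, $\mathcal Q(\theta^1,\dots,\theta^d)=\sum_{i=1}^m\sum_{h,k=1}^d q_{hk}\theta^k_i\overline{\theta^h_i}$. $\operatorname{sign}\boldsymbol u=|\boldsymbol u|^{-1}\boldsymbol u\,\chi_{\{\boldsymbol u\ne 0\}}$, $a\wedge b=\min\{a,b\}$. Assumptions on the coefficients: (i) $Q=(q_{hk})_{h,k=1}^d$ is a real matrix-valued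 function with $q_{hk}\in L^\infty_{\rm loc}(\Omega)$; $Q(x)$ is symmetric for a.e. $x\in\Omega$, and $\lambda_Q:\Omega\to(0,\infty)$ has strictly positive essential infimum on compact subsets of $\Omega$. (ii) $V\in L^\infty_{\rm loc}(\Omega;\mathbb R^{m\times m})$, $v_0:=\operatorname{ess\,inf}_{x\in\Omega}\lambda_{V_S(x)}>0$, and there is $c_0>0$ such that $|\operatorname{Im}(V\xi,\xi)|\le c_0\operatorname{Re}(V\xi,\xi)$ for every $\xi\in\mathbb C^m$, a.e. in $\Omega$. (iii) $A^{hk}\in L^\infty_{\rm loc}(\Omega;\mathbb R^{m\times m})$ ($h,k=1,\dots,d$) and there is a positive constant $\kappa_A$ such that $0\le\operatorname{Re}\sum_{h,k}(A^{hk}\theta^k,\theta^h)\le\kappa_A\mathcal Q(\theta^1,\dots,\theta^d)$ and $|\operatorname{Im}\sum_{h,k}(A^{hk}\theta^k,\theta^h)|\le\kappa_A\mathcal Q(\theta^1,\dots,\theta^d)$ for all $\theta^1,\dots,\theta^d\in\mathbb C^m$, a.e. in $\Omega$. (iv) $B^h,C^h$ ($h=1,\dots,d$) and $W$ belong to $L^\infty_{\rm loc}(\Omega;\mathbb R^{m\times m})$ and there are constants $\kappa_B,\kappa_C,\kappa_W\ge 0$ and $\gamma,C_\gamma>0$ such that, a.e. in $\Omega$ and for all $\theta^1,\dots,\theta^d,\xi,\eta\in\mathbb C^m$, $|\sum_h(B^h\theta^h,\eta)|\le\kappa_B\,\mathcal Q(\theta^1,\dots,\theta^d)^{1/2}(\gamma(V_S\eta,\eta)+C_\gamma|\eta|^2)^{1/2}$,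 $|\sum_h(C^h\eta,\theta^h)|\le\kappa_C\,\mathcal Q(\theta^1,\dots,\theta^d)^{1/2}(\gamma(V_S\eta,\eta)+C_\gamma|\eta|^2)^{1/2}$, $|(W\xi,\eta)|\le\kappa_W(\gamma(V_S\xi,\xi)+C_\gamma|\xi|^2)^{1/2}(\gamma(V_S\eta,\eta)+C_\gamma|\eta|^2)^{1/2}$. (v) $K:=4\left(\frac1\gamma-\kappa_W\right)-(\kappa_B+\kappa_C)^2>0$. The space $D_{Q,V}$ is the set of $\boldsymbol u\in W^{1,2}_{\rm loc}(\Omega;\mathbb C^m)$ such that $\boldsymbol u,V_S^{1/2}\boldsymbol u\in L^2(\Omega;\mathbb C^m)$ and $Q^{1/2}\nabla u_i\in L^2(\Omega;\mathbb C^d)$ for $i=1,\dots,m$, with inner product $\langle\boldsymbol u,\boldsymbol v\rangle_{Q,V}=\int_\Omega[\sum_{i=1}^m(Q\nabla u_i,\nabla v_i)+(V_S\boldsymbol u,\boldsymbol v)]dx$. Assumptions on $\mathcal V$: (a) $\mathcal V$ is a closed subspace of $D_{Q,V}$ containing $C_c^\infty(\Omega;\mathbb C^m)$; (b) for every $\boldsymbol u\in\mathcal V$, $(1\wedge|\boldsymbol u|)\operatorname{sign}\boldsymbol u\in\mathcal V$. The form: for $\boldsymbol u,\boldsymbol v\in\mathcal V$, with $Q^{hk}=q_{hk}I+A^{hk}$, $$\mathfrak a(\boldsymbol u,\boldsymbol v)=\int_\Omega\Big[\sum_{h,k=1}^d(Q^{hk}D_k\boldsymbol u,D_h\boldsymbol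 v)+\sum_{h=1}^d[(B^hD_h\boldsymbol u,\boldsymbol v)+(C^h\boldsymbol u,D_h\boldsymbol v)]+((V+W)\boldsymbol u,\boldsymbol v)\Big]dx.$$ The operator $\boldsymbol{\mathcal A}_{\mathcal V}$ associated with $\mathfrak a$ has domain the set of $\boldsymbol u\in\mathcal V$ for which there is $\boldsymbol w\in L^2(\Omega;\mathbb C^m)$ with $\int_\Omega(\boldsymbol w,\boldsymbol\varphi)dx=\mathfrak a(\boldsymbol u,\boldsymbol\varphi)$ for all $\boldsymbol\varphi\in\mathcal V$, and $\boldsymbol{\mathcal A}_{\mathcal V}\boldsymbol u=\boldsymbol w$. *)

theory Defs
  imports "HOL-Analysis.Analysis" "HOL-Probability.Essential_Supremum"
begin

section \<open>Linear algebra\<close>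

definition cinner :: "complex^'n \<Rightarrow> complex^'n \<Rightarrow> complex" where
  "cinner x y = (\<Sum>i\<in>UNIV. x $ i * cnj (y $ i))"

text \<open>A real matrix, viewed as acting on complex vectors.\<close>

definition cmat :: "real^'n^'m \<Rightarrow> complex^'n^'m" where
  "cmat M = map_matrix complex_of_real M"

definition sym_part :: "real^'n^'n \<Rightarrow> real^'n^'n" where
  "sym_part M = (1/2) *\<^sub>R (M + transpose M)"

text \<open>Meaningful for symmetric matrices only, for which the set of real eigenvalues is
  finite and nonempty.\<close>

definition min_eigenvalue :: "real^'n^'n \<Rightarrow> real" where
  "min_eigenvalue M = Min {\<mu>. \<exists>x. x \<noteq> 0 \<and> M *v x = \<mu> *s x}"

text \<open>The positive semidefinite square root, which exists and is unique for positive
  semidefinite symmetric matrices; unspecified for all others.\<close>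

definition mat_sqrt :: "real^'n^'n \<Rightarrow> real^'n^'n" where
  "mat_sqrt M = (SOME R. transpose R = R \<and> (\<forall>x. 0 \<le> x \<bullet> (R *v x)) \<and> R ** R = M)"

text \<open>The form \<open>\<Sum>\<^sub>i \<Sum>\<^sub>h\<^sub>k q\<^sub>h\<^sub>k \<theta>\<^sup>k\<^sub>i cnj \<theta>\<^sup>h\<^sub>i\<close>; its value is real when the matrix is symmetric.\<close>

definition qform :: "real^'d^'d \<Rightarrow> ('d \<Rightarrow> complex^'m) \<Rightarrow> complex" where
  "qform M \<theta> = (\<Sum>i\<in>UNIV. \<Sum>h\<in>UNIV. \<Sum>k\<in>UNIV.
      complex_of_real (M $ h $ k) * \<theta> k $ i * cnj (\<theta> h $ i))"

section \<open>Function spaces\<close>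

text \<open>Functions on an open set \<open>\<Omega>\<close> are total functions of which only the values on \<open>\<Omega>\<close> matter.
  Elements of Lebesgue and Sobolev spaces are represented by functions rather than by
  classes modulo equality almost everywhere; the sets representing them are saturated
  with respect to that equality.\<close>

definition ess_inf :: "'a measure \<Rightarrow> ('a \<Rightarrow> real) \<Rightarrow> ereal" where
  "ess_inf M f = - esssup M (\<lambda>x. - ereal (f x))"

definition L2 :: "'a::euclidean_space set \<Rightarrow> ('a \<Rightarrow> 'b::euclidean_space) set" where
  "L2 \<Omega> = {f. f \<in> borel_measurable (lebesgue_on \<Omega>) \<and>
              integrable (lebesgue_on \<Omega>) (\<lambda>x. (norm (f x))\<^sup>2)}"

definition L2_norm :: "'a::euclidean_space set \<Rightarrow> ('a \<Rightarrow> 'b::euclidean_space) \<Rightarrow> real" where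
  "L2_norm \<Omega> f = sqrt (\<integral>x. (norm (f x))\<^sup>2 \<partial>lebesgue_on \<Omega>)"

definition L1_loc :: "'a::euclidean_space set \<Rightarrow> ('a \<Rightarrow> 'b::euclidean_space) set" where
  "L1_loc \<Omega> = {f. \<forall>K. compact K \<and> K \<subseteq> \<Omega> \<longrightarrow> integrable (lebesgue_on K) f}"

definition L2_loc :: "'a::euclidean_space set \<Rightarrow> ('a \<Rightarrow> 'b::euclidean_space) set" where
  "L2_loc \<Omega> = {f. \<forall>K. compact K \<and> K \<subseteq> \<Omega> \<longrightarrow> f \<in> L2 K}"

definition Linf_loc :: "'a::euclidean_space set \<Rightarrow> ('a \<Rightarrow> 'b::euclidean_space) set" where
  "Linf_loc \<Omega> = {f. f \<in> borel_measurable (lebesgue_on \<Omega>) \<and>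
     (\<forall>K. compact K \<and> K \<subseteq> \<Omega> \<longrightarrow> (\<exists>c. AE x in lebesgue_on K. norm (f x) \<le> c))}"

definition pdiff :: "'d \<Rightarrow> (real^'d \<Rightarrow> 'b::real_normed_vector) \<Rightarrow> real^'d \<Rightarrow> 'b" where
  "pdiff h f x = frechet_derivative f (at x) (axis h 1)"

text \<open>\<open>C\<^sup>\<infinity>\<close> on the whole space: every iterated partial derivative exists and is again
  (Frechet) differentiable, in particular continuous.\<close>

definition smooth :: "(real^'d \<Rightarrow> 'b::real_normed_vector) \<Rightarrow> bool" where
  "smooth f \<longleftrightarrow> (\<forall>hs :: 'd list. fold pdiff hs f differentiable_on UNIV)"

text \<open>\<open>C\<^sub>c\<^sup>\<infinity>(\<Omega>)\<close>, its elements being extended by zero outside \<open>\<Omega>\<close>.\<close>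

definition test_functions :: "(real^'d) set \<Rightarrow> (real^'d \<Rightarrow> 'b::real_normed_vector) set" where
  "test_functions \<Omega> = {\<phi>. smooth \<phi> \<and> compact (closure {x. \<phi> x \<noteq> 0}) \<and>
                            closure {x. \<phi> x \<noteq> 0} \<subseteq> \<Omega>}"

definition has_weak_pdiff ::
    "(real^'d) set \<Rightarrow> 'd \<Rightarrow> (real^'d \<Rightarrow> 'b::euclidean_space) \<Rightarrow> (real^'d \<Rightarrow> 'b) \<Rightarrow> bool" where
  "has_weak_pdiff \<Omega> h u g \<longleftrightarrow> u \<in> L1_loc \<Omega> \<and> g \<in> L1_loc \<Omega> \<and>
     (\<forall>\<phi> :: real^'d \<Rightarrow> real. \<phi> \<in> test_functions \<Omega> \<longrightarrow>
        (\<integral>x. pdiff h \<phi> x *\<^sub>R u x \<partial>lebesgue_on \<Omega>) = - (\<integral>x. \<phi> x *\<^sub>R g x \<partial>lebesgue_on \<Omega>))"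

text \<open>A representative of the weak derivative \<open>D\<^sub>h u\<close>, which is unique almost everywhere in \<open>\<Omega>\<close>.\<close>

definition wpdiff ::
    "(real^'d) set \<Rightarrow> 'd \<Rightarrow> (real^'d \<Rightarrow> 'b::euclidean_space) \<Rightarrow> real^'d \<Rightarrow> 'b" where
  "wpdiff \<Omega> h u = (SOME g. has_weak_pdiff \<Omega> h u g)"

definition W12_loc :: "(real^'d) set \<Rightarrow> (real^'d \<Rightarrow> 'b::euclidean_space) set" where
  "W12_loc \<Omega> = {u. u \<in> L2_loc \<Omega> \<and> (\<forall>h. \<exists>g. g \<in> L2_loc \<Omega> \<and> has_weak_pdiff \<Omega> h u g)}"

text \<open>The gradient of the \<open>i\<close>-th component.\<close>

definition wgrad :: "(real^'d) set \<Rightarrow> (real^'d \<Rightarrow> complex^'m) \<Rightarrow> 'm \<Rightarrow> real^'d \<Rightarrow> complex^'d" where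
  "wgrad \<Omega> u i x = (\<chi> h. wpdiff \<Omega> h u x $ i)"

definition D_QV :: "(real^'d) set \<Rightarrow> (real^'d \<Rightarrow> real^'d^'d) \<Rightarrow> (real^'d \<Rightarrow> real^'m^'m) \<Rightarrow>
    (real^'d \<Rightarrow> complex^'m) set" where
  "D_QV \<Omega> Q V = {u. u \<in> W12_loc \<Omega> \<and> u \<in> L2 \<Omega> \<and>
      (\<lambda>x. cmat (mat_sqrt (sym_part (V x))) *v u x) \<in> L2 \<Omega> \<and>
      (\<forall>i. (\<lambda>x. cmat (mat_sqrt (Q x)) *v wgrad \<Omega> u i x) \<in> L2 \<Omega>)}"

definition inner_QV :: "(real^'d) set \<Rightarrow> (real^'d \<Rightarrow> real^'d^'d) \<Rightarrow> (real^'d \<Rightarrow> real^'m^'m) \<Rightarrow>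
    (real^'d \<Rightarrow> complex^'m) \<Rightarrow> (real^'d \<Rightarrow> complex^'m) \<Rightarrow> complex" where
  "inner_QV \<Omega> Q V u v =
     (\<integral>x. (\<Sum>i\<in>UNIV. cinner (cmat (Q x) *v wgrad \<Omega> u i x) (wgrad \<Omega> v i x))
         + cinner (cmat (sym_part (V x)) *v u x) (v x) \<partial>lebesgue_on \<Omega>)"

definition norm_QV :: "(real^'d) set \<Rightarrow> (real^'d \<Rightarrow> real^'d^'d) \<Rightarrow> (real^'d \<Rightarrow> real^'m^'m) \<Rightarrow>
    (real^'d \<Rightarrow> complex^'m) \<Rightarrow> real" where
  "norm_QV \<Omega> Q V u = sqrt (Re (inner_QV \<Omega> Q V u u))"

text \<open>Closedness makes such a set saturated with respect to equality almost everywhere in \<open>\<Omega>\<close>.\<close>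

definition closed_subspace_QV :: "(real^'d) set \<Rightarrow> (real^'d \<Rightarrow> real^'d^'d) \<Rightarrow>
    (real^'d \<Rightarrow> real^'m^'m) \<Rightarrow> (real^'d \<Rightarrow> complex^'m) set \<Rightarrow> bool" where
  "closed_subspace_QV \<Omega> Q V \<V> \<longleftrightarrow>
     \<V> \<subseteq> D_QV \<Omega> Q V \<and>
     (\<lambda>x. 0) \<in> \<V> \<and>
     (\<forall>u\<in>\<V>. \<forall>v\<in>\<V>. (\<lambda>x. u x + v x) \<in> \<V>) \<and>
     (\<forall>c. \<forall>u\<in>\<V>. (\<lambda>x. c *s u x) \<in> \<V>) \<and>
     (\<forall>us u. (\<forall>n::nat. us n \<in> \<V>) \<and> u \<in> D_QV \<Omega> Q V \<and>
        (\<lambda>n. norm_QV \<Omega> Q V (\<lambda>x. us n x - u x)) \<longlonglongrightarrow> 0 \<longrightarrow> u \<in> \<V>)"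

section \<open>The form and the associated operator\<close>

definition form_a :: "(real^'d) set \<Rightarrow> (real^'d \<Rightarrow> real^'d^'d) \<Rightarrow>
    ('d \<Rightarrow> 'd \<Rightarrow> real^'d \<Rightarrow> real^'m^'m) \<Rightarrow>
    ('d \<Rightarrow> real^'d \<Rightarrow> real^'m^'m) \<Rightarrow> ('d \<Rightarrow> real^'d \<Rightarrow> real^'m^'m) \<Rightarrow>
    (real^'d \<Rightarrow> real^'m^'m) \<Rightarrow> (real^'d \<Rightarrow> real^'m^'m) \<Rightarrow>
    (real^'d \<Rightarrow> complex^'m) \<Rightarrow> (real^'d \<Rightarrow> complex^'m) \<Rightarrow> complex" where
  "form_a \<Omega> Q A B C V W u v =
     (\<integral>x. (\<Sum>h\<in>UNIV. \<Sum>k\<in>UNIV.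
             cinner (cmat (mat (Q x $ h $ k) + A h k x) *v wpdiff \<Omega> k u x) (wpdiff \<Omega> h v x))
         + (\<Sum>h\<in>UNIV. cinner (cmat (B h x) *v wpdiff \<Omega> h u x) (v x)
                    + cinner (cmat (C h x) *v u x) (wpdiff \<Omega> h v x))
         + cinner (cmat (V x + W x) *v u x) (v x) \<partial>lebesgue_on \<Omega>)"

text \<open>The graph of the operator in \<open>L\<^sup>2(\<Omega>;\<complex>\<^sup>m)\<close> associated with a form \<open>a\<close> with domain \<open>\<V>\<close>.\<close>

definition form_operator :: "(real^'d) set \<Rightarrow> (real^'d \<Rightarrow> complex^'m) set \<Rightarrow>
    ((real^'d \<Rightarrow> complex^'m) \<Rightarrow> (real^'d \<Rightarrow> complex^'m) \<Rightarrow> complex) \<Rightarrow>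
    ((real^'d \<Rightarrow> complex^'m) \<times> (real^'d \<Rightarrow> complex^'m)) set" where
  "form_operator \<Omega> \<V> a = {(u, w). u \<in> \<V> \<and> w \<in> L2 \<Omega> \<and>
     (\<forall>\<phi>\<in>\<V>. (\<integral>x. cinner (w x) (\<phi> x) \<partial>lebesgue_on \<Omega>) = a u \<phi>)}"

section \<open>Semigroups in \<open>L\<^sup>2(\<Omega>;\<complex>\<^sup>m)\<close>\<close>

text \<open>Operators act on representatives. Being linear almost everywhere and bounded, the operators
  below map functions that agree almost everywhere in \<open>\<Omega>\<close> to functions that agree almost
  everywhere in \<open>\<Omega>\<close>.\<close>

definition bounded_op :: "(real^'d) set \<Rightarrow> ((real^'d \<Rightarrow> complex^'m) \<Rightarrow> (real^'d \<Rightarrow> complex^'m)) \<Rightarrow> bool" where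
  "bounded_op \<Omega> T \<longleftrightarrow>
     (\<forall>f\<in>L2 \<Omega>. T f \<in> L2 \<Omega>) \<and>
     (\<forall>f\<in>L2 \<Omega>. \<forall>g\<in>L2 \<Omega>. AE x in lebesgue_on \<Omega>. T (\<lambda>y. f y + g y) x = T f x + T g x) \<and>
     (\<forall>c. \<forall>f\<in>L2 \<Omega>. AE x in lebesgue_on \<Omega>. T (\<lambda>y. c *s f y) x = c *s T f x) \<and>
     (\<exists>M. \<forall>f\<in>L2 \<Omega>. L2_norm \<Omega> (T f) \<le> M * L2_norm \<Omega> f)"

definition op_norm :: "(real^'d) set \<Rightarrow> ((real^'d \<Rightarrow> complex^'m) \<Rightarrow> (real^'d \<Rightarrow> complex^'m)) \<Rightarrow> real" where
  "op_norm \<Omega> T = Sup {L2_norm \<Omega> (T f) | f. f \<in> L2 \<Omega> \<and> L2_norm \<Omega> f \<le> 1}"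

definition C0_semigroup ::
    "(real^'d) set \<Rightarrow> (real \<Rightarrow> (real^'d \<Rightarrow> complex^'m) \<Rightarrow> (real^'d \<Rightarrow> complex^'m)) \<Rightarrow> bool" where
  "C0_semigroup \<Omega> T \<longleftrightarrow>
     (\<forall>t\<ge>0. bounded_op \<Omega> (T t)) \<and>
     (\<forall>f\<in>L2 \<Omega>. AE x in lebesgue_on \<Omega>. T 0 f x = f x) \<and>
     (\<forall>s\<ge>0. \<forall>t\<ge>0. \<forall>f\<in>L2 \<Omega>. AE x in lebesgue_on \<Omega>. T (s + t) f x = T s (T t f) x) \<and>
     (\<forall>f\<in>L2 \<Omega>. \<forall>t\<ge>0. ((\<lambda>s. L2_norm \<Omega> (\<lambda>x. T s f x - T t f x)) \<longlongrightarrow> 0) (at t within {0..}))"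

text \<open>The graph of the infinitesimal generator.\<close>

definition generator ::
    "(real^'d) set \<Rightarrow> (real \<Rightarrow> (real^'d \<Rightarrow> complex^'m) \<Rightarrow> (real^'d \<Rightarrow> complex^'m)) \<Rightarrow>
     ((real^'d \<Rightarrow> complex^'m) \<times> (real^'d \<Rightarrow> complex^'m)) set" where
  "generator \<Omega> T = {(u, w). u \<in> L2 \<Omega> \<and> w \<in> L2 \<Omega> \<and>
     ((\<lambda>t. L2_norm \<Omega> (\<lambda>x. (1 / t) *\<^sub>R (T t u x - u x) - w x)) \<longlongrightarrow> 0) (at_right 0)}"

definition sector :: "real \<Rightarrow> complex set" where
  "sector \<theta> = {z. z \<noteq> 0 \<and> \<bar>Arg z\<bar> < \<theta>}"

text \<open>A semigroup is analytic if it extends to a family of bounded operators on a sector that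
  satisfies the semigroup law, is holomorphic in the operator norm, and
  converges strongly to the identity at \<open>0\<close> within every smaller sector.\<close>

definition analytic_semigroup ::
    "(real^'d) set \<Rightarrow> (real \<Rightarrow> (real^'d \<Rightarrow> complex^'m) \<Rightarrow> (real^'d \<Rightarrow> complex^'m)) \<Rightarrow> bool" where
  "analytic_semigroup \<Omega> T \<longleftrightarrow>
     (\<exists>\<theta> S. 0 < \<theta> \<and> \<theta> \<le> pi / 2 \<and>
       (\<forall>t\<ge>0. \<forall>f\<in>L2 \<Omega>. AE x in lebesgue_on \<Omega>. S (complex_of_real t) f x = T t f x) \<and>
       (\<forall>z\<in>insert 0 (sector \<theta>). bounded_op \<Omega> (S z)) \<and>
       (\<forall>z\<in>insert 0 (sector \<theta>). \<forall>w\<in>insert 0 (sector \<theta>). \<forall>f\<in>L2 \<Omega>.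
          AE x in lebesgue_on \<Omega>. S (z + w) f x = S z (S w f) x) \<and>
       (\<forall>z\<in>sector \<theta>. \<exists>D. bounded_op \<Omega> D \<and>
          ((\<lambda>w. op_norm \<Omega> (\<lambda>f x. (1 / (w - z)) *s (S w f x - S z f x) - D f x)) \<longlongrightarrow> 0) (at z)) \<and>
       (\<forall>\<theta>'. 0 < \<theta>' \<and> \<theta>' < \<theta> \<longrightarrow> (\<forall>f\<in>L2 \<Omega>.
          ((\<lambda>z. L2_norm \<Omega> (\<lambda>x. S z f x - f x)) \<longlongrightarrow> 0) (at 0 within sector \<theta>'))))"

end

theory Submission
  imports Defs "HOL-Complex_Analysis.Cauchy_Integral_Formula"
begin

text \<open>After the shift by \<open>\<omega> = C\<^sub>\<gamma> (\<kappa>\<^sub>W + (\<kappa>\<^sub>B + \<kappa>\<^sub>C)\<^sup>2 / 4)\<close> the form is coercive: Young's inequality absorbs the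
  terms with \<open>B\<close>, \<open>C\<close>, \<open>W\<close> into \<open>Q\<close> and \<open>V\<close>, with room to spare because \<open>K > 0\<close>. Its imaginary part is
  dominated by \<open>\<mu>\<close> times its real part, so the shifted operator \<open>\<B>\<close> satisfies
  \<open>Re (z \<B>u, u) \<ge> 0\<close> for all \<open>z\<close> with \<open>\<mu> \<bar>Im z\<bar> < Re z\<close>. The map
  \<open>u \<mapsto> (u, V\<^sub>S\<^sup>1\<^sup>/\<^sup>2 u, Q\<^sup>1\<^sup>/\<^sup>2 \<nabla>u)\<close> identifies the form domain with a closed subspace of an \<open>L\<^sup>2\<close> space,
  where the Lax--Milgram theorem shows that \<open>1 + z \<B>\<close> is onto; its inverse \<open>F z\<close> is a contraction.
  The powers \<open>(F (z / 2\<^sup>k))\<close> to the exponent \<open>2\<^sup>k\<close> converge to a holomorphic contraction semigroup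
  on the sector (Euler's exponential formula), and multiplication by \<open>e\<^sup>\<omega>\<^sup>z\<close> undoes the shift.\<close>

section \<open>Lax--Milgram in a real Hilbert space\<close>

text \<open>The obstacle is degeneracy. \<open>min_eigenvalue (Q x)\<close> is bounded away from 0
  only on compact subsets of \<Omega>, and the coefficients are bounded only locally, so the form
  cannot be compared with a Sobolev norm on \<Omega>. It is compared with the energy density
  pointwise, by finite-dimensional algebra, and integrated afterwards. Gradients are recovered from
  the energy only almost everywhere and locally in L2, which still suffices for closedness of the
  embedded form domain. The shift is what completing the square leaves over. If q and v are the
  Q-part and the V-part of the energy density, then with s =
  \<open>\<kappa>\<^sub>B + \<kappa>\<^sub>C\<close> and P = \<open>\<gamma>\<close> v +
  \<open>C\<^sub>\<gamma>\<close> |u|^2 one has s sqrt(q P) <= q + s^2 P / 4. The v in P is absorbed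
  because K > 0; the coefficient of |u|^2 that remains is exactly \<open>\<omega>\<close>. Dyadic
  exponents make Euler's formula converge geometrically. Two resolvent steps h and one step 2h
  differ by O(|h|^2) on the domain of the squared operator, and 2^k such errors add up to
  O(2^-k).\<close>

lemma riesz_on_closed_subspace:
  fixes S :: "'a::{real_inner,complete_space} set" and l :: "'a \<Rightarrow> real"
  assumes S: "subspace S" "closed S"
    and add: "\<And>x y. x \<in> S \<Longrightarrow> y \<in> S \<Longrightarrow> l (x + y) = l x + l y"
    and scale: "\<And>r x. x \<in> S \<Longrightarrow> l (r *\<^sub>R x) = r * l x"
    and bound: "\<And>x. x \<in> S \<Longrightarrow> \<bar>l x\<bar> \<le> C * norm x"
  obtains u where "u \<in> S" "\<And>x. x \<in> S \<Longrightarrow> inner u x = l x"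
proof -
  \<comment> \<open>If u represents l, then J x = |x - u|^2 - |u|^2, so the representing vector can
    only be the minimiser of J over S.\<close>
  define J where "J x = (norm x)\<^sup>2 - 2 * l x" for x
  have J_lower: "J x \<ge> - C\<^sup>2" if "x \<in> S" for x
  proof -
    have "0 \<le> (norm x - C)\<^sup>2" by simp
    then have "2 * (C * norm x) \<le> (norm x)\<^sup>2 + C\<^sup>2"
      by (simp add: power2_diff algebra_simps)
    then show ?thesis using bound[OF that] unfolding J_def by linarith
  qed
  define m where "m = Inf (J ` S)"
  have "0 \<in> S" using S by (simp add: subspace_0)
  have bdd: "bdd_below (J ` S)" by (rule bdd_belowI[of _ "- C\<^sup>2"]) (use J_lower in auto)
  have m_le: "m \<le> J x" if "x \<in> S" for x
    unfolding m_def using that bdd by (auto intro: cInf_lower)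
  have "\<exists>x\<in>S. J x < m + 1 / real (Suc n)" for n
  proof -
    have "Inf (J ` S) < m + 1 / real (Suc n)" by (simp add: m_def)
    then show ?thesis
      using cInf_lessD[of "J ` S"] \<open>0 \<in> S\<close> by blast
  qed
  then obtain X where X: "\<And>n. X n \<in> S" "\<And>n. J (X n) < m + 1 / real (Suc n)"
    by metis
  \<comment> \<open>The midpoint of x and y lies in S, so J there is at least m. With the
    parallelogram law this bounds |x - y| by the excess of J over m, and a minimising sequence is
    Cauchy.\<close>
  have parallelogram: "(norm (x - y))\<^sup>2 \<le> 2 * (J x - m) + 2 * (J y - m)" if "x \<in> S" "y \<in> S" for x y
  proof -
    define z where "z = (1/2) *\<^sub>R (x + y)"
    have mid: "z \<in> S" unfolding z_def using S that by (simp add: subspace_add subspace_scale)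
    have "l z = (l x + l y) / 2"
      using add[OF that] scale[of "x + y" "1/2"] S that by (simp add: z_def subspace_add)
    moreover have "4 * (norm z)\<^sup>2 = (norm (x + y))\<^sup>2"
      by (simp add: z_def power_divide)
    moreover have "(norm (x + y))\<^sup>2 + (norm (x - y))\<^sup>2 = 2 * (norm x)\<^sup>2 + 2 * (norm y)\<^sup>2"
      by (simp add: power2_norm_eq_inner inner_add_left inner_add_right inner_diff_left inner_diff_right)
    ultimately have "(norm (x - y))\<^sup>2 = 2 * J x + 2 * J y - 4 * J z"
      unfolding J_def by (simp add: algebra_simps)
    then show ?thesis using m_le[OF mid] by (simp add: algebra_simps)
  qed
  have "Cauchy X"
  proof (rule CauchyI)
    fix e :: real assume "e > 0"
    obtain N where N: "4 / e\<^sup>2 < real N" using reals_Archimedean2 by blast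
    have "norm (X i - X j) < e" if "i \<ge> N" "j \<ge> N" for i j
    proof -
      have "real N > 0" using N \<open>e > 0\<close> by (smt (verit) divide_nonneg_nonneg zero_le_power2)
      have "(norm (X i - X j))\<^sup>2 \<le> 2 * (1 / real (Suc i)) + 2 * (1 / real (Suc j))"
        using parallelogram[OF X(1) X(1), of i j] X(2)[of i] X(2)[of j] by (smt (verit))
      also have "\<dots> \<le> 2 * (1 / real N) + 2 * (1 / real N)"
        using that \<open>real N > 0\<close> by (intro add_mono mult_left_mono divide_left_mono) auto
      also have "\<dots> = 4 / real N" by simp
      also have "\<dots> < e\<^sup>2"
        using N \<open>real N > 0\<close> \<open>e > 0\<close> by (simp add: field_simps)
      finally show ?thesis using \<open>e > 0\<close> by (simp add: power_less_imp_less_base)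
    qed
    then show "\<exists>M. \<forall>m\<ge>M. \<forall>n\<ge>M. norm (X m - X n) < e" by blast
  qed
  then obtain u where u: "X \<longlonglongrightarrow> u"
    using Cauchy_convergent_iff convergent_def by blast
  have uS: "u \<in> S"
    using S(2) X(1) u closed_sequentially by blast
  have Ju: "J u \<le> m"
  proof -
    have "(\<lambda>n. l (X n)) \<longlonglongrightarrow> l u"
    proof (rule Lim_null_comparison[THEN LIM_zero_cancel])
      show "\<forall>\<^sub>F n in sequentially. norm (l (X n) - l u) \<le> \<bar>C\<bar> * norm (X n - u)"
      proof (rule always_eventually, rule allI)
        fix n
        have "l (X n) = l (X n - u) + l u"
          using add[of "X n - u" u] S X uS by (simp add: subspace_diff)
        then show "norm (l (X n) - l u) \<le> \<bar>C\<bar> * norm (X n - u)"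
          using bound[of "X n - u"] S X(1)[of n] uS
          by (smt (verit) mult_right_mono norm_ge_zero real_norm_def subspace_diff)
      qed
      show "(\<lambda>n. \<bar>C\<bar> * norm (X n - u)) \<longlonglongrightarrow> 0"
        using tendsto_mult[OF tendsto_const tendsto_norm[OF LIM_zero[OF u]], of "\<bar>C\<bar>"] by simp
    qed
    then have "(\<lambda>n. J (X n)) \<longlonglongrightarrow> J u"
      unfolding J_def by (intro tendsto_intros u)
    moreover have "(\<lambda>n. m + 1 / real (Suc n)) \<longlonglongrightarrow> m + 0"
      by (intro tendsto_intros LIMSEQ_Suc lim_1_over_n)
    ultimately show ?thesis
      using X(2) by (intro LIMSEQ_le[where X="\<lambda>n. J (X n)" and Y="\<lambda>n. m + 1 / real (Suc n)"]) (auto intro: less_imp_le)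
  qed
  have "inner u x = l x" if x: "x \<in> S" for x
  proof (rule ccontr)
    assume neq: "inner u x \<noteq> l x"
    define d where "d = inner u x - l x"
    have "d \<noteq> 0" using neq by (simp add: d_def)
    have key: "0 \<le> 2 * t * d + t\<^sup>2 * (norm x)\<^sup>2" for t
    proof -
      have "J (u + t *\<^sub>R x) = J u + 2 * t * d + t\<^sup>2 * (norm x)\<^sup>2"
      proof -
        have "(norm (u + t *\<^sub>R x))\<^sup>2 = (norm u)\<^sup>2 + 2 * t * inner u x + t\<^sup>2 * (norm x)\<^sup>2"
          by (simp only: power2_norm_eq_inner inner_add_left inner_add_right inner_scaleR_left inner_scaleR_right)
             (simp add: inner_commute power2_eq_square algebra_simps)
        then show ?thesis
          using add[OF uS, of "t *\<^sub>R x"] scale[OF x, of t] S x unfolding J_def d_def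
          by (simp add: subspace_scale algebra_simps)
      qed
      moreover have "m \<le> J (u + t *\<^sub>R x)"
        using S x uS by (intro m_le) (simp add: subspace_add subspace_scale)
      ultimately show ?thesis using Ju by linarith
    qed
    have "d = 0"
    proof (cases "x = 0")
      case True
      then show ?thesis using scale[OF x, of 0] by (simp add: d_def)
    next
      case False
      \<comment> \<open>The value of t is the vertex of the quadratic, where it equals
        -d^2/|x|^2.\<close>
      have "0 \<le> 2 * (- d / (norm x)\<^sup>2) * d + (- d / (norm x)\<^sup>2)\<^sup>2 * (norm x)\<^sup>2" by (rule key)
      also have "\<dots> = - (d\<^sup>2 / (norm x)\<^sup>2)" using False by (simp add: field_simps power2_eq_square)
      finally show ?thesis using False by (smt (verit) divide_pos_pos zero_less_norm_iff zero_less_power2)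
    qed
    then show False using \<open>d \<noteq> 0\<close> by simp
  qed
  then show ?thesis using that uS by blast
qed

lemma subspace_closure:
  fixes S :: "'a::real_normed_vector set"
  assumes "subspace S"
  shows "subspace (closure S)"
proof (rule subspaceI)
  show "0 \<in> closure S" using assms closure_subset subspace_0 by blast
  fix x y assume "x \<in> closure S" "y \<in> closure S"
  then obtain X Y where "\<And>n. X n \<in> S" "X \<longlonglongrightarrow> x" "\<And>n. Y n \<in> S" "Y \<longlonglongrightarrow> y"
    unfolding closure_sequential by blast
  then show "x + y \<in> closure S"
    unfolding closure_sequential using assms
    by (intro exI[of _ "\<lambda>n. X n + Y n"]) (auto intro: tendsto_add subspace_add)
next
  fix c x assume "x \<in> closure S"
  then obtain X where "\<And>n. X n \<in> S" "X \<longlonglongrightarrow> x"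
    unfolding closure_sequential by blast
  then show "c *\<^sub>R x \<in> closure S"
    unfolding closure_sequential using assms
    by (intro exI[of _ "\<lambda>n. c *\<^sub>R X n"]) (auto intro: tendsto_scaleR subspace_scale)
qed

text \<open>Representing the functional \<open>inner x\<close> on the closure of S gives the
  orthogonal projection u of x. The difference x - u is orthogonal to S, hence zero.\<close>

lemma subspace_dense_if_orthogonal_trivial:
  fixes S :: "'a::{real_inner,complete_space} set"
  assumes S: "subspace S" and triv: "\<And>x. (\<And>y. y \<in> S \<Longrightarrow> inner x y = 0) \<Longrightarrow> x = 0"
  shows "closure S = UNIV"
proof -
  have sub: "subspace (closure S)" using S by (rule subspace_closure)
  { fix x
    obtain u where u: "u \<in> closure S" "\<And>y. y \<in> closure S \<Longrightarrow> inner u y = inner x y"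
    proof (rule riesz_on_closed_subspace[OF sub closed_closure, of "inner x" "norm x"])
      show "\<bar>inner x y\<bar> \<le> norm x * norm y" for y by (rule Cauchy_Schwarz_ineq2)
    qed (auto simp: inner_add_right)
    have "x - u = 0"
      by (rule triv) (use u(2) closure_subset[of S] in \<open>auto simp: inner_diff_left\<close>)
    then have "x \<in> closure S" using u by simp }
  then show ?thesis by auto
qed

text \<open>The form need not be symmetric, so it is not itself an inner product to which the Riesz
  representation applies. Riesz represents \<open>\<beta> x\<close> by R x and l by f instead, and R
  u = f is the fixed point equation of x - \<rho> (R x - f), which contracts for small
  \<rho>.\<close>

lemma lax_milgram_on_closed_subspace:
  fixes S :: "'a::{real_inner,complete_space} set" and \<beta> :: "'a \<Rightarrow> 'a \<Rightarrow> real" and l :: "'a \<Rightarrow> real"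
  assumes S: "subspace S" "closed S"
    and add_left: "\<And>x y z. x \<in> S \<Longrightarrow> y \<in> S \<Longrightarrow> z \<in> S \<Longrightarrow> \<beta> (x + y) z = \<beta> x z + \<beta> y z"
    and add_right: "\<And>x y z. x \<in> S \<Longrightarrow> y \<in> S \<Longrightarrow> z \<in> S \<Longrightarrow> \<beta> z (x + y) = \<beta> z x + \<beta> z y"
    and scale_left: "\<And>r x y. x \<in> S \<Longrightarrow> y \<in> S \<Longrightarrow> \<beta> (r *\<^sub>R x) y = r * \<beta> x y"
    and scale_right: "\<And>r x y. x \<in> S \<Longrightarrow> y \<in> S \<Longrightarrow> \<beta> x (r *\<^sub>R y) = r * \<beta> x y"
    and bounded: "\<And>x y. x \<in> S \<Longrightarrow> y \<in> S \<Longrightarrow> \<bar>\<beta> x y\<bar> \<le> M * norm x * norm y"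
    and c: "c > 0" and coercive: "\<And>x. x \<in> S \<Longrightarrow> c * (norm x)\<^sup>2 \<le> \<beta> x x"
    and l_add: "\<And>x y. x \<in> S \<Longrightarrow> y \<in> S \<Longrightarrow> l (x + y) = l x + l y"
    and l_scale: "\<And>r x. x \<in> S \<Longrightarrow> l (r *\<^sub>R x) = r * l x"
    and l_bound: "\<And>x. x \<in> S \<Longrightarrow> \<bar>l x\<bar> \<le> K * norm x"
  obtains u where "u \<in> S" "\<And>x. x \<in> S \<Longrightarrow> \<beta> u x = l x"
proof -
  \<comment> \<open>Enlarging the bound beyond c makes 1 - c^2/M1^2 positive, so that its square
    root \<open>q\<close> is a legitimate contraction factor.\<close>
  define M1 where "M1 = \<bar>M\<bar> + c + 1"
  have M1: "M1 > c" "M1 > 0" "\<And>x y. x \<in> S \<Longrightarrow> y \<in> S \<Longrightarrow> \<bar>\<beta> x y\<bar> \<le> M1 * norm x * norm y"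
  proof -
    show "M1 > c" "M1 > 0" using c by (auto simp: M1_def)
    fix x y assume "x \<in> S" "y \<in> S"
    have "M * norm x * norm y \<le> M1 * norm x * norm y"
      unfolding M1_def using c by (intro mult_right_mono) auto
    then show "\<bar>\<beta> x y\<bar> \<le> M1 * norm x * norm y" using bounded[OF \<open>x \<in> S\<close> \<open>y \<in> S\<close>] by linarith
  qed
  have "\<exists>w. w \<in> S \<and> (\<forall>y\<in>S. inner w y = \<beta> x y)" if "x \<in> S" for x
    by (rule riesz_on_closed_subspace[OF S, of "\<beta> x" "M1 * norm x"])
       (use that add_right scale_right M1(3) in auto)
  then obtain R where R: "\<And>x. x \<in> S \<Longrightarrow> R x \<in> S" "\<And>x y. x \<in> S \<Longrightarrow> y \<in> S \<Longrightarrow> inner (R x) y = \<beta> x y"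
    by metis
  obtain f where f: "f \<in> S" "\<And>y. y \<in> S \<Longrightarrow> inner f y = l y"
    using riesz_on_closed_subspace[OF S, of l K] l_add l_scale l_bound by metis
  \<comment> \<open>This value minimises 1 - 2 \<rho> c + \<rho>^2 M1^2, the bound for the squared
    contraction factor, and gives 1 - c^2/M1^2.\<close>
  define \<rho> where "\<rho> = c / M1\<^sup>2"
  have "\<rho> > 0" using c M1 by (simp add: \<rho>_def)
  define T where "T x = x - \<rho> *\<^sub>R (R x - f)" for x
  define q where "q = sqrt (1 - c\<^sup>2 / M1\<^sup>2)"
  have "c\<^sup>2 / M1\<^sup>2 < 1" using M1 c by (simp add: power_strict_mono)
  moreover have "c\<^sup>2 / M1\<^sup>2 > 0" using M1 c by simp
  ultimately have q: "0 \<le> q" "q < 1" "q\<^sup>2 = 1 - c\<^sup>2 / M1\<^sup>2" by (auto simp: q_def)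
  have contr: "dist (T x) (T y) \<le> q * dist x y" if "x \<in> S" "y \<in> S" for x y
  proof -
    let ?d = "x - y" and ?e = "R x - R y"
    have d: "?d \<in> S" and e: "?e \<in> S" using S that R(1) by (auto simp: subspace_diff)
    have inn: "inner ?e z = \<beta> ?d z" if z: "z \<in> S" for z
      using R(2)[OF \<open>x \<in> S\<close> z] R(2)[OF \<open>y \<in> S\<close> z] add_left[OF d \<open>y \<in> S\<close> z]
      by (simp add: inner_diff_left)
    have "(norm ?e)\<^sup>2 \<le> M1 * norm ?d * norm ?e"
      using inn[OF e] M1(3)[OF d e] by (simp add: power2_norm_eq_inner)
    then have ne: "norm ?e \<le> M1 * norm ?d"
      using M1(2) by (cases "norm ?e = 0") (auto simp: power2_eq_square)
    have "(norm (?d - \<rho> *\<^sub>R ?e))\<^sup>2 = (norm ?d)\<^sup>2 - 2 * \<rho> * inner ?e ?d + \<rho>\<^sup>2 * (norm ?e)\<^sup>2"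
      by (simp only: power2_norm_eq_inner inner_diff_left inner_diff_right inner_scaleR_left
          inner_scaleR_right) (simp add: inner_commute power2_eq_square algebra_simps)
    also have "\<dots> \<le> (norm ?d)\<^sup>2 - 2 * \<rho> * (c * (norm ?d)\<^sup>2) + \<rho>\<^sup>2 * (M1 * norm ?d)\<^sup>2"
    proof -
      have "\<rho> * (c * (norm ?d)\<^sup>2) \<le> \<rho> * inner ?e ?d"
        using inn[OF d] coercive[OF d] \<open>\<rho> > 0\<close> by simp
      moreover have "\<rho>\<^sup>2 * (norm ?e)\<^sup>2 \<le> \<rho>\<^sup>2 * (M1 * norm ?d)\<^sup>2"
        using ne by (intro mult_left_mono power_mono) auto
      ultimately show ?thesis by linarith
    qed
    also have "\<dots> = q\<^sup>2 * (norm ?d)\<^sup>2"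
      unfolding q \<rho>_def using M1(2) by (simp add: field_simps power2_eq_square)
    finally have "norm (?d - \<rho> *\<^sub>R ?e) \<le> q * norm ?d"
      using q(1) by (metis mult_nonneg_nonneg norm_ge_zero power2_le_imp_le power_mult_distrib)
    moreover have "T x - T y = ?d - \<rho> *\<^sub>R ?e" by (simp add: T_def algebra_simps)
    ultimately show ?thesis by (simp add: dist_norm)
  qed
  have "\<exists>!x\<in>S. T x = x"
  proof (rule Banach_fix[OF _ _ q(1) q(2)])
    show "complete S" using S(2) by (simp add: complete_eq_closed)
    show "S \<noteq> {}" using f by auto
    show "T ` S \<subseteq> S" using S R(1) f by (auto simp: T_def subspace_diff subspace_scale)
    show "dist (T x) (T y) \<le> q * dist x y" if "x \<in> S" "y \<in> S" for x y using contr that by blast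
  qed
  then obtain u where u: "u \<in> S" "T u = u" by blast
  then have "R u = f" using \<open>\<rho> > 0\<close> by (simp add: T_def)
  then show ?thesis using that u R(2) f(2) by metis
qed

section \<open>Holomorphic contraction semigroups of sectorial operators\<close>

locale complex_structure =
  fixes sc :: "complex \<Rightarrow> 'h::{real_inner,complete_space} \<Rightarrow> 'h"
  assumes sc_add_left: "sc (a + b) x = sc a x + sc b x"
    and sc_add_right: "sc a (x + y) = sc a x + sc a y"
    and sc_mult: "sc (a * b) x = sc a (sc b x)"
    and sc_of_real: "sc (complex_of_real r) x = r *\<^sub>R x"
    and norm_sc: "norm (sc a x) = cmod a * norm x"
begin

lemma sc_1 [simp]: "sc 1 x = x" using sc_of_real[of 1] by simp
lemma sc_0_left [simp]: "sc 0 x = 0" using sc_of_real[of 0] by simp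
lemma sc_0_right [simp]: "sc a 0 = 0" using norm_sc[of a 0] by simp
lemma sc_minus_left: "sc (- a) x = - sc a x" using sc_add_left[of a "- a" x] by (simp add: eq_neg_iff_add_eq_0 add.commute)
lemma sc_minus_right: "sc a (- x) = - sc a x" using sc_add_right[of a x "- x"] by (simp add: eq_neg_iff_add_eq_0 add.commute)
lemma sc_diff_left: "sc (a - b) x = sc a x - sc b x" using sc_add_left[of a "- b" x] by (simp add: sc_minus_left)
lemma sc_diff_right: "sc a (x - y) = sc a x - sc a y" using sc_add_right[of a x "- y"] by (simp add: sc_minus_right)
lemma sc_scaleR: "sc a (r *\<^sub>R x) = r *\<^sub>R sc a x"
  by (metis mult.commute sc_mult sc_of_real)
lemma sc_commute: "sc a (sc b x) = sc b (sc a x)" by (metis mult.commute sc_mult)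
lemma sc_inverse: "a \<noteq> 0 \<Longrightarrow> sc (1 / a) (sc a x) = x" by (simp flip: sc_mult)
lemma bounded_linear_sc: "bounded_linear (sc a)"
  by (rule bounded_linear_intro[where K="cmod a"])
     (auto simp: sc_add_right sc_scaleR norm_sc mult.commute)

text \<open>The Hermitian product recovered from its real part through Im (x, y) = - Re (i x, y). It
  makes scalar function theory available for vector-valued functions.\<close>

definition ci :: "'h \<Rightarrow> 'h \<Rightarrow> complex" where
  "ci x y = Complex (inner x y) (- inner (sc \<i> x) y)"

lemma ci_diff_left: "ci (x - y) z = ci x z - ci y z"
  by (simp add: ci_def sc_diff_right inner_diff_left complex_eq_iff)

lemma ci_scale: "ci (sc a x) y = a * ci x y"
proof -
  have a: "sc a x = Re a *\<^sub>R x + Im a *\<^sub>R sc \<i> x" for a x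
  proof -
    have "sc a x = sc (complex_of_real (Re a) + complex_of_real (Im a) * \<i>) x"
      by (metis complex_eq mult.commute)
    then show ?thesis unfolding sc_add_left sc_mult sc_of_real .
  qed
  have ii: "sc \<i> (sc \<i> x) = - x"
    by (metis i_squared power2_eq_square sc_1 sc_minus_left sc_mult)
  have "inner (sc a x) y = Re a * inner x y + Im a * inner (sc \<i> x) y"
    by (subst a[of a x]) (simp add: inner_add_left)
  moreover have "inner (sc \<i> (sc a x)) y = Re a * inner (sc \<i> x) y - Im a * inner x y"
    by (subst a[of a x]) (simp add: sc_add_right sc_scaleR ii inner_add_left inner_diff_left)
  ultimately show ?thesis by (simp add: ci_def complex_eq_iff algebra_simps)
qed

lemma cmod_ci_le: "cmod (ci x y) \<le> 2 * norm x * norm y"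
proof -
  have "cmod (ci x y) \<le> \<bar>Re (ci x y)\<bar> + \<bar>Im (ci x y)\<bar>" by (rule cmod_le)
  also have "\<dots> \<le> norm x * norm y + norm (sc \<i> x) * norm y"
    unfolding ci_def by (intro add_mono) (auto simp: Cauchy_Schwarz_ineq2)
  finally show ?thesis by (simp add: norm_sc)
qed

lemma norm_le_ci: "(norm x)\<^sup>2 \<le> cmod (ci x x)"
  using abs_Re_le_cmod[of "ci x x"] by (simp add: ci_def power2_norm_eq_inner)

lemma tendsto_ci: "(f \<longlongrightarrow> l) F \<Longrightarrow> ((\<lambda>w. ci (f w) g) \<longlongrightarrow> ci l g) F"
  unfolding ci_def
  by (intro tendsto_Complex tendsto_intros bounded_linear.tendsto[OF bounded_linear_sc])

end

text \<open>For M > 0 this is the sector |arg z| < arctan (1/M), written as an inequality between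
  real and imaginary part so that openness and closure under sums and positive multiples are
  immediate.\<close>

definition open_sector :: "real \<Rightarrow> complex set" where
  "open_sector M = {z. M * \<bar>Im z\<bar> < Re z}"

lemma open_open_sector: "open (open_sector M)"
  unfolding open_sector_def
  by (intro open_Collect_less continuous_intros)

lemma open_sector_add:
  assumes "0 \<le> M" "z \<in> open_sector M" "w \<in> open_sector M"
  shows "z + w \<in> open_sector M"
proof -
  have "M * \<bar>Im z + Im w\<bar> \<le> M * (\<bar>Im z\<bar> + \<bar>Im w\<bar>)"
    using assms(1) by (intro mult_left_mono) auto
  then show ?thesis using assms by (simp add: open_sector_def algebra_simps)
qed

lemma open_sector_scale: "r > 0 \<Longrightarrow> z \<in> open_sector M \<Longrightarrow> z / complex_of_real r \<in> open_sector M"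
  by (simp add: open_sector_def divide_strict_right_mono)

lemma open_sector_nonzero: "z \<in> open_sector M \<Longrightarrow> z \<noteq> 0"
  by (auto simp: open_sector_def)

lemma of_real_in_open_sector: "t > 0 \<Longrightarrow> complex_of_real t \<in> open_sector M"
  by (auto simp: open_sector_def)

text \<open>Sectoriality is expressed as accretivity of every rotated operator z B. The resolvent
  estimate at complex z is then the same contraction argument as for a positive step size.\<close>

locale m_sectorial = complex_structure sc
  for sc :: "complex \<Rightarrow> 'h::{real_inner,complete_space} \<Rightarrow> 'h" +
  fixes D :: "'h set" and B :: "'h \<Rightarrow> 'h" and M :: real
  assumes M_nonneg: "0 \<le> M"
    and D_add: "x \<in> D \<Longrightarrow> y \<in> D \<Longrightarrow> x + y \<in> D"
    and D_sc: "x \<in> D \<Longrightarrow> sc a x \<in> D"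
    and D_0: "0 \<in> D"
    and B_add: "x \<in> D \<Longrightarrow> y \<in> D \<Longrightarrow> B (x + y) = B x + B y"
    and B_sc: "x \<in> D \<Longrightarrow> B (sc a x) = sc a (B x)"
    and accretive: "z \<in> open_sector M \<Longrightarrow> x \<in> D \<Longrightarrow> 0 \<le> inner (sc z (B x)) x"
    and range_full: "z \<in> open_sector M \<Longrightarrow> \<exists>x\<in>D. x + sc z (B x) = f"
    and dense: "closure D = UNIV"
begin

abbreviation "\<Sigma> \<equiv> open_sector M"

lemma D_diff: "x \<in> D \<Longrightarrow> y \<in> D \<Longrightarrow> x - y \<in> D"
  using D_add[of x "sc (-1) y"] D_sc[of y "-1"] by (simp add: sc_minus_left)

lemma B_diff: "x \<in> D \<Longrightarrow> y \<in> D \<Longrightarrow> B (x - y) = B x - B y"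
  using B_add[of x "sc (-1) y"] B_sc[of y "-1"] D_sc[of y "-1"] by (simp add: sc_minus_left)

section \<open>Resolvents: contractivity, uniqueness and commutation\<close>

lemma norm_le_resolvent_eq:
  assumes "z \<in> \<Sigma>" "x \<in> D"
  shows "norm x \<le> norm (x + sc z (B x))"
proof -
  have "(norm x)\<^sup>2 \<le> inner (x + sc z (B x)) x"
    using accretive[OF assms] by (simp add: inner_add_left power2_norm_eq_inner)
  also have "\<dots> \<le> norm (x + sc z (B x)) * norm x"
    by (rule norm_cauchy_schwarz)
  finally show ?thesis by (cases "norm x = 0") (auto simp: power2_eq_square)
qed

text \<open>The resolvent (1 + z B)^-1, that is, one backward Euler step of size z for u' = - B
  u.\<close>

definition F :: "complex \<Rightarrow> 'h \<Rightarrow> 'h" where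
  "F z f = (SOME x. x \<in> D \<and> x + sc z (B x) = f)"

lemma
  assumes "z \<in> \<Sigma>"
  shows F_in: "F z f \<in> D" and F_eq: "F z f + sc z (B (F z f)) = f"
proof -
  have "\<exists>x. x \<in> D \<and> x + sc z (B x) = f" using range_full[OF assms] by blast
  from someI_ex[OF this] show "F z f \<in> D" "F z f + sc z (B (F z f)) = f"
    unfolding F_def by auto
qed

lemma F_unique:
  assumes "z \<in> \<Sigma>" "x \<in> D" "x + sc z (B x) = f"
  shows "F z f = x"
proof -
  let ?d = "F z f - x"
  have "?d + sc z (B ?d) = (F z f + sc z (B (F z f))) - (x + sc z (B x))"
    using F_in[OF assms(1)] assms(2) by (simp add: B_diff sc_diff_right)
  also have "\<dots> = 0" using F_eq[OF assms(1)] assms(3) by simp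
  finally show ?thesis
    using norm_le_resolvent_eq[OF assms(1) D_diff[OF F_in[OF assms(1), of f] assms(2)]] by simp
qed

lemma norm_F_le: "z \<in> \<Sigma> \<Longrightarrow> norm (F z f) \<le> norm f"
  using norm_le_resolvent_eq[OF _ F_in] by (metis F_eq)

lemma F_add: "z \<in> \<Sigma> \<Longrightarrow> F z (f + g) = F z f + F z g"
proof (rule F_unique)
  assume z: "z \<in> \<Sigma>"
  show "F z f + F z g \<in> D" by (intro D_add F_in z)
  have "F z f + F z g + sc z (B (F z f + F z g)) = (F z f + sc z (B (F z f))) + (F z g + sc z (B (F z g)))"
    using F_in[OF z] by (simp add: B_add sc_add_right)
  also have "\<dots> = f + g" by (simp only: F_eq[OF z])
  finally show "F z f + F z g + sc z (B (F z f + F z g)) = f + g" .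
qed

lemma F_sc: "z \<in> \<Sigma> \<Longrightarrow> F z (sc a f) = sc a (F z f)"
  by (rule F_unique) (auto simp: D_sc F_in B_sc sc_commute[of z] F_eq simp flip: sc_add_right)

lemma linear_F: "z \<in> \<Sigma> \<Longrightarrow> linear (F z)"
  by (rule linearI) (auto simp: F_add F_sc simp flip: sc_of_real)

lemma F_diff: "z \<in> \<Sigma> \<Longrightarrow> F z (f - g) = F z f - F z g"
  using linear_F by (rule linear_diff)

text \<open>The resolvent equation makes B (F z f) a multiple of f - F z f, which lies in D when f
  does. Applying B to that equation shows that B (F z f) solves the one that defines F z (B
  f).\<close>

lemma B_F_commute:
  assumes "z \<in> \<Sigma>" "f \<in> D"
  shows "B (F z f) \<in> D" "B (F z f) = F z (B f)"
proof -
  have "sc z (B (F z f)) = f - F z f" using F_eq[OF assms(1)] by (simp add: algebra_simps)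
  then have "B (F z f) = sc (1 / z) (f - F z f)"
    by (metis sc_inverse open_sector_nonzero assms(1))
  moreover have "f - F z f \<in> D" using assms F_in D_diff by blast
  ultimately show *: "B (F z f) \<in> D" using D_sc by simp
  have "B (F z f + sc z (B (F z f))) = B (F z f) + sc z (B (B (F z f)))"
    using * assms F_in D_sc by (simp add: B_add B_sc)
  then have "B (F z f) + sc z (B (B (F z f))) = B f"
    by (simp only: F_eq[OF assms(1)])
  then show "B (F z f) = F z (B f)"
    using F_unique[OF assms(1) *] by metis
qed

text \<open>The domain of the square of B, on which the error of an Euler step is of second order in
  the step size.\<close>

definition D2 :: "'h set" where "D2 = {x \<in> D. B x \<in> D}"

lemma F_D2:
  assumes "z \<in> \<Sigma>" "f \<in> D2"
  shows "F z f \<in> D2" "B (B (F z f)) = F z (B (B f))"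
  using assms F_in B_F_commute unfolding D2_def by auto

lemma F_commute:
  assumes "z \<in> \<Sigma>" "w \<in> \<Sigma>"
  shows "F z (F w f) = F w (F z f)"
proof (rule F_unique[OF assms(1)])
  show "F w (F z f) \<in> D" using F_in assms by blast
  have "sc z (B (F w (F z f))) = F w (sc z (B (F z f)))"
    using assms F_in by (simp add: B_F_commute F_sc)
  then show "F w (F z f) + sc z (B (F w (F z f))) = F w f"
    by (metis F_add F_eq assms)
qed

lemma norm_F_minus_id:
  assumes "z \<in> \<Sigma>" "f \<in> D"
  shows "norm (F z f - f) \<le> cmod z * norm (B f)"
proof -
  have "F z f - f = - sc z (F z (B f))"
    using F_eq[OF assms(1), of f] B_F_commute[OF assms] by (simp add: algebra_simps)
  then have "norm (F z f - f) = cmod z * norm (F z (B f))" by (simp add: norm_sc)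
  also have "\<dots> \<le> cmod z * norm (B f)" by (intro mult_left_mono norm_F_le assms) auto
  finally show ?thesis .
qed

text \<open>With y = F (z + w) f one has (1 + z B) (1 + w B) y = f + z w B^2 y. The product of two
  resolvents therefore misses the resolvent of the sum only by a term with the factor z w.\<close>

lemma norm_F_F_minus_F:
  assumes "z \<in> \<Sigma>" "w \<in> \<Sigma>" "f \<in> D2"
  shows "norm (F z (F w f) - F (z + w) f) \<le> cmod z * cmod w * norm (B (B f))"
proof -
  have zw: "z + w \<in> \<Sigma>" using open_sector_add[OF M_nonneg] assms by blast
  define y where "y = F (z + w) f"
  have y: "y \<in> D" "B y \<in> D" "B (B y) = F (z + w) (B (B f))" "y + sc (z + w) (B y) = f"
    using F_D2[OF zw assms(3)] F_eq[OF zw] by (auto simp: y_def D2_def)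
  define g where "g = y + sc w (B y)"
  have g: "g \<in> D" using y by (simp add: g_def D_add D_sc)
  have Fg: "F w g = y" using F_unique[OF assms(2) y(1)] g_def by simp
  have gz: "g + sc z (B g) = f + sc (z * w) (B (B y))"
    using y by (simp add: g_def B_add B_sc D_sc sc_add_right sc_add_left sc_mult add_ac
        flip: y(4))
  then have "g = F z (f + sc (z * w) (B (B y)))"
    using F_unique[OF assms(1) g] by simp
  then have "y = F w (F z f) + F w (F z (sc (z * w) (B (B y))))"
    using Fg assms by (simp add: F_add)
  then have "F z (F w f) - y = - F w (F z (sc (z * w) (B (B y))))"
    using F_commute[OF assms(1,2)] by (simp add: algebra_simps)
  then have "norm (F z (F w f) - y) \<le> norm (sc (z * w) (B (B y)))"
    by (metis assms norm_F_le norm_minus_cancel order_trans)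
  also have "\<dots> \<le> cmod z * cmod w * norm (B (B f))"
    unfolding norm_sc y(3) norm_mult by (intro mult_left_mono norm_F_le zw) auto
  finally show ?thesis by (simp add: y_def)
qed

section \<open>Dyadic Euler approximations and their rate of convergence\<close>

lemma norm_funpow_le:
  fixes X :: "'h \<Rightarrow> 'h"
  assumes "\<And>x. norm (X x) \<le> norm x"
  shows "norm ((X ^^ n) x) \<le> norm x"
proof (induction n)
  case (Suc n)
  then show ?case using order_trans[OF assms Suc] by simp
qed auto

lemma funpow_commute_on:
  fixes X Y :: "'h \<Rightarrow> 'h"
  assumes "\<And>x. X (Y x) = Y (X x)"
  shows "X ((Y ^^ n) x) = (Y ^^ n) (X x)"
  by (induction n) (auto simp: assms)

text \<open>Telescoping: the difference of the n-th powers is a sum of n terms, each a product of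
  X's and Y's applied to X f - Y f. The factors are contractions, and commutation moves the
  difference next to f.\<close>

lemma norm_funpow_diff_le:
  fixes X Y :: "'h \<Rightarrow> 'h"
  assumes X: "\<And>x. norm (X x) \<le> norm x" and Y: "\<And>x. norm (Y x) \<le> norm x"
    and lin: "linear X" "linear Y" and comm: "\<And>x. X (Y x) = Y (X x)"
  shows "norm ((X ^^ n) f - (Y ^^ n) f) \<le> real n * norm (X f - Y f)"
proof (induction n)
  case (Suc n)
  have linYn: "linear (Y ^^ n)" using lin(2) linear_id by (induction n) (auto intro: linear_compose simp: comp_def[symmetric] id_def)
  have "(X ^^ Suc n) f - (Y ^^ Suc n) f = X ((X ^^ n) f - (Y ^^ n) f) + (Y ^^ n) (X f - Y f)"
    using funpow_commute_on[of X Y, OF comm, of n f] funpow_commute_on[of Y Y n f]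
    by (simp add: linear_diff[OF lin(1)] linear_diff[OF linYn] funpow_swap1)
  then have "norm ((X ^^ Suc n) f - (Y ^^ Suc n) f)
      \<le> norm (X ((X ^^ n) f - (Y ^^ n) f)) + norm ((Y ^^ n) (X f - Y f))"
    by (simp add: norm_triangle_ineq)
  also have "\<dots> \<le> real n * norm (X f - Y f) + norm (X f - Y f)"
    using order_trans[OF X Suc] norm_funpow_le[of Y, OF Y] by (rule add_mono)
  finally show ?case by (simp add: algebra_simps)
qed auto

text \<open>(1 + z B / n)^-n with n = 2^k. Doubling n replaces every step of size 2h by two steps of
  size h, so consecutive approximations can be compared step by step.\<close>

definition E :: "nat \<Rightarrow> complex \<Rightarrow> 'h \<Rightarrow> 'h" where
  "E k z = F (z / 2 ^ k) ^^ (2 ^ k)"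

lemma scale_pow_in: "z \<in> \<Sigma> \<Longrightarrow> z / 2 ^ k \<in> \<Sigma>"
  using open_sector_scale[of "2 ^ k" z M] by simp

lemma linear_funpow: "linear X \<Longrightarrow> linear (X ^^ n)" for X :: "'h \<Rightarrow> 'h"
  using linear_id by (induction n) (auto intro: linear_compose simp: comp_def[symmetric] id_def)

lemma linear_E: "z \<in> \<Sigma> \<Longrightarrow> linear (E k z)"
  unfolding E_def by (intro linear_funpow linear_F scale_pow_in)

lemma E_sc: "z \<in> \<Sigma> \<Longrightarrow> E k z (sc a x) = sc a (E k z x)"
proof -
  assume "z \<in> \<Sigma>"
  then have "(F (z / 2 ^ k) ^^ n) (sc a x) = sc a ((F (z / 2 ^ k) ^^ n) x)" for n
    by (induction n) (auto simp: F_sc scale_pow_in)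
  then show ?thesis by (simp add: E_def)
qed

lemma norm_E_le: "z \<in> \<Sigma> \<Longrightarrow> norm (E k z x) \<le> norm x"
  unfolding E_def by (intro norm_funpow_le norm_F_le scale_pow_in)

text \<open>With h = z / 2^(k+1) there are 2^k comparisons of two steps h with one step 2h. Each
  costs |h|^2 |B^2 f|, and 2^k |z|^2 / 4^(k+1) is |z|^2 / 4 times 2^-k.\<close>

lemma norm_E_Suc_diff:
  assumes z: "z \<in> \<Sigma>" and f: "f \<in> D2"
  shows "norm (E (Suc k) z f - E k z f) \<le> (cmod z)\<^sup>2 * norm (B (B f)) / 4 * (1/2) ^ k"
proof -
  define h where "h = z / 2 ^ Suc k"
  have h: "h \<in> \<Sigma>" unfolding h_def by (rule scale_pow_in[OF z])
  have hh: "h + h = z / 2 ^ k" by (simp add: h_def)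
  let ?X = "F h \<circ> F h" and ?Y = "F (h + h)"
  have hh\<Sigma>: "h + h \<in> \<Sigma>" unfolding hh by (rule scale_pow_in[OF z])
  have XX: "?X = F h ^^ 2" by (simp add: numeral_2_eq_2 fun_eq_iff)
  have 1: "E (Suc k) z = ?X ^^ (2 ^ k)"
    unfolding XX funpow_mult by (simp only: E_def h_def power_Suc)
  have 2: "E k z = ?Y ^^ (2 ^ k)" unfolding E_def hh by (rule refl)
  have 3: "norm ((?X ^^ (2 ^ k)) f - (?Y ^^ (2 ^ k)) f) \<le> real (2 ^ k) * norm (?X f - ?Y f)"
  proof (rule norm_funpow_diff_le)
    show "norm (?X x) \<le> norm x" for x
      using order_trans[OF norm_F_le[OF h] norm_F_le[OF h]] by simp
    show "linear ?X" using h by (intro linear_compose linear_F)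
    show "?X (?Y x) = ?Y (?X x)" for x
      by (metis F_commute[OF h hh\<Sigma>] comp_apply)
  qed (intro norm_F_le linear_F hh\<Sigma>)+
  have "norm (?X f - ?Y f) \<le> cmod h * cmod h * norm (B (B f))"
    using norm_F_F_minus_F[OF h h f] by simp
  from order_trans[OF 3 mult_left_mono[OF this of_nat_0_le_iff]]
  have "norm (E (Suc k) z f - E k z f) \<le> 2 ^ k * (cmod h * cmod h * norm (B (B f)))"
    unfolding 1 2 by simp
  also have "\<dots> = (cmod z)\<^sup>2 * norm (B (B f)) / 4 * (1/2) ^ k"
    by (simp add: h_def norm_divide norm_power power2_eq_square field_simps power_divide)
  finally show ?thesis .
qed

lemma norm_E_diff:
  assumes z: "z \<in> \<Sigma>" and f: "f \<in> D2" and "k \<le> l"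
  shows "norm (E l z f - E k z f) \<le> (cmod z)\<^sup>2 * norm (B (B f)) / 2 * (1/2) ^ k"
proof -
  define c where "c = (cmod z)\<^sup>2 * norm (B (B f)) / 4"
  have "c \<ge> 0" by (simp add: c_def)
  \<comment> \<open>The bound carries the exact partial sum of the geometric series; dropping its
    negative part afterwards makes it uniform in j.\<close>
  have "norm (E (k + j) z f - E k z f) \<le> c * (2 * (1/2) ^ k - 2 * (1/2) ^ (k + j))" for j
  proof (induction j)
    case (Suc j)
    have "norm (E (k + Suc j) z f - E k z f)
        \<le> norm (E (Suc (k + j)) z f - E (k + j) z f) + norm (E (k + j) z f - E k z f)"
      by (metis add_Suc_right diff_add_cancel add_diff_eq norm_triangle_ineq)
    also have "\<dots> \<le> c * (1/2) ^ (k + j) + c * (2 * (1/2) ^ k - 2 * (1/2) ^ (k + j))"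
      using norm_E_Suc_diff[OF z f, of "k + j"] Suc by (intro add_mono) (auto simp: c_def)
    also have "\<dots> = c * (2 * (1/2) ^ k - 2 * (1/2) ^ (k + Suc j))" by (simp add: algebra_simps)
    finally show ?case .
  qed auto
  from this[of "l - k"] \<open>k \<le> l\<close>
  have "norm (E l z f - E k z f) \<le> c * (2 * (1/2) ^ k - 2 * (1/2) ^ l)" by simp
  also have "\<dots> \<le> c * (2 * (1/2) ^ k)" using \<open>c \<ge> 0\<close> by (intro mult_left_mono) auto
  finally show ?thesis by (simp add: c_def mult_ac)
qed

text \<open>A resolvent maps D into D2 and is close to the identity on D for a small step. So f is
  approximated in D first, and the approximant is smoothed by one small step.\<close>

lemma D2_approx:
  assumes "e > 0"
  obtains g where "g \<in> D2" "norm (g - f) < e"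
proof -
  obtain f1 where f1: "f1 \<in> D" "norm (f1 - f) < e / 3"
    using dense assms closure_approachable[of f D] by (metis UNIV_I dist_norm divide_pos_pos zero_less_numeral)
  have approx: "\<exists>s>0. norm (F (complex_of_real s) x - x) < e / 3" if "x \<in> D" for x
  proof -
    \<comment> \<open>The summand 1 keeps the denominator positive when B x = 0, and e / 6 leaves
      room for a strict inequality.\<close>
    define s where "s = e / 6 / (norm (B x) + 1)"
    have s: "s > 0" using assms by (auto simp: s_def add_nonneg_pos)
    have "norm (F (complex_of_real s) x - x) \<le> s * norm (B x)"
      using norm_F_minus_id[OF of_real_in_open_sector[OF s] that] s by simp
    also have "\<dots> \<le> s * (norm (B x) + 1)" using s by simp
    also have "\<dots> = e / 6"
    proof -
      have "norm (B x) + 1 \<noteq> 0" by (smt (verit) norm_ge_zero)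
      then show ?thesis unfolding s_def by (rule nonzero_eq_divide_eq[THEN iffD1]) simp
    qed
    also have "\<dots> < e / 3" using assms by simp
    finally show ?thesis using s by blast
  qed
  obtain s where s: "s > 0" "norm (F (complex_of_real s) f1 - f1) < e / 3"
    using approx[OF f1(1)] by blast
  have "F (complex_of_real s) f1 \<in> D2"
    using B_F_commute(1)[OF of_real_in_open_sector[OF s(1)] f1(1)] F_in[OF of_real_in_open_sector[OF s(1)]]
    by (simp add: D2_def)
  moreover have "norm (F (complex_of_real s) f1 - f) < e"
    using norm_triangle_ineq[of "F (complex_of_real s) f1 - f1" "f1 - f"] s f1 assms by simp
  ultimately show ?thesis using that by blast
qed

text \<open>The rate is known on D2 only. Since all \<open>E k z\<close> are contractions, density
  of D2 extends the Cauchy property to every f. Uniformity over bounded parts of the sector is what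
  makes the limit holomorphic.\<close>

lemma E_uniformly_Cauchy:
  assumes "e > 0"
  obtains N where "\<And>k l z. N \<le> k \<Longrightarrow> k \<le> l \<Longrightarrow> z \<in> \<Sigma> \<Longrightarrow> cmod z \<le> R \<Longrightarrow> norm (E l z f - E k z f) < e"
proof -
  obtain g where g: "g \<in> D2" "norm (g - f) < e / 4" using D2_approx[of "e / 4" f] assms by auto
  define K where "K = R\<^sup>2 * norm (B (B g)) / 2"
  have "(\<lambda>k. K * (1/2) ^ k) \<longlonglongrightarrow> K * 0"
    by (intro tendsto_intros LIMSEQ_power_zero) auto
  then have "\<forall>\<^sub>F k in sequentially. K * (1/2) ^ k < e / 2"
    using assms by (intro order_tendstoD(2)[where y=0]) auto
  then obtain N where N: "\<And>k. k \<ge> N \<Longrightarrow> K * (1/2) ^ k < e / 2"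
    unfolding eventually_sequentially by blast
  have "norm (E l z f - E k z f) < e" if "N \<le> k" "k \<le> l" "z \<in> \<Sigma>" "cmod z \<le> R" for k l z
  proof -
    have "E l z f - E k z f = (E l z g - E k z g) - E l z (g - f) + E k z (g - f)"
      using linear_E[OF that(3)] by (simp add: linear_diff)
    then have "norm (E l z f - E k z f) \<le> norm (E l z g - E k z g) + norm (E l z (g - f)) + norm (E k z (g - f))"
      using norm_triangle_ineq[of "E l z g - E k z g - E l z (g - f)" "E k z (g - f)"]
        norm_triangle_ineq4[of "E l z g - E k z g" "E l z (g - f)"] by (smt (verit))
    also have "\<dots> \<le> (cmod z)\<^sup>2 * norm (B (B g)) / 2 * (1/2) ^ k + norm (g - f) + norm (g - f)"
      using that by (intro add_mono norm_E_le norm_E_diff g)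
    also have "\<dots> \<le> K * (1/2) ^ k + norm (g - f) + norm (g - f)"
      unfolding K_def using that by (intro add_right_mono mult_right_mono divide_right_mono power_mono) auto
    also have "\<dots> < e" using N[OF that(1)] g(2) by simp
    finally show ?thesis .
  qed
  then show ?thesis using that by blast
qed

section \<open>The limit semigroup on the open sector together with its vertex 0\<close>

definition S :: "complex \<Rightarrow> 'h \<Rightarrow> 'h" where
  "S z f = (if z = 0 then f else lim (\<lambda>k. E k z f))"

lemma E_tendsto_S:
  assumes "z \<in> \<Sigma>"
  shows "(\<lambda>k. E k z f) \<longlonglongrightarrow> S z f"
proof -
  have "Cauchy (\<lambda>k. E k z f)"
  proof (rule CauchyI)
    fix e :: real assume "e > 0"
    then obtain N where N: "\<And>k l. N \<le> k \<Longrightarrow> k \<le> l \<Longrightarrow> norm (E l z f - E k z f) < e"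
      using E_uniformly_Cauchy[of e "cmod z" f] assms by (metis order_refl)
    then have "norm (E k z f - E l z f) < e" if "N \<le> k" "N \<le> l" for k l
      using that by (metis linear norm_minus_commute)
    then show "\<exists>M. \<forall>m\<ge>M. \<forall>n\<ge>M. norm (E m z f - E n z f) < e" by blast
  qed
  then have "convergent (\<lambda>k. E k z f)" by (simp add: Cauchy_convergent_iff)
  then show ?thesis using open_sector_nonzero[OF assms] by (simp add: S_def convergent_LIMSEQ_iff)
qed

lemma E_uniformly_tendsto_S:
  assumes "e > 0"
  obtains N where "\<And>k z. N \<le> k \<Longrightarrow> z \<in> \<Sigma> \<Longrightarrow> cmod z \<le> R \<Longrightarrow> norm (S z f - E k z f) \<le> e"
proof -
  obtain N where N: "\<And>k l z. N \<le> k \<Longrightarrow> k \<le> l \<Longrightarrow> z \<in> \<Sigma> \<Longrightarrow> cmod z \<le> R \<Longrightarrow> norm (E l z f - E k z f) < e"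
    using E_uniformly_Cauchy[OF assms] by metis
  have "norm (S z f - E k z f) \<le> e" if "N \<le> k" "z \<in> \<Sigma>" "cmod z \<le> R" for k z
  proof (rule LIMSEQ_le_const2)
    show "(\<lambda>l. norm (E l z f - E k z f)) \<longlonglongrightarrow> norm (S z f - E k z f)"
      by (intro tendsto_intros E_tendsto_S that)
    show "\<exists>N. \<forall>n\<ge>N. norm (E n z f - E k z f) \<le> e"
      using N that by (intro exI[of _ k]) (auto intro: less_imp_le)
  qed
  then show ?thesis using that by blast
qed

lemma S_0 [simp]: "S 0 f = f" by (simp add: S_def)

lemma linear_S: "z \<in> insert 0 \<Sigma> \<Longrightarrow> linear (S z)"
proof (cases "z = 0")
  case True
  then have "S z = id" by (auto simp: S_def)
  then show ?thesis using linear_id by (simp add: id_def)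
next
  case False
  assume "z \<in> insert 0 \<Sigma>"
  with False have z: "z \<in> \<Sigma>" by simp
  show ?thesis
  proof (rule linearI)
    fix x y
    have "(\<lambda>k. E k z (x + y)) \<longlonglongrightarrow> S z x + S z y"
      using tendsto_add[OF E_tendsto_S[OF z] E_tendsto_S[OF z]] by (simp add: linear_add[OF linear_E[OF z]])
    then show "S z (x + y) = S z x + S z y" using E_tendsto_S[OF z] LIMSEQ_unique by blast
  next
    fix r x
    have "(\<lambda>k. E k z (r *\<^sub>R x)) \<longlonglongrightarrow> r *\<^sub>R S z x"
      using tendsto_scaleR[OF tendsto_const E_tendsto_S[OF z]] by (simp add: linear_scale[OF linear_E[OF z]])
    then show "S z (r *\<^sub>R x) = r *\<^sub>R S z x" using E_tendsto_S[OF z] LIMSEQ_unique by blast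
  qed
qed

lemma S_sc: "z \<in> insert 0 \<Sigma> \<Longrightarrow> S z (sc a x) = sc a (S z x)"
proof (cases "z = 0")
  case False
  assume "z \<in> insert 0 \<Sigma>"
  with False have z: "z \<in> \<Sigma>" by simp
  have "(\<lambda>k. E k z (sc a x)) \<longlonglongrightarrow> sc a (S z x)"
    unfolding E_sc[OF z] by (intro bounded_linear.tendsto[OF bounded_linear_sc] E_tendsto_S z)
  then show ?thesis using E_tendsto_S[OF z] LIMSEQ_unique by blast
qed auto

lemma norm_S_le: "z \<in> insert 0 \<Sigma> \<Longrightarrow> norm (S z x) \<le> norm x"
proof (cases "z = 0")
  case False
  assume "z \<in> insert 0 \<Sigma>"
  with False have z: "z \<in> \<Sigma>" by simp
  show ?thesis
    by (rule LIMSEQ_le_const2[OF tendsto_norm[OF E_tendsto_S[OF z]]]) (auto intro: norm_E_le z)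
qed auto

text \<open>Invariance passes from resolvents to their powers and to limits. It serves to show that
  the semigroup preserves functions vanishing outside \<Omega>.\<close>

lemma S_in_closed:
  assumes "closed X" "\<And>z f. z \<in> \<Sigma> \<Longrightarrow> f \<in> X \<Longrightarrow> F z f \<in> X" "z \<in> insert 0 \<Sigma>" "f \<in> X"
  shows "S z f \<in> X"
proof (cases "z = 0")
  case False
  with assms(3) have z: "z \<in> \<Sigma>" by simp
  have "(F (z / 2 ^ k) ^^ n) f \<in> X" for k n
    using assms(4) by (induction n) (auto intro: assms(2) scale_pow_in z)
  then show ?thesis
    using closed_sequentially[OF assms(1) _ E_tendsto_S[OF z, of f]] by (simp add: E_def)
qed (use assms in auto)

text \<open>On D2 the vectors \<open>E k z (E k w g)\<close> and \<open>E k (z + w) g\<close> are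
  2^k-th powers, of F (z/2^k) F (w/2^k) and of F ((z + w)/2^k), applied to g. One step differs by
  O(4^-k), hence the powers by O(2^-k). Contractivity and density give all f.\<close>

lemma S_semigroup:
  assumes "z \<in> insert 0 \<Sigma>" "w \<in> insert 0 \<Sigma>"
  shows "S (z + w) f = S z (S w f)"
proof (cases "z = 0 \<or> w = 0")
  case False
  then have z: "z \<in> \<Sigma>" and w: "w \<in> \<Sigma>" using assms by auto
  then have zw: "z + w \<in> \<Sigma>" using open_sector_add[OF M_nonneg] by blast
  \<comment> \<open>Operator and argument both vary with k; contractivity, uniform in k, separates
    the two limits.\<close>
  have EE: "(\<lambda>k. E k z (E k w f)) \<longlonglongrightarrow> S z (S w f)" for f
  proof (rule LIM_zero_cancel, rule Lim_null_comparison)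
    show "\<forall>\<^sub>F k in sequentially. norm (E k z (E k w f) - S z (S w f))
        \<le> norm (E k w f - S w f) + norm (E k z (S w f) - S z (S w f))"
    proof (rule always_eventually, rule allI)
      fix k
      have *: "E k z (E k w f) - S z (S w f) = E k z (E k w f - S w f) + (E k z (S w f) - S z (S w f))"
        by (simp add: linear_diff[OF linear_E[OF z]])
      show "norm (E k z (E k w f) - S z (S w f))
          \<le> norm (E k w f - S w f) + norm (E k z (S w f) - S z (S w f))"
        unfolding * by (rule order_trans[OF norm_triangle_ineq add_right_mono[OF norm_E_le[OF z]]])
    qed
    show "(\<lambda>k. norm (E k w f - S w f) + norm (E k z (S w f) - S z (S w f))) \<longlonglongrightarrow> 0"
      using tendsto_add[OF tendsto_norm[OF LIM_zero[OF E_tendsto_S[OF w]]]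
          tendsto_norm[OF LIM_zero[OF E_tendsto_S[OF z]]]] by simp
  qed
  have D2_case: "S (z + w) g = S z (S w g)" if g: "g \<in> D2" for g
  proof -
    have le: "norm (E k z (E k w g) - E k (z + w) g) \<le> cmod z * cmod w * norm (B (B g)) * (1/2) ^ k" for k
    proof -
      let ?z = "z / 2 ^ k" and ?w = "w / 2 ^ k"
      let ?X = "F ?z \<circ> F ?w" and ?Y = "F (?z + ?w)"
      have zk: "?z \<in> \<Sigma>" and wk: "?w \<in> \<Sigma>" and zwk: "?z + ?w \<in> \<Sigma>"
        using scale_pow_in[OF z] scale_pow_in[OF w] scale_pow_in[OF zw] by (auto simp: add_divide_distrib)
      have "(F ?z ^^ n) ((F ?w ^^ n) g) = (?X ^^ n) g" for n
      proof (induction n)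
        case (Suc n)
        have "(F ?z ^^ Suc n) ((F ?w ^^ Suc n) g) = F ?z (F ?w ((F ?z ^^ n) ((F ?w ^^ n) g)))"
          using funpow_commute_on[of "F ?w" "F ?z" n] F_commute[OF zk wk] by simp
        then show ?case using Suc by simp
      qed auto
      then have 1: "E k z (E k w g) = (?X ^^ (2 ^ k)) g" by (simp only: E_def)
      have 2: "E k (z + w) g = (?Y ^^ (2 ^ k)) g" by (simp only: E_def add_divide_distrib)
      have "norm ((?X ^^ (2 ^ k)) g - (?Y ^^ (2 ^ k)) g) \<le> real (2 ^ k) * norm (?X g - ?Y g)"
      proof (rule norm_funpow_diff_le)
        show "norm (?X x) \<le> norm x" for x
          using order_trans[OF norm_F_le[OF zk] norm_F_le[OF wk]] by simp
        show "linear ?X" using zk wk by (intro linear_compose linear_F)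
        show "?X (?Y x) = ?Y (?X x)" for x
          by (metis F_commute[OF zk zwk] F_commute[OF wk zwk] comp_apply)
      qed (intro norm_F_le linear_F zwk)+
      also have "\<dots> \<le> real (2 ^ k) * (cmod ?z * cmod ?w * norm (B (B g)))"
        using norm_F_F_minus_F[OF zk wk g] by (intro mult_left_mono) auto
      also have "\<dots> = cmod z * cmod w * norm (B (B g)) * (1/2) ^ k"
        by (simp add: norm_divide norm_power field_simps power_divide)
      finally show ?thesis unfolding 1 2 .
    qed
    have "(\<lambda>k. cmod z * cmod w * norm (B (B g)) * (1/2) ^ k) \<longlonglongrightarrow> 0"
      by (intro tendsto_mult_right_zero LIMSEQ_power_zero) auto
    then have "(\<lambda>k. E k z (E k w g) - E k (z + w) g) \<longlonglongrightarrow> 0"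
      by (rule Lim_null_comparison[OF always_eventually[OF allI[OF le]]])
    moreover have "(\<lambda>k. E k z (E k w g) - E k (z + w) g) \<longlonglongrightarrow> S z (S w g) - S (z + w) g"
      by (intro tendsto_diff EE E_tendsto_S zw)
    ultimately have "0 = S z (S w g) - S (z + w) g" by (rule LIMSEQ_unique)
    then show ?thesis by simp
  qed
  have "norm (S (z + w) f - S z (S w f)) \<le> e" if e: "e > 0" for e
  proof -
    obtain g where g: "g \<in> D2" "norm (g - f) < e / 2" 
      by (rule D2_approx[of "e / 2" f]) (use e in auto)
    have "S (z + w) f - S z (S w f) = S z (S w (g - f)) - S (z + w) (g - f)"
      using D2_case[OF g(1)] z w zw by (simp add: linear_diff[OF linear_S])
    then have "norm (S (z + w) f - S z (S w f)) \<le> norm (S z (S w (g - f))) + norm (S (z + w) (g - f))"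
      using norm_triangle_ineq4[of "S z (S w (g - f))" "S (z + w) (g - f)"] by simp
    also have "\<dots> \<le> norm (g - f) + norm (g - f)"
      using z w zw by (intro add_mono order_trans[OF norm_S_le norm_S_le] norm_S_le) auto
    finally show ?thesis using g by simp
  qed
  then have "norm (S (z + w) f - S z (S w f)) \<le> 0" by (rule field_le_epsilon) simp
  then show ?thesis by simp
qed auto

end

section \<open>Holomorphy, first in the weak sense and then in operator norm\<close>

context m_sectorial
begin

text \<open>The resolvent identity, in a form from which the derivative - F z (B (F z x)) in z can
  be read off.\<close>

lemma F_diff_eq:
  assumes "w \<in> \<Sigma>" "z \<in> \<Sigma>"
  shows "F w x - F z x = sc (z - w) (F w (B (F z x)))"
proof -
  let ?y = "F z x"
  have y: "?y \<in> D" by (rule F_in[OF assms(2)])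
  have "?y = F w (?y + sc w (B ?y))" using F_unique[OF assms(1) y refl] by simp
  then have "F w x - ?y = F w (x - (?y + sc w (B ?y)))" by (simp only: F_diff[OF assms(1)])
  also have "x - (?y + sc w (B ?y)) = sc (z - w) (B ?y)"
    using F_eq[OF assms(2), of x] by (simp add: sc_diff_left algebra_simps)
  finally show ?thesis by (simp only: F_sc[OF assms(1)])
qed

lemma eventually_in_sector: "z \<in> \<Sigma> \<Longrightarrow> \<forall>\<^sub>F w in at z. w \<in> \<Sigma>"
  using open_open_sector eventually_at_topological by blast

lemma F_tendsto:
  assumes "z \<in> \<Sigma>"
  shows "((\<lambda>w. F w x) \<longlongrightarrow> F z x) (at z)"
proof (rule LIM_zero_cancel, rule Lim_null_comparison)
  show "\<forall>\<^sub>F w in at z. norm (F w x - F z x) \<le> cmod (z - w) * norm (B (F z x))"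
    using eventually_in_sector[OF assms]
    by eventually_elim (simp add: F_diff_eq[OF _ assms] norm_sc mult_left_mono norm_F_le)
  have "((\<lambda>w. cmod (z - w) * norm (B (F z x))) \<longlongrightarrow> cmod (z - z) * norm (B (F z x))) (at z)"
    by (intro tendsto_intros)
  then show "((\<lambda>w. cmod (z - w) * norm (B (F z x))) \<longlongrightarrow> 0) (at z)" by simp
qed

lemma F_tendsto2:
  assumes "z \<in> \<Sigma>" "(X \<longlongrightarrow> x) (at z)"
  shows "((\<lambda>w. F w (X w)) \<longlongrightarrow> F z x) (at z)"
proof (rule LIM_zero_cancel, rule Lim_null_comparison)
  show "\<forall>\<^sub>F w in at z. norm (F w (X w) - F z x) \<le> norm (X w - x) + norm (F w x - F z x)"
    using eventually_in_sector[OF assms(1)]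
  proof eventually_elim
    case (elim w)
    have "F w (X w) - F z x = F w (X w - x) + (F w x - F z x)" by (simp add: F_diff elim)
    then show ?case using order_trans[OF norm_triangle_ineq add_right_mono[OF norm_F_le[OF elim]]] by metis
  qed
  show "((\<lambda>w. norm (X w - x) + norm (F w x - F z x)) \<longlongrightarrow> 0) (at z)"
    using tendsto_add[OF tendsto_norm[OF LIM_zero[OF assms(2)]]
        tendsto_norm[OF LIM_zero[OF F_tendsto[OF assms(1)]]]] by simp
qed

text \<open>The product rule by induction: the quotient for n + 1 is F w applied to the quotient for
  n, minus F w (B (F z x)) with x the n-th power at z. Joint continuity of F handles the moving
  operator F w.\<close>

lemma F_power_difference_quotient:
  assumes z: "z \<in> \<Sigma>"
  shows "\<exists>d. ((\<lambda>w. sc (1 / (w - z)) ((F w ^^ n) f - (F z ^^ n) f)) \<longlongrightarrow> d) (at z)"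
proof (induction n)
  case (Suc n)
  then obtain d where d: "((\<lambda>w. sc (1 / (w - z)) ((F w ^^ n) f - (F z ^^ n) f)) \<longlongrightarrow> d) (at z)" by blast
  let ?x = "(F z ^^ n) f"
  have "((\<lambda>w. F w (sc (1 / (w - z)) ((F w ^^ n) f - ?x)) - F w (B (F z ?x)))
      \<longlongrightarrow> F z d - F z (B (F z ?x))) (at z)"
    by (intro tendsto_diff F_tendsto2 z d tendsto_const)
  moreover have "\<forall>\<^sub>F w in at z. F w (sc (1 / (w - z)) ((F w ^^ n) f - ?x)) - F w (B (F z ?x))
      = sc (1 / (w - z)) ((F w ^^ Suc n) f - (F z ^^ Suc n) f)"
    using eventually_in_sector[OF z] eventually_neq_at_within[of z]
  proof eventually_elim
    case (elim w)
    have "(F w ^^ Suc n) f - (F z ^^ Suc n) f = F w ((F w ^^ n) f - ?x) + (F w ?x - F z ?x)"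
      by (simp add: F_diff elim)
    also have "\<dots> = F w ((F w ^^ n) f - ?x) - sc (w - z) (F w (B (F z ?x)))"
      unfolding F_diff_eq[OF elim(1) z] by (simp add: sc_diff_left)
    finally have *: "(F w ^^ Suc n) f - (F z ^^ Suc n) f = F w ((F w ^^ n) f - ?x) - sc (w - z) (F w (B (F z ?x)))" .
    have gen: "sc (1 / (w - z)) (F w y - sc (w - z) y') = F w (sc (1 / (w - z)) y) - y'" for y y'
      using elim by (simp add: sc_diff_right sc_inverse F_sc)
    show ?case unfolding * gen by (rule refl)
  qed
  ultimately show ?case using tendsto_cong by fast
qed auto

text \<open>Pairing with a fixed vector g reduces the claim to scalar holomorphic functions, whose
  locally uniform limits are again holomorphic. Norm estimates are regained later by letting g be
  the error vector itself.\<close>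

lemma holomorphic_E: "(\<lambda>z. ci (E k z f) g) holomorphic_on \<Sigma>"
proof -
  have "(\<lambda>w. ci ((F w ^^ n) f) g) field_differentiable at z" if z: "z \<in> \<Sigma>" for z n
  proof -
    obtain d where "((\<lambda>w. sc (1 / (w - z)) ((F w ^^ n) f - (F z ^^ n) f)) \<longlongrightarrow> d) (at z)"
      using F_power_difference_quotient[OF z] by blast
    from tendsto_ci[OF this, of g]
    have "((\<lambda>w. ci ((F w ^^ n) f) g) has_field_derivative ci d g) (at z)"
      unfolding has_field_derivative_iff by (simp add: ci_scale ci_diff_left)
    then show ?thesis unfolding field_differentiable_def by blast
  qed
  then have "(\<lambda>w. ci ((F w ^^ n) f) g) holomorphic_on \<Sigma>" for n
    by (simp add: holomorphic_on_def field_differentiable_at_within)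
  moreover have "(\<lambda>z. z / 2 ^ k) holomorphic_on \<Sigma>" by (intro holomorphic_intros) auto
  moreover have "(\<lambda>z. z / 2 ^ k) ` \<Sigma> \<subseteq> \<Sigma>" using scale_pow_in by blast
  ultimately have "((\<lambda>w. ci ((F w ^^ (2 ^ k)) f) g) \<circ> (\<lambda>z. z / 2 ^ k)) holomorphic_on \<Sigma>"
    using holomorphic_on_compose_gen by blast
  then show ?thesis unfolding E_def comp_def .
qed

lemma holomorphic_S: "(\<lambda>z. ci (S z f) g) holomorphic_on \<Sigma>"
proof (rule holomorphic_uniform_sequence[OF open_open_sector holomorphic_E])
  fix z assume "z \<in> \<Sigma>"
  then obtain d where d: "d > 0" "cball z d \<subseteq> \<Sigma>"
    using open_open_sector open_contains_cball by blast
  have "uniform_limit (cball z d) (\<lambda>k z. ci (E k z f) g) (\<lambda>z. ci (S z f) g) sequentially"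
  proof (rule uniform_limitI)
    fix e :: real assume "e > 0"
    \<comment> \<open>A positive bound for \<open>norm g\<close>, also when g = 0. The divisor 4 c
      compensates the factor 2 in \<open>cmod_ci_le\<close> and leaves e / 2.\<close>
    define c where "c = norm g + 1"
    define e' where "e' = e / (4 * c)"
    have ng: "c > 0" by (simp add: c_def add_nonneg_pos)
    have "e' > 0" using \<open>e > 0\<close> ng by (simp add: e'_def)
    then obtain N where N: "\<And>k w. N \<le> k \<Longrightarrow> w \<in> \<Sigma> \<Longrightarrow> cmod w \<le> cmod z + d \<Longrightarrow> norm (S w f - E k w f) \<le> e'"
      using E_uniformly_tendsto_S by metis
    have "dist (ci (E k w f) g) (ci (S w f) g) < e" if "k \<ge> N" "w \<in> cball z d" for k w
    proof -
      have "cmod w \<le> cmod z + d"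
        using that norm_triangle_ineq2[of w z] by (auto simp: dist_norm norm_minus_commute)
      then have *: "norm (S w f - E k w f) \<le> e'" using N that d by blast
      have "dist (ci (E k w f) g) (ci (S w f) g) = cmod (ci (S w f - E k w f) g)"
        by (simp add: ci_diff_left dist_norm norm_minus_commute)
      also have "\<dots> \<le> 2 * norm (S w f - E k w f) * norm g" by (rule cmod_ci_le)
      also have "\<dots> \<le> 2 * e' * c" using * \<open>e' > 0\<close> by (intro mult_mono) (auto simp: c_def)
      also have "\<dots> = e / 2" using ng by (simp add: e'_def)
      finally show ?thesis using \<open>e > 0\<close> by simp
    qed
    then show "\<forall>\<^sub>F k in sequentially. \<forall>w\<in>cball z d. dist (ci (E k w f) g) (ci (S w f) g) < e"
      unfolding eventually_sequentially by blast
  qed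
  then show "\<exists>d>0. cball z d \<subseteq> \<Sigma> \<and> uniform_limit (cball z d) (\<lambda>k z. ci (E k z f) g) (\<lambda>z. ci (S z f) g) sequentially"
    using d by blast
qed

end

text \<open>Every point of the half ball is the centre of a disc of radius r / 2 inside the ball, so
  Cauchy's inequality bounds the second derivative by 2 C / (r/2)^2. Taylor's formula of order one,
  whose remainder is divided by \<open>fact 1\<close>, does the rest.\<close>

lemma holomorphic_second_order_bound:
  assumes hol: "f holomorphic_on T" "open T" "cball z r \<subseteq> T" and r: "r > 0"
    and bound: "\<And>w. w \<in> cball z r \<Longrightarrow> cmod (f w) \<le> C"
    and w: "cmod (w - z) \<le> r / 2"
  shows "cmod (f w - f z - deriv f z * (w - z)) \<le> 8 * C / r\<^sup>2 * (cmod (w - z))\<^sup>2"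
proof -
  let ?B = "8 * C / r\<^sup>2"
  have "cmod ((\<lambda>i. (deriv ^^ i) f) 0 w - (\<Sum>i\<le>1. (deriv ^^ i) f z * (w - z) ^ i / fact i))
      \<le> ?B * cmod (w - z) ^ Suc 1 / fact 1"
  proof (rule complex_Taylor[where S="cball z (r / 2)"])
    fix i and x assume x: "x \<in> cball z (r / 2)" and "i \<le> (1::nat)"
    have "x \<in> T" using x r hol(3) by (auto simp: dist_norm subset_iff)
    then have "((deriv ^^ i) f has_field_derivative deriv ((deriv ^^ i) f) x) (at x)"
      using holomorphic_higher_deriv[OF hol(1,2)] hol(2) holomorphic_derivI by blast
    then show "((deriv ^^ i) f has_field_derivative (deriv ^^ Suc i) f x) (at x within cball z (r / 2))"
      by (simp add: has_field_derivative_at_within)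
  next
    fix x assume x: "x \<in> cball z (r / 2)"
    have sub: "cball x (r / 2) \<subseteq> cball z r"
    proof
      fix y assume "y \<in> cball x (r / 2)"
      then show "y \<in> cball z r" using x dist_triangle[of z y x] by simp
    qed
    have "cmod ((deriv ^^ 2) f x) \<le> fact 2 * C / (r / 2) ^ 2"
    proof (rule Cauchy_inequality)
      have "ball x (r / 2) \<subseteq> T" "cball x (r / 2) \<subseteq> T"
        using sub hol(3) ball_subset_cball by (auto simp: subset_iff)
      then show "f holomorphic_on ball x (r / 2)" "continuous_on (cball x (r / 2)) f"
        using hol(1) holomorphic_on_subset holomorphic_on_imp_continuous_on by blast+
      show "cmod (f y) \<le> C" if "cmod (x - y) = r / 2" for y
        using sub that by (intro bound) (auto simp: dist_norm subset_iff)
    qed (use r in auto)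
    then show "cmod ((deriv ^^ Suc 1) f x) \<le> ?B"
      by (simp add: numeral_2_eq_2 power_divide)
  qed (use r w in \<open>auto simp: dist_norm norm_minus_commute\<close>)
  then show ?thesis by (simp add: power2_eq_square algebra_simps)
qed

context m_sectorial
begin

text \<open>Weak holomorphy implies holomorphy in operator norm. The scalar Taylor bound depends on
  f and g only through their norms, so the difference quotients form a Cauchy family with an error
  proportional to \<open>norm f\<close>, and their limit is the derivative.\<close>

lemma S_difference_quotient:
  assumes z: "z \<in> \<Sigma>"
  obtains D' K r where "linear D'" "\<And>a f. D' (sc a f) = sc a (D' f)" "r > 0" "K \<ge> 0"
    "\<And>w f. w \<noteq> z \<Longrightarrow> cmod (w - z) \<le> r \<Longrightarrow> w \<in> \<Sigma> \<and> norm (sc (1 / (w - z)) (S w f - S z f) - D' f) \<le> K * cmod (w - z) * norm f"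
proof -
  obtain r where r: "r > 0" "cball z r \<subseteq> \<Sigma>"
    using z open_open_sector open_contains_cball by blast
  define q where "q w f = sc (1 / (w - z)) (S w f - S z f)" for w f
  \<comment> \<open>16 = 8 times 2: the constant of the Taylor bound, with 2 |f| |g| as the bound
    for the scalar function.\<close>
  define K where "K = 16 / r\<^sup>2"
  have K: "K \<ge> 0" by (simp add: K_def)
  define P where "P w \<longleftrightarrow> w \<noteq> z \<and> cmod (w - z) \<le> r / 2" for w
  have in_sector: "w \<in> \<Sigma>" if "P w" for w
    using r that by (auto simp: P_def dist_norm norm_minus_commute subset_iff)
  have q_deriv: "cmod (ci (q w f) g - deriv (\<lambda>z. ci (S z f) g) z) \<le> K * cmod (w - z) * norm f * norm g"
    if w: "P w" for w f g
  proof -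
    let ?s = "\<lambda>z. ci (S z f) g" and ?C = "2 * norm f * norm g"
    have ineq: "cmod (?s w - ?s z - deriv ?s z * (w - z)) \<le> 8 * ?C / r\<^sup>2 * (cmod (w - z))\<^sup>2"
    proof (rule holomorphic_second_order_bound[OF holomorphic_S open_open_sector r(2,1)])
      show "cmod (w - z) \<le> r / 2" using w by (simp add: P_def)
      fix x assume "x \<in> cball z r"
      then have "norm (S x f) \<le> norm f" using r by (intro norm_S_le) auto
      then have "2 * norm (S x f) * norm g \<le> ?C" by (intro mult_mono) auto
      then show "cmod (?s x) \<le> ?C" using cmod_ci_le order_trans by blast
    qed
    have eq: "ci (q w f) g - deriv ?s z = (?s w - ?s z - deriv ?s z * (w - z)) / (w - z)"
      using w by (simp add: q_def ci_scale ci_diff_left P_def field_simps)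
    have "cmod (ci (q w f) g - deriv ?s z) \<le> 8 * ?C / r\<^sup>2 * (cmod (w - z))\<^sup>2 / cmod (w - z)"
      unfolding eq norm_divide by (intro divide_right_mono ineq norm_ge_zero)
    also have "\<dots> = K * cmod (w - z) * norm f * norm g"
      using w by (simp add: K_def P_def power2_eq_square)
    finally show ?thesis .
  qed
  have q_diff: "norm (q w f - q w' f) \<le> K * norm f * (cmod (w - z) + cmod (w' - z))"
    if "P w" "P w'" for w w' f
  proof -
    \<comment> \<open>Testing with the difference itself turns the weak estimate into a norm
      estimate: one factor |g| cancels.\<close>
    let ?g = "q w f - q w' f"
    have "(norm ?g)\<^sup>2 \<le> cmod (ci ?g ?g)" by (rule norm_le_ci)
    also have "\<dots> = cmod ((ci (q w f) ?g - deriv (\<lambda>z. ci (S z f) ?g) z) - (ci (q w' f) ?g - deriv (\<lambda>z. ci (S z f) ?g) z))"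
      by (simp add: ci_diff_left)
    also have "\<dots> \<le> K * cmod (w - z) * norm f * norm ?g + K * cmod (w' - z) * norm f * norm ?g"
      by (rule order_trans[OF norm_triangle_ineq4 add_mono[OF q_deriv q_deriv]]) (use that in auto)
    also have "\<dots> = (K * norm f * (cmod (w - z) + cmod (w' - z))) * norm ?g" by (simp add: algebra_simps)
    finally show ?thesis
      using K by (cases "norm ?g = 0") (auto simp: power2_eq_square)
  qed
  \<comment> \<open>Any sequence tending to z would do; this one runs parallel to the real axis
    within distance r / 2. Its quotients define D', and the estimate for all other w follows by
    comparison with them.\<close>
  define v where "v n = z + complex_of_real (r / 2 / real (Suc n))" for n
  have cmod_v: "cmod (v n - z) = r / 2 / real (Suc n)" for n
    unfolding v_def add_diff_cancel_left' norm_of_real using r by simp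
  have Pv: "P (v n)" for n
  proof -
    have "r / 2 / real (Suc n) \<le> r / 2 / 1" using r by (intro divide_left_mono) auto
    moreover have "r / 2 / real (Suc n) > 0" using r by simp
    ultimately show ?thesis unfolding P_def cmod_v by (metis cmod_v div_by_1 norm_zero order_less_irrefl right_minus_eq)
  qed
  have v_lim: "(\<lambda>n. cmod (v n - z)) \<longlonglongrightarrow> 0"
    unfolding cmod_v using LIMSEQ_Suc[OF lim_const_over_n] by blast
  have "\<exists>l. (\<lambda>n. q (v n) f) \<longlonglongrightarrow> l" for f
  proof -
    have "Cauchy (\<lambda>n. q (v n) f)"
    proof (rule CauchyI)
      fix e :: real assume "e > 0"
      have "(\<lambda>n. K * norm f * cmod (v n - z)) \<longlonglongrightarrow> 0"
        by (rule tendsto_mult_right_zero[OF v_lim])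
      from order_tendstoD(2)[OF this, of "e / 2"] \<open>e > 0\<close>
      obtain N where N: "\<And>n. n \<ge> N \<Longrightarrow> K * norm f * cmod (v n - z) < e / 2"
        unfolding eventually_sequentially by auto
      have "norm (q (v m) f - q (v n) f) < e" if "m \<ge> N" "n \<ge> N" for m n
        using q_diff[OF Pv Pv, of m f n] N[OF that(1)] N[OF that(2)] by (simp add: distrib_left)
      then show "\<exists>M. \<forall>m\<ge>M. \<forall>n\<ge>M. norm (q (v m) f - q (v n) f) < e" by blast
    qed
    then show ?thesis by (simp add: Cauchy_convergent_iff convergent_def)
  qed
  then obtain D' where D': "\<And>f. (\<lambda>n. q (v n) f) \<longlonglongrightarrow> D' f" by metis
  have lin_q: "q (v n) (f + g) = q (v n) f + q (v n) g" "q (v n) (sc a f) = sc a (q (v n) f)" for n f g a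
    using linear_S[of z] linear_S[of "v n"] z in_sector[OF Pv]
    by (auto simp: q_def linear_add S_sc sc_commute[of a] add_diff_add simp flip: sc_add_right sc_diff_right)
  have D'_add: "D' (f + g) = D' f + D' g" for f g
    using LIMSEQ_unique[OF D'[of "f + g"]] tendsto_add[OF D'[of f] D'[of g]] by (simp add: lin_q)
  have D'_sc: "D' (sc a f) = sc a (D' f)" for a f
    using LIMSEQ_unique[OF D'[of "sc a f"]] bounded_linear.tendsto[OF bounded_linear_sc D'[of f], of a] by (simp add: lin_q)
  show ?thesis
  proof (rule that[of D' "r / 2" K])
    show "linear D'"
      by (rule linearI) (use D'_add D'_sc[of "complex_of_real _"] in \<open>auto simp: sc_of_real\<close>)
    show "D' (sc a f) = sc a (D' f)" for a f by (rule D'_sc)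
    fix w f assume w: "w \<noteq> z" "cmod (w - z) \<le> r / 2"
    then have Pw: "P w" by (simp add: P_def)
    have "norm (q w f - D' f) \<le> K * norm f * (cmod (w - z) + 0)"
    proof (rule LIMSEQ_le)
      show "(\<lambda>n. norm (q w f - q (v n) f)) \<longlonglongrightarrow> norm (q w f - D' f)"
        by (intro tendsto_intros D')
      show "(\<lambda>n. K * norm f * (cmod (w - z) + cmod (v n - z))) \<longlonglongrightarrow> K * norm f * (cmod (w - z) + 0)"
        by (intro tendsto_intros v_lim)
      show "\<exists>N. \<forall>n\<ge>N. norm (q w f - q (v n) f) \<le> K * norm f * (cmod (w - z) + cmod (v n - z))"
        using q_diff[OF Pw Pv] by blast
    qed
    then show "w \<in> \<Sigma> \<and> norm (sc (1 / (w - z)) (S w f - S z f) - D' f) \<le> K * cmod (w - z) * norm f"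
      using in_sector[OF Pw] by (simp add: q_def mult_ac)
  qed (use r K in auto)
qed

section \<open>Behaviour at the vertex and the generator\<close>

lemma norm_F_power_minus_id:
  assumes "z \<in> \<Sigma>" "f \<in> D"
  shows "norm ((F z ^^ n) f - f) \<le> real n * (cmod z * norm (B f))"
proof -
  have "norm ((F z ^^ n) f - (id ^^ n) f) \<le> real n * norm (F z f - id f)"
    by (rule norm_funpow_diff_le) (auto simp: norm_F_le linear_F assms linear_id)
  also have "\<dots> \<le> real n * (cmod z * norm (B f))"
    using norm_F_minus_id[OF assms] by (intro mult_left_mono) auto
  finally show ?thesis by simp
qed

lemma norm_S_minus_id:
  assumes z: "z \<in> \<Sigma>" and f: "f \<in> D"
  shows "norm (S z f - f) \<le> cmod z * norm (B f)"
proof (rule LIMSEQ_le_const2)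
  show "(\<lambda>k. norm (E k z f - f)) \<longlonglongrightarrow> norm (S z f - f)"
    by (intro tendsto_intros E_tendsto_S z)
  have "norm (E k z f - f) \<le> cmod z * norm (B f)" for k
    using norm_F_power_minus_id[OF scale_pow_in[OF z, of k] f, where n="2 ^ k"]
    by (simp add: E_def norm_divide norm_power)
  then show "\<exists>N. \<forall>n\<ge>N. norm (E n z f - f) \<le> cmod z * norm (B f)" by blast
qed

lemma S_tendsto_id: "((\<lambda>z. S z f) \<longlongrightarrow> f) (at 0 within \<Sigma>)"
proof (rule tendstoI)
  fix e :: real assume e: "e > 0"
  obtain g where g: "g \<in> D" "norm (g - f) < e / 3"
    using dense e closure_approachable[of f D] by (metis UNIV_I dist_norm divide_pos_pos zero_less_numeral)
  have "((\<lambda>z. cmod z * norm (B g)) \<longlongrightarrow> cmod 0 * norm (B g)) (at 0 within \<Sigma>)"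
    by (intro tendsto_intros)
  then have "\<forall>\<^sub>F z in at 0 within \<Sigma>. cmod z * norm (B g) < e / 3"
    using e by (intro order_tendstoD(2)[where y=0]) auto
  moreover have "\<forall>\<^sub>F z in at 0 within \<Sigma>. z \<in> \<Sigma>"
    by (simp add: eventually_at_filter)
  ultimately show "\<forall>\<^sub>F z in at 0 within \<Sigma>. dist (S z f) f < e"
  proof eventually_elim
    case (elim z)
    have "S z f - f = (S z g - g) + (g - f) - S z (g - f)"
      using elim by (simp add: linear_diff[OF linear_S])
    then have "norm (S z f - f) \<le> norm (S z g - g) + norm (g - f) + norm (S z (g - f))"
      using norm_triangle_ineq4[of "(S z g - g) + (g - f)" "S z (g - f)"] norm_triangle_ineq[of "S z g - g" "g - f"]
      by (smt (verit))
    also have "\<dots> \<le> cmod z * norm (B g) + norm (g - f) + norm (g - f)"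
      using elim by (intro add_mono norm_S_minus_id norm_S_le g) auto
    also have "\<dots> < e" using elim g by simp
    finally show ?case by (simp add: dist_norm)
  qed
qed

text \<open>Each factor changes the vector by exactly - z F^j (B f). Replacing all these by - z B f
  costs at most |z| \<delta> per step.\<close>

lemma norm_F_power_first_order:
  assumes z: "z \<in> \<Sigma>" and f: "f \<in> D" and \<delta>: "\<And>j. j \<le> n \<Longrightarrow> norm ((F z ^^ j) (B f) - B f) \<le> \<delta>"
  shows "norm ((F z ^^ n) f - f + sc (of_nat n * z) (B f)) \<le> real n * cmod z * \<delta>"
  using \<delta>
proof (induction n)
  case (Suc n)
  have "F z f - f = - sc z (F z (B f))"
    using F_eq[OF z, of f] B_F_commute[OF z f] by (simp add: algebra_simps)
  have lin: "linear (F z ^^ n)" by (intro linear_funpow linear_F z)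
  have "(F z ^^ n) (sc a x) = sc a ((F z ^^ n) x)" for a x
    by (induction n) (auto simp: F_sc z)
  moreover have "(F z ^^ Suc n) f - (F z ^^ n) f = (F z ^^ n) (F z f - f)"
    by (simp add: linear_diff[OF lin] funpow_swap1)
  ultimately have "(F z ^^ Suc n) f - (F z ^^ n) f = - sc z ((F z ^^ Suc n) (B f))"
    using \<open>F z f - f = - sc z (F z (B f))\<close> by (simp add: linear_neg[OF lin] funpow_swap1)
  then have eq: "(F z ^^ Suc n) f - f + sc (of_nat (Suc n) * z) (B f)
      = ((F z ^^ n) f - f + sc (of_nat n * z) (B f)) - sc z ((F z ^^ Suc n) (B f) - B f)"
    by (simp add: sc_diff_right sc_add_left distrib_right algebra_simps)
  have "norm ((F z ^^ n) f - f + sc (of_nat n * z) (B f)) \<le> real n * cmod z * \<delta>"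
    using Suc by simp
  moreover have "norm (sc z ((F z ^^ Suc n) (B f) - B f)) \<le> cmod z * \<delta>"
    unfolding norm_sc by (intro mult_left_mono Suc) auto
  ultimately show ?case
    unfolding eq by (intro order_trans[OF norm_triangle_ineq4 order_trans[OF add_mono]]) (auto simp: algebra_simps)
qed auto

text \<open>B f need not lie in D, so powers of F cannot be compared with the identity on it
  directly. An approximation g in D is inserted: the powers move g by at most |z| |B g|, and
  contractivity charges the rest 2 |B f - g|.\<close>

lemma norm_S_first_order:
  assumes z: "z \<in> \<Sigma>" and f: "f \<in> D" and g: "g \<in> D"
  shows "norm (S z f - f + sc z (B f)) \<le> cmod z * (2 * norm (B f - g) + cmod z * norm (B g))"
proof (rule LIMSEQ_le_const2)
  show "(\<lambda>k. norm (E k z f - f + sc z (B f))) \<longlonglongrightarrow> norm (S z f - f + sc z (B f))"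
    by (intro tendsto_intros E_tendsto_S z)
  have "norm (E k z f - f + sc z (B f)) \<le> cmod z * (2 * norm (B f - g) + cmod z * norm (B g))" for k
  proof -
    let ?h = "z / 2 ^ k"
    have h: "?h \<in> \<Sigma>" by (rule scale_pow_in[OF z])
    have "norm ((F ?h ^^ j) (B f) - B f) \<le> 2 * norm (B f - g) + cmod z * norm (B g)" if "j \<le> 2 ^ k" for j
    proof -
      have lin: "linear (F ?h ^^ j)" by (intro linear_funpow linear_F h)
      have "(F ?h ^^ j) (B f) - B f = ((F ?h ^^ j) (B f - g) - (B f - g)) + ((F ?h ^^ j) g - g)"
        by (simp add: linear_diff[OF lin])
      then have "norm ((F ?h ^^ j) (B f) - B f) \<le> norm ((F ?h ^^ j) (B f - g)) + norm (B f - g) + norm ((F ?h ^^ j) g - g)"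
        using norm_triangle_ineq4[of "(F ?h ^^ j) (B f - g)" "B f - g"]
          norm_triangle_ineq[of "(F ?h ^^ j) (B f - g) - (B f - g)" "(F ?h ^^ j) g - g"] by (smt (verit))
      also have "\<dots> \<le> norm (B f - g) + norm (B f - g) + real j * (cmod ?h * norm (B g))"
        by (intro add_mono norm_funpow_le norm_F_le h norm_F_power_minus_id g order_refl)
      also have "real j * (cmod ?h * norm (B g)) \<le> 2 ^ k * (cmod ?h * norm (B g))"
        using of_nat_mono[OF that, where 'a=real] by (intro mult_right_mono) auto
      finally show ?thesis by (simp add: norm_divide norm_power)
    qed
    from norm_F_power_first_order[OF h f this, where n="2 ^ k"]
    show ?thesis by (simp add: E_def norm_divide norm_power)
  qed
  then show "\<exists>N. \<forall>n\<ge>N. norm (E n z f - f + sc z (B f)) \<le> cmod z * (2 * norm (B f - g) + cmod z * norm (B g))" by blast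
qed

lemma S_derivative_at_0:
  assumes f: "f \<in> D"
  shows "((\<lambda>t. (1 / t) *\<^sub>R (S (complex_of_real t) f - f)) \<longlongrightarrow> - B f) (at_right 0)"
proof (rule tendstoI)
  fix e :: real assume e: "e > 0"
  obtain g where g: "g \<in> D" "norm (g - B f) < e / 4"
    using dense e closure_approachable[of "B f" D] by (metis UNIV_I dist_norm divide_pos_pos zero_less_numeral)
  have "((\<lambda>t. t * norm (B g)) \<longlongrightarrow> 0 * norm (B g)) (at_right 0)"
    by (intro tendsto_intros)
  then have "\<forall>\<^sub>F t in at_right 0. t * norm (B g) < e / 2"
    using e by (intro order_tendstoD(2)[where y=0]) auto
  moreover have "\<forall>\<^sub>F t in at_right 0. t > (0::real)" by (simp add: eventually_at_filter)
  ultimately show "\<forall>\<^sub>F t in at_right 0. dist ((1 / t) *\<^sub>R (S (complex_of_real t) f - f)) (- B f) < e"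
  proof eventually_elim
    case (elim t)
    then have "norm (S (complex_of_real t) f - f + t *\<^sub>R B f) \<le> t * (2 * norm (B f - g) + t * norm (B g))"
      using norm_S_first_order[OF of_real_in_open_sector f g(1), of t] by (simp add: sc_of_real)
    moreover have "(1 / t) *\<^sub>R (S (complex_of_real t) f - f) - (- B f) = (1 / t) *\<^sub>R (S (complex_of_real t) f - f + t *\<^sub>R B f)"
      using elim by (simp add: scaleR_add_right)
    ultimately have "norm ((1 / t) *\<^sub>R (S (complex_of_real t) f - f) - (- B f)) \<le> 2 * norm (B f - g) + t * norm (B g)"
      using elim by (simp add: divide_le_eq mult.commute)
    also have "\<dots> < e" using g elim by (simp add: norm_minus_commute)
    finally show ?case by (simp add: dist_norm)
  qed
qed

text \<open>For the direction not covered by the derivative on D, solve v + B v = u - w. Then d = u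
  - v has derivative w + B v = d at 0. Contractivity gives (S t d - d, d) <= 0 for t > 0, so |d|^2
  <= 0 and u = v lies in D.\<close>

lemma S_generator:
  "((\<lambda>t. (1 / t) *\<^sub>R (S (complex_of_real t) u - u)) \<longlongrightarrow> w) (at_right 0) \<longleftrightarrow> u \<in> D \<and> w = - B u"
proof
  assume lim: "((\<lambda>t. (1 / t) *\<^sub>R (S (complex_of_real t) u - u)) \<longlongrightarrow> w) (at_right 0)"
  have 1: "1 \<in> \<Sigma>" using of_real_in_open_sector[of 1 M] by simp
  define v where "v = F 1 (u - w)"
  have v: "v \<in> D" "v + B v = u - w" using F_in[OF 1] F_eq[OF 1, of "u - w"] by (simp_all add: v_def)
  define d where "d = u - v"
  have "((\<lambda>t. (1 / t) *\<^sub>R (S (complex_of_real t) u - u) - (1 / t) *\<^sub>R (S (complex_of_real t) v - v)) \<longlongrightarrow> w - (- B v)) (at_right 0)"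
    by (intro tendsto_diff lim S_derivative_at_0 v)
  moreover have "w - (- B v) = d" using v by (simp add: d_def algebra_simps)
  ultimately have "((\<lambda>t. inner ((1 / t) *\<^sub>R (S (complex_of_real t) u - u) - (1 / t) *\<^sub>R (S (complex_of_real t) v - v)) d) \<longlongrightarrow> inner d d) (at_right 0)"
    by (intro tendsto_intros) simp
  moreover have "\<forall>\<^sub>F t in at_right 0. inner ((1 / t) *\<^sub>R (S (complex_of_real t) u - u) - (1 / t) *\<^sub>R (S (complex_of_real t) v - v)) d \<le> 0"
    unfolding eventually_at_filter
  proof (rule always_eventually, intro allI impI)
    fix t :: real assume "t \<in> {0<..}"
    then have t: "t > 0" "complex_of_real t \<in> insert 0 \<Sigma>" using of_real_in_open_sector by auto
    have "inner (S (complex_of_real t) d) d \<le> norm (S (complex_of_real t) d) * norm d" by (rule norm_cauchy_schwarz)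
    also have "\<dots> \<le> norm d * norm d" by (intro mult_right_mono norm_S_le t) auto
    finally have "inner (S (complex_of_real t) d - d) d \<le> 0"
      by (simp add: inner_diff_left power2_norm_eq_inner[symmetric] power2_eq_square)
    moreover have "(1 / t) *\<^sub>R (S (complex_of_real t) u - u) - (1 / t) *\<^sub>R (S (complex_of_real t) v - v) = (1 / t) *\<^sub>R (S (complex_of_real t) d - d)"
      unfolding d_def linear_diff[OF linear_S[OF t(2)]] by (simp add: algebra_simps)
    ultimately show "inner ((1 / t) *\<^sub>R (S (complex_of_real t) u - u) - (1 / t) *\<^sub>R (S (complex_of_real t) v - v)) d \<le> 0"
      using t by (simp add: divide_nonpos_pos)
  qed
  ultimately have "inner d d \<le> 0" by (rule tendsto_upperbound) simp
  then have "d = 0" by (metis inner_gt_zero_iff not_le)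
  then show "u \<in> D \<and> w = - B u" using v by (auto simp: d_def algebra_simps eq_neg_iff_add_eq_0)
qed (use S_derivative_at_0 in auto)


section \<open>The exponentially rescaled semigroup\<close>

definition U :: "real \<Rightarrow> complex \<Rightarrow> 'h \<Rightarrow> 'h" where
  "U \<omega> z f = sc (exp (complex_of_real \<omega> * z)) (S z f)"

lemma U_0 [simp]: "U \<omega> 0 f = f"
  by (simp add: U_def)

lemma linear_U: "z \<in> insert 0 \<Sigma> \<Longrightarrow> linear (U \<omega> z)"
  unfolding U_def using linear_compose[OF linear_S bounded_linear.linear[OF bounded_linear_sc]]
  by (simp add: comp_def)

lemma U_sc: "z \<in> insert 0 \<Sigma> \<Longrightarrow> U \<omega> z (sc a x) = sc a (U \<omega> z x)"
  unfolding U_def by (metis S_sc sc_commute)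

lemma norm_U_le: "z \<in> insert 0 \<Sigma> \<Longrightarrow> norm (U \<omega> z x) \<le> exp (\<omega> * Re z) * norm x"
  unfolding U_def norm_sc norm_exp_eq_Re using norm_S_le by simp

lemma U_semigroup:
  assumes "z \<in> insert 0 \<Sigma>" "w \<in> insert 0 \<Sigma>"
  shows "U \<omega> (z + w) f = U \<omega> z (U \<omega> w f)"
  using assms by (simp add: U_def S_semigroup S_sc distrib_left exp_add sc_mult del: insert_iff)

lemma U_in_closed:
  assumes "closed X" "\<And>z f. z \<in> \<Sigma> \<Longrightarrow> f \<in> X \<Longrightarrow> F z f \<in> X" "\<And>a f. f \<in> X \<Longrightarrow> sc a f \<in> X"
    "z \<in> insert 0 \<Sigma>" "f \<in> X"
  shows "U \<omega> z f \<in> X"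
  unfolding U_def using assms by (intro assms(3) S_in_closed) auto

lemma U_tendsto_id: "((\<lambda>z. U \<omega> z f) \<longlongrightarrow> f) (at 0 within \<Sigma>)"
proof (rule LIM_zero_cancel, rule Lim_null_comparison[OF always_eventually])
  let ?e = "\<lambda>z. exp (complex_of_real \<omega> * z)"
  show "\<forall>z. norm (U \<omega> z f - f) \<le> cmod (?e z) * norm (S z f - f) + cmod (?e z - 1) * norm f"
  proof
    fix z
    have "U \<omega> z f - f = sc (?e z) (S z f - f) + sc (?e z - 1) f"
      by (simp add: U_def sc_diff_right sc_diff_left)
    then show "norm (U \<omega> z f - f) \<le> cmod (?e z) * norm (S z f - f) + cmod (?e z - 1) * norm f"
      by (metis norm_sc norm_triangle_ineq)
  qed
  have "((\<lambda>z. cmod (?e z) * norm (S z f - f) + cmod (?e z - 1) * norm f) \<longlongrightarrow>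
      cmod (?e 0) * norm (f - f) + cmod (?e 0 - 1) * norm f) (at 0 within \<Sigma>)"
    by (intro tendsto_intros S_tendsto_id)
  then show "((\<lambda>z. cmod (?e z) * norm (S z f - f) + cmod (?e z - 1) * norm f) \<longlongrightarrow> 0) (at 0 within \<Sigma>)"
    by simp
qed

text \<open>The quotients of U and S are affine functions of each other with convergent
  coefficients, so that either limit exists if the other one does. This gives the equivalence
  without assuming u in D beforehand.\<close>

lemma U_generator:
  "((\<lambda>t. (1 / t) *\<^sub>R (U \<omega> (complex_of_real t) u - u)) \<longlongrightarrow> w) (at_right 0) \<longleftrightarrow> u \<in> D \<and> w = \<omega> *\<^sub>R u - B u"
proof -
  let ?Q = "\<lambda>t. (1 / t) *\<^sub>R (S (complex_of_real t) u - u)"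
  let ?P = "\<lambda>t. (1 / t) *\<^sub>R (U \<omega> (complex_of_real t) u - u)"
  let ?r = "\<lambda>t. (exp (\<omega> * t) - 1) / t"
  have U: "U \<omega> (complex_of_real t) u = exp (\<omega> * t) *\<^sub>R S (complex_of_real t) u" for t
    unfolding U_def by (metis exp_of_real of_real_mult sc_of_real)
  have r: "(?r \<longlongrightarrow> \<omega>) (at_right 0)"
  proof -
    have "((\<lambda>t. exp (\<omega> * t)) has_real_derivative exp (\<omega> * 0) * \<omega>) (at 0)"
      by (auto intro!: derivative_eq_intros)
    then show ?thesis
      unfolding has_field_derivative_iff by (simp add: filterlim_at_split)
  qed
  have e: "((\<lambda>t. exp (\<omega> * t)) \<longlongrightarrow> 1) (at_right 0)"
  proof -
    have "((\<lambda>t. exp (\<omega> * t)) \<longlongrightarrow> exp (\<omega> * 0)) (at_right 0)" by (intro tendsto_intros)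
    then show ?thesis by simp
  qed
  have e': "((\<lambda>t. exp (- \<omega> * t)) \<longlongrightarrow> 1) (at_right 0)"
  proof -
    have "((\<lambda>t. exp (- \<omega> * t)) \<longlongrightarrow> exp (- \<omega> * 0)) (at_right 0)" by (intro tendsto_intros)
    then show ?thesis by simp
  qed
  have P: "?P t = exp (\<omega> * t) *\<^sub>R ?Q t + ?r t *\<^sub>R u" for t
    unfolding U by (simp add: algebra_simps diff_divide_distrib)
  have Q: "?Q t = exp (- \<omega> * t) *\<^sub>R (?P t - ?r t *\<^sub>R u)" for t
    unfolding P by (simp add: exp_minus)
  have "(?P \<longlongrightarrow> w) (at_right 0) \<longleftrightarrow> (?Q \<longlongrightarrow> w - \<omega> *\<^sub>R u) (at_right 0)"
  proof
    assume "(?P \<longlongrightarrow> w) (at_right 0)"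
    then have "((\<lambda>t. exp (- \<omega> * t) *\<^sub>R (?P t - ?r t *\<^sub>R u)) \<longlongrightarrow> 1 *\<^sub>R (w - \<omega> *\<^sub>R u)) (at_right 0)"
      by (intro tendsto_scaleR tendsto_diff e' r tendsto_const)
    then show "(?Q \<longlongrightarrow> w - \<omega> *\<^sub>R u) (at_right 0)" unfolding Q[symmetric] scaleR_one .
  next
    assume "(?Q \<longlongrightarrow> w - \<omega> *\<^sub>R u) (at_right 0)"
    then have "((\<lambda>t. exp (\<omega> * t) *\<^sub>R ?Q t + ?r t *\<^sub>R u) \<longlongrightarrow> 1 *\<^sub>R (w - \<omega> *\<^sub>R u) + \<omega> *\<^sub>R u) (at_right 0)"
      by (intro tendsto_add tendsto_scaleR e r tendsto_const)
    then show "(?P \<longlongrightarrow> w) (at_right 0)" unfolding P[symmetric] by simp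
  qed
  also have "\<dots> \<longleftrightarrow> u \<in> D \<and> w - \<omega> *\<^sub>R u = - B u" by (rule S_generator)
  also have "\<dots> \<longleftrightarrow> u \<in> D \<and> w = \<omega> *\<^sub>R u - B u" by (auto simp: algebra_simps)
  finally show ?thesis .
qed

lemma U_differentiable:
  assumes z: "z \<in> \<Sigma>"
  obtains D' K \<epsilon> where "linear D'" "\<And>a f. D' (sc a f) = sc a (D' f)" "\<And>f. norm (D' f) \<le> K * norm f"
    "(\<epsilon> \<longlongrightarrow> 0) (at z)"
    "\<forall>\<^sub>F w in at z. w \<in> \<Sigma> \<and> (\<forall>f. norm (sc (1 / (w - z)) (U \<omega> w f - U \<omega> z f) - D' f) \<le> \<epsilon> w * norm f)"
proof -
  obtain G k r where G: "linear G" "\<And>a f. G (sc a f) = sc a (G f)" and r: "r > 0" and "k \<ge> 0"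
    and est: "\<And>w f. w \<noteq> z \<Longrightarrow> cmod (w - z) \<le> r \<Longrightarrow>
       w \<in> \<Sigma> \<and> norm (sc (1 / (w - z)) (S w f - S z f) - G f) \<le> k * cmod (w - z) * norm f"
    using S_difference_quotient[OF z] by metis
  \<comment> \<open>A bound for G: it is within k r of one difference quotient at distance r, and
    two contractions over r give 2 / r for that quotient.\<close>
  define g where "g = (k * r + 2 / r)"
  have g: "norm (G f) \<le> g * norm f" for f
  proof -
    define w where "w = z + complex_of_real r"
    have w: "cmod (w - z) = r" "w \<noteq> z" using r by (auto simp: w_def)
    then have w\<Sigma>: "w \<in> \<Sigma>" and le: "norm (sc (1 / (w - z)) (S w f - S z f) - G f) \<le> k * r * norm f"
      using est[of w f] by auto
    have "norm (sc (1 / (w - z)) (S w f - S z f)) = norm (S w f - S z f) / r"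
      using w by (simp add: norm_sc norm_divide)
    also have "\<dots> \<le> (norm f + norm f) / r"
      using r w\<Sigma> z by (intro divide_right_mono order_trans[OF norm_triangle_ineq4] add_mono norm_S_le) auto
    finally have "norm (sc (1 / (w - z)) (S w f - S z f)) \<le> 2 / r * norm f" by simp
    from order_trans[OF norm_triangle_ineq4 add_mono[OF this le]]
    have "norm (G f) \<le> 2 / r * norm f + k * r * norm f" by simp
    then show ?thesis by (simp add: g_def algebra_simps)
  qed
  let ?e = "\<lambda>w. exp (complex_of_real \<omega> * w)"
  define D' where "D' f = sc (?e z) (G f) + sc (complex_of_real \<omega> * ?e z) (S z f)" for f
  \<comment> \<open>The three errors of the product rule: the quotient of S against G, the variation
    of the exponential in front of G, and the quotient of the exponential in front of S z. None
    depends on f.\<close>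
  define \<epsilon> where "\<epsilon> w = cmod (?e w) * (k * cmod (w - z)) + cmod (?e w - ?e z) * g
      + cmod ((?e w - ?e z) / (w - z) - complex_of_real \<omega> * ?e z)" for w
  show ?thesis
  proof (rule that[of D' "cmod (?e z) * g + cmod (complex_of_real \<omega> * ?e z)" \<epsilon>])
    show "linear D'"
    proof -
      have "linear (S z)" using linear_S z by blast
      then show ?thesis
        by (intro linearI) (simp_all add: D'_def linear_add linear_scale G(1) sc_add_right sc_scaleR scaleR_add_right)
    qed
    show "D' (sc a f) = sc a (D' f)" for a f
      using z by (simp add: D'_def G S_sc sc_add_right sc_commute[of a])
    show "norm (D' f) \<le> (cmod (?e z) * g + cmod (complex_of_real \<omega> * ?e z)) * norm f" for f
    proof -
      have "norm (D' f) \<le> cmod (?e z) * norm (G f) + cmod (complex_of_real \<omega> * ?e z) * norm (S z f)"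
        unfolding D'_def by (metis norm_sc norm_triangle_ineq)
      also have "\<dots> \<le> cmod (?e z) * (g * norm f) + cmod (complex_of_real \<omega> * ?e z) * norm f"
        using z by (intro add_mono mult_left_mono g norm_S_le) auto
      finally show ?thesis by (simp add: algebra_simps)
    qed
    have "(?e has_field_derivative complex_of_real \<omega> * ?e z) (at z)"
      by (auto intro!: derivative_eq_intros)
    then have "((\<lambda>w. (?e w - ?e z) / (w - z)) \<longlongrightarrow> complex_of_real \<omega> * ?e z) (at z)"
      by (simp add: has_field_derivative_iff)
    then have "(\<epsilon> \<longlongrightarrow> cmod (?e z) * (k * cmod (z - z)) + cmod (?e z - ?e z) * g
      + cmod (complex_of_real \<omega> * ?e z - complex_of_real \<omega> * ?e z)) (at z)"
      unfolding \<epsilon>_def by (intro tendsto_intros)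
    then show "(\<epsilon> \<longlongrightarrow> 0) (at z)" by simp
    have "\<forall>\<^sub>F w in at z. w \<noteq> z \<and> cmod (w - z) \<le> r"
      unfolding eventually_at using r by (intro exI[of _ r]) (auto simp: dist_norm)
    then show "\<forall>\<^sub>F w in at z. w \<in> \<Sigma> \<and> (\<forall>f. norm (sc (1 / (w - z)) (U \<omega> w f - U \<omega> z f) - D' f) \<le> \<epsilon> w * norm f)"
    proof (rule eventually_mono, intro conjI allI)
      fix w f assume w: "w \<noteq> z \<and> cmod (w - z) \<le> r"
      then show "w \<in> \<Sigma>" using est by blast
      let ?q = "sc (1 / (w - z)) (S w f - S z f)"
      have "U \<omega> w f - U \<omega> z f = sc (?e w) (S w f - S z f) + sc (?e w - ?e z) (S z f)"
        by (simp add: U_def sc_diff_right sc_diff_left)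
      then have "sc (1 / (w - z)) (U \<omega> w f - U \<omega> z f) = sc (?e w) ?q + sc ((?e w - ?e z) / (w - z)) (S z f)"
        by (simp add: sc_add_right sc_commute[of "inverse (w - z)"] divide_inverse sc_mult)
      then have "sc (1 / (w - z)) (U \<omega> w f - U \<omega> z f) - D' f
          = sc (?e w) (?q - G f) + sc (?e w - ?e z) (G f)
            + sc ((?e w - ?e z) / (w - z) - complex_of_real \<omega> * ?e z) (S z f)"
        unfolding D'_def by (simp add: sc_diff_right sc_diff_left)
      then have "norm (sc (1 / (w - z)) (U \<omega> w f - U \<omega> z f) - D' f)
          \<le> cmod (?e w) * norm (?q - G f) + cmod (?e w - ?e z) * norm (G f)
            + cmod ((?e w - ?e z) / (w - z) - complex_of_real \<omega> * ?e z) * norm (S z f)"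
        by (simp only: flip: norm_sc) (intro order_trans[OF norm_triangle_ineq add_right_mono[OF norm_triangle_ineq]])
      also have "\<dots> \<le> cmod (?e w) * (k * cmod (w - z) * norm f) + cmod (?e w - ?e z) * (g * norm f)
            + cmod ((?e w - ?e z) / (w - z) - complex_of_real \<omega> * ?e z) * norm f"
        using est[of w f] w z by (intro add_mono mult_left_mono g norm_S_le) auto
      also have "\<dots> = \<epsilon> w * norm f" by (simp add: \<epsilon>_def algebra_simps)
      finally show "norm (sc (1 / (w - z)) (U \<omega> w f - U \<omega> z f) - D' f) \<le> \<epsilon> w * norm f" .
    qed
  qed
qed

end

section \<open>The Hilbert space of square integrable functions\<close>

definition square_integrable :: "'a measure \<Rightarrow> ('a \<Rightarrow> 'b::euclidean_space) \<Rightarrow> bool" where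
  "square_integrable M f \<longleftrightarrow> f \<in> borel_measurable M \<and> integrable M (\<lambda>x. (norm (f x))\<^sup>2)"

lemma square_integrable_dominated:
  assumes "f \<in> borel_measurable M" "integrable M g" "AE x in M. (norm (f x))\<^sup>2 \<le> g x"
  shows "square_integrable M f"
  unfolding square_integrable_def
proof
  show "f \<in> borel_measurable M" by (rule assms)
  show "integrable M (\<lambda>x. (norm (f x))\<^sup>2)"
  proof (rule Bochner_Integration.integrable_bound[OF assms(2)])
    show "AE x in M. norm ((norm (f x))\<^sup>2) \<le> norm (g x)"
      using assms(3) by eventually_elim simp
  qed (use assms(1) in measurable)
qed

lemma square_integrable_zero [simp]: "square_integrable M (\<lambda>x. 0)"
  by (simp add: square_integrable_def)

lemma square_integrable_add:
  assumes "square_integrable M f" "square_integrable M g"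
  shows "square_integrable M (\<lambda>x. f x + g x)"
proof (rule square_integrable_dominated[where g="\<lambda>x. 2 * (norm (f x))\<^sup>2 + 2 * (norm (g x))\<^sup>2"])
  have "(norm (u + v))\<^sup>2 \<le> 2 * (norm u)\<^sup>2 + 2 * (norm v)\<^sup>2" for u v :: 'b
  proof -
    have "(norm (u + v))\<^sup>2 + (norm (u - v))\<^sup>2 = 2 * (norm u)\<^sup>2 + 2 * (norm v)\<^sup>2"
      by (simp only: power2_norm_eq_inner inner_add_left inner_add_right inner_diff_left inner_diff_right)
    then show ?thesis by (smt (verit) zero_le_power2)
  qed
  then show "AE x in M. (norm (f x + g x))\<^sup>2 \<le> 2 * (norm (f x))\<^sup>2 + 2 * (norm (g x))\<^sup>2" by simp
qed (use assms in \<open>auto simp: square_integrable_def\<close>)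

lemma square_integrable_bounded_linear:
  assumes "square_integrable M f" "bounded_linear T"
  shows "square_integrable M (\<lambda>x. T (f x))"
proof -
  obtain K where K: "\<And>x. norm (T x) \<le> norm x * K" "K > 0"
    using bounded_linear.pos_bounded[OF assms(2)] by blast
  show ?thesis
  proof (rule square_integrable_dominated[where g="\<lambda>x. K\<^sup>2 * (norm (f x))\<^sup>2"])
    show "(\<lambda>x. T (f x)) \<in> borel_measurable M"
      using assms(1) borel_measurable_continuous_onI[OF bounded_linear.continuous_on[OF assms(2) continuous_on_id]]
      by (auto simp: square_integrable_def intro: measurable_compose)
    have "(norm (T (f x)))\<^sup>2 \<le> K\<^sup>2 * (norm (f x))\<^sup>2" for x
      using power_mono[OF K(1)[of "f x"], of 2] by (simp add: power_mult_distrib mult.commute)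
    then show "AE x in M. (norm (T (f x)))\<^sup>2 \<le> K\<^sup>2 * (norm (f x))\<^sup>2" by simp
  qed (use assms in \<open>auto simp: square_integrable_def\<close>)
qed

lemma square_integrable_scaleR: "square_integrable M f \<Longrightarrow> square_integrable M (\<lambda>x. c *\<^sub>R f x)"
  by (rule square_integrable_bounded_linear) (auto simp: bounded_linear_scaleR_right)

lemma square_integrable_uminus: "square_integrable M f \<Longrightarrow> square_integrable M (\<lambda>x. - f x)"
  using square_integrable_scaleR[of M f "-1"] by simp

lemma square_integrable_diff:
  "square_integrable M f \<Longrightarrow> square_integrable M g \<Longrightarrow> square_integrable M (\<lambda>x. f x - g x)"
  using square_integrable_add[of M f "\<lambda>x. - g x"] square_integrable_uminus[of M g] by simp

lemma integrable_norm_mult: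
  assumes "square_integrable M f" "square_integrable M g"
  shows "integrable M (\<lambda>x. norm (f x) * norm (g x))"
proof (rule Bochner_Integration.integrable_bound[where f="\<lambda>x. (norm (f x))\<^sup>2 + (norm (g x))\<^sup>2"])
  have "norm (f x) * norm (g x) \<le> (norm (f x))\<^sup>2 + (norm (g x))\<^sup>2" for x
  proof -
    have "2 * norm (f x) * norm (g x) \<le> (norm (f x))\<^sup>2 + (norm (g x))\<^sup>2" by (rule sum_squares_bound)
    moreover have "0 \<le> norm (f x) * norm (g x)" by simp
    ultimately show ?thesis by linarith
  qed
  then show "AE x in M. norm (norm (f x) * norm (g x)) \<le> norm ((norm (f x))\<^sup>2 + (norm (g x))\<^sup>2)" by simp
qed (use assms in \<open>auto simp: square_integrable_def\<close>)

lemma integrable_inner_square_integrable: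
  assumes "square_integrable M f" "square_integrable M g"
  shows "integrable M (\<lambda>x. inner (f x) (g x))"
  by (rule Bochner_Integration.integrable_bound[OF integrable_norm_mult[OF assms]])
     (use assms in \<open>auto simp: square_integrable_def Cauchy_Schwarz_ineq2\<close>)

lemma square_integrable_AE_cong:
  assumes "square_integrable M f" "AE x in M. f x = g x" "g \<in> borel_measurable M"
  shows "square_integrable M g"
  using assms unfolding square_integrable_def
  by (auto intro!: Bochner_Integration.integrable_cong_AE[THEN iffD1, of "\<lambda>x. (norm (f x))\<^sup>2" M "\<lambda>x. (norm (g x))\<^sup>2"])

text \<open>The weights 4^n against the integrals 8^-n leave a convergent series. So the sum of 4^n
  |d n x|^2 is finite almost everywhere, which forces |d n x| = O(2^-n).\<close>

lemma AE_Cauchy_of_summable_squares: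
  fixes d :: "nat \<Rightarrow> 'a \<Rightarrow> 'b::euclidean_space"
  assumes d: "\<And>n. square_integrable M (d n)" and le: "\<And>n. (\<integral>x. (norm (d n x))\<^sup>2 \<partial>M) \<le> (1/8) ^ n"
  shows "AE x in M. summable (\<lambda>n. d n x)"
proof -
  let ?h = "\<lambda>n x. ennreal (4 ^ n * (norm (d n x))\<^sup>2)"
  have m: "?h n \<in> borel_measurable M" for n
    using d[of n] by (auto simp: square_integrable_def)
  have "(\<integral>\<^sup>+x. (\<Sum>n. ?h n x) \<partial>M) = (\<Sum>n. \<integral>\<^sup>+x. ?h n x \<partial>M)"
    by (rule nn_integral_suminf[OF m])
  also have "\<dots> \<le> (\<Sum>n. ennreal ((1/2) ^ n))"
  proof (rule suminf_le)
    fix n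
    have "(\<integral>\<^sup>+x. ?h n x \<partial>M) = ennreal (\<integral>x. 4 ^ n * (norm (d n x))\<^sup>2 \<partial>M)"
      using d[of n] by (intro nn_integral_eq_integral) (auto simp: square_integrable_def)
    also have "\<dots> \<le> ennreal (4 ^ n * (1/8) ^ n)"
      using le[of n] by (intro ennreal_leI) simp
    also have "4 ^ n * (1/8) ^ n = (1/2 :: real) ^ n"
      by (simp flip: power_mult_distrib)
    finally show "(\<integral>\<^sup>+x. ?h n x \<partial>M) \<le> ennreal ((1/2) ^ n)" .
  qed auto
  also have "\<dots> = ennreal (\<Sum>n. (1/2) ^ n)"
    by (intro suminf_ennreal2 summable_geometric) auto
  also have "\<dots> < \<infinity>" by simp
  finally have "(\<integral>\<^sup>+x. (\<Sum>n. ?h n x) \<partial>M) \<noteq> \<infinity>" by simp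
  then have "AE x in M. (\<Sum>n. ?h n x) \<noteq> \<infinity>"
    by (intro nn_integral_PInf_AE) (use m in measurable)
  then show ?thesis
  proof eventually_elim
    case (elim x)
    define K where "K = enn2real (\<Sum>n. ?h n x)"
    have K: "K \<ge> 0" "(\<Sum>n. ?h n x) = ennreal K"
      using elim by (auto simp: K_def less_top)
    have "norm (d n x) \<le> sqrt K * (1/2) ^ n" for n
    proof -
      have "?h n x = (\<Sum>i\<in>{n}. ?h i x)" by simp
      also have "\<dots> \<le> ennreal K" unfolding K(2)[symmetric] by (intro sum_le_suminf) auto
      finally have "4 ^ n * (norm (d n x))\<^sup>2 \<le> K" using K(1) by simp
      moreover have "((2::real) ^ n)\<^sup>2 = 4 ^ n" by (simp add: power2_eq_square flip: power_mult_distrib)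
      ultimately have "(2 ^ n * norm (d n x))\<^sup>2 \<le> K" by (simp add: power_mult_distrib)
      then have "2 ^ n * norm (d n x) \<le> sqrt K" by (rule real_le_rsqrt)
      then show ?thesis by (simp add: field_simps power_divide)
    qed
    moreover have "summable (\<lambda>n. sqrt K * (1/2) ^ n)"
      by (intro summable_mult summable_geometric) simp
    ultimately show ?case
      using summable_comparison_test'[where N=0 and g="\<lambda>n. sqrt K * (1/2) ^ n" and f="\<lambda>n. d n x"] by blast
  qed
qed

text \<open>Riesz--Fischer, with the almost everywhere convergent subsequence kept in the
  conclusion: pointwise convergence later identifies the components of a limit of energy
  vectors.\<close>

theorem square_integrable_Cauchy_limit:
  fixes f :: "nat \<Rightarrow> 'a \<Rightarrow> 'b::euclidean_space"
  assumes f: "\<And>n. square_integrable M (f n)"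
    and Cauchy: "\<And>e. e > 0 \<Longrightarrow> \<exists>N. \<forall>m\<ge>N. \<forall>n\<ge>N. (\<integral>x. (norm (f m x - f n x))\<^sup>2 \<partial>M) < e"
  obtains g r where "square_integrable M g" "strict_mono r" "AE x in M. (\<lambda>n. f (r n) x) \<longlonglongrightarrow> g x"
    "(\<lambda>n. \<integral>x. (norm (f n x - g x))\<^sup>2 \<partial>M) \<longlonglongrightarrow> 0"
proof -
  have m[measurable]: "f n \<in> borel_measurable M" for n using f by (auto simp: square_integrable_def)
  have "\<forall>k. \<exists>N. \<forall>m\<ge>N. \<forall>n\<ge>N. (\<integral>x. (norm (f m x - f n x))\<^sup>2 \<partial>M) < (1/8) ^ k"
    using Cauchy by simp
  then obtain N where "\<forall>k. \<forall>m\<ge>N k. \<forall>n\<ge>N k. (\<integral>x. (norm (f m x - f n x))\<^sup>2 \<partial>M) < (1/8) ^ k"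
    by (rule choice[THEN exE])
  then have N: "(\<integral>x. (norm (f m x - f n x))\<^sup>2 \<partial>M) < (1/8) ^ k" if "m \<ge> N k" "n \<ge> N k" for k m n
    using that by blast
  \<comment> \<open>The maximum makes r strictly increasing and at the same time at least
    \<open>N k\<close>, so the rate (1/8)^k holds along the subsequence.\<close>
  define r where "r = rec_nat (N 0) (\<lambda>k s. max (Suc s) (N (Suc k)))"
  have r_Suc: "r (Suc k) = max (Suc (r k)) (N (Suc k))" for k by (simp add: r_def)
  have r_mono: "strict_mono r" by (rule strict_monoI_Suc) (simp add: r_Suc)
  have r_N: "r k \<ge> N k" for k by (cases k) (auto simp: r_def)
  have "AE x in M. summable (\<lambda>n. f (r (Suc n)) x - f (r n) x)"
  proof (rule AE_Cauchy_of_summable_squares)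
    show "(\<integral>x. (norm (f (r (Suc n)) x - f (r n) x))\<^sup>2 \<partial>M) \<le> (1/8) ^ n" for n
      using N[of n "r (Suc n)" "r n"] r_N[of n] strict_mono_leD[OF r_mono, of n "Suc n"] by simp
  qed (intro square_integrable_diff f)
  moreover define g where "g x = lim (\<lambda>n. f (r n) x)" for x
  ultimately have lim: "AE x in M. (\<lambda>n. f (r n) x) \<longlonglongrightarrow> g x"
  proof (elim eventually_mono)
    fix x assume "summable (\<lambda>n. f (r (Suc n)) x - f (r n) x)"
    then have "(\<lambda>m. \<Sum>n<m. f (r (Suc n)) x - f (r n) x) \<longlonglongrightarrow> (\<Sum>n. f (r (Suc n)) x - f (r n) x)"
      by (rule summable_LIMSEQ)
    then have "(\<lambda>m. (f (r m) x - f (r 0) x) + f (r 0) x) \<longlonglongrightarrow> (\<Sum>n. f (r (Suc n)) x - f (r n) x) + f (r 0) x"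
      unfolding sum_lessThan_telescope[of "\<lambda>n. f (r n) x"] by (intro tendsto_intros)
    then have "convergent (\<lambda>n. f (r n) x)" by (auto simp: convergent_def)
    then show "(\<lambda>n. f (r n) x) \<longlonglongrightarrow> g x" by (simp add: g_def convergent_LIMSEQ_iff)
  qed
  have gm[measurable]: "g \<in> borel_measurable M" unfolding g_def by measurable
  \<comment> \<open>Only the inner index runs along the subsequence; n is arbitrary, so convergence
    in mean is obtained for the whole sequence.\<close>
  have Fatou: "(\<integral>\<^sup>+x. ennreal ((norm (f n x - g x))\<^sup>2) \<partial>M) \<le> ennreal e"
    if n: "\<And>k. k \<ge> N0 \<Longrightarrow> (\<integral>x. (norm (f n x - f k x))\<^sup>2 \<partial>M) \<le> e" for n N0 e
  proof -
    have "(\<integral>\<^sup>+x. ennreal ((norm (f n x - g x))\<^sup>2) \<partial>M)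
        = (\<integral>\<^sup>+x. liminf (\<lambda>k. ennreal ((norm (f n x - f (r k) x))\<^sup>2)) \<partial>M)"
    proof (rule nn_integral_cong_AE, use lim in eventually_elim)
      case (elim x)
      then have "(\<lambda>k. ennreal ((norm (f n x - f (r k) x))\<^sup>2)) \<longlonglongrightarrow> ennreal ((norm (f n x - g x))\<^sup>2)"
        by (intro tendsto_intros)
      then show ?case by (intro lim_imp_Liminf[symmetric]) auto
    qed
    also have "\<dots> \<le> liminf (\<lambda>k. \<integral>\<^sup>+x. ennreal ((norm (f n x - f (r k) x))\<^sup>2) \<partial>M)"
      by (rule nn_integral_liminf) measurable
    also have "\<dots> \<le> ennreal e"
    proof (rule Liminf_le)
      have "(\<integral>\<^sup>+x. ennreal ((norm (f n x - f (r k) x))\<^sup>2) \<partial>M) \<le> ennreal e" if "k \<ge> N0" for k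
      proof -
        have "(\<integral>\<^sup>+x. ennreal ((norm (f n x - f (r k) x))\<^sup>2) \<partial>M) = ennreal (\<integral>x. (norm (f n x - f (r k) x))\<^sup>2 \<partial>M)"
          using square_integrable_diff[OF f f, of n "r k"] by (intro nn_integral_eq_integral) (auto simp: square_integrable_def)
        then show ?thesis
          using n[of "r k"] that strict_mono_imp_increasing[OF r_mono, of k] by (simp add: ennreal_leI)
      qed
      then show "\<forall>\<^sub>F k in sequentially. (\<integral>\<^sup>+x. ennreal ((norm (f n x - f (r k) x))\<^sup>2) \<partial>M) \<le> ennreal e"
        unfolding eventually_sequentially by blast
    qed simp
    finally show ?thesis .
  qed
  have int: "square_integrable M (\<lambda>x. f n x - g x) \<and> (\<integral>x. (norm (f n x - g x))\<^sup>2 \<partial>M) \<le> e"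
    if n: "\<And>k. k \<ge> N0 \<Longrightarrow> (\<integral>x. (norm (f n x - f k x))\<^sup>2 \<partial>M) \<le> e" for n N0 e
  proof -
    have "0 \<le> (\<integral>x. (norm (f n x - f N0 x))\<^sup>2 \<partial>M)" by (rule integral_nonneg_AE) simp
    then have "e \<ge> 0" by (rule order_trans) (rule n[OF order_refl])
    have F: "(\<integral>\<^sup>+x. ennreal ((norm (f n x - g x))\<^sup>2) \<partial>M) \<le> ennreal e"
      by (rule Fatou[of N0 n e]) (rule n)
    have I: "integrable M (\<lambda>x. (norm (f n x - g x))\<^sup>2)"
      unfolding integrable_iff_bounded using le_less_trans[OF F ennreal_less_top] by simp
    then have "ennreal (\<integral>x. (norm (f n x - g x))\<^sup>2 \<partial>M) \<le> ennreal e"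
      using F by (subst nn_integral_eq_integral[symmetric]) auto
    then show ?thesis using I \<open>e \<ge> 0\<close> by (simp add: square_integrable_def)
  qed
  have "square_integrable M g"
  proof -
    obtain N1 where "\<forall>m\<ge>N1. \<forall>n\<ge>N1. (\<integral>x. (norm (f m x - f n x))\<^sup>2 \<partial>M) < 1" using Cauchy[of 1] by auto
    then have "square_integrable M (\<lambda>x. f N1 x - g x)"
      by (intro int[THEN conjunct1, of N1 N1 1]) (auto intro: less_imp_le)
    from square_integrable_diff[OF f[of N1] this] show ?thesis by simp
  qed
  moreover have "(\<lambda>n. \<integral>x. (norm (f n x - g x))\<^sup>2 \<partial>M) \<longlonglongrightarrow> 0"
  proof (rule LIMSEQ_I)
    fix e :: real assume "e > 0"
    then obtain N1 where N1: "\<forall>m\<ge>N1. \<forall>n\<ge>N1. (\<integral>x. (norm (f m x - f n x))\<^sup>2 \<partial>M) < e / 2"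
      using Cauchy[of "e / 2"] by auto
    have "norm ((\<integral>x. (norm (f n x - g x))\<^sup>2 \<partial>M) - 0) < e" if "n \<ge> N1" for n
    proof -
      have "(\<integral>x. (norm (f n x - g x))\<^sup>2 \<partial>M) \<le> e / 2"
        using N1 that by (intro int[THEN conjunct2, of N1]) (auto intro: less_imp_le)
      moreover have "0 \<le> (\<integral>x. (norm (f n x - g x))\<^sup>2 \<partial>M)" by (rule integral_nonneg_AE) simp
      ultimately show ?thesis using \<open>e > 0\<close> by simp
    qed
    then show "\<exists>no. \<forall>n\<ge>no. norm ((\<integral>x. (norm (f n x - g x))\<^sup>2 \<partial>M) - 0) < e" by blast
  qed
  ultimately show ?thesis using that lim r_mono by blast
qed

\<comment> \<open>Only classes modulo equality almost everywhere form a normed space. A type cannot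
  depend on the set \<Omega>, so the classes consist of functions on the whole space, and functions
  on \<Omega> enter through extension by zero.\<close>
quotient_type (overloaded) ('a, 'b) l2 = "'a::euclidean_space \<Rightarrow> 'b::euclidean_space" /
  partial: "\<lambda>f g. square_integrable lebesgue f \<and> square_integrable lebesgue g \<and> (AE x in lebesgue. f x = g x)"
proof (rule part_equivpI)
  show "\<exists>f :: 'a \<Rightarrow> 'b. square_integrable lebesgue f \<and> square_integrable lebesgue f \<and> (AE x in lebesgue. f x = f x)"
    by (rule exI[of _ "\<lambda>x. 0"]) simp
  show "symp (\<lambda>f g :: 'a \<Rightarrow> 'b. square_integrable lebesgue f \<and> square_integrable lebesgue g \<and> (AE x in lebesgue. f x = g x))"
    by (rule sympI) auto
  show "transp (\<lambda>f g :: 'a \<Rightarrow> 'b. square_integrable lebesgue f \<and> square_integrable lebesgue g \<and> (AE x in lebesgue. f x = g x))"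
    by (rule transpI) auto
qed

lemma square_integrable_rep_l2 [simp]: "square_integrable lebesgue (rep_l2 u)"
  using Quotient3_rep_reflp[OF Quotient3_l2] by blast

lemma abs_rep_l2 [simp]: "abs_l2 (rep_l2 u) = u"
  by (rule Quotient3_abs_rep[OF Quotient3_l2])

lemma abs_l2_eq_iff:
  "square_integrable lebesgue f \<Longrightarrow> square_integrable lebesgue g \<Longrightarrow> abs_l2 f = abs_l2 g \<longleftrightarrow> (AE x in lebesgue. f x = g x)"
  using Quotient3_rel[OF Quotient3_l2, of f g] by auto

lemma rep_abs_l2:
  assumes "square_integrable lebesgue f"
  shows "AE x in lebesgue. rep_l2 (abs_l2 f) x = f x"
  using abs_l2_eq_iff[of "rep_l2 (abs_l2 f)" f] assms by simp

lemma l2_eqI: "(AE x in lebesgue. rep_l2 u x = rep_l2 v x) \<Longrightarrow> u = v"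
  using abs_l2_eq_iff[of "rep_l2 u" "rep_l2 v"] by simp

instantiation l2 :: (euclidean_space, euclidean_space) real_inner
begin

definition "0 = abs_l2 (\<lambda>x. 0)"
definition "u + v = abs_l2 (\<lambda>x. rep_l2 u x + rep_l2 v x)"
definition "u - v = abs_l2 (\<lambda>x. rep_l2 u x - rep_l2 v x)"
definition "- u = abs_l2 (\<lambda>x. - rep_l2 u x)"
definition "c *\<^sub>R u = abs_l2 (\<lambda>x. c *\<^sub>R rep_l2 u x)"
definition "inner u v = (\<integral>x. inner (rep_l2 u x) (rep_l2 v x) \<partial>lebesgue)"
definition "norm (u :: ('a, 'b) l2) = sqrt (inner u u)"
definition "dist (u :: ('a, 'b) l2) v = norm (u - v)"
definition "sgn (u :: ('a, 'b) l2) = inverse (norm u) *\<^sub>R u"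
definition [code del]: "(uniformity :: (('a, 'b) l2 \<times> ('a, 'b) l2) filter) = (INF e\<in>{0<..}. principal {(x, y). dist x y < e})"
definition [code del]: "open (U :: ('a, 'b) l2 set) \<longleftrightarrow> (\<forall>x\<in>U. eventually (\<lambda>(x', y). x' = x \<longrightarrow> y \<in> U) uniformity)"

lemma rep_l2_zero: "AE x in lebesgue. rep_l2 (0 :: ('a, 'b) l2) x = 0"
  unfolding zero_l2_def by (intro rep_abs_l2) simp

lemma rep_l2_add: "AE x in lebesgue. rep_l2 (u + v :: ('a, 'b) l2) x = rep_l2 u x + rep_l2 v x"
  unfolding plus_l2_def by (intro rep_abs_l2 square_integrable_add) simp_all

lemma rep_l2_diff: "AE x in lebesgue. rep_l2 (u - v :: ('a, 'b) l2) x = rep_l2 u x - rep_l2 v x"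
  unfolding minus_l2_def by (intro rep_abs_l2 square_integrable_diff) simp_all

lemma rep_l2_uminus: "AE x in lebesgue. rep_l2 (- u :: ('a, 'b) l2) x = - rep_l2 u x"
  unfolding uminus_l2_def by (intro rep_abs_l2 square_integrable_uminus) simp

lemma rep_l2_scaleR: "AE x in lebesgue. rep_l2 (c *\<^sub>R u :: ('a, 'b) l2) x = c *\<^sub>R rep_l2 u x"
  unfolding scaleR_l2_def by (intro rep_abs_l2 square_integrable_scaleR) simp

lemma measurable_rep_l2 [measurable]: "rep_l2 u \<in> borel_measurable lebesgue"
  using square_integrable_rep_l2[of u] by (simp add: square_integrable_def del: square_integrable_rep_l2)

instance
proof
  fix u v w :: "('a, 'b) l2" and a b r :: real
  show "u + v + w = u + (v + w)"
    by (rule l2_eqI, use rep_l2_add[of u v] rep_l2_add[of "u + v" w] rep_l2_add[of v w] rep_l2_add[of u "v + w"] in eventually_elim) (simp add: add.assoc)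
  show "u + v = v + u"
    by (rule l2_eqI, use rep_l2_add[of u v] rep_l2_add[of v u] in eventually_elim) (simp add: add.commute)
  show "0 + u = u"
    by (rule l2_eqI, use rep_l2_add[of 0 u] rep_l2_zero in eventually_elim) simp
  show "- u + u = 0"
    by (rule l2_eqI, use rep_l2_add[of "- u" u] rep_l2_uminus[of u] rep_l2_zero in eventually_elim) simp
  show "u - v = u + - v"
    by (rule l2_eqI, use rep_l2_add[of u "- v"] rep_l2_uminus[of v] rep_l2_diff[of u v] in eventually_elim) simp
  show "a *\<^sub>R (u + v) = a *\<^sub>R u + a *\<^sub>R v"
    by (rule l2_eqI, use rep_l2_add[of u v] rep_l2_scaleR[of a "u + v"] rep_l2_scaleR[of a u] rep_l2_scaleR[of a v] rep_l2_add[of "a *\<^sub>R u" "a *\<^sub>R v"] in eventually_elim)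
       (simp add: scaleR_add_right)
  show "(a + b) *\<^sub>R u = a *\<^sub>R u + b *\<^sub>R u"
    by (rule l2_eqI, use rep_l2_scaleR[of "a + b" u] rep_l2_scaleR[of a u] rep_l2_scaleR[of b u] rep_l2_add[of "a *\<^sub>R u" "b *\<^sub>R u"] in eventually_elim)
       (simp add: scaleR_add_left)
  show "a *\<^sub>R b *\<^sub>R u = (a * b) *\<^sub>R u"
    by (rule l2_eqI, use rep_l2_scaleR[of a "b *\<^sub>R u"] rep_l2_scaleR[of b u] rep_l2_scaleR[of "a * b" u] in eventually_elim) simp
  show "1 *\<^sub>R u = u"
    by (rule l2_eqI, use rep_l2_scaleR[of 1 u] in eventually_elim) simp
  show "dist u v = norm (u - v)" by (rule dist_l2_def)
  show "sgn u = inverse (norm u) *\<^sub>R u" by (rule sgn_l2_def)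
  show "uniformity = (INF e\<in>{0<..}. principal {(x, y :: ('a, 'b) l2). dist x y < e})" by (rule uniformity_l2_def)
  show "open U \<longleftrightarrow> (\<forall>x\<in>U. \<forall>\<^sub>F (x', y) in uniformity. x' = x \<longrightarrow> y \<in> U)" for U :: "('a, 'b) l2 set" by (rule open_l2_def)
  show "norm u = sqrt (inner u u)" by (rule norm_l2_def)
  show "inner u v = inner v u" by (simp add: inner_l2_def inner_commute)
  show "0 \<le> inner u u" by (simp add: inner_l2_def)
  show "inner (u + v) w = inner u w + inner v w"
  proof -
    have "inner (u + v) w = (\<integral>x. inner (rep_l2 u x) (rep_l2 w x) + inner (rep_l2 v x) (rep_l2 w x) \<partial>lebesgue)"
      unfolding inner_l2_def
      by (rule integral_cong_AE) (measurable, use rep_l2_add[of u v] in eventually_elim, simp add: inner_add_left)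
    then show ?thesis
      by (simp add: inner_l2_def integrable_inner_square_integrable)
  qed
  show "inner (r *\<^sub>R u) v = r * inner u v"
  proof -
    have "inner (r *\<^sub>R u) v = (\<integral>x. r * inner (rep_l2 u x) (rep_l2 v x) \<partial>lebesgue)"
      unfolding inner_l2_def
      by (rule integral_cong_AE) (measurable, use rep_l2_scaleR[of r u] in eventually_elim, simp)
    then show ?thesis
      by (simp add: inner_l2_def)
  qed
  show "inner u u = 0 \<longleftrightarrow> u = 0"
  proof
    assume "inner u u = 0"
    then have ae: "AE x in lebesgue. inner (rep_l2 u x) (rep_l2 u x) = 0"
      unfolding inner_l2_def
      by (subst (asm) integral_nonneg_eq_0_iff_AE) (auto intro: integrable_inner_square_integrable)
    show "u = 0" by (rule l2_eqI, use ae rep_l2_zero in eventually_elim) simp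
  next
    assume u: "u = 0"
    have "AE x in lebesgue. inner (rep_l2 u x) (rep_l2 u x) = 0"
      unfolding u using rep_l2_zero by eventually_elim simp
    then show "inner u u = 0" unfolding inner_l2_def by (rule integral_eq_zero_AE)
  qed
qed

end

lemma power2_norm_l2: "(norm u)\<^sup>2 = (\<integral>x. (norm (rep_l2 u x))\<^sup>2 \<partial>lebesgue)"
  by (simp add: power2_norm_eq_inner inner_l2_def)

lemma power2_norm_diff_l2: "(norm (u - v))\<^sup>2 = (\<integral>x. (norm (rep_l2 u x - rep_l2 v x))\<^sup>2 \<partial>lebesgue)"
  unfolding power2_norm_l2
  by (rule integral_cong_AE) (measurable, use rep_l2_diff[of u v] in eventually_elim, simp)

lemma inner_abs_l2:
  assumes "square_integrable lebesgue f" "square_integrable lebesgue g"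
  shows "inner (abs_l2 f) (abs_l2 g) = (\<integral>x. inner (f x) (g x) \<partial>lebesgue)"
proof -
  have [measurable]: "f \<in> borel_measurable lebesgue" "g \<in> borel_measurable lebesgue"
    using assms by (auto simp: square_integrable_def)
  show ?thesis unfolding inner_l2_def
    by (rule integral_cong_AE) (measurable, use rep_abs_l2[OF assms(1)] rep_abs_l2[OF assms(2)] in eventually_elim, simp)
qed

lemma l2_Cauchy_limit:
  assumes "Cauchy X"
  obtains u r where "X \<longlonglongrightarrow> u" "strict_mono r" "AE x in lebesgue. (\<lambda>n. rep_l2 (X (r n)) x) \<longlonglongrightarrow> rep_l2 u x"
proof -
  have "\<exists>N. \<forall>m\<ge>N. \<forall>n\<ge>N. (\<integral>x. (norm (rep_l2 (X m) x - rep_l2 (X n) x))\<^sup>2 \<partial>lebesgue) < e" if e: "e > 0" for e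
  proof -
    obtain N where N: "\<forall>m\<ge>N. \<forall>n\<ge>N. norm (X m - X n) < sqrt e"
      using CauchyD[OF assms, of "sqrt e"] e by auto
    have "(norm (X m - X n))\<^sup>2 < e" if "m \<ge> N" "n \<ge> N" for m n
      using power_strict_mono[of "norm (X m - X n)" "sqrt e" 2] N that e by simp
    then show ?thesis unfolding power2_norm_diff_l2 by blast
  qed
  from square_integrable_Cauchy_limit[where M=lebesgue and f="\<lambda>n. rep_l2 (X n)", OF square_integrable_rep_l2 this]
  obtain g r where g: "square_integrable lebesgue g" "strict_mono r"
    "AE x in lebesgue. (\<lambda>n. rep_l2 (X (r n)) x) \<longlonglongrightarrow> g x"
    "(\<lambda>n. \<integral>x. (norm (rep_l2 (X n) x - g x))\<^sup>2 \<partial>lebesgue) \<longlonglongrightarrow> 0"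
    by blast
  note rg = rep_abs_l2[OF g(1)]
  have [measurable]: "g \<in> borel_measurable lebesgue" using g(1) by (simp add: square_integrable_def)
  have "(norm (X n - abs_l2 g))\<^sup>2 = (\<integral>x. (norm (rep_l2 (X n) x - g x))\<^sup>2 \<partial>lebesgue)" for n
    unfolding power2_norm_diff_l2 by (rule integral_cong_AE) (measurable, use rg in eventually_elim, simp)
  then have "(\<lambda>n. sqrt ((norm (X n - abs_l2 g))\<^sup>2)) \<longlonglongrightarrow> sqrt 0"
    using g(4) by (intro tendsto_real_sqrt) simp
  then have "(\<lambda>n. norm (X n - abs_l2 g)) \<longlonglongrightarrow> 0" by simp
  then have "X \<longlonglongrightarrow> abs_l2 g" by (rule LIM_zero_cancel[OF tendsto_norm_zero_cancel])
  moreover have "AE x in lebesgue. (\<lambda>n. rep_l2 (X (r n)) x) \<longlonglongrightarrow> rep_l2 (abs_l2 g) x"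
    using g(3) rg by eventually_elim simp
  ultimately show ?thesis by (rule that[OF _ g(2)])
qed

instance l2 :: (euclidean_space, euclidean_space) complete_space
proof
  fix X :: "nat \<Rightarrow> ('a, 'b) l2" assume "Cauchy X"
  then obtain u where "X \<longlonglongrightarrow> u" by (rule l2_Cauchy_limit)
  then show "convergent X" by (rule convergentI)
qed

section \<open>Bump functions on boxes\<close>

text \<open>p(1/t) exp(-1/t), extended by zero. The polynomial factor makes the family closed under
  differentiation, so one derivative rule yields smoothness, including at 0.\<close>

definition flat_exp :: "real poly \<Rightarrow> real \<Rightarrow> real" where
  "flat_exp p t = (if t > 0 then poly p (1 / t) * exp (- (1 / t)) else 0)"

lemma poly_times_exp_tendsto_0:
  fixes q :: "real poly"
  shows "((\<lambda>s. poly q s * exp (- s)) \<longlongrightarrow> 0) at_top"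
proof -
  have "((\<lambda>s. \<Sum>i\<le>degree q. coeff q i * (s ^ i / exp s)) \<longlongrightarrow> 0) at_top"
    by (intro tendsto_null_sum tendsto_mult_right_zero tendsto_power_div_exp_0)
  moreover have "(\<Sum>i\<le>degree q. coeff q i * (s ^ i / exp s)) = poly q s * exp (- s)" for s
    by (simp add: poly_altdef sum_distrib_right exp_minus divide_inverse mult.assoc)
  ultimately show ?thesis by simp
qed

text \<open>In the variable s = 1/t the derivative multiplies by s^2 and replaces p by p - p', which
  is the polynomial in the statement. At 0 the right quotient is s p(s) exp(-s) for s tending to
  infinity.\<close>

lemma flat_exp_has_derivative:
  "(flat_exp p has_real_derivative flat_exp (pCons 0 (pCons 0 (p - pderiv p))) t) (at t)"
proof -
  consider "t > 0" | "t < 0" | "t = 0" by linarith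
  then show ?thesis
  proof cases
    case 1
    have "((\<lambda>t. poly p (1 / t) * exp (- (1 / t))) has_real_derivative
        flat_exp (pCons 0 (pCons 0 (p - pderiv p))) t) (at t)"
      using 1 by (auto intro!: derivative_eq_intros poly_DERIV[THEN DERIV_chain2] simp: flat_exp_def field_simps power2_eq_square)
    then show ?thesis
      by (rule has_field_derivative_transform_within_open[of _ _ _ "{0<..}"]) (use 1 in \<open>auto simp: flat_exp_def\<close>)
  next
    case 2
    have "((\<lambda>t. 0) has_real_derivative flat_exp (pCons 0 (pCons 0 (p - pderiv p))) t) (at t)"
      using 2 by (simp add: flat_exp_def)
    then show ?thesis
      by (rule has_field_derivative_transform_within_open[of _ _ _ "{..<0}"]) (use 2 in \<open>auto simp: flat_exp_def\<close>)
  next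
    case 3
    have "((\<lambda>h. flat_exp p h / h) \<longlongrightarrow> 0) (at_left 0)"
      by (rule tendsto_eventually) (auto simp: eventually_at_filter flat_exp_def)
    moreover have "((\<lambda>h. flat_exp p h / h) \<longlongrightarrow> 0) (at_right 0)"
    proof -
      have "((\<lambda>h. poly (pCons 0 p) (inverse h) * exp (- inverse h)) \<longlongrightarrow> 0) (at_right 0)"
        by (rule filterlim_compose[OF poly_times_exp_tendsto_0 filterlim_inverse_at_top_right])
      then show ?thesis
        by (rule Lim_transform_eventually)
           (auto simp: eventually_at_filter flat_exp_def field_simps)
    qed
    ultimately show ?thesis
      using 3 by (simp add: has_field_derivative_iff filterlim_at_split flat_exp_def)
  qed
qed

lemma flat_exp_1_bounds: "0 \<le> flat_exp 1 t" "flat_exp 1 t \<le> 1" "0 < flat_exp 1 t \<longleftrightarrow> 0 < t"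
  by (auto simp: flat_exp_def)

text \<open>A class that contains the bumps and is stable under sums, products and, as a
  consequence, partial derivatives. All iterated derivatives then exist by one induction, without
  formulas for them.\<close>

inductive bump_algebra :: "(real^'d \<Rightarrow> real) \<Rightarrow> bool" where
  const: "bump_algebra (\<lambda>x. c)"
| bump: "bump_algebra (\<lambda>x. flat_exp p (s * (x $ i) + b))"
| add: "bump_algebra f \<Longrightarrow> bump_algebra g \<Longrightarrow> bump_algebra (\<lambda>x. f x + g x)"
| mult: "bump_algebra f \<Longrightarrow> bump_algebra g \<Longrightarrow> bump_algebra (\<lambda>x. f x * g x)"

lemma pdiff_eqI: "(f has_derivative f') (at x) \<Longrightarrow> pdiff h f x = f' (axis h 1)"
  unfolding pdiff_def by (metis frechet_derivative_at)

lemma bump_algebra_differentiable: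
  fixes f :: "real^'d \<Rightarrow> real"
  assumes "bump_algebra f"
  shows "f differentiable (at x)" and "bump_algebra (pdiff h f)"
proof -
  have "(\<forall>x. f differentiable (at x)) \<and> (\<forall>h. bump_algebra (pdiff h f))"
    using assms
  proof induction
    case (const c)
    have "pdiff h (\<lambda>x :: real^'d. c) = (\<lambda>x. 0)" for h by (rule ext, subst pdiff_eqI[OF has_derivative_const]) simp
    then show ?case by (auto intro: bump_algebra.const)
  next
    case (bump p s i b)
    define p' where "p' = pCons 0 (pCons 0 (p - pderiv p))"
    have D: "((\<lambda>x :: real^'d. flat_exp p (s * (x $ i) + b)) has_derivative (\<lambda>v. flat_exp p' (s * (x $ i) + b) * (s * v $ i))) (at x)" for x
    proof -
      have "((\<lambda>x :: real^'d. s * (x $ i) + b) has_derivative (\<lambda>v. s * v $ i)) (at x)"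
        by (auto intro!: derivative_eq_intros bounded_linear_imp_has_derivative bounded_linear_vec_nth)
      from DERIV_compose_FDERIV[OF flat_exp_has_derivative this]
      show ?thesis by (simp add: p'_def mult_ac)
    qed
    have eq: "pdiff h (\<lambda>x :: real^'d. flat_exp p (s * (x $ i) + b)) = (\<lambda>x. (s * axis h 1 $ i) * flat_exp p' (s * (x $ i) + b))" for h
      by (rule ext, subst pdiff_eqI[OF D]) (simp add: mult_ac)
    show ?case
      unfolding eq using D
      by (intro conjI allI bump_algebra.mult bump_algebra.const bump_algebra.bump) (auto simp: differentiable_def)
  next
    case (add f g)
    have "pdiff h (\<lambda>x. f x + g x) = (\<lambda>x. pdiff h f x + pdiff h g x)" for h
    proof (rule ext)
      fix x
      show "pdiff h (\<lambda>x. f x + g x) x = pdiff h f x + pdiff h g x"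
        by (subst pdiff_eqI[OF has_derivative_add[OF frechet_derivative_works[THEN iffD1] frechet_derivative_works[THEN iffD1]]])
           (use add in \<open>auto simp: pdiff_def\<close>)
    qed
    then show ?case using add by (auto intro: bump_algebra.add)
  next
    case (mult f g)
    have "pdiff h (\<lambda>x. f x * g x) = (\<lambda>x. f x * pdiff h g x + pdiff h f x * g x)" for h
    proof (rule ext)
      fix x
      show "pdiff h (\<lambda>x. f x * g x) x = f x * pdiff h g x + pdiff h f x * g x"
        by (subst pdiff_eqI[OF has_derivative_mult[OF frechet_derivative_works[THEN iffD1] frechet_derivative_works[THEN iffD1]]])
           (use mult in \<open>auto simp: pdiff_def\<close>)
    qed
    then show ?case using mult by (simp add: bump_algebra.add bump_algebra.mult)
  qed
  then show "f differentiable (at x)" "bump_algebra (pdiff h f)" by auto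
qed

lemma bump_algebra_fold_pdiff: "bump_algebra f \<Longrightarrow> bump_algebra (fold pdiff hs f)"
  by (induction hs arbitrary: f) (auto intro: bump_algebra_differentiable)

lemma bump_algebra_smooth: "bump_algebra f \<Longrightarrow> smooth f"
  unfolding smooth_def differentiable_on_def
  using bump_algebra_fold_pdiff bump_algebra_differentiable(1) differentiable_at_withinI by blast

lemma fold_pdiff_scaleR_left:
  assumes "bump_algebra f"
  shows "fold pdiff hs (\<lambda>x. f x *\<^sub>R v) = (\<lambda>x. fold pdiff hs f x *\<^sub>R v)"
  using assms
proof (induction hs arbitrary: f)
  case (Cons h hs)
  have "pdiff h (\<lambda>x. f x *\<^sub>R v) = (\<lambda>x. pdiff h f x *\<^sub>R v)"
  proof (rule ext)
    fix x
    show "pdiff h (\<lambda>x. f x *\<^sub>R v) x = pdiff h f x *\<^sub>R v"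
      by (subst pdiff_eqI[OF has_derivative_scaleR_left[OF frechet_derivative_works[THEN iffD1]]])
         (use Cons.prems in \<open>auto simp: pdiff_def bump_algebra_differentiable\<close>)
  qed
  then show ?case using Cons.IH bump_algebra_differentiable(2)[OF Cons.prems] by simp
qed simp

lemma bump_algebra_smooth_scaleR:
  assumes "bump_algebra f"
  shows "smooth (\<lambda>x. f x *\<^sub>R v)"
  unfolding smooth_def fold_pdiff_scaleR_left[OF assms]
proof
  fix hs
  have "fold pdiff hs f differentiable_on UNIV" using bump_algebra_smooth[OF assms] by (simp add: smooth_def)
  then show "(\<lambda>x. fold pdiff hs f x *\<^sub>R v) differentiable_on UNIV"
    unfolding differentiable_on_def differentiable_def using has_derivative_scaleR_left by fast
qed

lemma bump_algebra_prod: "finite I \<Longrightarrow> (\<And>i. i \<in> I \<Longrightarrow> bump_algebra (f i)) \<Longrightarrow> bump_algebra (\<lambda>x. \<Prod>i\<in>I. f i x)"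
  by (induction I rule: finite_induct) (auto intro: bump_algebra.const bump_algebra.mult)

lemma bump_algebra_power: "bump_algebra f \<Longrightarrow> bump_algebra (\<lambda>x. f x ^ n)"
  by (induction n) (auto intro: bump_algebra.const bump_algebra.mult)

lemma bump_algebra_one_minus: "bump_algebra f \<Longrightarrow> bump_algebra (\<lambda>x. 1 - f x)"
  using bump_algebra.add[OF bump_algebra.const[of 1] bump_algebra.mult[OF bump_algebra.const[of "-1"]]] by simp

definition box_bump :: "real^'d \<Rightarrow> real^'d \<Rightarrow> real^'d \<Rightarrow> real" where
  "box_bump a b x = (\<Prod>i\<in>UNIV. flat_exp 1 (x $ i - a $ i) * flat_exp 1 (b $ i - x $ i))"

lemma box_bump_bounds: "0 \<le> box_bump a b x" "box_bump a b x \<le> 1"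
  unfolding box_bump_def by (auto intro!: prod_nonneg prod_le_1 mult_le_one flat_exp_1_bounds mult_nonneg_nonneg)

lemma box_bump_pos_iff: "0 < box_bump a b x \<longleftrightarrow> x \<in> box a b"
proof -
  have "box_bump a b x \<noteq> 0 \<longleftrightarrow> (\<forall>i. flat_exp 1 (x $ i - a $ i) \<noteq> 0 \<and> flat_exp 1 (b $ i - x $ i) \<noteq> 0)"
    by (simp add: box_bump_def)
  also have "\<dots> \<longleftrightarrow> x \<in> box a b" by (auto simp: flat_exp_def mem_box_cart)
  finally show ?thesis using box_bump_bounds(1)[of a b x] by linarith
qed

lemma bump_algebra_box_bump: "bump_algebra (box_bump a b)"
proof -
  have "bump_algebra (\<lambda>x. flat_exp 1 (1 * (x $ i) + - (a $ i)) * flat_exp 1 ((-1) * (x $ i) + b $ i))" for i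
    by (intro bump_algebra.mult bump_algebra.bump)
  then have "bump_algebra (\<lambda>x. flat_exp 1 (x $ i - a $ i) * flat_exp 1 (b $ i - x $ i))" for i
    by (simp add: add.commute[of "- (_ $ _)"])
  then show ?thesis unfolding box_bump_def[abs_def] by (intro bump_algebra_prod) auto
qed

text \<open>These functions increase to the indicator function of the box as \<open>n\<close> tends to infinity.\<close>

definition box_plateau :: "real^'d \<Rightarrow> real^'d \<Rightarrow> nat \<Rightarrow> real^'d \<Rightarrow> real" where
  "box_plateau a b n x = 1 - (1 - box_bump a b x) ^ n"

lemma bump_algebra_box_plateau: "bump_algebra (box_plateau a b n)"
  unfolding box_plateau_def[abs_def]
  by (intro bump_algebra_one_minus bump_algebra_power bump_algebra_box_bump)

lemma box_plateau_bounds: "0 \<le> box_plateau a b n x" "box_plateau a b n x \<le> 1"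
  unfolding box_plateau_def using box_bump_bounds[of a b x] by (auto intro: power_le_one)

lemma box_plateau_outside: "x \<notin> box a b \<Longrightarrow> box_plateau a b n x = 0"
  unfolding box_plateau_def using box_bump_pos_iff[of a b x] box_bump_bounds(1)[of a b x] by simp

lemma box_plateau_tendsto: "(\<lambda>n. box_plateau a b n x) \<longlonglongrightarrow> indicator (box a b) x"
proof (cases "x \<in> box a b")
  case True
  then have "(\<lambda>n. 1 - (1 - box_bump a b x) ^ n) \<longlonglongrightarrow> 1 - 0"
    using box_bump_pos_iff[of a b x] box_bump_bounds[of a b x]
    by (intro tendsto_diff tendsto_const LIMSEQ_power_zero) auto
  then show ?thesis using True by (simp add: box_plateau_def)
qed (simp add: box_plateau_outside)

lemma closure_support_subset_cbox:
  fixes \<phi> :: "real^'d \<Rightarrow> 'b::real_vector"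
  assumes "\<And>x. x \<notin> box a b \<Longrightarrow> \<phi> x = 0"
  shows "closure {x. \<phi> x \<noteq> 0} \<subseteq> cbox a b"
  using assms box_subset_cbox by (intro closure_minimal closed_cbox) blast

lemma test_function_box_plateau:
  fixes a b :: "real^'d" and v :: "'b::real_normed_vector"
  assumes "cbox a b \<subseteq> \<Omega>"
  shows "box_plateau a b n \<in> test_functions \<Omega>" "(\<lambda>x. box_plateau a b n x *\<^sub>R v) \<in> test_functions \<Omega>"
proof -
  have "closure {x. box_plateau a b n x \<noteq> 0} \<subseteq> cbox a b"
    "closure {x. box_plateau a b n x *\<^sub>R v \<noteq> 0} \<subseteq> cbox a b"
    by (intro closure_support_subset_cbox; simp add: box_plateau_outside)+
  moreover have "compact (closure S)" if "closure S \<subseteq> cbox a b" for S :: "(real^'d) set"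
    using compact_Int_closed[OF compact_cbox closed_closure, of a b S] that by (simp add: inf.absorb2)
  moreover have "smooth (box_plateau a b n)" "smooth (\<lambda>x. box_plateau a b n x *\<^sub>R v)"
    by (rule bump_algebra_smooth bump_algebra_smooth_scaleR, rule bump_algebra_box_plateau)+
  ultimately show "box_plateau a b n \<in> test_functions \<Omega>" "(\<lambda>x. box_plateau a b n x *\<^sub>R v) \<in> test_functions \<Omega>"
    using assms unfolding test_functions_def by auto
qed

text \<open>Lebesgue differentiation: almost every value of f is the limit of its averages over
  small cubes with that corner, and these averages vanish.\<close>

lemma AE_zero_if_all_box_integrals_zero:
  fixes f :: "'a::euclidean_space \<Rightarrow> 'b::euclidean_space"
  assumes f: "integrable lebesgue f"
    and zero: "\<And>a b. cbox a b \<subseteq> cbox A B \<Longrightarrow> (\<integral>x. indicator (box a b) x *\<^sub>R f x \<partial>lebesgue) = 0"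
  shows "AE x in lebesgue. x \<in> cbox A B \<longrightarrow> f x = 0"
proof -
  have int: "set_integrable lebesgue S f" if "S \<in> sets lebesgue" for S
    unfolding set_integrable_def using integrable_mult_indicator[OF that f] by simp
  have "f integrable_on cbox a b" for a b
    by (rule set_lebesgue_integral_eq_integral(1)[OF int]) simp
  then obtain N where N: "negligible N"
    "\<And>x e. x \<notin> N \<Longrightarrow> 0 < e \<Longrightarrow> \<exists>d>0. \<forall>h. 0 < h \<and> h < d \<longrightarrow>
      norm (integral (cbox x (x + h *\<^sub>R One)) f /\<^sub>R h ^ DIM('a) - f x) < e"
    using integrable_ccontinuous_explicit[of f] by metis
  have "f x = 0" if x: "x \<in> box A B" "x \<notin> N" for x
  proof (rule ccontr)
    assume "f x \<noteq> 0"
    then obtain d where d: "d > 0" "\<And>h. 0 < h \<Longrightarrow> h < d \<Longrightarrow>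
      norm (integral (cbox x (x + h *\<^sub>R One)) f /\<^sub>R h ^ DIM('a) - f x) < norm (f x)"
      using N(2)[OF x(2), of "norm (f x)"] by auto
    obtain e where e: "e > 0" "cball x e \<subseteq> box A B"
      using x(1) open_box open_contains_cball by blast
    \<comment> \<open>Dividing e by the dimension keeps the cube inside the ball, because the norm
      is at most the sum of the absolute coordinates; d / 2 ensures h < d.\<close>
    define h where "h = min (d / 2) (e / DIM('a))"
    have h: "0 < h" "h < d" "DIM('a) * h \<le> e"
      using d(1) e(1) by (auto simp: h_def min_def field_simps)
    have "cbox x (x + h *\<^sub>R One) \<subseteq> cball x e"
    proof
      fix y assume "y \<in> cbox x (x + h *\<^sub>R One)"
      then have "\<bar>(y - x) \<bullet> i\<bar> \<le> h" if "i \<in> Basis" for i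
        using that by (auto simp: mem_box inner_diff_left inner_add_left)
      then have "(\<Sum>i\<in>Basis. \<bar>(y - x) \<bullet> i\<bar>) \<le> (\<Sum>i\<in>(Basis::'a set). h)" by (intro sum_mono) auto
      then have "norm (y - x) \<le> DIM('a) * h" using norm_le_l1[of "y - x"] by simp
      then show "y \<in> cball x e" using h by (simp add: dist_norm norm_minus_commute)
    qed
    then have "cbox x (x + h *\<^sub>R One) \<subseteq> cbox A B" using e(2) box_subset_cbox by blast
    then have "(\<integral>y. indicator (box x (x + h *\<^sub>R One)) y *\<^sub>R f y \<partial>lebesgue) = 0" by (rule zero)
    then have "integral (box x (x + h *\<^sub>R One)) f = 0"
      using set_lebesgue_integral_eq_integral(2)[OF int, of "box x (x + h *\<^sub>R One)"]
      by (simp add: set_lebesgue_integral_def)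
    then have "integral (cbox x (x + h *\<^sub>R One)) f = 0"
      by (simp add: integral_open_interval)
    then show False using d(2)[OF h(1,2)] by simp
  qed
  \<comment> \<open>The argument needs room around x and therefore covers the open box only; its
    boundary joins the exceptional set.\<close>
  then have sub: "{x \<in> space lebesgue. \<not> (x \<in> cbox A B \<longrightarrow> f x = 0)} \<subseteq> N \<union> (cbox A B - box A B)" by auto
  have "negligible (N \<union> (cbox A B - box A B))"
    using N(1) negligible_frontier_interval by (simp add: negligible_Un)
  then show ?thesis
    by (intro AE_I'[OF _ sub]) (simp add: negligible_iff_null_sets)
qed

text \<open>The fundamental lemma of the calculus of variations, tested on plateaus. They converge
  boundedly to indicators of boxes, so all box integrals vanish by dominated convergence, and
  \<Omega> is a countable union of closed boxes.\<close>

theorem test_functions_separate_L1_loc: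
  fixes g :: "real^'d \<Rightarrow> 'b::euclidean_space"
  assumes \<Omega>: "open \<Omega>" and g: "g \<in> L1_loc \<Omega>"
    and zero: "\<And>a b n. cbox a b \<subseteq> \<Omega> \<Longrightarrow> (\<integral>x. box_plateau a b n x *\<^sub>R g x \<partial>lebesgue_on \<Omega>) = 0"
  shows "AE x in lebesgue_on \<Omega>. g x = 0"
proof -
  have \<Omega>m: "\<Omega> \<in> sets lebesgue" using \<Omega> by simp
  have on_cbox: "AE x in lebesgue. x \<in> cbox A B \<longrightarrow> g x = 0" if sub: "cbox A B \<subseteq> \<Omega>" for A B
  proof -
    define f where "f x = indicator (cbox A B) x *\<^sub>R g x" for x
    have "integrable (lebesgue_on (cbox A B)) g" using g sub by (simp add: L1_loc_def)
    then have f: "integrable lebesgue f" unfolding f_def by (subst (asm) integrable_restrict_space) auto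
    have "AE x in lebesgue. x \<in> cbox A B \<longrightarrow> f x = 0"
    proof (rule AE_zero_if_all_box_integrals_zero[OF f])
      fix a b assume ab: "cbox a b \<subseteq> cbox A B"
      have eq: "box_plateau a b n x *\<^sub>R f x = indicator \<Omega> x *\<^sub>R (box_plateau a b n x *\<^sub>R g x)" for n x
        using ab sub box_subset_cbox[of a b] box_plateau_outside[of x a b n]
        by (cases "x \<in> box a b") (auto simp: f_def indicator_def subset_iff)
      have "(\<lambda>n. \<integral>x. box_plateau a b n x *\<^sub>R f x \<partial>lebesgue) \<longlonglongrightarrow> (\<integral>x. indicator (box a b) x *\<^sub>R f x \<partial>lebesgue)"
      proof (rule integral_dominated_convergence[where w="\<lambda>x. norm (f x)"])
        have "continuous_on UNIV (box_plateau a b n)" for n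
          using bump_algebra_differentiable(1)[OF bump_algebra_box_plateau]
          by (intro continuous_at_imp_continuous_on ballI differentiable_imp_continuous_within)
        then have bm: "box_plateau a b n \<in> borel_measurable lebesgue" for n
          by (intro measurable_completion) (simp add: borel_measurable_continuous_onI)
        show "(\<lambda>x. box_plateau a b n x *\<^sub>R f x) \<in> borel_measurable lebesgue" for n
          using f bm by (intro borel_measurable_scaleR) auto
        show "(\<lambda>x. indicator (box a b) x *\<^sub>R f x) \<in> borel_measurable lebesgue"
          using f by (intro borel_measurable_scaleR borel_measurable_indicator) auto
        show "AE x in lebesgue. (\<lambda>n. box_plateau a b n x *\<^sub>R f x) \<longlonglongrightarrow> indicator (box a b) x *\<^sub>R f x"
          by (intro always_eventually allI tendsto_scaleR box_plateau_tendsto tendsto_const)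
        show "AE x in lebesgue. norm (box_plateau a b n x *\<^sub>R f x) \<le> norm (f x)" for n
          using box_plateau_bounds[of a b n] by (auto simp: mult_left_le_one_le)
      qed (use f in auto)
      moreover have "(\<integral>x. box_plateau a b n x *\<^sub>R f x \<partial>lebesgue) = 0" for n
        unfolding eq using zero[of a b n] ab sub integral_restrict_space[of \<Omega> lebesgue "\<lambda>x. box_plateau a b n x *\<^sub>R g x"] \<Omega>m by auto
      ultimately show "(\<integral>x. indicator (box a b) x *\<^sub>R f x \<partial>lebesgue) = 0"
        by (simp add: LIMSEQ_const_iff)
    qed
    then show ?thesis by eventually_elim (auto simp: f_def)
  qed
  obtain \<D> where \<D>: "countable \<D>" "\<D> \<subseteq> Pow \<Omega>" "\<And>X. X \<in> \<D> \<Longrightarrow> \<exists>a b. X = cbox a b" "\<Union>\<D> = \<Omega>"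
    using open_countable_Union_open_cbox[OF \<Omega>] by metis
  have "AE x in lebesgue. \<forall>X\<in>\<D>. x \<in> X \<longrightarrow> g x = 0"
    unfolding AE_ball_countable[OF \<D>(1)] using \<D>(2,3) on_cbox by blast
  then show ?thesis
    unfolding AE_restrict_space_iff[of \<Omega> lebesgue, simplified, OF \<Omega>m] using \<D>(4)
    by (auto elim: eventually_mono)
qed

section \<open>Symmetric real matrices acting on complex vectors\<close>

lemma linear_coeff_zero_if_quadratic_nonneg:
  fixes d c :: real
  assumes "\<And>t. 0 \<le> 2 * t * d + t\<^sup>2 * c"
  shows "d = 0"
proof (rule ccontr)
  assume "d \<noteq> 0"
  \<comment> \<open>A positive majorant of c allows the choice t = -d/k whatever the sign of
    c.\<close>
  define k where "k = \<bar>c\<bar> + 1"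
  have k: "k > 0" "c \<le> k" "k \<noteq> 0" by (auto simp: k_def)
  have "0 \<le> 2 * (- d / k) * d + (- d / k)\<^sup>2 * c" by (rule assms)
  also have "\<dots> \<le> 2 * (- d / k) * d + (- d / k)\<^sup>2 * k" using k by (intro add_left_mono mult_left_mono) auto
  also have "\<dots> = - (d\<^sup>2 / k)" using k by (simp add: power2_eq_square field_simps)
  finally show False using k \<open>d \<noteq> 0\<close> by (smt (verit) divide_pos_pos zero_less_power2)
qed

section \<open>The spectral theorem for real symmetric matrices\<close>

lemma inner_matrix_transpose: "x \<bullet> (M *v y) = (transpose M *v x) \<bullet> y" for M :: "real^'n^'m"
  by (simp add: dot_lmul_matrix[symmetric])

text \<open>The minimiser of the quadratic form on the unit sphere of S. Its first variation
  vanishes in every direction of S, and invariance puts M x - \<mu> x into S, so this vector is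
  orthogonal to itself.\<close>

lemma symmetric_minimal_eigenvector:
  fixes M :: "real^'n^'n"
  assumes sym: "transpose M = M" and S: "subspace S" "S \<noteq> {0}" and inv: "\<And>y. y \<in> S \<Longrightarrow> M *v y \<in> S"
  obtains x \<mu> where "x \<in> S" "norm x = 1" "M *v x = \<mu> *\<^sub>R x" "\<And>y. y \<in> S \<Longrightarrow> \<mu> * (norm y)\<^sup>2 \<le> y \<bullet> (M *v y)"
proof -
  have symM: "x \<bullet> (M *v y) = (M *v x) \<bullet> y" for x y
    using inner_matrix_transpose[of x M y] sym by simp
  let ?K = "S \<inter> sphere 0 1"
  have "compact ?K" using closed_subspace[OF S(1)] by (simp add: closed_Int_compact)
  moreover have "?K \<noteq> {}"
  proof -
    obtain y where y: "y \<in> S" "y \<noteq> 0" using S subspace_0 by blast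
    then have "y /\<^sub>R norm y \<in> ?K" using S(1) by (simp add: subspace_scale)
    then show ?thesis by blast
  qed
  moreover have "continuous_on ?K (\<lambda>y. y \<bullet> (M *v y))"
    by (intro continuous_intros linear_continuous_on matrix_vector_mul_bounded_linear)
  ultimately obtain x where x: "x \<in> ?K" "\<And>y. y \<in> ?K \<Longrightarrow> x \<bullet> (M *v x) \<le> y \<bullet> (M *v y)"
    using continuous_attains_inf[of ?K "\<lambda>y. y \<bullet> (M *v y)"] by blast
  define \<mu> where "\<mu> = x \<bullet> (M *v x)"
  have xS: "x \<in> S" "norm x = 1" using x(1) by auto
  have lower: "\<mu> * (norm y)\<^sup>2 \<le> y \<bullet> (M *v y)" if y: "y \<in> S" for y
  proof (cases "y = 0")
    case False
    have "y /\<^sub>R norm y \<in> ?K" using S(1) y False by (simp add: subspace_scale)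
    from x(2)[OF this] have "\<mu> \<le> (y \<bullet> (M *v y)) / (norm y)\<^sup>2"
      by (simp add: \<mu>_def matrix_vector_mult_scaleR divide_inverse power2_eq_square mult_ac)
    then show ?thesis using False by (simp add: pos_le_divide_eq)
  qed simp
  have "(M *v x - \<mu> *\<^sub>R x) \<bullet> y = 0" if y: "y \<in> S" for y
  proof (rule linear_coeff_zero_if_quadratic_nonneg)
    fix t
    have "x + t *\<^sub>R y \<in> S" using xS y S(1) by (simp add: subspace_add subspace_scale)
    then have "0 \<le> (x + t *\<^sub>R y) \<bullet> (M *v (x + t *\<^sub>R y)) - \<mu> * (norm (x + t *\<^sub>R y))\<^sup>2"
      using lower by simp
    also have "(x + t *\<^sub>R y) \<bullet> (M *v (x + t *\<^sub>R y)) = \<mu> + 2 * t * ((M *v x) \<bullet> y) + t\<^sup>2 * (y \<bullet> (M *v y))"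
      by (simp add: matrix_vector_right_distrib matrix_vector_mult_scaleR inner_add_left inner_add_right
          symM[of x y] \<mu>_def inner_commute[of y "M *v x"] power2_eq_square algebra_simps)
    also have "(norm (x + t *\<^sub>R y))\<^sup>2 = 1 + 2 * t * (x \<bullet> y) + t\<^sup>2 * (y \<bullet> y)"
    proof -
      have "x \<bullet> x = 1" using xS(2) by (simp add: norm_eq_1)
      then show ?thesis unfolding power2_norm_eq_inner
        by (simp add: inner_add_left inner_add_right inner_commute power2_eq_square algebra_simps)
    qed
    finally show "0 \<le> 2 * t * ((M *v x - \<mu> *\<^sub>R x) \<bullet> y) + t\<^sup>2 * (y \<bullet> (M *v y) - \<mu> * (y \<bullet> y))"
      by (simp add: inner_diff_left algebra_simps)
  qed
  moreover have "M *v x - \<mu> *\<^sub>R x \<in> S" using xS S(1) inv by (simp add: subspace_diff subspace_scale)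
  ultimately have "M *v x = \<mu> *\<^sub>R x" by fastforce
  then show ?thesis using that xS lower by blast
qed

text \<open>Induction on the dimension: split off one eigenvector; by symmetry its orthogonal
  complement within S is again invariant.\<close>

lemma symmetric_eigenbasis_subspace:
  fixes M :: "real^'n^'n"
  assumes sym: "transpose M = M"
  shows "subspace S \<Longrightarrow> (\<And>y. y \<in> S \<Longrightarrow> M *v y \<in> S) \<Longrightarrow>
    \<exists>B. finite B \<and> pairwise orthogonal B \<and> (\<forall>b\<in>B. norm b = 1 \<and> (\<exists>\<mu>. M *v b = \<mu> *\<^sub>R b)) \<and> span B = S"
proof (induction "dim S" arbitrary: S rule: less_induct)
  case less
  have symM: "x \<bullet> (M *v y) = (M *v x) \<bullet> y" for x y
    using inner_matrix_transpose[of x M y] sym by simp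
  show ?case
  proof (cases "S = {0}")
    case True
    then show ?thesis by (intro exI[of _ "{}"]) auto
  next
    case False
    obtain x \<mu> where x: "x \<in> S" "norm x = 1" "M *v x = \<mu> *\<^sub>R x"
      using symmetric_minimal_eigenvector[OF sym less.prems(1) False less.prems(2)] by metis
    have xx: "x \<bullet> x = 1" using x(2) by (simp add: norm_eq_1)
    define S' where "S' = {y \<in> S. x \<bullet> y = 0}"
    have sub: "subspace S'"
      using less.prems(1) unfolding S'_def subspace_def by (auto simp: inner_add_right)
    have "x \<notin> S'" using xx by (simp add: S'_def)
    then have "S' \<subset> S" using x(1) unfolding S'_def by blast
    then have "span S' \<subset> span S"
      unfolding span_eq_iff[THEN iffD2, OF sub] span_eq_iff[THEN iffD2, OF less.prems(1)] .
    then have "dim S' < dim S" by (rule dim_psubset)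
    moreover have "M *v y \<in> S'" if "y \<in> S'" for y
      using that less.prems(2) symM[of x y] x(3) by (auto simp: S'_def)
    ultimately obtain B where B: "finite B" "pairwise orthogonal B"
      "\<forall>b\<in>B. norm b = 1 \<and> (\<exists>\<mu>. M *v b = \<mu> *\<^sub>R b)" "span B = S'"
      using less.hyps[of S'] sub by blast
    have "B \<subseteq> S'" using B(4) span_superset by blast
    have "span (insert x B) = S"
    proof
      show "span (insert x B) \<subseteq> S"
        using \<open>B \<subseteq> S'\<close> x(1) less.prems(1) by (intro span_minimal) (auto simp: S'_def)
      show "S \<subseteq> span (insert x B)"
      proof
        fix y assume y: "y \<in> S"
        have "y - (x \<bullet> y) *\<^sub>R x \<in> S'"
          using y x(1) less.prems(1) xx by (simp add: S'_def subspace_diff subspace_scale inner_diff_right)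
        then have "y - (x \<bullet> y) *\<^sub>R x \<in> span (insert x B)" using B(4) span_mono[of B "insert x B"] by blast
        moreover have "(x \<bullet> y) *\<^sub>R x \<in> span (insert x B)" by (intro span_scale span_base) simp
        ultimately show "y \<in> span (insert x B)" using span_add by fastforce
      qed
    qed
    moreover have "pairwise orthogonal (insert x B)"
      using B(2) \<open>B \<subseteq> S'\<close> by (intro pairwise_insert[THEN iffD2]) (auto simp: orthogonal_def S'_def inner_commute)
    ultimately show ?thesis using B x by (intro exI[of _ "insert x B"]) auto
  qed
qed

lemma symmetric_eigenbasis:
  fixes M :: "real^'n^'n"
  assumes "transpose M = M"
  obtains B \<mu> where "finite B" "pairwise orthogonal B" "\<And>b. b \<in> B \<Longrightarrow> norm b = 1"
    "\<And>b. b \<in> B \<Longrightarrow> M *v b = \<mu> b *\<^sub>R b" "\<And>x. (\<Sum>b\<in>B. (x \<bullet> b) *\<^sub>R b) = x"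
proof -
  obtain B where B: "finite B" "pairwise orthogonal B" "\<forall>b\<in>B. norm b = 1 \<and> (\<exists>\<mu>. M *v b = \<mu> *\<^sub>R b)" "span B = UNIV"
    using symmetric_eigenbasis_subspace[OF assms, of UNIV] by auto
  obtain \<mu> where "\<forall>b\<in>B. M *v b = \<mu> b *\<^sub>R b" using B(3) by metis
  then show ?thesis
    using that[of B \<mu>] B orthonormal_basis_expand[OF B(2)] by auto
qed

text \<open>\<open>min_eigenvalue\<close> is a \<open>Min\<close>, so the set of eigenvalues has to
  be shown finite first: an eigenvector has a nonzero coefficient at some basis vector, and symmetry
  forces the two eigenvalues to agree. The minimum of the quadratic form is one of these eigenvalues
  and is thus at least \<open>min_eigenvalue M\<close>.\<close>

lemma min_eigenvalue_le:
  fixes M :: "real^'n^'n"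
  assumes sym: "transpose M = M"
  shows "min_eigenvalue M * (norm y)\<^sup>2 \<le> y \<bullet> (M *v y)"
proof -
  let ?E = "{\<mu>. \<exists>x. x \<noteq> 0 \<and> M *v x = \<mu> *s x}"
  obtain B \<mu> where B: "finite B" "\<And>b. b \<in> B \<Longrightarrow> M *v b = \<mu> b *\<^sub>R b" "\<And>x. (\<Sum>b\<in>B. (x \<bullet> b) *\<^sub>R b) = x"
    by (rule symmetric_eigenbasis[OF sym]) blast
  have "?E \<subseteq> \<mu> ` B"
  proof
    fix l assume "l \<in> ?E"
    then obtain x where x: "x \<noteq> 0" "M *v x = l *\<^sub>R x" by (auto simp: scalar_mult_eq_scaleR)
    then obtain b where b: "b \<in> B" "x \<bullet> b \<noteq> 0"
      using B(3)[of x] by (metis (no_types, lifting) scaleR_zero_left sum.neutral)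
    have "l * (x \<bullet> b) = (M *v x) \<bullet> b" by (simp add: x)
    also have "\<dots> = x \<bullet> (M *v b)" using inner_matrix_transpose[of x M b] sym by simp
    also have "\<dots> = \<mu> b * (x \<bullet> b)" by (simp add: B(2)[OF b(1)])
    finally show "l \<in> \<mu> ` B" using b by auto
  qed
  then have fin: "finite ?E" using B(1) finite_surj by blast
  have "(UNIV :: (real^'n) set) \<noteq> {0}"
    by (metis UNIV_I axis_eq_0_iff singletonD zero_neq_one)
  then obtain x m where x: "norm x = 1" "M *v x = m *\<^sub>R x" "\<And>y. m * (norm y)\<^sup>2 \<le> y \<bullet> (M *v y)"
    using symmetric_minimal_eigenvector[OF sym, of UNIV] by auto
  have "m \<in> ?E" using x(1,2) by (intro CollectI exI[of _ x]) (auto simp: scalar_mult_eq_scaleR)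
  then have "min_eigenvalue M \<le> m" unfolding min_eigenvalue_def using fin by (rule Min_le[rotated])
  then have "min_eigenvalue M * (norm y)\<^sup>2 \<le> m * (norm y)\<^sup>2" by (rule mult_right_mono) simp
  then show ?thesis using x(3)[of y] by linarith
qed

text \<open>\<open>mat_sqrt\<close> is defined by choice, so a root has to be exhibited: the map
  that multiplies each vector of an eigenbasis by the square root of its eigenvalue.\<close>

lemma
  fixes M :: "real^'n^'n"
  assumes sym: "transpose M = M" and pos: "\<And>x. 0 \<le> x \<bullet> (M *v x)"
  shows transpose_mat_sqrt: "transpose (mat_sqrt M) = mat_sqrt M"
    and mat_sqrt_mult_self: "mat_sqrt M ** mat_sqrt M = M"
proof -
  obtain B \<mu> where B: "finite B" "pairwise orthogonal B" "\<And>b. b \<in> B \<Longrightarrow> norm b = 1"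
    "\<And>b. b \<in> B \<Longrightarrow> M *v b = \<mu> b *\<^sub>R b" "\<And>x. (\<Sum>b\<in>B. (x \<bullet> b) *\<^sub>R b) = x"
    by (rule symmetric_eigenbasis[OF sym], rule that)
  have bb: "b \<bullet> c = (if b = c then 1 else 0)" if "b \<in> B" "c \<in> B" for b c
    using B(2,3) that by (auto simp: pairwise_def orthogonal_def norm_eq_1)
  have \<mu>: "\<mu> b \<ge> 0" if "b \<in> B" for b
    using pos[of b] B(4)[OF that] bb[OF that that] by simp
  define f where "f x = (\<Sum>b\<in>B. (sqrt (\<mu> b) * (x \<bullet> b)) *\<^sub>R b)" for x
  have lin: "linear f"
  proof (rule linearI)
    show "f (x + y) = f x + f y" for x y
      unfolding f_def inner_add_left distrib_left scaleR_add_left sum.distrib by (rule refl)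
    show "f (r *\<^sub>R x) = r *\<^sub>R f x" for r x
      unfolding f_def scaleR_sum_right by (rule sum.cong) (simp_all add: mult_ac)
  qed
  have Rf: "matrix f *v x = f x" for x by (rule fun_cong[OF matrix_vector_mul(2)[OF lin]])
  have f_inner: "y \<bullet> f x = (\<Sum>b\<in>B. sqrt (\<mu> b) * (x \<bullet> b) * (y \<bullet> b))" for x y
    by (simp add: f_def inner_sum_right)
  have "f x \<bullet> b = sqrt (\<mu> b) * (x \<bullet> b)" if "b \<in> B" for x b
  proof -
    have "f x \<bullet> b = (\<Sum>c\<in>B. sqrt (\<mu> c) * (x \<bullet> c) * (b \<bullet> c))" using f_inner[of b x] by (simp add: inner_commute)
    also have "\<dots> = (\<Sum>c\<in>B. if b = c then sqrt (\<mu> c) * (x \<bullet> c) else 0)" by (rule sum.cong) (auto simp: bb that)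
    finally show ?thesis using that B(1) by simp
  qed
  then have "f (f x) = (\<Sum>b\<in>B. (sqrt (\<mu> b) * (sqrt (\<mu> b) * (x \<bullet> b))) *\<^sub>R b)" for x
    by (subst f_def) (rule sum.cong, auto)
  moreover have "M *v x = (\<Sum>b\<in>B. (\<mu> b * (x \<bullet> b)) *\<^sub>R b)" for x
  proof -
    have "M *v x = M *v (\<Sum>b\<in>B. (x \<bullet> b) *\<^sub>R b)" by (simp only: B(5))
    also have "\<dots> = (\<Sum>b\<in>B. (x \<bullet> b) *\<^sub>R (M *v b))"
      by (simp add: linear_sum[OF matrix_vector_mul_linear] matrix_vector_mult_scaleR)
    also have "\<dots> = (\<Sum>b\<in>B. (\<mu> b * (x \<bullet> b)) *\<^sub>R b)" by (rule sum.cong) (auto simp: B(4) mult.commute)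
    finally show ?thesis .
  qed
  moreover have "(\<Sum>b\<in>B. (sqrt (\<mu> b) * (sqrt (\<mu> b) * (x \<bullet> b))) *\<^sub>R b) = (\<Sum>b\<in>B. (\<mu> b * (x \<bullet> b)) *\<^sub>R b)" for x
    by (rule sum.cong) (use \<mu> in \<open>auto simp flip: mult.assoc\<close>)
  ultimately have sq: "f (f x) = M *v x" for x by simp
  have "transpose (matrix f) = matrix f"
  proof -
    have "(transpose (matrix f) *v y) \<bullet> x = (matrix f *v y) \<bullet> x" for x y
      using f_inner[of y x] f_inner[of x y] inner_matrix_transpose[of y "matrix f" x]
      by (simp add: Rf inner_commute mult_ac)
    then show ?thesis unfolding matrix_eq by (metis vector_eq_rdot)
  qed
  moreover have "0 \<le> x \<bullet> (matrix f *v x)" for x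
    unfolding Rf f_inner using \<mu> by (intro sum_nonneg) (simp add: mult.assoc)
  moreover have "matrix f ** matrix f = M"
    unfolding matrix_eq by (simp add: matrix_vector_mul_assoc[symmetric] Rf sq)
  ultimately have "\<exists>R. transpose R = R \<and> (\<forall>x. 0 \<le> x \<bullet> (R *v x)) \<and> R ** R = M" by blast
  from someI_ex[OF this] show "transpose (mat_sqrt M) = mat_sqrt M" "mat_sqrt M ** mat_sqrt M = M"
    unfolding mat_sqrt_def by auto
qed

lemma transpose_sym_part: "transpose (sym_part M) = sym_part M"
  by (simp add: sym_part_def vec_eq_iff transpose_def add.commute)

section \<open>The Hermitian product and real matrices on complex vectors\<close>

lemma cinner_add_left: "cinner (x + y) z = cinner x z + cinner y z"
  by (simp add: cinner_def distrib_right sum.distrib)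

lemma cinner_add_right: "cinner z (x + y) = cinner z x + cinner z y"
  by (simp add: cinner_def distrib_left sum.distrib)

lemma cinner_scale_left: "cinner (c *s x) y = c * cinner x y"
  by (simp add: cinner_def sum_distrib_left mult.assoc)

lemma cinner_scale_right: "cinner x (c *s y) = cnj c * cinner x y"
  by (simp add: cinner_def sum_distrib_left mult_ac)

lemma Re_cinner: "Re (cinner x y) = x \<bullet> y"
  by (simp add: cinner_def inner_vec_def inner_complex_def)

lemma norm_cscale: "norm (c *s x) = cmod c * norm x" for x :: "complex^'n"
  by (simp add: norm_vec_def norm_mult L2_set_right_distrib)

lemma Im_cinner: "Im (cinner x y) = - ((\<i> *s x) \<bullet> y)"
proof -
  have "(\<i> *s x) \<bullet> y = Re (\<i> * cinner x y)" by (simp only: cinner_scale_left flip: Re_cinner)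
  then show ?thesis by simp
qed

lemma cmod_cinner_le: "cmod (cinner x y) \<le> 2 * norm x * norm y"
proof -
  have "cmod (cinner x y) \<le> \<bar>Re (cinner x y)\<bar> + \<bar>Im (cinner x y)\<bar>" by (rule cmod_le)
  also have "\<dots> \<le> norm x * norm y + norm (\<i> *s x) * norm y"
    unfolding Re_cinner Im_cinner abs_minus_cancel by (intro add_mono Cauchy_Schwarz_ineq2)
  finally show ?thesis by (simp add: norm_cscale)
qed

lemma cmat_nth: "cmat M $ i $ j = complex_of_real (M $ i $ j)"
  by (simp add: cmat_def map_matrix_def)

lemma cmat_vec_nth: "(cmat M *v x) $ i = (\<Sum>j\<in>UNIV. complex_of_real (M $ i $ j) * x $ j)"
  by (simp add: cmat_def matrix_vector_mult_def map_matrix_def)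

lemma cmat_add: "cmat (M + N) *v x = cmat M *v x + cmat N *v x"
  by (simp add: vec_eq_iff cmat_vec_nth distrib_right sum.distrib)

lemma cmat_mat: "cmat (mat c) *v x = complex_of_real c *s x"
proof -
  have "(\<Sum>j\<in>UNIV. complex_of_real (if i = j then c else 0) * x $ j) = (\<Sum>j\<in>UNIV. if i = j then complex_of_real c * x $ j else 0)" for i
    by (rule sum.cong) auto
  then show ?thesis by (simp add: vec_eq_iff cmat_vec_nth mat_def)
qed

lemma cmat_scale: "cmat M *v (c *s x) = c *s (cmat M *v x)"
  by (simp add: vec_eq_iff cmat_vec_nth sum_distrib_left mult_ac)

lemma cmat_vec_add: "cmat M *v (x + y) = cmat M *v x + cmat M *v y"
  by (rule matrix_vector_right_distrib)

lemma bounded_linear_cmat: "bounded_linear ((*v) (cmat M :: complex^'n^'m))"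
proof -
  have "linear ((*v) (cmat M :: complex^'n^'m))"
    by (rule linearI) (simp_all add: cmat_vec_add vec_eq_iff cmat_vec_nth scaleR_sum_right)
  then show ?thesis by (simp add: linear_conv_bounded_linear)
qed

lemma cinner_cmat: "cinner (cmat M *v x) y = cinner x (cmat (transpose M) *v y)"
proof -
  have "cinner (cmat M *v x) y = (\<Sum>i\<in>UNIV. \<Sum>j\<in>UNIV. complex_of_real (M $ i $ j) * x $ j * cnj (y $ i))"
    by (simp add: cinner_def cmat_vec_nth sum_distrib_right)
  also have "\<dots> = (\<Sum>j\<in>UNIV. \<Sum>i\<in>UNIV. complex_of_real (M $ i $ j) * x $ j * cnj (y $ i))" by (rule sum.swap)
  also have "\<dots> = cinner x (cmat (transpose M) *v y)"
    by (simp add: cinner_def cmat_vec_nth transpose_def sum_distrib_left mult_ac)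
  finally show ?thesis .
qed

lemma cmat_mult: "cmat (M ** N) *v x = cmat M *v (cmat N *v x)"
proof -
  have "(\<Sum>j\<in>UNIV. complex_of_real (\<Sum>k\<in>UNIV. M $ i $ k * N $ k $ j) * x $ j)
      = (\<Sum>k\<in>UNIV. complex_of_real (M $ i $ k) * (\<Sum>j\<in>UNIV. complex_of_real (N $ k $ j) * x $ j))" for i
    by (simp add: sum_distrib_right sum_distrib_left mult.assoc) (rule sum.swap)
  then show ?thesis by (simp add: vec_eq_iff cmat_vec_nth matrix_matrix_mult_def)
qed

text \<open>A real matrix acts on real and imaginary parts separately. This reduces the complex
  estimates to the real quadratic form, and the spectral bounds transfer.\<close>

lemma Re_cinner_cmat:
  "Re (cinner (cmat M *v x) x) = (\<chi> i. Re (x $ i)) \<bullet> (M *v (\<chi> i. Re (x $ i))) + (\<chi> i. Im (x $ i)) \<bullet> (M *v (\<chi> i. Im (x $ i)))"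
  by (simp add: cinner_def cmat_nth inner_vec_def matrix_vector_mult_def sum_distrib_left sum_distrib_right
      sum.distrib[symmetric] mult_ac)

lemma Re_cinner_sym_part: "Re (cinner (cmat (sym_part M) *v x) x) = Re (cinner (cmat M *v x) x)"
proof -
  have "y \<bullet> (sym_part M *v y) = y \<bullet> (M *v y)" for y
    using inner_matrix_transpose[of y M y]
    by (simp add: sym_part_def scaleR_matrix_vector_assoc[symmetric] matrix_vector_mult_add_rdistrib inner_add_right inner_commute)
  then show ?thesis by (simp add: Re_cinner_cmat)
qed

lemma min_eigenvalue_le_cinner:
  assumes "transpose M = M"
  shows "min_eigenvalue M * (norm x)\<^sup>2 \<le> Re (cinner (cmat M *v x) x)"
proof -
  have "(norm x)\<^sup>2 = (norm (\<chi> i. Re (x $ i)))\<^sup>2 + (norm (\<chi> i. Im (x $ i)))\<^sup>2"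
    by (simp add: power2_norm_eq_inner inner_vec_def inner_complex_def sum.distrib)
  then show ?thesis
    unfolding Re_cinner_cmat distrib_left using min_eigenvalue_le[OF assms] by (simp add: distrib_left add_mono)
qed

lemma cinner_cmat_eq_mat_sqrt:
  assumes sym: "transpose M = M" and pos: "0 \<le> min_eigenvalue M"
  shows "cinner (cmat M *v x) y = cinner (cmat (mat_sqrt M) *v x) (cmat (mat_sqrt M) *v y)"
proof -
  have "0 \<le> x \<bullet> (M *v x)" for x
    using min_eigenvalue_le[OF sym, of x] pos by (smt (verit) mult_nonneg_nonneg zero_le_power2)
  note R = transpose_mat_sqrt[OF sym this] mat_sqrt_mult_self[OF sym this]
  have "cinner (cmat M *v x) y = cinner (cmat (mat_sqrt M) *v (cmat (mat_sqrt M) *v x)) y"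
    by (subst R(2)[symmetric]) (simp only: cmat_mult)
  then show ?thesis by (simp add: cinner_cmat[of "mat_sqrt M"] R(1))
qed

text \<open>4 f x y is a combination with unimodular coefficients of the values of f at x + c y for
  the four fourth roots of unity c. When the bounds are added, the mixed terms of g cancel. Sum and
  multiple are parameters because the lemma is applied to jets, which carry no vector space
  class.\<close>

lemma polarization_bound:
  fixes f g :: "'x \<Rightarrow> 'x \<Rightarrow> complex" and pl :: "'x \<Rightarrow> 'x \<Rightarrow> 'x" and sc :: "complex \<Rightarrow> 'x \<Rightarrow> 'x"
  assumes f: "\<And>x y z. f (pl x y) z = f x z + f y z" "\<And>x y z. f z (pl x y) = f z x + f z y"
      "\<And>c x y. f (sc c x) y = c * f x y" "\<And>c x y. f x (sc c y) = cnj c * f x y"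
    and g: "\<And>x y z. g (pl x y) z = g x z + g y z" "\<And>x y z. g z (pl x y) = g z x + g z y"
      "\<And>c x y. g (sc c x) y = c * g x y" "\<And>c x y. g x (sc c y) = cnj c * g x y"
    and bound: "\<And>z. cmod (f z z) \<le> \<kappa> * Re (g z z)"
  shows "cmod (f x y) \<le> \<kappa> * (Re (g x x) + Re (g y y))"
proof -
  define z where "z c = pl x (sc c y)" for c
  have fz: "f (z c) (z c) = f x x + c * f y x + cnj c * f x y + c * cnj c * f y y" for c
    by (simp add: z_def f algebra_simps)
  have gz: "g (z c) (z c) = g x x + c * g y x + cnj c * g x y + c * cnj c * g y y" for c
    by (simp add: z_def g algebra_simps)
  have "4 * f x y = f (z 1) (z 1) + (-1) * f (z (-1)) (z (-1)) + \<i> * f (z \<i>) (z \<i>) + (- \<i>) * f (z (- \<i>)) (z (- \<i>))"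
    unfolding fz by (simp add: algebra_simps)
  then have "cmod (4 * f x y) \<le> cmod (f (z 1) (z 1)) + cmod ((-1) * f (z (-1)) (z (-1))) + cmod (\<i> * f (z \<i>) (z \<i>)) + cmod ((- \<i>) * f (z (- \<i>)) (z (- \<i>)))"
    by (simp only:) (intro norm_triangle_mono order_refl)
  also have "\<dots> = cmod (f (z 1) (z 1)) + cmod (f (z (-1)) (z (-1))) + cmod (f (z \<i>) (z \<i>)) + cmod (f (z (- \<i>)) (z (- \<i>)))"
    by (simp add: norm_mult)
  also have "\<dots> \<le> \<kappa> * Re (g (z 1) (z 1)) + \<kappa> * Re (g (z (-1)) (z (-1))) + \<kappa> * Re (g (z \<i>) (z \<i>)) + \<kappa> * Re (g (z (- \<i>)) (z (- \<i>)))"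
    by (intro add_mono bound)
  also have "\<dots> = \<kappa> * Re (g (z 1) (z 1) + g (z (-1)) (z (-1)) + g (z \<i>) (z \<i>) + g (z (- \<i>)) (z (- \<i>)))"
    by (simp add: algebra_simps)
  also have "g (z 1) (z 1) + g (z (-1)) (z (-1)) + g (z \<i>) (z \<i>) + g (z (- \<i>)) (z (- \<i>)) = 4 * (g x x + g y y)"
    unfolding gz by (simp add: algebra_simps)
  finally show ?thesis by (simp add: norm_mult algebra_simps)
qed

section \<open>Weak derivatives\<close>

lemma L2_iff: "f \<in> L2 \<Omega> \<longleftrightarrow> square_integrable (lebesgue_on \<Omega>) f"
  by (simp add: L2_def square_integrable_def)

lemma AE_lebesgue_on_iff: "\<Omega> \<in> sets lebesgue \<Longrightarrow> (AE x in lebesgue_on \<Omega>. P x) \<longleftrightarrow> (AE x in lebesgue. x \<in> \<Omega> \<longrightarrow> P x)"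
  by (rule AE_restrict_space_iff) simp

lemma AE_lebesgue_on_subset:
  assumes "K \<subseteq> \<Omega>" "K \<in> sets lebesgue" "\<Omega> \<in> sets lebesgue" "AE x in lebesgue_on \<Omega>. P x"
  shows "AE x in lebesgue_on K. P x"
  using assms(4) unfolding AE_lebesgue_on_iff[OF assms(2)] AE_lebesgue_on_iff[OF assms(3)]
  by eventually_elim (use assms(1) in auto)

lemma measurable_lebesgue_on_AE:
  fixes f g :: "'a::euclidean_space \<Rightarrow> 'b::euclidean_space"
  assumes \<Omega>: "\<Omega> \<in> sets lebesgue" and f: "f \<in> borel_measurable (lebesgue_on \<Omega>)"
    and eq: "AE x in lebesgue_on \<Omega>. f x = g x"
  shows "g \<in> borel_measurable (lebesgue_on \<Omega>)"
proof -
  have iff: "h \<in> borel_measurable (lebesgue_on \<Omega>) \<longleftrightarrow> (\<lambda>x. indicator \<Omega> x *\<^sub>R h x) \<in> borel_measurable lebesgue" for h :: "'a \<Rightarrow> 'b"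
    using \<Omega> by (intro borel_measurable_restrict_space_iff) simp
  have "AE x in lebesgue. indicator \<Omega> x *\<^sub>R f x = indicator \<Omega> x *\<^sub>R g x"
    using eq unfolding AE_lebesgue_on_iff[OF \<Omega>] by eventually_elim (auto simp: indicator_def)
  with f show ?thesis unfolding iff by (rule borel_measurable_AE)
qed

lemma measurable_lebesgue_on_subset:
  fixes f :: "'a::euclidean_space \<Rightarrow> 'b::euclidean_space"
  assumes "K \<subseteq> \<Omega>" "f \<in> borel_measurable (lebesgue_on \<Omega>)"
  shows "f \<in> borel_measurable (lebesgue_on K)"
  by (rule measurable_restrict_mono[OF assms(2,1)])

lemma integrable_lebesgue_on_subset:
  fixes f :: "'a::euclidean_space \<Rightarrow> 'b::euclidean_space"
  assumes "K \<subseteq> \<Omega>" "K \<in> sets lebesgue" "\<Omega> \<in> sets lebesgue" "integrable (lebesgue_on \<Omega>) f"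
  shows "integrable (lebesgue_on K) f"
proof -
  have "integrable lebesgue (\<lambda>x. indicator K x *\<^sub>R (indicator \<Omega> x *\<^sub>R f x))"
    by (rule integrable_mult_indicator) (use assms in \<open>auto simp: integrable_restrict_space\<close>)
  moreover have "(\<lambda>x. indicator K x *\<^sub>R (indicator \<Omega> x *\<^sub>R f x)) = (\<lambda>x. indicator K x *\<^sub>R f x :: 'b)"
    using assms(1) by (intro ext) (auto simp: indicator_def)
  ultimately have "integrable lebesgue (\<lambda>x. indicator K x *\<^sub>R f x)" by (simp only:)
  then show ?thesis using assms(2) by (simp add: integrable_restrict_space)
qed

lemma integral_lebesgue_on_subset_mono:
  fixes f :: "'a::euclidean_space \<Rightarrow> real"
  assumes "K \<subseteq> \<Omega>" "K \<in> sets lebesgue" "\<Omega> \<in> sets lebesgue" "integrable (lebesgue_on \<Omega>) f" "\<And>x. 0 \<le> f x"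
  shows "(\<integral>x. f x \<partial>lebesgue_on K) \<le> (\<integral>x. f x \<partial>lebesgue_on \<Omega>)"
  using assms integrable_lebesgue_on_subset[OF assms(1-4)]
  by (auto simp: integral_restrict_space integrable_restrict_space indicator_def intro!: integral_mono)

lemma L2_subset:
  fixes f :: "'a::euclidean_space \<Rightarrow> 'b::euclidean_space"
  assumes "K \<subseteq> \<Omega>" "K \<in> sets lebesgue" "\<Omega> \<in> sets lebesgue" "f \<in> L2 \<Omega>"
  shows "f \<in> L2 K"
proof -
  have "f \<in> borel_measurable (lebesgue_on \<Omega>)" "integrable (lebesgue_on \<Omega>) (\<lambda>x. (norm (f x))\<^sup>2)"
    using assms(4) unfolding L2_def by blast+
  from measurable_lebesgue_on_subset[OF assms(1) this(1)] integrable_lebesgue_on_subset[OF assms(1-3) this(2)]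
  show ?thesis unfolding L2_def by blast
qed

lemma compact_sets_lebesgue: "compact K \<Longrightarrow> K \<in> sets lebesgue" for K :: "'a::euclidean_space set"
  by (intro sets_completionI_sets) (simp add: borel_compact)

lemma finite_measure_lebesgue_on_compact: "compact K \<Longrightarrow> finite_measure (lebesgue_on K)" for K :: "'a::euclidean_space set"
  using fmeasurableD2[OF lmeasurable_compact]
  by (intro finite_measureI) (simp add: emeasure_restrict_space compact_sets_lebesgue del: emeasure_completion)

lemma integrable_L2_compact:
  fixes f :: "'a::euclidean_space \<Rightarrow> 'b::euclidean_space"
  assumes K: "compact K" and f: "f \<in> L2 K"
  shows "integrable (lebesgue_on K) f"
proof (rule Bochner_Integration.integrable_bound)
  interpret finite_measure "lebesgue_on K" by (rule finite_measure_lebesgue_on_compact[OF K])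
  show "integrable (lebesgue_on K) (\<lambda>x. 1 + (norm (f x))\<^sup>2)"
    using f by (intro Bochner_Integration.integrable_add) (auto simp: L2_def)
  have "norm (f x) \<le> norm (1 + (norm (f x))\<^sup>2)" for x
  proof -
    have "2 * norm (f x) * 1 \<le> (norm (f x))\<^sup>2 + 1\<^sup>2" by (rule sum_squares_bound)
    then show ?thesis using norm_ge_zero[of "f x"] by (simp del: norm_ge_zero)
  qed
  then show "AE x in lebesgue_on K. norm (f x) \<le> norm (1 + (norm (f x))\<^sup>2)" by simp
qed (use f in \<open>auto simp: L2_def\<close>)

lemma L2_loc_L1_loc: "f \<in> L2_loc \<Omega> \<Longrightarrow> f \<in> L1_loc \<Omega>"
  for f :: "'a::euclidean_space \<Rightarrow> 'b::euclidean_space"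
  by (auto simp: L2_loc_def L1_loc_def intro: integrable_L2_compact)

lemma L2_L2_loc: "\<Omega> \<in> sets lebesgue \<Longrightarrow> f \<in> L2 \<Omega> \<Longrightarrow> f \<in> L2_loc \<Omega>"
  for f :: "'a::euclidean_space \<Rightarrow> 'b::euclidean_space"
  by (auto simp: L2_loc_def intro: L2_subset compact_sets_lebesgue)

text \<open>On a set of finite measure, |f| <= d + |f|^2 / d for every d > 0. The first term is made
  small by the choice of d, the second by the convergence in mean square.\<close>

lemma integral_norm_tendsto_0_compact:
  fixes f :: "nat \<Rightarrow> 'a::euclidean_space \<Rightarrow> 'b::euclidean_space"
  assumes K: "compact K" and f: "\<And>n. f n \<in> L2 K" and lim: "(\<lambda>n. \<integral>x. (norm (f n x))\<^sup>2 \<partial>lebesgue_on K) \<longlonglongrightarrow> 0"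
  shows "(\<lambda>n. \<integral>x. norm (f n x) \<partial>lebesgue_on K) \<longlonglongrightarrow> 0"
proof (rule LIMSEQ_I)
  interpret finite_measure "lebesgue_on K" by (rule finite_measure_lebesgue_on_compact[OF K])
  \<comment> \<open>Adding 1 keeps m positive also when K is a null set.\<close>
  define m where "m = measure (lebesgue_on K) (space (lebesgue_on K)) + 1"
  have m: "m > 0" "measure (lebesgue_on K) (space (lebesgue_on K)) \<le> m"
    using measure_nonneg[of "lebesgue_on K" "space (lebesgue_on K)"] unfolding m_def by linarith+
  fix e :: real assume e: "e > 0"
  define d where "d = e / (2 * m)"
  have d: "d > 0" "d * m = e / 2" using e m by (auto simp: d_def)
  have "\<forall>\<^sub>F n in sequentially. (\<integral>x. (norm (f n x))\<^sup>2 \<partial>lebesgue_on K) < d * e / 2"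
    by (rule order_tendstoD(2)[OF lim]) (use d e in simp)
  then obtain N where N: "\<And>n. n \<ge> N \<Longrightarrow> (\<integral>x. (norm (f n x))\<^sup>2 \<partial>lebesgue_on K) < d * e / 2"
    unfolding eventually_sequentially by blast
  have "norm ((\<integral>x. norm (f n x) \<partial>lebesgue_on K) - 0) < e" if n: "n \<ge> N" for n
  proof -
    have i1: "integrable (lebesgue_on K) (\<lambda>x. norm (f n x))" using integrable_L2_compact[OF K f] by simp
    have i2: "integrable (lebesgue_on K) (\<lambda>x. (norm (f n x))\<^sup>2)" using f[of n] by (simp add: L2_def)
    have "norm (f n x) \<le> d + (norm (f n x))\<^sup>2 / d" for x
    proof -
      have "2 * d * norm (f n x) \<le> d\<^sup>2 + (norm (f n x))\<^sup>2" by (rule sum_squares_bound)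
      moreover have "0 \<le> d * norm (f n x)" using d by simp
      ultimately have "d * norm (f n x) \<le> d\<^sup>2 + (norm (f n x))\<^sup>2" by linarith
      then show ?thesis using d by (simp add: field_simps power2_eq_square)
    qed
    then have "(\<integral>x. norm (f n x) \<partial>lebesgue_on K) \<le> (\<integral>x. d + (norm (f n x))\<^sup>2 / d \<partial>lebesgue_on K)"
      using i1 i2 by (intro integral_mono) auto
    also have "\<dots> = d * measure (lebesgue_on K) (space (lebesgue_on K)) + (\<integral>x. (norm (f n x))\<^sup>2 \<partial>lebesgue_on K) / d"
      using i2 by simp
    also have "\<dots> < d * m + (d * e / 2) / d"
      using N[OF n] d m by (intro add_le_less_mono mult_left_mono divide_strict_right_mono) auto
    also have "\<dots> = e" using d by simp
    finally have "(\<integral>x. norm (f n x) \<partial>lebesgue_on K) < e" .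
    moreover have "0 \<le> (\<integral>x. norm (f n x) \<partial>lebesgue_on K)" by simp
    ultimately show ?thesis by simp
  qed
  then show "\<exists>no. \<forall>n\<ge>no. norm ((\<integral>x. norm (f n x) \<partial>lebesgue_on K) - 0) < e" by blast
qed

text \<open>Local integrability gives measurability on compact sets only; preimages in \<Omega> are
  assembled from countably many closed boxes.\<close>

lemma L1_loc_measurable:
  fixes f :: "'a::euclidean_space \<Rightarrow> 'b::euclidean_space"
  assumes \<Omega>: "open \<Omega>" and f: "f \<in> L1_loc \<Omega>"
  shows "f \<in> borel_measurable (lebesgue_on \<Omega>)"
proof (rule measurableI)
  fix T :: "'b set" assume T: "T \<in> sets borel"
  obtain \<D> where \<D>: "countable \<D>" "\<D> \<subseteq> Pow \<Omega>" "\<And>X. X \<in> \<D> \<Longrightarrow> \<exists>a b. X = cbox a b" "\<Union>\<D> = \<Omega>"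
    using open_countable_Union_open_cbox[OF \<Omega>] by metis
  have \<Omega>m: "\<Omega> \<in> sets lebesgue" using \<Omega> by simp
  have "f -` T \<inter> X \<in> sets lebesgue" if X: "X \<in> \<D>" for X
  proof -
    obtain a b where "X = cbox a b" using \<D>(3)[OF X] by blast
    then have "compact X" by simp
    have "X \<subseteq> \<Omega>" using X \<D>(2) by blast
    with f \<open>compact X\<close> have "integrable (lebesgue_on X) f" unfolding L1_loc_def by blast
    then have "f \<in> borel_measurable (lebesgue_on X)" by simp
    then have "f -` T \<inter> space (lebesgue_on X) \<in> sets (lebesgue_on X)" using T by (rule measurable_sets)
    then show ?thesis using compact_sets_lebesgue[OF \<open>compact X\<close>]
      by (auto simp: sets_restrict_space_iff space_restrict_space)
  qed
  then have "(\<Union>X\<in>\<D>. f -` T \<inter> X) \<in> sets lebesgue" using \<D>(1) by blast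
  moreover have "(\<Union>X\<in>\<D>. f -` T \<inter> X) = f -` T \<inter> \<Omega>" using \<D>(4) by blast
  ultimately show "f -` T \<inter> space (lebesgue_on \<Omega>) \<in> sets (lebesgue_on \<Omega>)"
    using \<Omega>m by (simp add: sets_restrict_space_iff space_restrict_space)
qed simp

lemma test_function_support:
  fixes \<phi> :: "real^'d \<Rightarrow> real"
  assumes "\<phi> \<in> test_functions \<Omega>"
  obtains K where "compact K" "K \<subseteq> \<Omega>" "\<And>x. x \<notin> K \<Longrightarrow> \<phi> x = 0" "\<And>x h. x \<notin> K \<Longrightarrow> pdiff h \<phi> x = 0"
    "continuous_on UNIV \<phi>" "\<And>h. continuous_on UNIV (pdiff h \<phi>)"
proof -
  let ?K = "closure {x. \<phi> x \<noteq> 0}"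
  have smooth: "smooth \<phi>" and K: "compact ?K" "?K \<subseteq> \<Omega>" using assms by (auto simp: test_functions_def)
  have zero: "\<phi> x = 0" if "x \<notin> ?K" for x
    using that closure_subset[of "{x. \<phi> x \<noteq> 0}"] by auto
  have "pdiff h \<phi> x = 0" if x: "x \<notin> ?K" for x h
  proof -
    have "(\<phi> has_derivative (\<lambda>v. 0)) (at x)"
    proof (rule has_derivative_transform_within_open)
      show "((\<lambda>x. 0) has_derivative (\<lambda>v. 0)) (at x)" by (rule has_derivative_const)
      show "open (- ?K)" by (rule open_Compl[OF closed_closure])
      show "x \<in> - ?K" using x by simp
      show "0 = \<phi> y" if "y \<in> - ?K" for y using zero[of y] that by simp
    qed
    then show ?thesis by (rule pdiff_eqI)
  qed
  moreover have "continuous_on UNIV (fold pdiff hs \<phi>)" for hs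
    using smooth differentiable_imp_continuous_on unfolding smooth_def by blast
  from this[of "[]"] this[of "[_]"] have "continuous_on UNIV \<phi>" "continuous_on UNIV (pdiff h \<phi>)" for h by simp_all
  ultimately show ?thesis by (intro that[OF K zero])
qed

lemma
  fixes u :: "'a::euclidean_space \<Rightarrow> 'b::euclidean_space" and \<psi> :: "'a \<Rightarrow> real"
  assumes \<Omega>: "\<Omega> \<in> sets lebesgue" and u: "u \<in> L1_loc \<Omega>" and \<psi>: "continuous_on UNIV \<psi>"
    and K: "compact K" "K \<subseteq> \<Omega>" "\<And>x. x \<notin> K \<Longrightarrow> \<psi> x = 0"
  shows integrable_test_mult: "integrable (lebesgue_on \<Omega>) (\<lambda>x. \<psi> x *\<^sub>R u x)"
    and integrable_test_mult_compact: "integrable (lebesgue_on K) (\<lambda>x. \<psi> x *\<^sub>R u x)"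
    and integral_test_mult: "(\<integral>x. \<psi> x *\<^sub>R u x \<partial>lebesgue_on \<Omega>) = (\<integral>x. \<psi> x *\<^sub>R u x \<partial>lebesgue_on K)"
proof -
  have Km: "K \<in> sets lebesgue" by (rule compact_sets_lebesgue[OF K(1)])
  have uK: "integrable (lebesgue_on K) u" using u K by (simp add: L1_loc_def)
  obtain C where C: "\<And>x. x \<in> K \<Longrightarrow> \<bar>\<psi> x\<bar> \<le> C"
    using compact_imp_bounded[OF compact_continuous_image[OF continuous_on_subset[OF \<psi>] K(1)]]
    unfolding bounded_iff by auto
  have \<psi>m: "\<psi> \<in> borel_measurable (lebesgue_on K)"
    by (intro measurable_restrict_space1 measurable_completion) (simp add: borel_measurable_continuous_onI[OF \<psi>])
  show *: "integrable (lebesgue_on K) (\<lambda>x. \<psi> x *\<^sub>R u x)"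
  proof (rule Bochner_Integration.integrable_bound[where f="\<lambda>x. C *\<^sub>R u x"])
    have "norm (\<psi> x *\<^sub>R u x) \<le> norm (C *\<^sub>R u x)" if "x \<in> K" for x
      using C[OF that] by (auto intro!: mult_right_mono)
    then show "AE x in lebesgue_on K. norm (\<psi> x *\<^sub>R u x) \<le> norm (C *\<^sub>R u x)"
      by (intro AE_I2) (simp add: space_restrict_space)
  qed (use uK \<psi>m in auto)
  have eq: "(\<lambda>x. indicator \<Omega> x *\<^sub>R (\<psi> x *\<^sub>R u x)) = (\<lambda>x. indicator K x *\<^sub>R (\<psi> x *\<^sub>R u x))"
    using K by (intro ext) (auto simp: indicator_def)
  have iff: "integrable (lebesgue_on S) f \<longleftrightarrow> integrable lebesgue (\<lambda>x. indicator S x *\<^sub>R f x)"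
    "(\<integral>x. f x \<partial>lebesgue_on S) = (\<integral>x. indicator S x *\<^sub>R f x \<partial>lebesgue)"
    if "S \<in> sets lebesgue" for S and f :: "'a \<Rightarrow> 'b"
    using that by (auto intro!: integrable_restrict_space integral_restrict_space)
  show "integrable (lebesgue_on \<Omega>) (\<lambda>x. \<psi> x *\<^sub>R u x)"
    using * unfolding iff[OF \<Omega>] iff[OF Km] eq .
  show "(\<integral>x. \<psi> x *\<^sub>R u x \<partial>lebesgue_on \<Omega>) = (\<integral>x. \<psi> x *\<^sub>R u x \<partial>lebesgue_on K)"
    unfolding iff[OF \<Omega>] iff[OF Km] eq ..
qed

section \<open>Calculus of weak derivatives\<close>

lemma L1_loc_add: "f \<in> L1_loc \<Omega> \<Longrightarrow> g \<in> L1_loc \<Omega> \<Longrightarrow> (\<lambda>x. f x + g x) \<in> L1_loc \<Omega>"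
  by (auto simp: L1_loc_def)

lemma L1_loc_bounded_linear: "bounded_linear T \<Longrightarrow> f \<in> L1_loc \<Omega> \<Longrightarrow> (\<lambda>x. T (f x)) \<in> L1_loc \<Omega>"
  by (auto simp: L1_loc_def intro: integrable_bounded_linear)

lemma has_weak_pdiff_add:
  assumes \<Omega>: "open \<Omega>" and "has_weak_pdiff \<Omega> h u g" "has_weak_pdiff \<Omega> h v k"
  shows "has_weak_pdiff \<Omega> h (\<lambda>x. u x + v x) (\<lambda>x. g x + k x)"
  unfolding has_weak_pdiff_def
proof (intro conjI allI impI)
  show "(\<lambda>x. u x + v x) \<in> L1_loc \<Omega>" "(\<lambda>x. g x + k x) \<in> L1_loc \<Omega>"
    using assms by (auto simp: has_weak_pdiff_def intro: L1_loc_add)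
  fix \<phi> :: "real^'a \<Rightarrow> real" assume \<phi>: "\<phi> \<in> test_functions \<Omega>"
  obtain K where K: "compact K" "K \<subseteq> \<Omega>" "\<And>x. x \<notin> K \<Longrightarrow> \<phi> x = 0" "\<And>x h. x \<notin> K \<Longrightarrow> pdiff h \<phi> x = 0"
    "continuous_on UNIV \<phi>" "\<And>h. continuous_on UNIV (pdiff h \<phi>)"
    by (rule test_function_support[OF \<phi>], rule that)
  have int: "integrable (lebesgue_on \<Omega>) (\<lambda>x. \<phi> x *\<^sub>R w x)" "integrable (lebesgue_on \<Omega>) (\<lambda>x. pdiff h \<phi> x *\<^sub>R w x)"
    if "w \<in> L1_loc \<Omega>" for w :: "real^'a \<Rightarrow> 'b"
    using \<Omega> K that by (auto intro!: integrable_test_mult[of \<Omega> w _ K])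
  have 1: "(\<integral>x. pdiff h \<phi> x *\<^sub>R u x \<partial>lebesgue_on \<Omega>) = - (\<integral>x. \<phi> x *\<^sub>R g x \<partial>lebesgue_on \<Omega>)"
    "(\<integral>x. pdiff h \<phi> x *\<^sub>R v x \<partial>lebesgue_on \<Omega>) = - (\<integral>x. \<phi> x *\<^sub>R k x \<partial>lebesgue_on \<Omega>)"
    "u \<in> L1_loc \<Omega>" "v \<in> L1_loc \<Omega>" "g \<in> L1_loc \<Omega>" "k \<in> L1_loc \<Omega>"
    using assms \<phi> by (auto simp: has_weak_pdiff_def)
  show "(\<integral>x. pdiff h \<phi> x *\<^sub>R (u x + v x) \<partial>lebesgue_on \<Omega>) = - (\<integral>x. \<phi> x *\<^sub>R (g x + k x) \<partial>lebesgue_on \<Omega>)"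
    using 1 by (simp add: scaleR_add_right int)
qed

lemma has_weak_pdiff_bounded_linear:
  assumes \<Omega>: "open \<Omega>" and T: "bounded_linear T" and "has_weak_pdiff \<Omega> h u g"
  shows "has_weak_pdiff \<Omega> h (\<lambda>x. T (u x)) (\<lambda>x. T (g x))"
  unfolding has_weak_pdiff_def
proof (intro conjI allI impI)
  show "(\<lambda>x. T (u x)) \<in> L1_loc \<Omega>" "(\<lambda>x. T (g x)) \<in> L1_loc \<Omega>"
    using assms by (auto simp: has_weak_pdiff_def intro: L1_loc_bounded_linear)
  fix \<phi> :: "real^'a \<Rightarrow> real" assume \<phi>: "\<phi> \<in> test_functions \<Omega>"
  obtain K where K: "compact K" "K \<subseteq> \<Omega>" "\<And>x. x \<notin> K \<Longrightarrow> \<phi> x = 0" "\<And>x h. x \<notin> K \<Longrightarrow> pdiff h \<phi> x = 0"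
    "continuous_on UNIV \<phi>" "\<And>h. continuous_on UNIV (pdiff h \<phi>)"
    by (rule test_function_support[OF \<phi>], rule that)
  have 1: "(\<integral>x. pdiff h \<phi> x *\<^sub>R u x \<partial>lebesgue_on \<Omega>) = - (\<integral>x. \<phi> x *\<^sub>R g x \<partial>lebesgue_on \<Omega>)"
    "u \<in> L1_loc \<Omega>" "g \<in> L1_loc \<Omega>"
    using assms \<phi> by (auto simp: has_weak_pdiff_def)
  have int: "integrable (lebesgue_on \<Omega>) (\<lambda>x. \<phi> x *\<^sub>R g x)" "integrable (lebesgue_on \<Omega>) (\<lambda>x. pdiff h \<phi> x *\<^sub>R u x)"
    using \<Omega> K 1 by (auto intro!: integrable_test_mult[of \<Omega> _ _ K])
  have lin: "linear T" by (rule bounded_linear.linear[OF T])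
  show "(\<integral>x. pdiff h \<phi> x *\<^sub>R T (u x) \<partial>lebesgue_on \<Omega>) = - (\<integral>x. \<phi> x *\<^sub>R T (g x) \<partial>lebesgue_on \<Omega>)"
    using integral_bounded_linear[OF T int(1)] integral_bounded_linear[OF T int(2)] 1(1)
    by (simp add: linear_scale[OF lin] linear_neg[OF lin])
qed

lemma has_weak_pdiff_unique:
  assumes \<Omega>: "open \<Omega>" and "has_weak_pdiff \<Omega> h u g" "has_weak_pdiff \<Omega> h u k"
  shows "AE x in lebesgue_on \<Omega>. g x = k x"
proof -
  have gk: "g \<in> L1_loc \<Omega>" "k \<in> L1_loc \<Omega>" using assms by (auto simp: has_weak_pdiff_def)
  have "AE x in lebesgue_on \<Omega>. g x - k x = 0"
  proof (rule test_functions_separate_L1_loc[OF \<Omega>])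
    show "(\<lambda>x. g x - k x) \<in> L1_loc \<Omega>" using gk by (auto simp: L1_loc_def)
    fix a b n assume ab: "cbox a b \<subseteq> \<Omega>"
    let ?\<phi> = "box_plateau a b n"
    have \<phi>: "?\<phi> \<in> test_functions \<Omega>" by (rule test_function_box_plateau[OF ab])
    obtain K where K: "compact K" "K \<subseteq> \<Omega>" "\<And>x. x \<notin> K \<Longrightarrow> ?\<phi> x = 0" "\<And>x h. x \<notin> K \<Longrightarrow> pdiff h ?\<phi> x = 0"
      "continuous_on UNIV ?\<phi>" "\<And>h. continuous_on UNIV (pdiff h ?\<phi>)"
      by (rule test_function_support[OF \<phi>], rule that)
    have "integrable (lebesgue_on \<Omega>) (\<lambda>x. ?\<phi> x *\<^sub>R g x)" "integrable (lebesgue_on \<Omega>) (\<lambda>x. ?\<phi> x *\<^sub>R k x)"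
      using \<Omega> K gk by (auto intro!: integrable_test_mult[of \<Omega> _ _ K])
    moreover have "(\<integral>x. ?\<phi> x *\<^sub>R g x \<partial>lebesgue_on \<Omega>) = (\<integral>x. ?\<phi> x *\<^sub>R k x \<partial>lebesgue_on \<Omega>)"
      using assms \<phi> by (auto simp: has_weak_pdiff_def)
    ultimately show "(\<integral>x. ?\<phi> x *\<^sub>R (g x - k x) \<partial>lebesgue_on \<Omega>) = 0"
      by (simp add: scaleR_diff_right)
  qed
  then show ?thesis by eventually_elim simp
qed

lemma L1_loc_AE_cong:
  fixes f g :: "'a::euclidean_space \<Rightarrow> 'b::euclidean_space"
  assumes \<Omega>: "\<Omega> \<in> sets lebesgue" and f: "f \<in> L1_loc \<Omega>" and eq: "AE x in lebesgue_on \<Omega>. f x = g x"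
  shows "g \<in> L1_loc \<Omega>"
  unfolding L1_loc_def
proof (intro CollectI allI impI)
  fix K assume K: "compact K \<and> K \<subseteq> \<Omega>"
  have fK: "integrable (lebesgue_on K) f" using f K by (simp add: L1_loc_def)
  have Km: "K \<in> sets lebesgue" using compact_sets_lebesgue K by blast
  have e: "AE x in lebesgue_on K. f x = g x" using AE_lebesgue_on_subset[OF _ Km \<Omega> eq] K by blast
  have "g \<in> borel_measurable (lebesgue_on K)"
    by (rule measurable_lebesgue_on_AE[OF Km borel_measurable_integrable[OF fK] e])
  then show "integrable (lebesgue_on K) g"
    by (rule integrable_cong_AE_imp[OF fK _ e])
qed

lemma has_weak_pdiff_AE_cong:
  assumes \<Omega>: "open \<Omega>" and u: "AE x in lebesgue_on \<Omega>. u x = u' x" and w: "has_weak_pdiff \<Omega> h u g"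
  shows "has_weak_pdiff \<Omega> h u' g"
  unfolding has_weak_pdiff_def
proof (intro conjI allI impI)
  have \<Omega>m: "\<Omega> \<in> sets lebesgue" using \<Omega> by simp
  have uL: "u \<in> L1_loc \<Omega>" using w by (simp add: has_weak_pdiff_def)
  show u': "u' \<in> L1_loc \<Omega>" by (rule L1_loc_AE_cong[OF \<Omega>m uL u])
  show "g \<in> L1_loc \<Omega>" using w by (simp add: has_weak_pdiff_def)
  fix \<phi> :: "real^'a \<Rightarrow> real" assume \<phi>: "\<phi> \<in> test_functions \<Omega>"
  obtain K where K: "compact K" "K \<subseteq> \<Omega>" "\<And>x. x \<notin> K \<Longrightarrow> \<phi> x = 0" "\<And>x h. x \<notin> K \<Longrightarrow> pdiff h \<phi> x = 0"
    "continuous_on UNIV \<phi>" "\<And>h. continuous_on UNIV (pdiff h \<phi>)"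
    by (rule test_function_support[OF \<phi>], rule that)
  have "integrable (lebesgue_on \<Omega>) (\<lambda>x. pdiff h \<phi> x *\<^sub>R u x)" "integrable (lebesgue_on \<Omega>) (\<lambda>x. pdiff h \<phi> x *\<^sub>R u' x)"
    using \<Omega>m K uL u' by (auto intro!: integrable_test_mult[of \<Omega> _ _ K])
  then have "(\<integral>x. pdiff h \<phi> x *\<^sub>R u' x \<partial>lebesgue_on \<Omega>) = (\<integral>x. pdiff h \<phi> x *\<^sub>R u x \<partial>lebesgue_on \<Omega>)"
    by (intro integral_cong_AE) (use u in \<open>auto elim: eventually_mono\<close>)
  then show "(\<integral>x. pdiff h \<phi> x *\<^sub>R u' x \<partial>lebesgue_on \<Omega>) = - (\<integral>x. \<phi> x *\<^sub>R g x \<partial>lebesgue_on \<Omega>)"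
    using w \<phi> by (simp add: has_weak_pdiff_def)
qed

text \<open>The identity for a fixed test function involves u and g on its compact support only, so
  L1 convergence on compact sets passes to the limit. No more is available for gradients, since the
  ellipticity of Q may degenerate towards the boundary of \<Omega>.\<close>

lemma has_weak_pdiff_limit:
  assumes \<Omega>: "open \<Omega>" and w: "\<And>n. has_weak_pdiff \<Omega> h (us n) (gs n)" and u: "u \<in> L1_loc \<Omega>" and g: "g \<in> L1_loc \<Omega>"
    and us: "\<And>K. compact K \<Longrightarrow> K \<subseteq> \<Omega> \<Longrightarrow> (\<lambda>n. \<integral>x. norm (us n x - u x) \<partial>lebesgue_on K) \<longlonglongrightarrow> 0"
    and gs: "\<And>K. compact K \<Longrightarrow> K \<subseteq> \<Omega> \<Longrightarrow> (\<lambda>n. \<integral>x. norm (gs n x - g x) \<partial>lebesgue_on K) \<longlonglongrightarrow> 0"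
  shows "has_weak_pdiff \<Omega> h u g"
  unfolding has_weak_pdiff_def
proof (intro conjI allI impI u g)
  have \<Omega>m: "\<Omega> \<in> sets lebesgue" using \<Omega> by simp
  have L: "us n \<in> L1_loc \<Omega>" "gs n \<in> L1_loc \<Omega>" for n using w[of n] by (auto simp: has_weak_pdiff_def)
  fix \<phi> :: "real^'a \<Rightarrow> real" assume \<phi>: "\<phi> \<in> test_functions \<Omega>"
  obtain K where K: "compact K" "K \<subseteq> \<Omega>" "\<And>x. x \<notin> K \<Longrightarrow> \<phi> x = 0" "\<And>x h. x \<notin> K \<Longrightarrow> pdiff h \<phi> x = 0"
    "continuous_on UNIV \<phi>" "\<And>h. continuous_on UNIV (pdiff h \<phi>)"
    by (rule test_function_support[OF \<phi>], rule that)
  have lim: "(\<lambda>n. \<integral>x. \<psi> x *\<^sub>R fs n x \<partial>lebesgue_on \<Omega>) \<longlonglongrightarrow> (\<integral>x. \<psi> x *\<^sub>R f x \<partial>lebesgue_on \<Omega>)"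
    if \<psi>: "continuous_on UNIV \<psi>" "\<And>x. x \<notin> K \<Longrightarrow> \<psi> x = 0" and f: "f \<in> L1_loc \<Omega>" "\<And>n. fs n \<in> L1_loc \<Omega>"
      and fs: "(\<lambda>n. \<integral>x. norm (fs n x - f x) \<partial>lebesgue_on K) \<longlonglongrightarrow> 0"
    for \<psi> and f :: "real^'a \<Rightarrow> 'b" and fs
  proof -
    obtain C where C: "C \<ge> 0" "\<And>x. x \<in> K \<Longrightarrow> \<bar>\<psi> x\<bar> \<le> C"
    proof -
      obtain C where "\<And>x. x \<in> K \<Longrightarrow> \<bar>\<psi> x\<bar> \<le> C"
        using compact_imp_bounded[OF compact_continuous_image[OF continuous_on_subset[OF \<psi>(1)] K(1)]]
        unfolding bounded_iff by auto
      then show ?thesis by (intro that[of "max C 0"]) (auto simp: le_max_iff_disj)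
    qed
    have int: "integrable (lebesgue_on K) (\<lambda>x. fs n x - f x)" for n
      using f K by (auto simp: L1_loc_def)
    have le: "\<forall>n. norm ((\<integral>x. \<psi> x *\<^sub>R fs n x \<partial>lebesgue_on \<Omega>) - (\<integral>x. \<psi> x *\<^sub>R f x \<partial>lebesgue_on \<Omega>))
        \<le> C * (\<integral>x. norm (fs n x - f x) \<partial>lebesgue_on K)"
    proof
      fix n
      have i: "integrable (lebesgue_on K) (\<lambda>x. \<psi> x *\<^sub>R fs n x)" "integrable (lebesgue_on K) (\<lambda>x. \<psi> x *\<^sub>R f x)"
        using \<Omega>m K(1,2) \<psi> f by (auto intro!: integrable_test_mult_compact[of \<Omega>])
      have "(\<integral>x. \<psi> x *\<^sub>R fs n x \<partial>lebesgue_on \<Omega>) - (\<integral>x. \<psi> x *\<^sub>R f x \<partial>lebesgue_on \<Omega>)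
          = (\<integral>x. \<psi> x *\<^sub>R (fs n x - f x) \<partial>lebesgue_on K)"
        using integral_test_mult[OF \<Omega>m f(1) \<psi>(1) K(1,2) \<psi>(2)] integral_test_mult[OF \<Omega>m f(2)[of n] \<psi>(1) K(1,2) \<psi>(2)] i
        by (simp add: scaleR_diff_right)
      also have "norm \<dots> \<le> (\<integral>x. norm (\<psi> x *\<^sub>R (fs n x - f x)) \<partial>lebesgue_on K)"
        by (rule Bochner_Integration.integral_norm_bound)
      also have "\<dots> \<le> (\<integral>x. C * norm (fs n x - f x) \<partial>lebesgue_on K)"
      proof (rule integral_mono)
        show "integrable (lebesgue_on K) (\<lambda>x. norm (\<psi> x *\<^sub>R (fs n x - f x)))"
          using Bochner_Integration.integrable_diff[OF i] by (intro integrable_norm) (simp add: scaleR_diff_right)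
        show "integrable (lebesgue_on K) (\<lambda>x. C * norm (fs n x - f x))" using int by simp
        show "norm (\<psi> x *\<^sub>R (fs n x - f x)) \<le> C * norm (fs n x - f x)" if "x \<in> space (lebesgue_on K)" for x
          using C(2)[of x] that by (auto simp: space_restrict_space intro!: mult_right_mono)
      qed
      finally show "norm ((\<integral>x. \<psi> x *\<^sub>R fs n x \<partial>lebesgue_on \<Omega>) - (\<integral>x. \<psi> x *\<^sub>R f x \<partial>lebesgue_on \<Omega>))
        \<le> C * (\<integral>x. norm (fs n x - f x) \<partial>lebesgue_on K)" by simp
    qed
    have "(\<lambda>n. C * (\<integral>x. norm (fs n x - f x) \<partial>lebesgue_on K)) \<longlonglongrightarrow> 0"
      by (rule tendsto_mult_right_zero[OF fs])
    from Lim_null_comparison[OF always_eventually[OF le] this] show ?thesis by (rule LIM_zero_cancel)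
  qed
  have "(\<lambda>n. - (\<integral>x. \<phi> x *\<^sub>R gs n x \<partial>lebesgue_on \<Omega>)) \<longlonglongrightarrow> - (\<integral>x. \<phi> x *\<^sub>R g x \<partial>lebesgue_on \<Omega>)"
    by (intro tendsto_minus lim K g L gs)
  moreover have "(\<lambda>n. \<integral>x. pdiff h \<phi> x *\<^sub>R us n x \<partial>lebesgue_on \<Omega>) \<longlonglongrightarrow> (\<integral>x. pdiff h \<phi> x *\<^sub>R u x \<partial>lebesgue_on \<Omega>)"
    by (intro lim K u L us)
  moreover have "(\<integral>x. pdiff h \<phi> x *\<^sub>R us n x \<partial>lebesgue_on \<Omega>) = - (\<integral>x. \<phi> x *\<^sub>R gs n x \<partial>lebesgue_on \<Omega>)" for n
    using w[of n] \<phi> by (simp add: has_weak_pdiff_def)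
  ultimately show "(\<integral>x. pdiff h \<phi> x *\<^sub>R u x \<partial>lebesgue_on \<Omega>) = - (\<integral>x. \<phi> x *\<^sub>R g x \<partial>lebesgue_on \<Omega>)"
    using LIMSEQ_unique by simp
qed

lemma has_weak_pdiff_wpdiff:
  assumes "u \<in> W12_loc \<Omega>"
  shows "has_weak_pdiff \<Omega> h u (wpdiff \<Omega> h u)"
proof -
  have "\<exists>g. has_weak_pdiff \<Omega> h u g" using assms unfolding W12_loc_def by blast
  then show ?thesis unfolding wpdiff_def by (rule someI_ex)
qed

lemma wpdiff_measurable:
  assumes "open \<Omega>" "u \<in> W12_loc \<Omega>"
  shows "wpdiff \<Omega> h u \<in> borel_measurable (lebesgue_on \<Omega>)"
  using has_weak_pdiff_wpdiff[OF assms(2), of h] L1_loc_measurable[OF assms(1)] unfolding has_weak_pdiff_def by blast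

lemma wpdiff_AE_eqI:
  assumes "open \<Omega>" "u \<in> W12_loc \<Omega>" "has_weak_pdiff \<Omega> h u g"
  shows "AE x in lebesgue_on \<Omega>. wpdiff \<Omega> h u x = g x"
  using has_weak_pdiff_unique[OF assms(1) has_weak_pdiff_wpdiff[OF assms(2)] assms(3)] .

section \<open>Local Sobolev functions and their chosen derivatives\<close>

lemma L2_loc_add: "f \<in> L2_loc \<Omega> \<Longrightarrow> g \<in> L2_loc \<Omega> \<Longrightarrow> (\<lambda>x. f x + g x) \<in> L2_loc \<Omega>"
  unfolding L2_loc_def L2_iff by (blast intro: square_integrable_add)

lemma L2_loc_bounded_linear: "bounded_linear T \<Longrightarrow> f \<in> L2_loc \<Omega> \<Longrightarrow> (\<lambda>x. T (f x)) \<in> L2_loc \<Omega>"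
  unfolding L2_loc_def L2_iff by (blast intro: square_integrable_bounded_linear)

lemma W12_loc_add:
  assumes "open \<Omega>" "u \<in> W12_loc \<Omega>" "v \<in> W12_loc \<Omega>"
  shows "(\<lambda>x. u x + v x) \<in> W12_loc \<Omega>"
proof -
  have "\<exists>g. g \<in> L2_loc \<Omega> \<and> has_weak_pdiff \<Omega> h (\<lambda>x. u x + v x) g" for h
  proof -
    obtain g where g: "g \<in> L2_loc \<Omega>" "has_weak_pdiff \<Omega> h u g"
      using assms(2) unfolding W12_loc_def by blast
    obtain k where k: "k \<in> L2_loc \<Omega>" "has_weak_pdiff \<Omega> h v k"
      using assms(3) unfolding W12_loc_def by blast
    from L2_loc_add[OF g(1) k(1)] has_weak_pdiff_add[OF assms(1) g(2) k(2)] show ?thesis by blast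
  qed
  moreover have "(\<lambda>x. u x + v x) \<in> L2_loc \<Omega>"
    using assms(2,3) L2_loc_add unfolding W12_loc_def by blast
  ultimately show ?thesis unfolding W12_loc_def by blast
qed

lemma W12_loc_bounded_linear:
  assumes "open \<Omega>" "bounded_linear T" "u \<in> W12_loc \<Omega>"
  shows "(\<lambda>x. T (u x)) \<in> W12_loc \<Omega>"
proof -
  have "\<exists>g. g \<in> L2_loc \<Omega> \<and> has_weak_pdiff \<Omega> h (\<lambda>x. T (u x)) g" for h
  proof -
    obtain g where "g \<in> L2_loc \<Omega>" "has_weak_pdiff \<Omega> h u g"
      using assms(3) unfolding W12_loc_def by blast
    then have "(\<lambda>x. T (g x)) \<in> L2_loc \<Omega> \<and> has_weak_pdiff \<Omega> h (\<lambda>x. T (u x)) (\<lambda>x. T (g x))"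
      using L2_loc_bounded_linear[OF assms(2)] has_weak_pdiff_bounded_linear[OF assms(1,2)] by blast
    then show ?thesis by blast
  qed
  moreover have "(\<lambda>x. T (u x)) \<in> L2_loc \<Omega>"
    using L2_loc_bounded_linear[OF assms(2)] assms(3) unfolding W12_loc_def by blast
  ultimately show ?thesis unfolding W12_loc_def by blast
qed

lemma wpdiff_add:
  assumes "open \<Omega>" "u \<in> W12_loc \<Omega>" "v \<in> W12_loc \<Omega>"
  shows "AE x in lebesgue_on \<Omega>. wpdiff \<Omega> h (\<lambda>x. u x + v x) x = wpdiff \<Omega> h u x + wpdiff \<Omega> h v x"
  by (rule wpdiff_AE_eqI[OF assms(1) W12_loc_add[OF assms]
        has_weak_pdiff_add[OF assms(1) has_weak_pdiff_wpdiff[OF assms(2)] has_weak_pdiff_wpdiff[OF assms(3)]]])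

lemma wpdiff_bounded_linear:
  assumes "open \<Omega>" "bounded_linear T" "u \<in> W12_loc \<Omega>"
  shows "AE x in lebesgue_on \<Omega>. wpdiff \<Omega> h (\<lambda>x. T (u x)) x = T (wpdiff \<Omega> h u x)"
  by (rule wpdiff_AE_eqI[OF assms(1) W12_loc_bounded_linear[OF assms]
        has_weak_pdiff_bounded_linear[OF assms(1,2) has_weak_pdiff_wpdiff[OF assms(3)]]])

lemma W12_loc_AE_cong:
  assumes \<Omega>: "open \<Omega>" and u: "u \<in> W12_loc \<Omega>" and eq: "AE x in lebesgue_on \<Omega>. u x = u' x"
  shows "u' \<in> W12_loc \<Omega>"
proof -
  have \<Omega>m: "\<Omega> \<in> sets lebesgue" using \<Omega> by simp
  have "u' \<in> L2_loc \<Omega>"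
    unfolding L2_loc_def
  proof (intro CollectI allI impI)
    fix K assume K: "compact K \<and> K \<subseteq> \<Omega>"
    have Km: "K \<in> sets lebesgue" using compact_sets_lebesgue K by blast
    have uK: "square_integrable (lebesgue_on K) u" using u K by (auto simp: W12_loc_def L2_loc_def L2_iff)
    have e: "AE x in lebesgue_on K. u x = u' x" using AE_lebesgue_on_subset[OF _ Km \<Omega>m eq] K by blast
    have "u' \<in> borel_measurable (lebesgue_on K)"
      using measurable_lebesgue_on_AE[OF Km _ e] uK by (auto simp: square_integrable_def)
    then show "u' \<in> L2 K" unfolding L2_iff by (rule square_integrable_AE_cong[OF uK e])
  qed
  moreover have "\<exists>g. g \<in> L2_loc \<Omega> \<and> has_weak_pdiff \<Omega> h u' g" for h
    using u has_weak_pdiff_AE_cong[OF \<Omega> eq] unfolding W12_loc_def by blast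
  ultimately show ?thesis unfolding W12_loc_def by blast
qed

section \<open>Pointwise coercivity\<close>

text \<open>The integrand of the form at a point sees only the derivatives and the value of u there.
  Treating these as independent vectors turns every estimate of the form into algebra in finite
  dimension.\<close>

type_synonym ('d, 'm) jet = "('d \<Rightarrow> complex^'m) \<times> (complex^'m)"

definition jet_add :: "('d, 'm::finite) jet \<Rightarrow> ('d, 'm) jet \<Rightarrow> ('d, 'm) jet" where
  "jet_add p q = ((\<lambda>h. fst p h + fst q h), snd p + snd q)"

definition jet_scale :: "complex \<Rightarrow> ('d, 'm::finite) jet \<Rightarrow> ('d, 'm) jet" where
  "jet_scale c p = ((\<lambda>h. c *s fst p h), c *s snd p)"

definition jet_form :: "real^'d^'d \<Rightarrow> ('d \<Rightarrow> 'd \<Rightarrow> real^'m^'m) \<Rightarrow> ('d \<Rightarrow> real^'m^'m) \<Rightarrow> ('d \<Rightarrow> real^'m^'m) \<Rightarrow>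
    real^'m^'m \<Rightarrow> real^'m^'m \<Rightarrow> ('d, 'm) jet \<Rightarrow> ('d, 'm) jet \<Rightarrow> complex" where
  "jet_form Q A B C V W p q =
     (\<Sum>h\<in>UNIV. \<Sum>k\<in>UNIV. cinner (cmat (mat (Q $ h $ k) + A h k) *v fst p k) (fst q h))
     + (\<Sum>h\<in>UNIV. cinner (cmat (B h) *v fst p h) (snd q) + cinner (cmat (C h) *v snd p) (fst q h))
     + cinner (cmat (V + W) *v snd p) (snd q)"

definition jet_gradient :: "('d, 'm::finite) jet \<Rightarrow> 'm \<Rightarrow> complex^'d" where
  "jet_gradient p i = (\<chi> h. fst p h $ i)"

definition jet_energy :: "real^'d^'d \<Rightarrow> real^'m^'m \<Rightarrow> ('d, 'm) jet \<Rightarrow> ('d, 'm) jet \<Rightarrow> complex" where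
  "jet_energy Q V p q = (\<Sum>i\<in>UNIV. cinner (cmat Q *v jet_gradient p i) (jet_gradient q i))
     + cinner (cmat (sym_part V) *v snd p) (snd q)"

lemma jet_form_sesquilinear:
  "jet_form Q A B C V W (jet_add p q) r = jet_form Q A B C V W p r + jet_form Q A B C V W q r"
  "jet_form Q A B C V W r (jet_add p q) = jet_form Q A B C V W r p + jet_form Q A B C V W r q"
  "jet_form Q A B C V W (jet_scale c p) q = c * jet_form Q A B C V W p q"
  "jet_form Q A B C V W p (jet_scale c q) = cnj c * jet_form Q A B C V W p q"
proof -
  note s = jet_form_def jet_add_def jet_scale_def
  show "jet_form Q A B C V W (jet_add p q) r = jet_form Q A B C V W p r + jet_form Q A B C V W q r"
    by (simp add: s cmat_vec_add cinner_add_left sum.distrib)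
  show "jet_form Q A B C V W r (jet_add p q) = jet_form Q A B C V W r p + jet_form Q A B C V W r q"
    by (simp add: s cinner_add_right sum.distrib)
  show "jet_form Q A B C V W (jet_scale c p) q = c * jet_form Q A B C V W p q"
    by (simp add: s cmat_scale cinner_scale_left sum_distrib_left distrib_left)
  show "jet_form Q A B C V W p (jet_scale c q) = cnj c * jet_form Q A B C V W p q"
    by (simp add: s cinner_scale_right sum_distrib_left distrib_left)
qed

lemma jet_energy_sesquilinear:
  "jet_energy Q V (jet_add p q) r = jet_energy Q V p r + jet_energy Q V q r"
  "jet_energy Q V r (jet_add p q) = jet_energy Q V r p + jet_energy Q V r q"
  "jet_energy Q V (jet_scale c p) q = c * jet_energy Q V p q"
  "jet_energy Q V p (jet_scale c q) = cnj c * jet_energy Q V p q"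
proof -
  have g: "jet_gradient (jet_add p q) i = jet_gradient p i + jet_gradient q i"
    "jet_gradient (jet_scale c p) i = c *s jet_gradient p i" for p q c i
    by (simp_all add: jet_gradient_def jet_add_def jet_scale_def vec_eq_iff)
  have s: "snd (jet_add p q) = snd p + snd q" "snd (jet_scale c p) = c *s snd p" for p q :: "('a, 'b) jet" and c
    by (simp_all add: jet_add_def jet_scale_def)
  show "jet_energy Q V (jet_add p q) r = jet_energy Q V p r + jet_energy Q V q r"
    "jet_energy Q V r (jet_add p q) = jet_energy Q V r p + jet_energy Q V r q"
    "jet_energy Q V (jet_scale c p) q = c * jet_energy Q V p q"
    "jet_energy Q V p (jet_scale c q) = cnj c * jet_energy Q V p q"
    by (simp_all add: jet_energy_def g s cmat_vec_add cmat_scale cinner_add_left cinner_add_right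
        cinner_scale_left cinner_scale_right sum.distrib sum_distrib_left distrib_left)
qed

lemma qform_eq_gradients: "qform Q (fst p) = (\<Sum>i\<in>UNIV. cinner (cmat Q *v jet_gradient p i) (jet_gradient p i))"
  by (simp add: qform_def cinner_def cmat_vec_nth jet_gradient_def sum_distrib_right)

lemma cinner_self: "cinner x x = complex_of_real ((norm x)\<^sup>2)"
proof -
  have "cinner x x = cnj (cinner x x)" by (simp add: cinner_def mult.commute)
  then have "Im (cinner x x) = 0" by (metis complex_cnj_cancel_iff cnj.sel(2) neg_equal_zero)
  then show ?thesis by (simp add: complex_eq_iff Re_cinner power2_norm_eq_inner)
qed

locale coefficients_at_point =
  fixes Q :: "real^'d^'d" and A :: "'d \<Rightarrow> 'd \<Rightarrow> real^'m^'m" and B C :: "'d \<Rightarrow> real^'m^'m" and V W :: "real^'m^'m"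
    and v\<^sub>0 c\<^sub>0 \<kappa>\<^sub>A \<kappa>\<^sub>B \<kappa>\<^sub>C \<kappa>\<^sub>W \<gamma> C\<^sub>\<gamma> :: real
  assumes Q_sym: "transpose Q = Q" and Q_pos: "0 < min_eigenvalue Q"
    and v0: "0 < v\<^sub>0" "v\<^sub>0 \<le> min_eigenvalue (sym_part V)"
    and V_sector: "\<And>\<xi>. \<bar>Im (cinner (cmat V *v \<xi>) \<xi>)\<bar> \<le> c\<^sub>0 * Re (cinner (cmat V *v \<xi>) \<xi>)"
    and A_Re: "\<And>\<theta> :: 'd \<Rightarrow> complex^'m. 0 \<le> Re (\<Sum>h\<in>UNIV. \<Sum>k\<in>UNIV. cinner (cmat (A h k) *v \<theta> k) (\<theta> h)) \<and>
          Re (\<Sum>h\<in>UNIV. \<Sum>k\<in>UNIV. cinner (cmat (A h k) *v \<theta> k) (\<theta> h)) \<le> \<kappa>\<^sub>A * Re (qform Q \<theta>)"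
    and A_Im: "\<And>\<theta> :: 'd \<Rightarrow> complex^'m. \<bar>Im (\<Sum>h\<in>UNIV. \<Sum>k\<in>UNIV. cinner (cmat (A h k) *v \<theta> k) (\<theta> h))\<bar> \<le> \<kappa>\<^sub>A * Re (qform Q \<theta>)"
    and B_bound: "\<And>\<theta> \<eta>. cmod (\<Sum>h\<in>UNIV. cinner (cmat (B h) *v \<theta> h) \<eta>) \<le> \<kappa>\<^sub>B * sqrt (Re (qform Q \<theta>))
               * sqrt (\<gamma> * Re (cinner (cmat (sym_part V) *v \<eta>) \<eta>) + C\<^sub>\<gamma> * (norm \<eta>)\<^sup>2)"
    and C_bound: "\<And>\<theta> \<eta>. cmod (\<Sum>h\<in>UNIV. cinner (cmat (C h) *v \<eta>) (\<theta> h)) \<le> \<kappa>\<^sub>C * sqrt (Re (qform Q \<theta>))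
               * sqrt (\<gamma> * Re (cinner (cmat (sym_part V) *v \<eta>) \<eta>) + C\<^sub>\<gamma> * (norm \<eta>)\<^sup>2)"
    and W_bound: "\<And>\<xi> \<eta>. cmod (cinner (cmat W *v \<xi>) \<eta>)
            \<le> \<kappa>\<^sub>W * sqrt (\<gamma> * Re (cinner (cmat (sym_part V) *v \<xi>) \<xi>) + C\<^sub>\<gamma> * (norm \<xi>)\<^sup>2)
               * sqrt (\<gamma> * Re (cinner (cmat (sym_part V) *v \<eta>) \<eta>) + C\<^sub>\<gamma> * (norm \<eta>)\<^sup>2)"
    and const_signs: "0 < c\<^sub>0" "0 < \<kappa>\<^sub>A" "0 \<le> \<kappa>\<^sub>B" "0 \<le> \<kappa>\<^sub>C" "0 \<le> \<kappa>\<^sub>W" "0 < \<gamma>" "0 < C\<^sub>\<gamma>"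
    and K_pos: "4 * (1 / \<gamma> - \<kappa>\<^sub>W) - (\<kappa>\<^sub>B + \<kappa>\<^sub>C)\<^sup>2 > 0"

text \<open>A sum of crude bounds. With c = \<open>\<gamma> + C\<^sub>\<gamma> / v\<^sub>0\<close>,
  P <= c v and sqrt(q P) <= q + c v, it collects the coefficients of q and of v and adds them
  instead of taking their maximum; the 3 contains slack that keeps it positive.\<close>

definition form_bound :: "real \<Rightarrow> real \<Rightarrow> real \<Rightarrow> real \<Rightarrow> real \<Rightarrow> real \<Rightarrow> real \<Rightarrow> real \<Rightarrow> real" where
  "form_bound v\<^sub>0 c\<^sub>0 \<kappa>\<^sub>A \<kappa>\<^sub>B \<kappa>\<^sub>C \<kappa>\<^sub>W \<gamma> C\<^sub>\<gamma> =
     3 + 2 * \<kappa>\<^sub>A + \<kappa>\<^sub>B + \<kappa>\<^sub>C + c\<^sub>0 + (\<kappa>\<^sub>B + \<kappa>\<^sub>C + \<kappa>\<^sub>W) * (\<gamma> + C\<^sub>\<gamma> / v\<^sub>0)"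

text \<open>The constant comes from Young's inequality
  \<open>s \<surd>q \<surd>p \<le> (1 - \<epsilon>) q + s\<^sup>2 p / (4 (1 - \<epsilon>))\<close> with \<open>\<epsilon>\<close> so small that
  the excess over \<open>s\<^sup>2 p / 4\<close> is absorbed by half of the slack in the coefficient of \<open>V\<^sub>S\<close>.\<close>

definition form_coercivity :: "real \<Rightarrow> real \<Rightarrow> real \<Rightarrow> real \<Rightarrow> real \<Rightarrow> real \<Rightarrow> real" where
  "form_coercivity v\<^sub>0 \<kappa>\<^sub>B \<kappa>\<^sub>C \<kappa>\<^sub>W \<gamma> C\<^sub>\<gamma> =
     (let s = \<kappa>\<^sub>B + \<kappa>\<^sub>C; \<delta> = 1 - \<gamma> * \<kappa>\<^sub>W - \<gamma> * s\<^sup>2 / 4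
      in min (min (1/2) (\<delta> / (s\<^sup>2 * (\<gamma> + C\<^sub>\<gamma> / v\<^sub>0) + 1))) (\<delta> / 2))"

context coefficients_at_point
begin

lemma qform_eq: "qform Q (fst p) = complex_of_real (\<Sum>i\<in>UNIV. (norm (cmat (mat_sqrt Q) *v jet_gradient p i))\<^sup>2)"
  using cinner_cmat_eq_mat_sqrt[OF Q_sym less_imp_le[OF Q_pos]] by (simp add: qform_eq_gradients cinner_self)

lemma sym_part_eq: "cinner (cmat (sym_part V) *v \<xi>) \<xi> = complex_of_real ((norm (cmat (mat_sqrt (sym_part V)) *v \<xi>))\<^sup>2)"
  using cinner_cmat_eq_mat_sqrt[OF transpose_sym_part, of V \<xi> \<xi>] v0 by (simp add: cinner_self)

lemma jet_energy_eq:
  "jet_energy Q V p p = complex_of_real ((\<Sum>i\<in>UNIV. (norm (cmat (mat_sqrt Q) *v jet_gradient p i))\<^sup>2)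
     + (norm (cmat (mat_sqrt (sym_part V)) *v snd p))\<^sup>2)"
  unfolding jet_energy_def qform_eq_gradients[symmetric] qform_eq sym_part_eq by simp

lemma v0_le: "v\<^sub>0 * (norm \<xi>)\<^sup>2 \<le> Re (cinner (cmat (sym_part V) *v \<xi>) \<xi>)"
  using min_eigenvalue_le_cinner[OF transpose_sym_part, of V \<xi>] mult_right_mono[OF v0(2), of "(norm \<xi>)\<^sup>2"] by simp

lemma v0_norm_le_energy: "v\<^sub>0 * (norm (snd p))\<^sup>2 \<le> Re (jet_energy Q V p p)"
proof -
  have "0 \<le> (\<Sum>i\<in>UNIV. (norm (cmat (mat_sqrt Q) *v jet_gradient p i))\<^sup>2)" by (intro sum_nonneg) auto
  then show ?thesis using v0_le[of "snd p"] unfolding jet_energy_eq sym_part_eq by simp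
qed

lemma min_eigenvalue_gradient_le:
  "min_eigenvalue Q * (norm g)\<^sup>2 \<le> (norm (cmat (mat_sqrt Q) *v g))\<^sup>2"
  using min_eigenvalue_le_cinner[OF Q_sym, of g]
  unfolding cinner_cmat_eq_mat_sqrt[OF Q_sym less_imp_le[OF Q_pos]] by (simp add: cinner_self)

lemma jet_form_diag:
  "jet_form Q A B C V W p p = qform Q (fst p) + (\<Sum>h\<in>UNIV. \<Sum>k\<in>UNIV. cinner (cmat (A h k) *v fst p k) (fst p h))
     + (\<Sum>h\<in>UNIV. cinner (cmat (B h) *v fst p h) (snd p)) + (\<Sum>h\<in>UNIV. cinner (cmat (C h) *v snd p) (fst p h))
     + cinner (cmat V *v snd p) (snd p) + cinner (cmat W *v snd p) (snd p)"
proof -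
  have "(\<Sum>h\<in>UNIV. \<Sum>k\<in>UNIV. complex_of_real (Q $ h $ k) * cinner (fst p k) (fst p h)) = qform Q (fst p)"
  proof -
    have "(\<Sum>h\<in>UNIV. \<Sum>k\<in>UNIV. complex_of_real (Q $ h $ k) * cinner (fst p k) (fst p h))
        = (\<Sum>h\<in>UNIV. \<Sum>i\<in>UNIV. \<Sum>k\<in>UNIV. complex_of_real (Q $ h $ k) * fst p k $ i * cnj (fst p h $ i))"
      unfolding cinner_def sum_distrib_left by (intro sum.cong refl trans[OF sum.swap]) (simp add: mult.assoc)
    also have "\<dots> = qform Q (fst p)" unfolding qform_def by (rule sum.swap)
    finally show ?thesis .
  qed
  then show ?thesis
    by (simp add: jet_form_def cmat_add cmat_mat cinner_add_left cinner_scale_left sum.distrib)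
qed

text \<open>The bookkeeping of the estimates: q and v are the two parts of the energy of a jet, and
  P is the expression under the square roots in the bounds for B, C and W.\<close>

context
  fixes p :: "('d, 'm) jet" and q v w P :: real
  defines "q \<equiv> Re (qform Q (fst p))" and "v \<equiv> Re (cinner (cmat (sym_part V) *v snd p) (snd p))"
    and "P \<equiv> \<gamma> * v + C\<^sub>\<gamma> * (norm (snd p))\<^sup>2"
begin

lemma nonneg: "0 \<le> q" "0 \<le> v" "0 \<le> P"
proof -
  show "0 \<le> q" unfolding q_def qform_eq by (simp add: sum_nonneg)
  show v: "0 \<le> v" unfolding v_def sym_part_eq by simp
  then show "0 \<le> P" unfolding P_def using const_signs by simp
qed

lemma energy_eq: "Re (jet_energy Q V p p) = q + v"
  by (simp add: jet_energy_def q_def v_def qform_eq_gradients)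

lemma P_le: "P \<le> (\<gamma> + C\<^sub>\<gamma> / v\<^sub>0) * v"
proof -
  have "(norm (snd p))\<^sup>2 \<le> v / v\<^sub>0" using v0_le[of "snd p"] v0 by (simp add: v_def pos_le_divide_eq mult.commute)
  then have "C\<^sub>\<gamma> * (norm (snd p))\<^sup>2 \<le> C\<^sub>\<gamma> * (v / v\<^sub>0)" using const_signs by (intro mult_left_mono) auto
  then show ?thesis by (simp add: P_def distrib_right)
qed

lemma lower_order_bounds:
  "cmod (\<Sum>h\<in>UNIV. cinner (cmat (B h) *v fst p h) (snd p)) \<le> \<kappa>\<^sub>B * (sqrt q * sqrt P)"
  "cmod (\<Sum>h\<in>UNIV. cinner (cmat (C h) *v snd p) (fst p h)) \<le> \<kappa>\<^sub>C * (sqrt q * sqrt P)"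
  "cmod (cinner (cmat W *v snd p) (snd p)) \<le> \<kappa>\<^sub>W * P"
  using B_bound[of "fst p" "snd p"] C_bound[of "snd p" "fst p"] W_bound[of "snd p" "snd p"] nonneg(3)
  by (simp_all add: q_def v_def P_def mult.assoc)

lemma jet_form_bound:
  "cmod (jet_form Q A B C V W p p) \<le> form_bound v\<^sub>0 c\<^sub>0 \<kappa>\<^sub>A \<kappa>\<^sub>B \<kappa>\<^sub>C \<kappa>\<^sub>W \<gamma> C\<^sub>\<gamma> * Re (jet_energy Q V p p)"
proof -
  let ?A = "\<Sum>h\<in>UNIV. \<Sum>k\<in>UNIV. cinner (cmat (A h k) *v fst p k) (fst p h)"
  let ?V = "cinner (cmat V *v snd p) (snd p)"
  define c where "c = \<gamma> + C\<^sub>\<gamma> / v\<^sub>0"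
  have c: "c \<ge> 0" using const_signs v0 by (simp add: c_def)
  have "cmod (qform Q (fst p)) = q" using nonneg(1) unfolding q_def qform_eq norm_of_real Re_complex_of_real by simp
  moreover have "cmod ?A \<le> 2 * \<kappa>\<^sub>A * q"
    using cmod_le[of ?A] A_Re[of "fst p"] A_Im[of "fst p"] by (simp add: q_def)
  moreover have "cmod ?V \<le> (1 + c\<^sub>0) * v"
    using cmod_le[of ?V] V_sector[of "snd p"] nonneg(2) unfolding v_def Re_cinner_sym_part by (simp add: distrib_right)
  moreover have sq: "sqrt q * sqrt P \<le> q + c * v"
  proof -
    have "2 * sqrt q * sqrt P \<le> (sqrt q)\<^sup>2 + (sqrt P)\<^sup>2" by (rule sum_squares_bound)
    moreover have "0 \<le> sqrt q * sqrt P" using nonneg by simp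
    ultimately have "sqrt q * sqrt P \<le> q + P" using nonneg by simp
    then show ?thesis using P_le unfolding c_def by linarith
  qed
  have "cmod (\<Sum>h\<in>UNIV. cinner (cmat (B h) *v fst p h) (snd p)) \<le> \<kappa>\<^sub>B * (q + c * v)"
    using lower_order_bounds(1) mult_left_mono[OF sq const_signs(3)] by linarith
  moreover have "cmod (\<Sum>h\<in>UNIV. cinner (cmat (C h) *v snd p) (fst p h)) \<le> \<kappa>\<^sub>C * (q + c * v)"
    using lower_order_bounds(2) mult_left_mono[OF sq const_signs(4)] by linarith
  moreover have "cmod (cinner (cmat W *v snd p) (snd p)) \<le> \<kappa>\<^sub>W * (c * v)"
    using lower_order_bounds(3) mult_left_mono[OF P_le const_signs(5)] unfolding c_def by linarith
  ultimately have "cmod (jet_form Q A B C V W p p)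
      \<le> q + 2 * \<kappa>\<^sub>A * q + \<kappa>\<^sub>B * (q + c * v) + \<kappa>\<^sub>C * (q + c * v) + (1 + c\<^sub>0) * v + \<kappa>\<^sub>W * (c * v)"
    unfolding jet_form_diag by (intro norm_triangle_mono) auto
  also have "\<dots> \<le> form_bound v\<^sub>0 c\<^sub>0 \<kappa>\<^sub>A \<kappa>\<^sub>B \<kappa>\<^sub>C \<kappa>\<^sub>W \<gamma> C\<^sub>\<gamma> * (q + v)"
  proof -
    have "form_bound v\<^sub>0 c\<^sub>0 \<kappa>\<^sub>A \<kappa>\<^sub>B \<kappa>\<^sub>C \<kappa>\<^sub>W \<gamma> C\<^sub>\<gamma> * (q + v)
        - (q + 2 * \<kappa>\<^sub>A * q + \<kappa>\<^sub>B * (q + c * v) + \<kappa>\<^sub>C * (q + c * v) + (1 + c\<^sub>0) * v + \<kappa>\<^sub>W * (c * v))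
        = 2 * q + c\<^sub>0 * q + (\<kappa>\<^sub>B + \<kappa>\<^sub>C + \<kappa>\<^sub>W) * c * q + (2 + 2 * \<kappa>\<^sub>A + \<kappa>\<^sub>B + \<kappa>\<^sub>C) * v"
      unfolding form_bound_def c_def[symmetric] by (simp add: algebra_simps)
    also have "\<dots> \<ge> 0" using nonneg const_signs c by (intro add_nonneg_nonneg mult_nonneg_nonneg) auto
    finally show ?thesis by linarith
  qed
  finally show ?thesis unfolding energy_eq .
qed

text \<open>The term with A has nonnegative real part, so the form is at least q + v - s sqrt(q P) -
  \<open>\<kappa>\<^sub>W\<close> P. Since P is \<open>\<gamma> * v\<close> plus
  \<open>C\<^sub>\<gamma>\<close> times |u|^2, the expression v - (s^2/4 +
  \<open>\<kappa>\<^sub>W\<close>) P plus the shift equals \<delta> v exactly, and 4 \<delta> is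
  \<gamma> times the constant assumed positive in \<open>K_pos\<close>.\<close>

lemma jet_form_coercive:
  "form_coercivity v\<^sub>0 \<kappa>\<^sub>B \<kappa>\<^sub>C \<kappa>\<^sub>W \<gamma> C\<^sub>\<gamma> * Re (jet_energy Q V p p)
    \<le> Re (jet_form Q A B C V W p p) + C\<^sub>\<gamma> * (\<kappa>\<^sub>W + (\<kappa>\<^sub>B + \<kappa>\<^sub>C)\<^sup>2 / 4) * (norm (snd p))\<^sup>2"
proof -
  define s where "s = \<kappa>\<^sub>B + \<kappa>\<^sub>C"
  define c where "c = \<gamma> + C\<^sub>\<gamma> / v\<^sub>0"
  define \<delta> where "\<delta> = 1 - \<gamma> * \<kappa>\<^sub>W - \<gamma> * s\<^sup>2 / 4"
  define \<epsilon> where "\<epsilon> = min (1/2) (\<delta> / (s\<^sup>2 * c + 1))"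
  have c: "c \<ge> 0" using const_signs v0 by (simp add: c_def)
  have s: "s \<ge> 0" using const_signs by (simp add: s_def)
  have \<delta>: "\<delta> > 0"
  proof -
    have "4 * \<delta> = \<gamma> * (4 * (1 / \<gamma> - \<kappa>\<^sub>W) - s\<^sup>2)" using const_signs by (simp add: \<delta>_def field_simps)
    moreover have "0 < \<gamma> * (4 * (1 / \<gamma> - \<kappa>\<^sub>W) - s\<^sup>2)"
      using K_pos const_signs(6) unfolding s_def by (intro mult_pos_pos)
    ultimately show ?thesis by linarith
  qed
  have den: "s\<^sup>2 * c + 1 > 0" using c by (simp add: add_nonneg_pos)
  have \<epsilon>: "0 < \<epsilon>" "\<epsilon> \<le> 1/2" "\<epsilon> * (s\<^sup>2 * c) \<le> \<delta>"
  proof -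
    show "0 < \<epsilon>" using \<delta> den by (simp add: \<epsilon>_def)
    show "\<epsilon> \<le> 1/2" unfolding \<epsilon>_def by (rule min.cobounded1)
    have "\<epsilon> * (s\<^sup>2 * c) \<le> \<epsilon> * (s\<^sup>2 * c + 1)" using \<open>0 < \<epsilon>\<close> by simp
    also have "\<dots> \<le> \<delta> / (s\<^sup>2 * c + 1) * (s\<^sup>2 * c + 1)" using den by (intro mult_right_mono) (auto simp: \<epsilon>_def)
    also have "\<dots> = \<delta>" using den by simp
    finally show "\<epsilon> * (s\<^sup>2 * c) \<le> \<delta>" .
  qed
  have coercivity: "form_coercivity v\<^sub>0 \<kappa>\<^sub>B \<kappa>\<^sub>C \<kappa>\<^sub>W \<gamma> C\<^sub>\<gamma> = min \<epsilon> (\<delta> / 2)"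
    by (simp add: form_coercivity_def \<epsilon>_def \<delta>_def c_def s_def Let_def)
  \<comment> \<open>The weight 1 - \<epsilon> saves \<epsilon> q for coercivity. Its price 1 / (1 -
    \<epsilon>) is at most 1 + 2 \<epsilon> because \<epsilon> <= 1/2.\<close>
  have young: "s * (sqrt q * sqrt P) \<le> (1 - \<epsilon>) * q + s\<^sup>2 / 4 * (1 + 2 * \<epsilon>) * P"
  proof -
    define r where "r = sqrt (1 - \<epsilon>)"
    have r: "r > 0" "r\<^sup>2 = 1 - \<epsilon>" using \<epsilon> by (auto simp: r_def)
    have "2 * (r * sqrt q) * (s / (2 * r) * sqrt P) \<le> (r * sqrt q)\<^sup>2 + (s / (2 * r) * sqrt P)\<^sup>2"
      by (rule sum_squares_bound)
    moreover have "2 * (r * sqrt q) * (s / (2 * r) * sqrt P) = s * (sqrt q * sqrt P)" using r by simp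
    moreover have "(r * sqrt q)\<^sup>2 = (1 - \<epsilon>) * q" using r nonneg by (simp add: power_mult_distrib)
    moreover have "(s / (2 * r) * sqrt P)\<^sup>2 = s\<^sup>2 / 4 * (1 / (1 - \<epsilon>)) * P"
      using nonneg by (simp add: power_mult_distrib power_divide r(2))
    moreover have "s\<^sup>2 / 4 * (1 / (1 - \<epsilon>)) * P \<le> s\<^sup>2 / 4 * (1 + 2 * \<epsilon>) * P"
    proof (intro mult_right_mono mult_left_mono)
      have "0 \<le> \<epsilon> * (1 - 2 * \<epsilon>)" using \<epsilon> by simp
      then have "1 \<le> (1 + 2 * \<epsilon>) * (1 - \<epsilon>)" by (simp add: algebra_simps power2_eq_square)
      then show "1 / (1 - \<epsilon>) \<le> 1 + 2 * \<epsilon>" using \<epsilon> by (simp add: pos_divide_le_eq)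
    qed (use nonneg in auto)
    ultimately show ?thesis by linarith
  qed
  let ?A = "\<Sum>h\<in>UNIV. \<Sum>k\<in>UNIV. cinner (cmat (A h k) *v fst p k) (fst p h)"
  let ?B = "\<Sum>h\<in>UNIV. cinner (cmat (B h) *v fst p h) (snd p)"
  let ?C = "\<Sum>h\<in>UNIV. cinner (cmat (C h) *v snd p) (fst p h)"
  let ?W = "cinner (cmat W *v snd p) (snd p)"
  have "Re (jet_form Q A B C V W p p) = q + Re ?A + Re ?B + Re ?C + v + Re ?W"
    unfolding jet_form_diag q_def v_def Re_cinner_sym_part by simp
  moreover have "0 \<le> Re ?A" using A_Re by blast
  moreover have "- (\<kappa>\<^sub>B * (sqrt q * sqrt P)) \<le> Re ?B" using lower_order_bounds(1) abs_Re_le_cmod[of ?B] by linarith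
  moreover have "- (\<kappa>\<^sub>C * (sqrt q * sqrt P)) \<le> Re ?C" using lower_order_bounds(2) abs_Re_le_cmod[of ?C] by linarith
  moreover have "- (\<kappa>\<^sub>W * P) \<le> Re ?W" using lower_order_bounds(3) abs_Re_le_cmod[of ?W] by linarith
  moreover have "s * (sqrt q * sqrt P) = \<kappa>\<^sub>B * (sqrt q * sqrt P) + \<kappa>\<^sub>C * (sqrt q * sqrt P)" by (simp add: s_def distrib_right)
  ultimately have "q + v - s * (sqrt q * sqrt P) - \<kappa>\<^sub>W * P \<le> Re (jet_form Q A B C V W p p)" by linarith
  note lower = this
  have "\<epsilon> * q + v - (s\<^sup>2 / 4 + \<kappa>\<^sub>W) * P - \<epsilon> / 2 * (s\<^sup>2 * P) \<le> Re (jet_form Q A B C V W p p)"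
  proof -
    have "\<epsilon> * q + v - (s\<^sup>2 / 4 + \<kappa>\<^sub>W) * P - \<epsilon> / 2 * (s\<^sup>2 * P)
        = q + v - ((1 - \<epsilon>) * q + s\<^sup>2 / 4 * (1 + 2 * \<epsilon>) * P) - \<kappa>\<^sub>W * P"
      by (simp add: field_simps)
    also have "\<dots> \<le> q + v - s * (sqrt q * sqrt P) - \<kappa>\<^sub>W * P" using young by simp
    finally show ?thesis using lower by (rule order_trans)
  qed
  \<comment> \<open>The excess in Young's inequality consumes half of \<delta> v; this is what the
    second entry in the minimum defining \<epsilon> is for.\<close>
  moreover have "\<epsilon> / 2 * (s\<^sup>2 * P) \<le> \<delta> / 2 * v"
  proof -
    have "\<epsilon> / 2 * (s\<^sup>2 * P) \<le> \<epsilon> / 2 * (s\<^sup>2 * (c * v))"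
      using P_le \<epsilon> unfolding c_def by (intro mult_left_mono) auto
    also have "\<dots> = (\<epsilon> * (s\<^sup>2 * c)) / 2 * v" by simp
    also have "\<dots> \<le> \<delta> / 2 * v" using \<epsilon>(3) nonneg by (intro mult_right_mono) auto
    finally show ?thesis .
  qed
  moreover have "v - (s\<^sup>2 / 4 + \<kappa>\<^sub>W) * P + C\<^sub>\<gamma> * (\<kappa>\<^sub>W + s\<^sup>2 / 4) * (norm (snd p))\<^sup>2 = \<delta> * v"
    by (simp add: P_def \<delta>_def algebra_simps)
  ultimately have "\<epsilon> * q + \<delta> / 2 * v \<le> Re (jet_form Q A B C V W p p) + C\<^sub>\<gamma> * (\<kappa>\<^sub>W + s\<^sup>2 / 4) * (norm (snd p))\<^sup>2"
    by (simp add: field_simps)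
  moreover have "min \<epsilon> (\<delta> / 2) * (q + v) \<le> \<epsilon> * q + \<delta> / 2 * v"
    unfolding distrib_left using nonneg by (intro add_mono mult_right_mono) auto
  ultimately show ?thesis unfolding energy_eq coercivity s_def by linarith
qed

end

text \<open>Polarisation extends the bound on the diagonal. It yields a sum of energies instead of a
  product of norms; homogeneity restores the product after integration, in
  \<open>bilinear_bound\<close>.\<close>

lemma jet_form_le:
  "cmod (jet_form Q A B C V W p q) \<le> form_bound v\<^sub>0 c\<^sub>0 \<kappa>\<^sub>A \<kappa>\<^sub>B \<kappa>\<^sub>C \<kappa>\<^sub>W \<gamma> C\<^sub>\<gamma> * (Re (jet_energy Q V p p) + Re (jet_energy Q V q q))"
  by (rule polarization_bound[where f="jet_form Q A B C V W" and g="jet_energy Q V" and pl=jet_add and sc=jet_scale])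
     (rule jet_form_sesquilinear jet_energy_sesquilinear jet_form_bound)+

end

section \<open>Extension by zero\<close>

lemma L2_iff_indicator:
  fixes f :: "'a::euclidean_space \<Rightarrow> 'b::euclidean_space"
  assumes "\<Omega> \<in> sets lebesgue"
  shows "f \<in> L2 \<Omega> \<longleftrightarrow> square_integrable lebesgue (\<lambda>x. indicator \<Omega> x *\<^sub>R f x)"
proof -
  have "(\<lambda>x. (norm (indicator \<Omega> x *\<^sub>R f x))\<^sup>2) = (\<lambda>x. indicator \<Omega> x *\<^sub>R (norm (f x))\<^sup>2)"
    by (intro ext) (simp add: indicator_def)
  moreover have "f \<in> borel_measurable (lebesgue_on \<Omega>) \<longleftrightarrow> (\<lambda>x. indicator \<Omega> x *\<^sub>R f x) \<in> borel_measurable lebesgue"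
    by (rule borel_measurable_restrict_space_iff) (use assms in simp)
  moreover have "integrable (lebesgue_on \<Omega>) (\<lambda>x. (norm (f x))\<^sup>2) \<longleftrightarrow> integrable lebesgue (\<lambda>x. indicator \<Omega> x *\<^sub>R (norm (f x))\<^sup>2)"
    by (rule integrable_restrict_space) (use assms in simp)
  ultimately show ?thesis unfolding L2_iff square_integrable_def by (simp only:)
qed

definition extend_l2 :: "'a::euclidean_space set \<Rightarrow> ('a \<Rightarrow> 'b::euclidean_space) \<Rightarrow> ('a, 'b) l2" where
  "extend_l2 \<Omega> f = abs_l2 (\<lambda>x. indicator \<Omega> x *\<^sub>R f x)"

context
  fixes \<Omega> :: "'a::euclidean_space set"
  assumes \<Omega>: "\<Omega> \<in> sets lebesgue"
begin

lemma rep_extend_l2: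
  "f \<in> L2 \<Omega> \<Longrightarrow> AE x in lebesgue. rep_l2 (extend_l2 \<Omega> f) x = indicator \<Omega> x *\<^sub>R f x"
  for f :: "'a \<Rightarrow> 'b::euclidean_space"
  unfolding extend_l2_def by (rule rep_abs_l2) (simp only: L2_iff_indicator[OF \<Omega>])

lemma rep_extend_l2_on:
  fixes f :: "'a \<Rightarrow> 'b::euclidean_space"
  assumes "f \<in> L2 \<Omega>"
  shows "AE x in lebesgue_on \<Omega>. rep_l2 (extend_l2 \<Omega> f) x = f x"
  unfolding AE_lebesgue_on_iff[OF \<Omega>] using rep_extend_l2[OF assms] by eventually_elim simp

lemma rep_l2_in_L2: "rep_l2 X \<in> L2 \<Omega>" for X :: "('a, 'b::euclidean_space) l2"
proof -
  have "rep_l2 X \<in> L2 UNIV" unfolding L2_iff by (simp add: lebesgue_on_UNIV_eq)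
  then show ?thesis by (rule L2_subset[OF _ \<Omega>, rotated 2]) auto
qed

lemma extend_l2_eq_iff:
  fixes f g :: "'a \<Rightarrow> 'b::euclidean_space"
  assumes "f \<in> L2 \<Omega>" "g \<in> L2 \<Omega>"
  shows "extend_l2 \<Omega> f = extend_l2 \<Omega> g \<longleftrightarrow> (AE x in lebesgue_on \<Omega>. f x = g x)"
proof -
  have "extend_l2 \<Omega> f = extend_l2 \<Omega> g \<longleftrightarrow> (AE x in lebesgue. indicator \<Omega> x *\<^sub>R f x = indicator \<Omega> x *\<^sub>R g x)"
    unfolding extend_l2_def by (rule abs_l2_eq_iff) (use assms in \<open>simp_all only: L2_iff_indicator[OF \<Omega>]\<close>)
  also have "\<dots> \<longleftrightarrow> (AE x in lebesgue. x \<in> \<Omega> \<longrightarrow> f x = g x)"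
    by (rule AE_cong) (auto simp: indicator_def)
  finally show ?thesis unfolding AE_lebesgue_on_iff[OF \<Omega>] .
qed

lemma extend_l2_cong:
  fixes f g :: "'a \<Rightarrow> 'b::euclidean_space"
  assumes "f \<in> L2 \<Omega>" "AE x in lebesgue_on \<Omega>. f x = g x"
  shows "g \<in> L2 \<Omega>" "extend_l2 \<Omega> f = extend_l2 \<Omega> g"
proof -
  have "g \<in> borel_measurable (lebesgue_on \<Omega>)"
    by (rule measurable_lebesgue_on_AE[OF \<Omega> _ assms(2)]) (use assms(1) in \<open>simp add: L2_def\<close>)
  from square_integrable_AE_cong[OF assms(1)[unfolded L2_iff] assms(2) this]
  show g: "g \<in> L2 \<Omega>" unfolding L2_iff .
  show "extend_l2 \<Omega> f = extend_l2 \<Omega> g" unfolding extend_l2_eq_iff[OF assms(1) g] by (rule assms(2))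
qed

lemma extend_l2_bounded_linear:
  fixes f :: "'a \<Rightarrow> 'b::euclidean_space" and T :: "'b \<Rightarrow> 'c::euclidean_space"
  assumes T: "bounded_linear T" and f: "f \<in> L2 \<Omega>"
  shows "(\<lambda>x. T (f x)) \<in> L2 \<Omega>" "AE x in lebesgue. rep_l2 (extend_l2 \<Omega> (\<lambda>x. T (f x))) x = T (rep_l2 (extend_l2 \<Omega> f) x)"
proof -
  show Tf: "(\<lambda>x. T (f x)) \<in> L2 \<Omega>" using f unfolding L2_iff by (rule square_integrable_bounded_linear[OF _ T])
  show "AE x in lebesgue. rep_l2 (extend_l2 \<Omega> (\<lambda>x. T (f x))) x = T (rep_l2 (extend_l2 \<Omega> f) x)"
    using rep_extend_l2[OF f] rep_extend_l2[OF Tf]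
    by eventually_elim (simp add: linear_scale[OF bounded_linear.linear[OF T]])
qed

lemma extend_l2_add:
  fixes f g :: "'a \<Rightarrow> 'b::euclidean_space"
  assumes "f \<in> L2 \<Omega>" "g \<in> L2 \<Omega>"
  shows "(\<lambda>x. f x + g x) \<in> L2 \<Omega>" "extend_l2 \<Omega> (\<lambda>x. f x + g x) = extend_l2 \<Omega> f + extend_l2 \<Omega> g"
proof -
  show fg: "(\<lambda>x. f x + g x) \<in> L2 \<Omega>" using assms unfolding L2_iff by (rule square_integrable_add)
  show "extend_l2 \<Omega> (\<lambda>x. f x + g x) = extend_l2 \<Omega> f + extend_l2 \<Omega> g"
    by (rule l2_eqI, use rep_extend_l2[OF fg] rep_extend_l2[OF assms(1)] rep_extend_l2[OF assms(2)]
        rep_l2_add[of "extend_l2 \<Omega> f" "extend_l2 \<Omega> g"] in eventually_elim) (simp add: scaleR_add_right)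
qed

lemma extend_l2_scaleR:
  fixes f :: "'a \<Rightarrow> 'b::euclidean_space"
  assumes "f \<in> L2 \<Omega>"
  shows "extend_l2 \<Omega> (\<lambda>x. c *\<^sub>R f x) = c *\<^sub>R extend_l2 \<Omega> f"
  by (rule l2_eqI, use extend_l2_bounded_linear(2)[OF bounded_linear_scaleR_right[of c] assms] rep_l2_scaleR[of c "extend_l2 \<Omega> f"] in eventually_elim) simp

lemma extend_l2_diff:
  fixes f g :: "'a \<Rightarrow> 'b::euclidean_space"
  assumes "f \<in> L2 \<Omega>" "g \<in> L2 \<Omega>"
  shows "(\<lambda>x. f x - g x) \<in> L2 \<Omega>" "extend_l2 \<Omega> (\<lambda>x. f x - g x) = extend_l2 \<Omega> f - extend_l2 \<Omega> g"
  using extend_l2_add[OF assms(1) extend_l2_bounded_linear(1)[OF bounded_linear_scaleR_right[of "-1"] assms(2)]]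
    extend_l2_scaleR[OF assms(2), of "-1"] by simp_all

lemma inner_extend_l2:
  fixes f g :: "'a \<Rightarrow> 'b::euclidean_space"
  assumes "f \<in> L2 \<Omega>" "g \<in> L2 \<Omega>"
  shows "inner (extend_l2 \<Omega> f) (extend_l2 \<Omega> g) = (\<integral>x. inner (f x) (g x) \<partial>lebesgue_on \<Omega>)"
proof -
  have "inner (extend_l2 \<Omega> f) (extend_l2 \<Omega> g) = (\<integral>x. inner (indicator \<Omega> x *\<^sub>R f x) (indicator \<Omega> x *\<^sub>R g x) \<partial>lebesgue)"
    unfolding extend_l2_def by (rule inner_abs_l2) (use assms in \<open>simp_all only: L2_iff_indicator[OF \<Omega>]\<close>)
  also have "(\<lambda>x. inner (indicator \<Omega> x *\<^sub>R f x) (indicator \<Omega> x *\<^sub>R g x)) = (\<lambda>x. indicator \<Omega> x *\<^sub>R inner (f x) (g x))"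
    by (intro ext) (simp add: indicator_def)
  also have "(\<integral>x. indicator \<Omega> x *\<^sub>R inner (f x) (g x) \<partial>lebesgue) = (\<integral>x. inner (f x) (g x) \<partial>lebesgue_on \<Omega>)"
    by (rule integral_restrict_space[symmetric]) (use \<Omega> in simp)
  finally show ?thesis .
qed

lemma norm_extend_l2:
  fixes f :: "'a \<Rightarrow> 'b::euclidean_space"
  assumes "f \<in> L2 \<Omega>"
  shows "norm (extend_l2 \<Omega> f) = L2_norm \<Omega> f"
  by (simp add: norm_eq_sqrt_inner inner_extend_l2[OF assms assms] L2_norm_def power2_norm_eq_inner)

lemma extend_rep_extend_l2: "f \<in> L2 \<Omega> \<Longrightarrow> extend_l2 \<Omega> (rep_l2 (extend_l2 \<Omega> f)) = extend_l2 \<Omega> f"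
  for f :: "'a \<Rightarrow> 'b::euclidean_space"
  by (simp add: extend_l2_eq_iff rep_l2_in_L2 rep_extend_l2_on)

lemma inner_extend_l2_left:
  fixes f :: "'a \<Rightarrow> 'b::euclidean_space"
  assumes f: "f \<in> L2 \<Omega>"
  shows "inner (extend_l2 \<Omega> f) X = inner (extend_l2 \<Omega> f) (extend_l2 \<Omega> (rep_l2 X))"
  unfolding inner_l2_def
  by (rule integral_cong_AE) (measurable, use rep_extend_l2[OF f] rep_extend_l2[OF rep_l2_in_L2, of X] in eventually_elim, simp add: indicator_def)

end

section \<open>Complex scalars on the Hilbert space\<close>

lemma bounded_linear_cscale: "bounded_linear (\<lambda>x :: complex^'m. c *s x)"
  by (rule bounded_linear_intro[where K="cmod c"])
     (simp_all add: norm_cscale mult.commute vec_eq_iff distrib_left)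

lemma scaleR_eq_cscale: "r *\<^sub>R w = complex_of_real r *s w" for w :: "complex^'n"
  unfolding vec_eq_iff vector_scaleR_component vector_smult_component by (simp add: scaleR_conv_of_real)

definition scale_l2 :: "complex \<Rightarrow> ('a::euclidean_space, complex^'m) l2 \<Rightarrow> ('a, complex^'m) l2" where
  "scale_l2 c X = abs_l2 (\<lambda>x. c *s rep_l2 X x)"

lemma rep_scale_l2: "AE x in lebesgue. rep_l2 (scale_l2 c X) x = c *s rep_l2 X x"
  unfolding scale_l2_def
  by (rule rep_abs_l2) (rule square_integrable_bounded_linear[OF square_integrable_rep_l2 bounded_linear_cscale])

lemma norm_scale_l2: "norm (scale_l2 c X) = cmod c * norm X"
proof -
  have "(norm (scale_l2 c X))\<^sup>2 = (\<integral>x. (cmod c)\<^sup>2 * (norm (rep_l2 X x))\<^sup>2 \<partial>lebesgue)"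
    unfolding power2_norm_l2
    by (rule integral_cong_AE) (measurable, use rep_scale_l2[of c X] in eventually_elim, simp add: norm_cscale power_mult_distrib)
  also have "\<dots> = (cmod c * norm X)\<^sup>2" by (simp add: power_mult_distrib power2_norm_l2)
  finally show ?thesis by (simp add: power2_eq_iff_nonneg)
qed

interpretation l2: complex_structure "scale_l2 :: complex \<Rightarrow> ('a::euclidean_space, complex^'m) l2 \<Rightarrow> ('a, complex^'m) l2"
proof
  fix a b :: complex and X Y :: "('a, complex^'m) l2" and r :: real
  show "scale_l2 (a + b) X = scale_l2 a X + scale_l2 b X"
    by (rule l2_eqI, use rep_scale_l2[of "a + b" X] rep_scale_l2[of a X] rep_scale_l2[of b X] rep_l2_add[of "scale_l2 a X" "scale_l2 b X"] in eventually_elim)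
       (simp add: vec_eq_iff distrib_right)
  show "scale_l2 a (X + Y) = scale_l2 a X + scale_l2 a Y"
    by (rule l2_eqI, use rep_scale_l2[of a "X + Y"] rep_scale_l2[of a X] rep_scale_l2[of a Y] rep_l2_add[of X Y] rep_l2_add[of "scale_l2 a X" "scale_l2 a Y"] in eventually_elim)
       (simp add: vec_eq_iff distrib_left)
  show "scale_l2 (a * b) X = scale_l2 a (scale_l2 b X)"
    by (rule l2_eqI, use rep_scale_l2[of "a * b" X] rep_scale_l2[of b X] rep_scale_l2[of a "scale_l2 b X"] in eventually_elim)
       (simp add: vec_eq_iff mult.assoc)
  show "scale_l2 (complex_of_real r) X = r *\<^sub>R X"
    by (rule l2_eqI, use rep_scale_l2[of "complex_of_real r" X] rep_l2_scaleR[of r X] in eventually_elim)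
       (simp add: scaleR_eq_cscale)
  show "norm (scale_l2 a X) = cmod a * norm X" by (rule norm_scale_l2)
qed

lemma extend_l2_cscale:
  fixes f :: "'a::euclidean_space \<Rightarrow> complex^'m"
  assumes "\<Omega> \<in> sets lebesgue" "f \<in> L2 \<Omega>"
  shows "(\<lambda>x. c *s f x) \<in> L2 \<Omega>" "extend_l2 \<Omega> (\<lambda>x. c *s f x) = scale_l2 c (extend_l2 \<Omega> f)"
proof -
  note * = extend_l2_bounded_linear[OF assms(1) bounded_linear_cscale assms(2)]
  show "(\<lambda>x. c *s f x) \<in> L2 \<Omega>" by (rule *(1))
  show "extend_l2 \<Omega> (\<lambda>x. c *s f x) = scale_l2 c (extend_l2 \<Omega> f)"
    by (rule l2_eqI, use *(2)[of c] rep_scale_l2[of c "extend_l2 \<Omega> f"] in eventually_elim) simp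
qed

section \<open>Jets and energy vectors of Sobolev functions\<close>

lemma square_integrable_sum:
  "finite I \<Longrightarrow> (\<And>i. i \<in> I \<Longrightarrow> square_integrable M (f i)) \<Longrightarrow> square_integrable M (\<lambda>x. \<Sum>i\<in>I. f i x)"
  by (induction I rule: finite_induct) (simp_all add: square_integrable_add)

definition sobolev_jet :: "(real^'d) set \<Rightarrow> (real^'d \<Rightarrow> complex^'m) \<Rightarrow> real^'d \<Rightarrow> ('d, 'm) jet" where
  "sobolev_jet \<Omega> u x = ((\<lambda>h. wpdiff \<Omega> h u x), u x)"

text \<open>The square roots turn the weighted energy into a plain L2 norm, so completeness of the
  form domain becomes closedness of a subset of \<open>l2\<close>. Carrying u as first component
  allows it to be read off from its image.\<close>

definition energy_vector :: "(real^'d) set \<Rightarrow> (real^'d \<Rightarrow> real^'d^'d) \<Rightarrow> (real^'d \<Rightarrow> real^'m^'m) \<Rightarrow>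
    (real^'d \<Rightarrow> complex^'m) \<Rightarrow> real^'d \<Rightarrow> (complex^'m) \<times> (complex^'m) \<times> (complex^'d^'m)" where
  "energy_vector \<Omega> Q V u x = (u x, cmat (mat_sqrt (sym_part (V x))) *v u x, \<chi> i. cmat (mat_sqrt (Q x)) *v wgrad \<Omega> u i x)"

lemma jet_gradient_sobolev_jet: "jet_gradient (sobolev_jet \<Omega> u x) i = wgrad \<Omega> u i x"
  by (simp add: jet_gradient_def sobolev_jet_def wgrad_def)

lemma sobolev_jet_add:
  assumes "open \<Omega>" "u \<in> W12_loc \<Omega>" "v \<in> W12_loc \<Omega>"
  shows "AE x in lebesgue_on \<Omega>. sobolev_jet \<Omega> (\<lambda>x. u x + v x) x = jet_add (sobolev_jet \<Omega> u x) (sobolev_jet \<Omega> v x)"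
proof -
  have "AE x in lebesgue_on \<Omega>. \<forall>h\<in>UNIV. wpdiff \<Omega> h (\<lambda>x. u x + v x) x = wpdiff \<Omega> h u x + wpdiff \<Omega> h v x"
    by (rule AE_finite_allI) (simp_all add: wpdiff_add[OF assms])
  then show ?thesis by eventually_elim (simp add: sobolev_jet_def jet_add_def)
qed

lemma sobolev_jet_scale:
  assumes "open \<Omega>" "u \<in> W12_loc \<Omega>"
  shows "AE x in lebesgue_on \<Omega>. sobolev_jet \<Omega> (\<lambda>x. c *s u x) x = jet_scale c (sobolev_jet \<Omega> u x)"
proof -
  have "AE x in lebesgue_on \<Omega>. \<forall>h\<in>UNIV. wpdiff \<Omega> h (\<lambda>x. c *s u x) x = c *s wpdiff \<Omega> h u x"
    by (rule AE_finite_allI) (simp_all add: wpdiff_bounded_linear[OF assms(1) bounded_linear_cscale assms(2)])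
  then show ?thesis by eventually_elim (simp add: sobolev_jet_def jet_scale_def)
qed

lemma sobolev_jet_cong:
  assumes "open \<Omega>" "u \<in> W12_loc \<Omega>" "AE x in lebesgue_on \<Omega>. u x = v x"
  shows "AE x in lebesgue_on \<Omega>. sobolev_jet \<Omega> u x = sobolev_jet \<Omega> v x"
proof -
  have "AE x in lebesgue_on \<Omega>. \<forall>h\<in>UNIV. wpdiff \<Omega> h v x = wpdiff \<Omega> h u x"
    by (rule AE_finite_allI)
       (simp_all add: wpdiff_AE_eqI[OF assms(1) W12_loc_AE_cong[OF assms] has_weak_pdiff_AE_cong[OF assms(1,3) has_weak_pdiff_wpdiff[OF assms(2)]]])
  with assms(3) show ?thesis by eventually_elim (simp add: sobolev_jet_def)
qed

lemma energy_vector_eq_jet: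
  "energy_vector \<Omega> Q V u x = (snd (sobolev_jet \<Omega> u x), cmat (mat_sqrt (sym_part (V x))) *v snd (sobolev_jet \<Omega> u x),
     \<chi> i. cmat (mat_sqrt (Q x)) *v jet_gradient (sobolev_jet \<Omega> u x) i)"
  by (simp add: energy_vector_def jet_gradient_sobolev_jet) (simp add: sobolev_jet_def)

lemma energy_vector_diff:
  fixes u v :: "real^'d \<Rightarrow> complex^'m"
  assumes "open \<Omega>" "u \<in> W12_loc \<Omega>" "v \<in> W12_loc \<Omega>"
  shows "AE x in lebesgue_on \<Omega>. energy_vector \<Omega> Q V (\<lambda>x. u x + v x) x = energy_vector \<Omega> Q V u x + energy_vector \<Omega> Q V v x"
    and "AE x in lebesgue_on \<Omega>. energy_vector \<Omega> Q V (\<lambda>x. r *\<^sub>R u x) x = r *\<^sub>R energy_vector \<Omega> Q V u x"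
    and "AE x in lebesgue_on \<Omega>. energy_vector \<Omega> Q V (\<lambda>x. u x - v x) x = energy_vector \<Omega> Q V u x - energy_vector \<Omega> Q V v x"
proof -
  have g: "jet_gradient (jet_add p q) i = jet_gradient p i + jet_gradient q i"
    "jet_gradient (jet_scale c p) i = c *s jet_gradient p i" for p q :: "('d, 'm) jet" and c i
    by (simp_all add: jet_gradient_def jet_add_def jet_scale_def vec_eq_iff)
  have s: "snd (jet_add p q) = snd p + snd q" "snd (jet_scale c p) = c *s snd p" for p q :: "('d, 'm) jet" and c
    by (simp_all add: jet_add_def jet_scale_def)
  have add: "AE x in lebesgue_on \<Omega>. energy_vector \<Omega> Q V (\<lambda>x. u x + v x) x = energy_vector \<Omega> Q V u x + energy_vector \<Omega> Q V v x"
    if "u \<in> W12_loc \<Omega>" "v \<in> W12_loc \<Omega>" for u v :: "real^'d \<Rightarrow> complex^'m"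
    using sobolev_jet_add[OF assms(1) that]
    by eventually_elim (simp add: energy_vector_eq_jet g s cmat_vec_add vec_eq_iff)
  have scale: "AE x in lebesgue_on \<Omega>. energy_vector \<Omega> Q V (\<lambda>x. r *\<^sub>R u x) x = r *\<^sub>R energy_vector \<Omega> Q V u x"
    if "u \<in> W12_loc \<Omega>" for u :: "real^'d \<Rightarrow> complex^'m" and r
    using sobolev_jet_scale[OF assms(1) that, of "complex_of_real r"]
  proof eventually_elim
    case (elim x)
    have eq: "(\<lambda>x. r *\<^sub>R u x) = (\<lambda>x. complex_of_real r *s u x)" by (simp only: scaleR_eq_cscale)
    show ?case unfolding eq energy_vector_eq_jet elim g s cmat_scale
      by (simp add: prod_eq_iff scaleR_eq_cscale vec_eq_iff vector_scaleR_component)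
  qed
  show "AE x in lebesgue_on \<Omega>. energy_vector \<Omega> Q V (\<lambda>x. u x + v x) x = energy_vector \<Omega> Q V u x + energy_vector \<Omega> Q V v x"
    by (rule add[OF assms(2,3)])
  show "AE x in lebesgue_on \<Omega>. energy_vector \<Omega> Q V (\<lambda>x. r *\<^sub>R u x) x = r *\<^sub>R energy_vector \<Omega> Q V u x"
    by (rule scale[OF assms(2)])
  have "(\<lambda>x. (-1) *\<^sub>R v x) \<in> W12_loc \<Omega>" by (rule W12_loc_bounded_linear[OF assms(1) bounded_linear_scaleR_right assms(3)])
  from add[OF assms(2) this] scale[OF assms(3), of "-1"]
  show "AE x in lebesgue_on \<Omega>. energy_vector \<Omega> Q V (\<lambda>x. u x - v x) x = energy_vector \<Omega> Q V u x - energy_vector \<Omega> Q V v x"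
    by eventually_elim simp
qed

lemma power2_norm_Pair: "(norm (a, b))\<^sup>2 = (norm a)\<^sup>2 + (norm b)\<^sup>2"
  by (simp add: norm_prod_def)

lemma power2_norm_vec_lambda: "(norm (\<chi> i. f i))\<^sup>2 = (\<Sum>i\<in>UNIV. (norm (f i))\<^sup>2)" for f :: "'n::finite \<Rightarrow> 'b::real_inner"
  by (simp add: power2_norm_eq_inner inner_vec_def)

lemma norm_energy_vector:
  "(norm (energy_vector \<Omega> Q V u x))\<^sup>2 = (norm (u x))\<^sup>2 + ((norm (cmat (mat_sqrt (sym_part (V x))) *v u x))\<^sup>2
     + (\<Sum>i\<in>UNIV. (norm (cmat (mat_sqrt (Q x)) *v wgrad \<Omega> u i x))\<^sup>2))"
  unfolding energy_vector_def power2_norm_Pair power2_norm_vec_lambda by (rule refl)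

text \<open>The vector is a finite sum of its components injected by bounded linear maps, so
  measurability and integrability are inherited from the components.\<close>

lemma energy_vector_in_L2:
  fixes u :: "real^'d \<Rightarrow> complex^'m"
  assumes "u \<in> D_QV \<Omega> Q V"
  shows "energy_vector \<Omega> Q V u \<in> L2 \<Omega>"
proof -
  let ?M = "lebesgue_on \<Omega>"
  have 1: "square_integrable ?M u" "square_integrable ?M (\<lambda>x. cmat (mat_sqrt (sym_part (V x))) *v u x)"
    "square_integrable ?M (\<lambda>x. cmat (mat_sqrt (Q x)) *v wgrad \<Omega> u i x)" for i
    using assms unfolding D_QV_def L2_iff by blast+
  define i1 :: "complex^'m \<Rightarrow> (complex^'m) \<times> (complex^'m) \<times> (complex^'d^'m)" where "i1 = (\<lambda>a. (a, 0, 0))"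
  define i2 :: "complex^'m \<Rightarrow> (complex^'m) \<times> (complex^'m) \<times> (complex^'d^'m)" where "i2 = (\<lambda>a. (0, a, 0))"
  define i3 :: "'m \<Rightarrow> complex^'d \<Rightarrow> (complex^'m) \<times> (complex^'m) \<times> (complex^'d^'m)" where "i3 = (\<lambda>i g. (0, 0, axis i g))"
  have "linear i1" "linear i2" "linear (i3 i)" for i
    by (intro linearI; simp add: i1_def i2_def i3_def vec_eq_iff axis_def)+
  then have bl: "bounded_linear i1" "bounded_linear i2" "bounded_linear (i3 i)" for i
    by (simp_all add: linear_conv_bounded_linear)
  have "square_integrable ?M (\<lambda>x. i1 (u x) + i2 (cmat (mat_sqrt (sym_part (V x))) *v u x)
      + (\<Sum>i\<in>UNIV. i3 i (cmat (mat_sqrt (Q x)) *v wgrad \<Omega> u i x)))"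
    by (intro square_integrable_add square_integrable_sum square_integrable_bounded_linear[OF 1(1) bl(1)]
        square_integrable_bounded_linear[OF 1(2) bl(2)] square_integrable_bounded_linear[OF 1(3) bl(3)] finite)
  moreover have "(\<Sum>i\<in>UNIV. i3 i (f i)) = (0, 0, \<chi> i. f i)" for f
  proof -
    have "(\<Sum>i\<in>UNIV. i3 i (f i)) = (0, 0, \<Sum>i\<in>UNIV. axis i (f i))"
      unfolding i3_def by (simp add: sum_prod)
    also have "(\<Sum>i\<in>UNIV. axis i (f i)) = (\<chi> i. f i)"
      by (simp add: vec_eq_iff axis_def)
    finally show ?thesis .
  qed
  ultimately show ?thesis unfolding L2_iff energy_vector_def[abs_def] by (simp add: i1_def i2_def)
qed

section \<open>The form domain\<close>

text \<open>Derivatives are controlled by the third component of the energy vector as long as the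
  least eigenvalue of Q is positive. The version for differences is the one that transfers the
  Cauchy property.\<close>

lemma (in coefficients_at_point) gradient_lower_bound:
  fixes a b :: "'d \<Rightarrow> complex^'m"
  shows "min_eigenvalue Q * (norm (a h - b h))\<^sup>2
    \<le> (norm ((\<chi> i. cmat (mat_sqrt Q) *v (\<chi> h. a h $ i)) - (\<chi> i. cmat (mat_sqrt Q) *v (\<chi> h. b h $ i))))\<^sup>2"
proof -
  let ?d = "\<lambda>i. (\<chi> h. (a h - b h) $ i)"
  have eq: "(\<chi> i. cmat (mat_sqrt Q) *v (\<chi> h. a h $ i)) - (\<chi> i. cmat (mat_sqrt Q) *v (\<chi> h. b h $ i))
      = (\<chi> i. cmat (mat_sqrt Q) *v ?d i)"
  proof -
    have "cmat (mat_sqrt Q) *v ?d i = cmat (mat_sqrt Q) *v (\<chi> h. a h $ i) - cmat (mat_sqrt Q) *v (\<chi> h. b h $ i)" for i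
      by (subst matrix_vector_mult_diff_distrib[symmetric]) (rule arg_cong[where f="(*v) _"], subst vec_eq_iff, simp only: vector_minus_component vec_lambda_beta simp_thms)
    then show ?thesis by (subst vec_eq_iff) (simp only: vector_minus_component vec_lambda_beta simp_thms)
  qed
  have "(norm (a h - b h))\<^sup>2 = (\<Sum>i\<in>UNIV. (norm ((a h - b h) $ i))\<^sup>2)"
    by (simp add: power2_norm_eq_inner inner_vec_def)
  also have "\<dots> \<le> (\<Sum>i\<in>UNIV. (norm (?d i))\<^sup>2)"
  proof (rule sum_mono, rule power_mono)
    fix i
    show "norm ((a h - b h) $ i) \<le> norm (?d i)" using Finite_Cartesian_Product.norm_nth_le[of "?d i" h] by simp
  qed simp
  finally have "min_eigenvalue Q * (norm (a h - b h))\<^sup>2 \<le> min_eigenvalue Q * (\<Sum>i\<in>UNIV. (norm (?d i))\<^sup>2)"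
    using Q_pos by (intro mult_left_mono) auto
  also have "\<dots> \<le> (\<Sum>i\<in>UNIV. (norm (cmat (mat_sqrt Q) *v ?d i))\<^sup>2)"
    unfolding sum_distrib_left by (intro sum_mono min_eigenvalue_gradient_le)
  finally show ?thesis unfolding eq power2_norm_vec_lambda .
qed

locale elliptic_form =
  fixes \<Omega> :: "(real^'d) set"
    and Q :: "real^'d \<Rightarrow> real^'d^'d" and A :: "'d \<Rightarrow> 'd \<Rightarrow> real^'d \<Rightarrow> real^'m^'m"
    and B C :: "'d \<Rightarrow> real^'d \<Rightarrow> real^'m^'m" and V W :: "real^'d \<Rightarrow> real^'m^'m"
    and \<V> :: "(real^'d \<Rightarrow> complex^'m) set"
    and v\<^sub>0 c\<^sub>0 \<kappa>\<^sub>A \<kappa>\<^sub>B \<kappa>\<^sub>C \<kappa>\<^sub>W \<gamma> C\<^sub>\<gamma> :: real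
  assumes open_\<Omega>: "open \<Omega>"
    and Q_measurable: "\<And>h k. (\<lambda>x. Q x $ h $ k) \<in> borel_measurable (lebesgue_on \<Omega>)"
    and coefficients_measurable: "\<And>h k. A h k \<in> borel_measurable (lebesgue_on \<Omega>)"
      "\<And>h. B h \<in> borel_measurable (lebesgue_on \<Omega>)" "\<And>h. C h \<in> borel_measurable (lebesgue_on \<Omega>)"
      "V \<in> borel_measurable (lebesgue_on \<Omega>)" "W \<in> borel_measurable (lebesgue_on \<Omega>)"
    and coefficients: "AE x in lebesgue_on \<Omega>. coefficients_at_point (Q x) (\<lambda>h k. A h k x) (\<lambda>h. B h x) (\<lambda>h. C h x) (V x) (W x)
        v\<^sub>0 c\<^sub>0 \<kappa>\<^sub>A \<kappa>\<^sub>B \<kappa>\<^sub>C \<kappa>\<^sub>W \<gamma> C\<^sub>\<gamma>"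
    and Q_lower: "\<And>K. compact K \<Longrightarrow> K \<subseteq> \<Omega> \<Longrightarrow> \<exists>l>0. AE x in lebesgue_on K. l \<le> min_eigenvalue (Q x)"
    and \<V>_closed: "closed_subspace_QV \<Omega> Q V \<V>"
    and \<V>_test: "test_functions \<Omega> \<subseteq> \<V>"
    and v\<^sub>0_pos: "0 < v\<^sub>0"
    and const_signs: "0 < c\<^sub>0" "0 < \<kappa>\<^sub>A" "0 \<le> \<kappa>\<^sub>B" "0 \<le> \<kappa>\<^sub>C" "0 \<le> \<kappa>\<^sub>W" "0 < \<gamma>" "0 < C\<^sub>\<gamma>"
    and K_pos: "4 * (1 / \<gamma> - \<kappa>\<^sub>W) - (\<kappa>\<^sub>B + \<kappa>\<^sub>C)\<^sup>2 > 0"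
begin

section \<open>The embedding of the form domain into an L2 space\<close>

lemma \<Omega>_sets: "\<Omega> \<in> sets lebesgue" using open_\<Omega> by simp

abbreviation "J \<equiv> energy_vector \<Omega> Q V"
abbreviation "\<iota> u \<equiv> extend_l2 \<Omega> (J u)"

lemma \<V>_props:
  assumes "u \<in> \<V>"
  shows "u \<in> D_QV \<Omega> Q V" "u \<in> W12_loc \<Omega>" "u \<in> L2 \<Omega>" "J u \<in> L2 \<Omega>"
proof -
  show D: "u \<in> D_QV \<Omega> Q V" using assms \<V>_closed unfolding closed_subspace_QV_def by blast
  then show "u \<in> W12_loc \<Omega>" "u \<in> L2 \<Omega>" unfolding D_QV_def by blast+
  show "J u \<in> L2 \<Omega>" by (rule energy_vector_in_L2[OF D])
qed

lemma \<V>_zero: "(\<lambda>x. 0) \<in> \<V>"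
  and \<V>_add: "u \<in> \<V> \<Longrightarrow> v \<in> \<V> \<Longrightarrow> (\<lambda>x. u x + v x) \<in> \<V>"
  and \<V>_scale: "u \<in> \<V> \<Longrightarrow> (\<lambda>x. c *s u x) \<in> \<V>"
  using \<V>_closed unfolding closed_subspace_QV_def by blast+

lemma \<V>_scaleR: "u \<in> \<V> \<Longrightarrow> (\<lambda>x. r *\<^sub>R u x) \<in> \<V>"
  using \<V>_scale[of u "complex_of_real r"] by (simp only: scaleR_eq_cscale)

lemma \<iota>_add:
  assumes u: "u \<in> \<V>" and v: "v \<in> \<V>"
  shows "\<iota> (\<lambda>x. u x + v x) = \<iota> u + \<iota> v"
proof -
  from extend_l2_cong(2)[OF \<Omega>_sets \<V>_props(4)[OF \<V>_add[OF u v]] energy_vector_diff(1)[OF open_\<Omega> \<V>_props(2)[OF u] \<V>_props(2)[OF v]]]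
  show ?thesis unfolding extend_l2_add(2)[OF \<Omega>_sets \<V>_props(4)[OF u] \<V>_props(4)[OF v]] .
qed

lemma \<iota>_scaleR:
  assumes u: "u \<in> \<V>"
  shows "\<iota> (\<lambda>x. r *\<^sub>R u x) = r *\<^sub>R \<iota> u"
proof -
  from extend_l2_cong(2)[OF \<Omega>_sets \<V>_props(4)[OF \<V>_scaleR[OF u]] energy_vector_diff(2)[OF open_\<Omega> \<V>_props(2)[OF u] \<V>_props(2)[OF u]]]
  show ?thesis unfolding extend_l2_scaleR[OF \<Omega>_sets \<V>_props(4)[OF u]] .
qed

lemma subspace_\<iota>: "subspace (\<iota> ` \<V>)"
proof (rule subspaceI)
  have "\<iota> (\<lambda>x. 0 *\<^sub>R 0) = 0 *\<^sub>R \<iota> (\<lambda>x. 0)" by (rule \<iota>_scaleR[OF \<V>_zero])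
  then show "0 \<in> \<iota> ` \<V>" using \<V>_zero by (auto intro!: image_eqI[of _ _ "\<lambda>x. 0"])
  fix X Y assume "X \<in> \<iota> ` \<V>" "Y \<in> \<iota> ` \<V>"
  then obtain u v where "u \<in> \<V>" "v \<in> \<V>" "X = \<iota> u" "Y = \<iota> v" by blast
  then show "X + Y \<in> \<iota> ` \<V>" using \<iota>_add[of u v] \<V>_add[of u v] by (intro image_eqI[of _ _ "\<lambda>x. u x + v x"]) auto
next
  fix c X assume "X \<in> \<iota> ` \<V>"
  then obtain u where "u \<in> \<V>" "X = \<iota> u" by blast
  then show "c *\<^sub>R X \<in> \<iota> ` \<V>" using \<iota>_scaleR[of u c] \<V>_scaleR[of u c] by (intro image_eqI[of _ _ "\<lambda>x. c *\<^sub>R u x"]) auto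
qed

lemma energy_vector_energy:
  "AE x in lebesgue_on \<Omega>. jet_energy (Q x) (V x) (sobolev_jet \<Omega> u x) (sobolev_jet \<Omega> u x)
     = complex_of_real ((norm (J u x))\<^sup>2 - (norm (u x))\<^sup>2)"
  using coefficients
proof eventually_elim
  case (elim x)
  have s: "snd (sobolev_jet \<Omega> u x) = u x" by (simp add: sobolev_jet_def)
  show ?case
    unfolding coefficients_at_point.jet_energy_eq[OF elim] norm_energy_vector jet_gradient_sobolev_jet s
    by (rule arg_cong[where f=complex_of_real]) linarith
qed

lemma integrable_norm2: "f \<in> L2 \<Omega> \<Longrightarrow> integrable (lebesgue_on \<Omega>) (\<lambda>x. (norm (f x))\<^sup>2)"
  unfolding L2_def by blast

lemma L2_measurable: "f \<in> L2 \<Omega> \<Longrightarrow> f \<in> borel_measurable (lebesgue_on \<Omega>)"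
  unfolding L2_def by blast

text \<open>\<open>inner_QV\<close> has no term |u|^2, while the first component of
  \<open>J u\<close> contributes one; hence the subtraction.\<close>

lemma inner_QV_eq:
  assumes "u \<in> L2 \<Omega>" "J u \<in> L2 \<Omega>"
  shows "inner_QV \<Omega> Q V u u = complex_of_real ((norm (\<iota> u))\<^sup>2 - (norm (extend_l2 \<Omega> u))\<^sup>2)"
proof -
  have [measurable]: "u \<in> borel_measurable (lebesgue_on \<Omega>)" "J u \<in> borel_measurable (lebesgue_on \<Omega>)"
    using assms by (auto intro: L2_measurable)
  let ?e = "\<lambda>x. complex_of_real ((norm (J u x))\<^sup>2 - (norm (u x))\<^sup>2)"
  have "?e \<in> borel_measurable (lebesgue_on \<Omega>)" by measurable
  moreover have "AE x in lebesgue_on \<Omega>. ?e x = jet_energy (Q x) (V x) (sobolev_jet \<Omega> u x) (sobolev_jet \<Omega> u x)"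
    using energy_vector_energy[of u] by eventually_elim (rule sym)
  \<comment> \<open>Measurability of the energy integrand is obtained from a measurable function
    that equals it almost everywhere, which avoids measurability of the matrix square roots.\<close>
  ultimately have m: "(\<lambda>x. jet_energy (Q x) (V x) (sobolev_jet \<Omega> u x) (sobolev_jet \<Omega> u x)) \<in> borel_measurable (lebesgue_on \<Omega>)"
    by (rule measurable_lebesgue_on_AE[OF \<Omega>_sets])
  have "inner_QV \<Omega> Q V u u = (\<integral>x. jet_energy (Q x) (V x) (sobolev_jet \<Omega> u x) (sobolev_jet \<Omega> u x) \<partial>lebesgue_on \<Omega>)"
    unfolding inner_QV_def jet_energy_def jet_gradient_sobolev_jet by (simp add: sobolev_jet_def)
  also have "\<dots> = (\<integral>x. ?e x \<partial>lebesgue_on \<Omega>)"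
    by (rule integral_cong_AE[OF m _ energy_vector_energy]) measurable
  also have "\<dots> = complex_of_real (\<integral>x. (norm (J u x))\<^sup>2 - (norm (u x))\<^sup>2 \<partial>lebesgue_on \<Omega>)"
    by (rule integral_complex_of_real)
  also have "(\<integral>x. (norm (J u x))\<^sup>2 - (norm (u x))\<^sup>2 \<partial>lebesgue_on \<Omega>) = (norm (\<iota> u))\<^sup>2 - (norm (extend_l2 \<Omega> u))\<^sup>2"
    unfolding Bochner_Integration.integral_diff[OF integrable_norm2[OF assms(2)] integrable_norm2[OF assms(1)]]
    unfolding power2_norm_eq_inner inner_extend_l2[OF \<Omega>_sets assms(1) assms(1)] inner_extend_l2[OF \<Omega>_sets assms(2) assms(2)] ..
  finally show ?thesis .
qed

lemma norm_QV_le: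
  assumes "u \<in> L2 \<Omega>" "J u \<in> L2 \<Omega>"
  shows "norm_QV \<Omega> Q V u \<le> norm (\<iota> u)"
  unfolding norm_QV_def inner_QV_eq[OF assms] Re_complex_of_real by (rule real_le_lsqrt) auto

lemma D_QV_of_energy_vector:
  assumes uW: "u \<in> W12_loc \<Omega>" and JuL2: "J u \<in> L2 \<Omega>"
  shows "u \<in> D_QV \<Omega> Q V" "u \<in> L2 \<Omega>"
proof -
  have "bounded_linear (\<lambda>p :: (complex^'m) \<times> (complex^'m) \<times> (complex^'d^'m). fst (snd p))"
    "bounded_linear (\<lambda>p :: (complex^'m) \<times> (complex^'m) \<times> (complex^'d^'m). snd (snd p) $ i)" for i
    by (intro bounded_linear_compose[OF bounded_linear_fst bounded_linear_snd]
        bounded_linear_compose[OF bounded_linear_vec_nth bounded_linear_compose[OF bounded_linear_snd bounded_linear_snd]])+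
  note c = this[THEN extend_l2_bounded_linear(1)[OF \<Omega>_sets _ JuL2]]
  have "(\<lambda>x. cmat (mat_sqrt (sym_part (V x))) *v u x) \<in> L2 \<Omega>" using c(1) by (simp add: energy_vector_def)
  moreover have "(\<lambda>x. cmat (mat_sqrt (Q x)) *v wgrad \<Omega> u i x) \<in> L2 \<Omega>" for i using c(2)[of i] by (simp add: energy_vector_def)
  moreover show uL2: "u \<in> L2 \<Omega>"
    using extend_l2_bounded_linear(1)[OF \<Omega>_sets bounded_linear_fst JuL2] by (simp add: energy_vector_def)
  ultimately show "u \<in> D_QV \<Omega> Q V" unfolding D_QV_def using uW by blast
qed

lemma norm_extend_le_\<iota>:
  assumes "u \<in> L2 \<Omega>" "J u \<in> L2 \<Omega>"
  shows "norm (extend_l2 \<Omega> u) \<le> norm (\<iota> u)"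
proof (rule power2_le_imp_le)
  show "(norm (extend_l2 \<Omega> u))\<^sup>2 \<le> (norm (\<iota> u))\<^sup>2"
    unfolding power2_norm_eq_inner inner_extend_l2[OF \<Omega>_sets assms(1) assms(1)] inner_extend_l2[OF \<Omega>_sets assms(2) assms(2)]
    unfolding power2_norm_eq_inner[symmetric]
    by (rule integral_mono[OF integrable_norm2[OF assms(1)] integrable_norm2[OF assms(2)]])
       (simp add: norm_energy_vector sum_nonneg)
qed simp

text \<open>Convergence of the embedded functions is convergence in a graph norm. It dominates
  \<open>norm_QV\<close>, the norm in which \<open>\<V>\<close> is closed.\<close>

lemma \<V>_limit:
  assumes un: "\<And>n. un n \<in> \<V>" and uW: "u \<in> W12_loc \<Omega>" and JuL2: "J u \<in> L2 \<Omega>"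
    and lim: "(\<lambda>n. \<iota> (un n)) \<longlonglongrightarrow> \<iota> u"
  shows "u \<in> \<V>"
proof -
  note P = \<V>_props[OF un]
  note uD = D_QV_of_energy_vector[OF uW JuL2]
  have "(\<lambda>n. norm_QV \<Omega> Q V (\<lambda>x. un n x - u x)) \<longlonglongrightarrow> 0"
  proof (rule tendsto_sandwich[OF _ _ tendsto_const])
    have L: "(\<lambda>x. un n x - u x) \<in> L2 \<Omega>" for n by (rule extend_l2_diff(1)[OF \<Omega>_sets P(3) uD(2)])
    have e: "AE x in lebesgue_on \<Omega>. J (un n) x - J u x = J (\<lambda>x. un n x - u x) x" for n
      using energy_vector_diff(3)[OF open_\<Omega> P(2)[of n] uW, where Q=Q and V=V] by eventually_elim (rule sym)
    note D = extend_l2_diff[OF \<Omega>_sets P(4) JuL2]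
    note E = extend_l2_cong[OF \<Omega>_sets D(1) e]
    have "norm_QV \<Omega> Q V (\<lambda>x. un n x - u x) \<le> norm (\<iota> (un n) - \<iota> u)" for n
      using norm_QV_le[OF L E(1)] unfolding E(2)[symmetric] D(2) .
    then show "\<forall>\<^sub>F n in sequentially. norm_QV \<Omega> Q V (\<lambda>x. un n x - u x) \<le> norm (\<iota> (un n) - \<iota> u)" by (intro always_eventually allI)
    have "0 \<le> norm_QV \<Omega> Q V (\<lambda>x. un n x - u x)" for n
      unfolding norm_QV_def inner_QV_eq[OF L E(1)] Re_complex_of_real
      using norm_extend_le_\<iota>[OF L E(1)] by (simp add: power_mono)
    then show "\<forall>\<^sub>F n in sequentially. 0 \<le> norm_QV \<Omega> Q V (\<lambda>x. un n x - u x)" by (intro always_eventually allI)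
    show "(\<lambda>n. norm (\<iota> (un n) - \<iota> u)) \<longlonglongrightarrow> 0" using tendsto_norm[OF LIM_zero[OF lim]] by simp
  qed
  then show "u \<in> \<V>" using \<V>_closed un uD(1) unfolding closed_subspace_QV_def by blast
qed

text \<open>Completeness of the form domain. The first component of the limit X is the candidate u.
  Invertibility of Q^(1/2) at almost every point makes the gradients converge pointwise, and the
  uniform ellipticity on compact sets upgrades this to local convergence in mean square. The
  pointwise limits are therefore weak derivatives of u, and X is the energy vector of u.\<close>

lemma closed_\<iota>: "closed (\<iota> ` \<V>)"
  unfolding closed_sequential_limits
proof (intro allI impI, elim conjE)
  fix Xs :: "nat \<Rightarrow> (real^'d, (complex^'m) \<times> (complex^'m) \<times> (complex^'d^'m)) l2" and X
  assume Xs: "\<forall>n. Xs n \<in> \<iota> ` \<V>" and lim: "Xs \<longlonglongrightarrow> X"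
  from Xs have "\<forall>n. \<exists>u. u \<in> \<V> \<and> Xs n = \<iota> u" by blast
  then obtain us where us: "\<forall>n. us n \<in> \<V> \<and> Xs n = \<iota> (us n)" by (rule choice[THEN exE])
  obtain X' r where X': "Xs \<longlonglongrightarrow> X'" and r: "strict_mono r" and ae: "AE x in lebesgue. (\<lambda>n. rep_l2 (Xs (r n)) x) \<longlonglongrightarrow> rep_l2 X' x"
    by (rule l2_Cauchy_limit[OF LIMSEQ_imp_Cauchy[OF lim]])
  have "X' = X" by (rule LIMSEQ_unique[OF X' lim])
  define un where "un n = us (r n)" for n
  have un: "un n \<in> \<V>" "Xs (r n) = \<iota> (un n)" for n using us by (auto simp: un_def)
  have lim_un: "(\<lambda>n. \<iota> (un n)) \<longlonglongrightarrow> X"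
    using LIMSEQ_subseq_LIMSEQ[OF lim r] by (simp add: comp_def un(2))
  note P = \<V>_props[OF un(1)]
  note XL2 = rep_l2_in_L2[OF \<Omega>_sets, of X]
  have ae_rep: "AE x in lebesgue. \<forall>n. rep_l2 (\<iota> (un n)) x = indicator \<Omega> x *\<^sub>R J (un n) x"
    unfolding AE_all_countable using rep_extend_l2[OF \<Omega>_sets P(4)] by blast
  have ae_lim: "AE x in lebesgue. (\<lambda>n. indicator \<Omega> x *\<^sub>R J (un n) x) \<longlonglongrightarrow> rep_l2 X x"
    using ae[unfolded \<open>X' = X\<close> un(2)] ae_rep by eventually_elim simp
  have aeJ: "AE x in lebesgue_on \<Omega>. (\<lambda>n. J (un n) x) \<longlonglongrightarrow> rep_l2 X x"
    unfolding AE_lebesgue_on_iff[OF \<Omega>_sets] using ae_lim by eventually_elim (auto simp: indicator_def)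
  \<comment> \<open>X vanishes outside \<Omega> as a limit of functions extended by zero, so
    restricting it to \<Omega> loses nothing.\<close>
  have ind: "AE x in lebesgue. indicator \<Omega> x *\<^sub>R rep_l2 X x = rep_l2 X x"
    using ae_lim by eventually_elim (auto simp: indicator_def LIMSEQ_const_iff)
  have extX: "extend_l2 \<Omega> (rep_l2 X) = X"
    by (rule l2_eqI, use rep_extend_l2[OF \<Omega>_sets XL2] ind in eventually_elim) simp
  have diff: "(\<lambda>x. J (un n) x - rep_l2 X x) \<in> L2 \<Omega>" "extend_l2 \<Omega> (\<lambda>x. J (un n) x - rep_l2 X x) = \<iota> (un n) - X" for n
    using extend_l2_diff[OF \<Omega>_sets P(4) XL2] extX by auto
  have int_lim: "(\<lambda>n. \<integral>x. (norm (J (un n) x - rep_l2 X x))\<^sup>2 \<partial>lebesgue_on \<Omega>) \<longlonglongrightarrow> 0"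
  proof -
    have "(\<integral>x. (norm (J (un n) x - rep_l2 X x))\<^sup>2 \<partial>lebesgue_on \<Omega>) = (norm (\<iota> (un n) - X))\<^sup>2" for n
      unfolding diff(2)[symmetric] power2_norm_eq_inner inner_extend_l2[OF \<Omega>_sets diff(1) diff(1)] ..
    moreover have "(\<lambda>n. (norm (\<iota> (un n) - X))\<^sup>2) \<longlonglongrightarrow> (norm (X - X))\<^sup>2"
      by (intro tendsto_intros lim_un)
    ultimately show ?thesis by simp
  qed
  define u where "u x = fst (rep_l2 X x)" for x
  \<comment> \<open>The candidate gradient, defined pointwise first: measurability is inherited by
    limits, and weak differentiability is checked afterwards.\<close>
  define \<gamma>' where "\<gamma>' h x = lim (\<lambda>n. wpdiff \<Omega> h (un n) x)" for h x
  have uL2: "u \<in> L2 \<Omega>"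
    unfolding u_def[abs_def] by (rule extend_l2_bounded_linear(1)[OF \<Omega>_sets bounded_linear_fst XL2])
  have third: "snd (snd (J w x)) = (\<chi> i. cmat (mat_sqrt (Q x)) *v (\<chi> h. wpdiff \<Omega> h w x $ i))" for w x
    by (simp add: energy_vector_def wgrad_def)
  have norm_third: "norm (snd (snd p) - snd (snd q)) \<le> norm (p - q)" for p q :: "(complex^'m) \<times> (complex^'m) \<times> (complex^'d^'m)"
    using order_trans[OF norm_snd_le[of "snd (snd (p - q))" "fst (snd (p - q))", unfolded prod.collapse] norm_snd_le[of "snd (p - q)" "fst (p - q)", unfolded prod.collapse]] by simp
  have ae_conv: "AE x in lebesgue_on \<Omega>. \<forall>h. (\<lambda>n. wpdiff \<Omega> h (un n) x) \<longlonglongrightarrow> \<gamma>' h x"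
    using coefficients aeJ
  proof eventually_elim
    case (elim x)
    interpret coefficients_at_point "Q x" "\<lambda>h k. A h k x" "\<lambda>h. B h x" "\<lambda>h. C h x" "V x" "W x"
      v\<^sub>0 c\<^sub>0 \<kappa>\<^sub>A \<kappa>\<^sub>B \<kappa>\<^sub>C \<kappa>\<^sub>W \<gamma> C\<^sub>\<gamma> by (rule elim(1))
    show ?case
    proof
      fix h
      have "Cauchy (\<lambda>n. wpdiff \<Omega> h (un n) x)"
      proof (rule CauchyI)
        fix e :: real assume e: "e > 0"
        let ?s = "sqrt (min_eigenvalue (Q x))"
        have s: "?s > 0" "?s\<^sup>2 = min_eigenvalue (Q x)" using Q_pos by auto
        have "0 < e * ?s" using e s by simp
        from CauchyD[OF LIMSEQ_imp_Cauchy[OF elim(2)] this]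
        obtain N where N: "\<forall>m\<ge>N. \<forall>n\<ge>N. norm (J (un m) x - J (un n) x) < e * ?s" by blast
        have "norm (wpdiff \<Omega> h (un m) x - wpdiff \<Omega> h (un n) x) < e" if "m \<ge> N" "n \<ge> N" for m n
        proof -
          have "?s\<^sup>2 * (norm (wpdiff \<Omega> h (un m) x - wpdiff \<Omega> h (un n) x))\<^sup>2 \<le> (norm (snd (snd (J (un m) x)) - snd (snd (J (un n) x))))\<^sup>2"
            unfolding s third by (rule gradient_lower_bound)
          then have "(?s * norm (wpdiff \<Omega> h (un m) x - wpdiff \<Omega> h (un n) x))\<^sup>2 \<le> (norm (J (un m) x - J (un n) x))\<^sup>2"
            unfolding power_mult_distrib by (rule order_trans[OF _ power_mono[OF norm_third norm_ge_zero]])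
          then have "?s * norm (wpdiff \<Omega> h (un m) x - wpdiff \<Omega> h (un n) x) \<le> norm (J (un m) x - J (un n) x)"
            by (rule power2_le_imp_le) simp
          also have "\<dots> < e * ?s" using N that by blast
          finally show ?thesis using s(1) by (simp add: mult.commute)
        qed
        then show "\<exists>M. \<forall>m\<ge>M. \<forall>n\<ge>M. norm (wpdiff \<Omega> h (un m) x - wpdiff \<Omega> h (un n) x) < e" by blast
      qed
      then have "convergent (\<lambda>n. wpdiff \<Omega> h (un n) x)" by (simp add: Cauchy_convergent_iff)
      then show "(\<lambda>n. wpdiff \<Omega> h (un n) x) \<longlonglongrightarrow> \<gamma>' h x" unfolding \<gamma>'_def convergent_LIMSEQ_iff .
    qed
  qed
  have ae_X: "AE x in lebesgue_on \<Omega>. rep_l2 X x = (u x, cmat (mat_sqrt (sym_part (V x))) *v u x,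
      \<chi> i. cmat (mat_sqrt (Q x)) *v (\<chi> h. \<gamma>' h x $ i))"
    using aeJ ae_conv
  proof eventually_elim
    case (elim x)
    have "(\<lambda>n. fst (J (un n) x)) \<longlonglongrightarrow> fst (rep_l2 X x)" by (rule tendsto_fst[OF elim(1)])
    then have 1: "(\<lambda>n. un n x) \<longlonglongrightarrow> u x" by (simp add: energy_vector_def u_def)
    have 2: "(\<lambda>n. cmat (mat_sqrt (sym_part (V x))) *v un n x) \<longlonglongrightarrow> cmat (mat_sqrt (sym_part (V x))) *v u x"
      by (rule bounded_linear.tendsto[OF bounded_linear_cmat 1])
    have 3: "(\<lambda>n. \<chi> i. cmat (mat_sqrt (Q x)) *v (\<chi> h. wpdiff \<Omega> h (un n) x $ i)) \<longlonglongrightarrow> (\<chi> i. cmat (mat_sqrt (Q x)) *v (\<chi> h. \<gamma>' h x $ i))"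
      by (intro tendsto_vec_lambda bounded_linear.tendsto[OF bounded_linear_cmat] tendsto_vec_nth) (use elim(2) in blast)
    have "(\<lambda>n. J (un n) x) \<longlonglongrightarrow> (u x, cmat (mat_sqrt (sym_part (V x))) *v u x, \<chi> i. cmat (mat_sqrt (Q x)) *v (\<chi> h. \<gamma>' h x $ i))"
      unfolding energy_vector_def wgrad_def by (intro tendsto_Pair 1 2 3)
    from LIMSEQ_unique[OF elim(1) this] show ?case .
  qed
  have wm: "wpdiff \<Omega> h (un n) \<in> borel_measurable (lebesgue_on \<Omega>)" for h n
    by (rule wpdiff_measurable[OF open_\<Omega> P(2)])
  have \<gamma>m: "\<gamma>' h \<in> borel_measurable (lebesgue_on \<Omega>)" for h
    unfolding \<gamma>'_def[abs_def] by (rule borel_measurable_lim_metric[OF wm])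
  \<comment> \<open>Here a single lower bound l for the least eigenvalue on K is essential: it
    converts convergence of energy vectors into convergence of derivatives with the fixed factor
    1/l.\<close>
  have local: "wpdiff \<Omega> h (un n) \<in> L2 K \<and> \<gamma>' h \<in> L2 K \<and> (\<lambda>n. \<integral>x. norm (wpdiff \<Omega> h (un n) x - \<gamma>' h x) \<partial>lebesgue_on K) \<longlonglongrightarrow> 0
      \<and> (\<lambda>n. \<integral>x. norm (un n x - u x) \<partial>lebesgue_on K) \<longlonglongrightarrow> 0"
    if K: "compact K" "K \<subseteq> \<Omega>" for K h n
  proof -
    have Km: "K \<in> sets lebesgue" by (rule compact_sets_lebesgue[OF K(1)])
    obtain l where l: "l > 0" "AE x in lebesgue_on K. l \<le> min_eigenvalue (Q x)" using Q_lower[OF K] by blast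
    note restrict = AE_lebesgue_on_subset[OF K(2) Km \<Omega>_sets]
    have le1: "AE x in lebesgue_on K. (norm (wpdiff \<Omega> h (un n) x - \<gamma>' h x))\<^sup>2 \<le> (norm (J (un n) x - rep_l2 X x))\<^sup>2 / l" for n
      using l(2) restrict[OF coefficients] restrict[OF ae_X]
    proof eventually_elim
      case (elim x)
      interpret coefficients_at_point "Q x" "\<lambda>h k. A h k x" "\<lambda>h. B h x" "\<lambda>h. C h x" "V x" "W x"
        v\<^sub>0 c\<^sub>0 \<kappa>\<^sub>A \<kappa>\<^sub>B \<kappa>\<^sub>C \<kappa>\<^sub>W \<gamma> C\<^sub>\<gamma> by (rule elim(2))
      have X3: "snd (snd (rep_l2 X x)) = (\<chi> i. cmat (mat_sqrt (Q x)) *v (\<chi> h. \<gamma>' h x $ i))" using elim(3) by simp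
      have "l * (norm (wpdiff \<Omega> h (un n) x - \<gamma>' h x))\<^sup>2 \<le> min_eigenvalue (Q x) * (norm (wpdiff \<Omega> h (un n) x - \<gamma>' h x))\<^sup>2"
        by (rule mult_right_mono[OF elim(1)]) simp
      also have "\<dots> \<le> (norm (snd (snd (J (un n) x)) - snd (snd (rep_l2 X x))))\<^sup>2"
        unfolding third X3 by (rule gradient_lower_bound)
      also have "\<dots> \<le> (norm (J (un n) x - rep_l2 X x))\<^sup>2" by (rule power_mono[OF norm_third norm_ge_zero])
      finally show ?case using l(1) by (simp add: pos_le_divide_eq mult.commute)
    qed
    \<comment> \<open>\<open>wpdiff\<close> is a chosen weak derivative and by this choice only
      locally integrable; its local square integrability is derived from the energy.\<close>
    have le2: "AE x in lebesgue_on K. (norm (wpdiff \<Omega> h (un n) x))\<^sup>2 \<le> (norm (J (un n) x))\<^sup>2 / l" for n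
      using l(2) restrict[OF coefficients]
    proof eventually_elim
      case (elim x)
      interpret coefficients_at_point "Q x" "\<lambda>h k. A h k x" "\<lambda>h. B h x" "\<lambda>h. C h x" "V x" "W x"
        v\<^sub>0 c\<^sub>0 \<kappa>\<^sub>A \<kappa>\<^sub>B \<kappa>\<^sub>C \<kappa>\<^sub>W \<gamma> C\<^sub>\<gamma> by (rule elim(2))
      have zero: "(\<chi> i. cmat (mat_sqrt (Q x)) *v (\<chi> h. (0 :: complex^'m) $ i)) = (0 :: complex^'d^'m)"
      proof -
        have "(\<chi> h. (0 :: complex^'m) $ i) = (0 :: complex^'d)" for i by (simp add: vec_eq_iff)
        then show ?thesis by (subst vec_eq_iff) (simp only: vec_lambda_beta zero_index matrix_vector_mult_0_right simp_thms)
      qed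
      have "l * (norm (wpdiff \<Omega> h (un n) x - 0))\<^sup>2 \<le> min_eigenvalue (Q x) * (norm (wpdiff \<Omega> h (un n) x - 0))\<^sup>2"
        by (rule mult_right_mono[OF elim(1)]) simp
      also have "\<dots> \<le> (norm (snd (snd (J (un n) x)) - 0))\<^sup>2"
        unfolding third zero[symmetric] by (rule gradient_lower_bound[where b="\<lambda>h. 0"])
      also have "\<dots> \<le> (norm (J (un n) x - 0))\<^sup>2" using norm_third[of "J (un n) x" 0] by (intro power_mono) auto
      finally show ?case using l(1) by (simp add: pos_le_divide_eq mult.commute)
    qed
    have dK: "integrable (lebesgue_on K) (\<lambda>x. (norm (J (un n) x - rep_l2 X x))\<^sup>2)" for n
      using L2_subset[OF K(2) Km \<Omega>_sets diff(1)] unfolding L2_def by blast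
    have JK: "integrable (lebesgue_on K) (\<lambda>x. (norm (J (un n) x))\<^sup>2)" for n
      using L2_subset[OF K(2) Km \<Omega>_sets P(4)] unfolding L2_def by blast
    note mK = measurable_lebesgue_on_subset[OF K(2)]
    have d1: "(\<lambda>x. wpdiff \<Omega> h (un n) x - \<gamma>' h x) \<in> L2 K" for n
      unfolding L2_iff using dK[of n]
      by (intro square_integrable_dominated[OF _ _ le1] borel_measurable_diff mK wm \<gamma>m) simp
    have w1: "wpdiff \<Omega> h (un n) \<in> L2 K" for n
      unfolding L2_iff using JK[of n] by (intro square_integrable_dominated[OF _ _ le2] mK wm) simp
    have "\<gamma>' h \<in> L2 K"
      using square_integrable_diff[OF w1[of 0, unfolded L2_iff] d1[of 0, unfolded L2_iff]] unfolding L2_iff by simp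
    have bound: "(\<integral>x. (norm (J (un n) x - rep_l2 X x))\<^sup>2 \<partial>lebesgue_on K) \<le> (\<integral>x. (norm (J (un n) x - rep_l2 X x))\<^sup>2 \<partial>lebesgue_on \<Omega>)" for n
      by (rule integral_lebesgue_on_subset_mono[OF K(2) Km \<Omega>_sets integrable_norm2[OF diff(1)]]) simp
    have "(\<lambda>n. \<integral>x. (norm (wpdiff \<Omega> h (un n) x - \<gamma>' h x))\<^sup>2 \<partial>lebesgue_on K) \<longlonglongrightarrow> 0"
    proof (rule tendsto_sandwich[OF _ _ tendsto_const])
      show "\<forall>\<^sub>F n in sequentially. 0 \<le> (\<integral>x. (norm (wpdiff \<Omega> h (un n) x - \<gamma>' h x))\<^sup>2 \<partial>lebesgue_on K)" by simp
      have "(\<integral>x. (norm (wpdiff \<Omega> h (un n) x - \<gamma>' h x))\<^sup>2 \<partial>lebesgue_on K) \<le> (\<integral>x. (norm (J (un n) x - rep_l2 X x))\<^sup>2 \<partial>lebesgue_on \<Omega>) / l" for n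
      proof -
        have "(\<integral>x. (norm (wpdiff \<Omega> h (un n) x - \<gamma>' h x))\<^sup>2 \<partial>lebesgue_on K) \<le> (\<integral>x. (norm (J (un n) x - rep_l2 X x))\<^sup>2 / l \<partial>lebesgue_on K)"
          by (rule integral_mono_AE[OF _ _ le1]) (use d1[of n] dK[of n] in \<open>auto simp: L2_def\<close>)
        also have "\<dots> = (\<integral>x. (norm (J (un n) x - rep_l2 X x))\<^sup>2 \<partial>lebesgue_on K) / l" by simp
        also have "\<dots> \<le> (\<integral>x. (norm (J (un n) x - rep_l2 X x))\<^sup>2 \<partial>lebesgue_on \<Omega>) / l"
          using bound l(1) by (intro divide_right_mono) auto
        finally show ?thesis .
      qed
      then show "\<forall>\<^sub>F n in sequentially. (\<integral>x. (norm (wpdiff \<Omega> h (un n) x - \<gamma>' h x))\<^sup>2 \<partial>lebesgue_on K) \<le> (\<integral>x. (norm (J (un n) x - rep_l2 X x))\<^sup>2 \<partial>lebesgue_on \<Omega>) / l"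
        by (intro always_eventually allI)
      show "(\<lambda>n. (\<integral>x. (norm (J (un n) x - rep_l2 X x))\<^sup>2 \<partial>lebesgue_on \<Omega>) / l) \<longlonglongrightarrow> 0"
        by (rule tendsto_divide_zero[OF int_lim])
    qed
    from integral_norm_tendsto_0_compact[OF K(1) d1 this]
    have c1: "(\<lambda>n. \<integral>x. norm (wpdiff \<Omega> h (un n) x - \<gamma>' h x) \<partial>lebesgue_on K) \<longlonglongrightarrow> 0" .
    have d2: "(\<lambda>x. un n x - u x) \<in> L2 K" for n
      using square_integrable_diff[OF L2_subset[OF K(2) Km \<Omega>_sets P(3), unfolded L2_iff] L2_subset[OF K(2) Km \<Omega>_sets uL2, unfolded L2_iff]]
      unfolding L2_iff .
    have fst_le: "(norm (un n x - u x))\<^sup>2 \<le> (norm (J (un n) x - rep_l2 X x))\<^sup>2" for n x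
    proof (rule power_mono[OF _ norm_ge_zero])
      have eq: "fst (J (un n) x - rep_l2 X x) = un n x - u x" by (simp add: energy_vector_def u_def)
      show "norm (un n x - u x) \<le> norm (J (un n) x - rep_l2 X x)"
        using norm_fst_le[of "fst (J (un n) x - rep_l2 X x)" "snd (J (un n) x - rep_l2 X x)", unfolded prod.collapse] unfolding eq .
    qed
    have "(\<lambda>n. \<integral>x. (norm (un n x - u x))\<^sup>2 \<partial>lebesgue_on K) \<longlonglongrightarrow> 0"
    proof (rule tendsto_sandwich[OF _ _ tendsto_const int_lim])
      show "\<forall>\<^sub>F n in sequentially. 0 \<le> (\<integral>x. (norm (un n x - u x))\<^sup>2 \<partial>lebesgue_on K)" by simp
      have "(\<integral>x. (norm (un n x - u x))\<^sup>2 \<partial>lebesgue_on K) \<le> (\<integral>x. (norm (J (un n) x - rep_l2 X x))\<^sup>2 \<partial>lebesgue_on K)" for n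
        by (rule integral_mono[OF _ dK fst_le]) (use d2[of n] in \<open>simp add: L2_def\<close>)
      then show "\<forall>\<^sub>F n in sequentially. (\<integral>x. (norm (un n x - u x))\<^sup>2 \<partial>lebesgue_on K) \<le> (\<integral>x. (norm (J (un n) x - rep_l2 X x))\<^sup>2 \<partial>lebesgue_on \<Omega>)"
        using bound by (intro always_eventually allI) (rule order_trans)
    qed
    from integral_norm_tendsto_0_compact[OF K(1) d2 this] c1 w1 \<open>\<gamma>' h \<in> L2 K\<close> show ?thesis by blast
  qed
  have \<gamma>L: "\<gamma>' h \<in> L2_loc \<Omega>" for h unfolding L2_loc_def using local by blast
  have weak: "has_weak_pdiff \<Omega> h u (\<gamma>' h)" for h
    by (rule has_weak_pdiff_limit[where us=un and gs="\<lambda>n. wpdiff \<Omega> h (un n)", OF open_\<Omega> has_weak_pdiff_wpdiff[OF P(2)] L2_loc_L1_loc[OF L2_L2_loc[OF \<Omega>_sets uL2]] L2_loc_L1_loc[OF \<gamma>L]])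
       (simp_all add: local)
  have uW: "u \<in> W12_loc \<Omega>" unfolding W12_loc_def using L2_L2_loc[OF \<Omega>_sets uL2] \<gamma>L weak by blast
  have "AE x in lebesgue_on \<Omega>. \<forall>h\<in>UNIV. wpdiff \<Omega> h u x = \<gamma>' h x"
    by (rule AE_finite_allI) (simp_all add: wpdiff_AE_eqI[OF open_\<Omega> uW weak])
  with ae_X have Ju: "AE x in lebesgue_on \<Omega>. rep_l2 X x = J u x"
    by eventually_elim (simp add: energy_vector_def wgrad_def)
  have JuL2: "J u \<in> L2 \<Omega>" by (rule extend_l2_cong(1)[OF \<Omega>_sets XL2 Ju])
  have \<iota>u: "\<iota> u = X" using extend_l2_cong(2)[OF \<Omega>_sets XL2 Ju] extX by simp
  have "u \<in> \<V>" using \<V>_limit[of un u, OF un(1) uW JuL2] lim_un \<iota>u by simp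
  then show "X \<in> \<iota> ` \<V>" using \<iota>u by blast
qed

end

section \<open>The form\<close>

lemma measurable_vec_nth: "f \<in> borel_measurable M \<Longrightarrow> (\<lambda>x. f x $ i) \<in> borel_measurable M" for f :: "'a \<Rightarrow> 'b::euclidean_space ^ 'n"
  by (rule measurable_compose[where g="\<lambda>v. v $ i", OF _ borel_measurable_continuous_onI]) (assumption, intro continuous_intros)

lemma measurable_cinner_cmat:
  fixes p :: "'a \<Rightarrow> complex^'n" and q :: "'a \<Rightarrow> complex^'m" and N :: "'a \<Rightarrow> real^'n^'m"
  assumes "N \<in> borel_measurable M" "p \<in> borel_measurable M" "q \<in> borel_measurable M"
  shows "(\<lambda>x. cinner (cmat (N x) *v p x) (q x)) \<in> borel_measurable M"
proof -
  have m [measurable]: "(\<lambda>x. N x $ i $ j) \<in> borel_measurable M" "(\<lambda>x. p x $ j) \<in> borel_measurable M"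
    "(\<lambda>x. q x $ i) \<in> borel_measurable M" for i j
    by (intro measurable_vec_nth assms)+
  have [measurable]: "(\<lambda>x. cnj (q x $ i)) \<in> borel_measurable M" for i
    by (rule measurable_compose[where g=cnj, OF m(3) borel_measurable_continuous_onI[OF continuous_on_cnj[OF continuous_on_id]]])
  show ?thesis unfolding cinner_def cmat_vec_nth by measurable
qed

lemma measurable_cinner:
  fixes p q :: "'a \<Rightarrow> complex^'n"
  assumes "p \<in> borel_measurable M" "q \<in> borel_measurable M"
  shows "(\<lambda>x. cinner (p x) (q x)) \<in> borel_measurable M"
  using measurable_cinner_cmat[of "\<lambda>x. mat 1", OF _ assms] by (simp add: cmat_mat)

lemma integrable_cinner:
  fixes f g :: "'a::euclidean_space \<Rightarrow> complex^'m"
  assumes "f \<in> L2 \<Omega>" "g \<in> L2 \<Omega>"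
  shows "integrable (lebesgue_on \<Omega>) (\<lambda>x. cinner (f x) (g x))"
proof (rule Bochner_Integration.integrable_bound)
  show "integrable (lebesgue_on \<Omega>) (\<lambda>x. (norm (f x))\<^sup>2 + (norm (g x))\<^sup>2)"
    using assms by (intro Bochner_Integration.integrable_add) (simp_all add: L2_def)
  show "(\<lambda>x. cinner (f x) (g x)) \<in> borel_measurable (lebesgue_on \<Omega>)"
    using assms by (intro measurable_cinner) (simp_all add: L2_def)
  show "AE x in lebesgue_on \<Omega>. norm (cinner (f x) (g x)) \<le> norm ((norm (f x))\<^sup>2 + (norm (g x))\<^sup>2)"
  proof (rule AE_I2)
    fix x
    have "2 * norm (f x) * norm (g x) \<le> (norm (f x))\<^sup>2 + (norm (g x))\<^sup>2" by (rule sum_squares_bound)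
    with cmod_cinner_le[of "f x" "g x"] show "norm (cinner (f x) (g x)) \<le> norm ((norm (f x))\<^sup>2 + (norm (g x))\<^sup>2)"
      by simp
  qed
qed

definition ip_L2 :: "'a::euclidean_space set \<Rightarrow> ('a \<Rightarrow> complex^'m) \<Rightarrow> ('a \<Rightarrow> complex^'m) \<Rightarrow> complex" where
  "ip_L2 \<Omega> f g = (\<integral>x. cinner (f x) (g x) \<partial>lebesgue_on \<Omega>)"

lemma ip_L2_add_left:
  "f \<in> L2 \<Omega> \<Longrightarrow> g \<in> L2 \<Omega> \<Longrightarrow> h \<in> L2 \<Omega> \<Longrightarrow> ip_L2 \<Omega> (\<lambda>x. f x + g x) h = ip_L2 \<Omega> f h + ip_L2 \<Omega> g h"
  unfolding ip_L2_def cinner_add_left by (intro Bochner_Integration.integral_add integrable_cinner)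

lemma ip_L2_add_right:
  "f \<in> L2 \<Omega> \<Longrightarrow> g \<in> L2 \<Omega> \<Longrightarrow> h \<in> L2 \<Omega> \<Longrightarrow> ip_L2 \<Omega> h (\<lambda>x. f x + g x) = ip_L2 \<Omega> h f + ip_L2 \<Omega> h g"
  unfolding ip_L2_def cinner_add_right by (intro Bochner_Integration.integral_add integrable_cinner)

lemma ip_L2_scale_left: "ip_L2 \<Omega> (\<lambda>x. c *s f x) g = c * ip_L2 \<Omega> f g"
  unfolding ip_L2_def cinner_scale_left by simp

lemma ip_L2_scale_right: "ip_L2 \<Omega> g (\<lambda>x. c *s f x) = cnj c * ip_L2 \<Omega> g f"
  unfolding ip_L2_def cinner_scale_right by simp

lemma ip_L2_diff_left:
  assumes "f \<in> L2 \<Omega>" "g \<in> L2 \<Omega>" "h \<in> L2 \<Omega>"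
  shows "ip_L2 \<Omega> (\<lambda>x. f x - g x) h = ip_L2 \<Omega> f h - ip_L2 \<Omega> g h"
proof -
  have "cinner (f x - g x) (h x) = cinner (f x) (h x) - cinner (g x) (h x)" for x
    using cinner_add_left[of "f x - g x" "g x" "h x"] by simp
  then show ?thesis unfolding ip_L2_def using assms by (simp add: Bochner_Integration.integral_diff integrable_cinner)
qed

lemma ip_L2_cong:
  fixes f g f' g' :: "'a::euclidean_space \<Rightarrow> complex^'m"
  assumes "f \<in> L2 \<Omega>" "g \<in> L2 \<Omega>" "f' \<in> L2 \<Omega>" "g' \<in> L2 \<Omega>"
    and ae: "AE x in lebesgue_on \<Omega>. f x = f' x" "AE x in lebesgue_on \<Omega>. g x = g' x"
  shows "ip_L2 \<Omega> f g = ip_L2 \<Omega> f' g'"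
  unfolding ip_L2_def
  by (rule integral_cong_AE[OF borel_measurable_integrable[OF integrable_cinner[OF assms(1,2)]]
        borel_measurable_integrable[OF integrable_cinner[OF assms(3,4)]]])
     (use ae in eventually_elim, simp)

lemma Re_ip_L2:
  assumes "\<Omega> \<in> sets lebesgue" "f \<in> L2 \<Omega>" "g \<in> L2 \<Omega>"
  shows "Re (ip_L2 \<Omega> f g) = inner (extend_l2 \<Omega> f) (extend_l2 \<Omega> g)"
  unfolding ip_L2_def integral_Re[OF integrable_cinner[OF assms(2,3)], symmetric] inner_extend_l2[OF assms] Re_cinner ..

lemma ip_L2_self:
  assumes "\<Omega> \<in> sets lebesgue" "f \<in> L2 \<Omega>"
  shows "ip_L2 \<Omega> f f = complex_of_real ((norm (extend_l2 \<Omega> f))\<^sup>2)"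
  unfolding ip_L2_def cinner_self power2_norm_eq_inner inner_extend_l2[OF assms(1) assms(2) assms(2)]
  by (rule integral_complex_of_real)

section \<open>The form on its domain: integrability, sesquilinearity, integrated bounds\<close>

context elliptic_form
begin

definition form_density :: "(real^'d \<Rightarrow> complex^'m) \<Rightarrow> (real^'d \<Rightarrow> complex^'m) \<Rightarrow> real^'d \<Rightarrow> complex" where
  "form_density u v x = jet_form (Q x) (\<lambda>h k. A h k x) (\<lambda>h. B h x) (\<lambda>h. C h x) (V x) (W x)
     (sobolev_jet \<Omega> u x) (sobolev_jet \<Omega> v x)"

abbreviation "\<a> \<equiv> form_a \<Omega> Q A B C V W"
abbreviation "\<beta> \<equiv> form_bound v\<^sub>0 c\<^sub>0 \<kappa>\<^sub>A \<kappa>\<^sub>B \<kappa>\<^sub>C \<kappa>\<^sub>W \<gamma> C\<^sub>\<gamma>"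
abbreviation "\<alpha> \<equiv> form_coercivity v\<^sub>0 \<kappa>\<^sub>B \<kappa>\<^sub>C \<kappa>\<^sub>W \<gamma> C\<^sub>\<gamma>"
abbreviation "\<omega> \<equiv> C\<^sub>\<gamma> * (\<kappa>\<^sub>W + (\<kappa>\<^sub>B + \<kappa>\<^sub>C)\<^sup>2 / 4)"

lemma form_a_eq: "\<a> u v = (\<integral>x. form_density u v x \<partial>lebesgue_on \<Omega>)"
  unfolding form_a_def form_density_def jet_form_def sobolev_jet_def fst_conv snd_conv ..

lemma \<beta>_nonneg: "0 \<le> \<beta>"
  using const_signs v\<^sub>0_pos unfolding form_bound_def by (intro add_nonneg_nonneg mult_nonneg_nonneg divide_nonneg_nonneg) auto

lemma \<omega>_nonneg: "0 \<le> \<omega>"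
  using const_signs by (intro mult_nonneg_nonneg add_nonneg_nonneg) auto

lemma \<alpha>_pos: "0 < \<alpha>"
proof -
  have "(\<kappa>\<^sub>B + \<kappa>\<^sub>C)\<^sup>2 < 4 * (1 / \<gamma> - \<kappa>\<^sub>W)" using K_pos by simp
  then have "\<gamma> * (\<kappa>\<^sub>B + \<kappa>\<^sub>C)\<^sup>2 < \<gamma> * (4 * (1 / \<gamma> - \<kappa>\<^sub>W))" using const_signs by (intro mult_strict_left_mono)
  also have "\<dots> = 4 * (1 - \<gamma> * \<kappa>\<^sub>W)" using const_signs by (simp add: field_simps)
  finally have \<delta>: "0 < 1 - \<gamma> * \<kappa>\<^sub>W - \<gamma> * (\<kappa>\<^sub>B + \<kappa>\<^sub>C)\<^sup>2 / 4" by simp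
  have "0 \<le> (\<kappa>\<^sub>B + \<kappa>\<^sub>C)\<^sup>2 * (\<gamma> + C\<^sub>\<gamma> / v\<^sub>0)" using const_signs v\<^sub>0_pos by (intro mult_nonneg_nonneg add_nonneg_nonneg) auto
  then have "0 < (\<kappa>\<^sub>B + \<kappa>\<^sub>C)\<^sup>2 * (\<gamma> + C\<^sub>\<gamma> / v\<^sub>0) + 1" by simp
  with \<delta> show ?thesis unfolding form_coercivity_def Let_def by (simp only: min_less_iff_conj divide_pos_pos half_gt_zero_iff zero_less_one simp_thms)
qed

lemma form_density_measurable:
  assumes u: "u \<in> \<V>" and v: "v \<in> \<V>"
  shows "form_density u v \<in> borel_measurable (lebesgue_on \<Omega>)"
proof -
  note w = wpdiff_measurable[OF open_\<Omega> \<V>_props(2)[OF u]] wpdiff_measurable[OF open_\<Omega> \<V>_props(2)[OF v]]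
  note m = L2_measurable[OF \<V>_props(3)[OF u]] L2_measurable[OF \<V>_props(3)[OF v]]
  have mat: "mat r = r *\<^sub>R (mat 1 :: real^'m^'m)" for r by (simp add: vec_eq_iff mat_def)
  have q: "(\<lambda>x. mat (Q x $ h $ k) + A h k x) \<in> borel_measurable (lebesgue_on \<Omega>)" for h k
    unfolding mat[of "Q _ $ h $ k"] using Q_measurable[of h k] coefficients_measurable(1)[of h k] by measurable
  have vw: "(\<lambda>x. V x + W x) \<in> borel_measurable (lebesgue_on \<Omega>)"
    using coefficients_measurable(4,5) by measurable
  show ?thesis
    unfolding form_density_def[abs_def] jet_form_def sobolev_jet_def fst_conv snd_conv
    by (intro borel_measurable_add borel_measurable_sum measurable_cinner_cmat w m q vw coefficients_measurable)
qed

lemma energy_le: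
  assumes "coefficients_at_point (Q x) (\<lambda>h k. A h k x) (\<lambda>h. B h x) (\<lambda>h. C h x) (V x) (W x) v\<^sub>0 c\<^sub>0 \<kappa>\<^sub>A \<kappa>\<^sub>B \<kappa>\<^sub>C \<kappa>\<^sub>W \<gamma> C\<^sub>\<gamma>"
  shows "Re (jet_energy (Q x) (V x) (sobolev_jet \<Omega> u x) (sobolev_jet \<Omega> u x)) = (norm (J u x))\<^sup>2 - (norm (u x))\<^sup>2"
proof -
  have s: "snd (sobolev_jet \<Omega> u x) = u x" by (simp add: sobolev_jet_def)
  show ?thesis
    unfolding coefficients_at_point.jet_energy_eq[OF assms] norm_energy_vector jet_gradient_sobolev_jet s Re_complex_of_real by linarith
qed

lemma form_density_bounds:
  "AE x in lebesgue_on \<Omega>. norm (form_density u v x) \<le> \<beta> * ((norm (J u x))\<^sup>2 + (norm (J v x))\<^sup>2)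
    \<and> norm (form_density u u x) \<le> \<beta> * ((norm (J u x))\<^sup>2 - (norm (u x))\<^sup>2)
    \<and> \<alpha> * ((norm (J u x))\<^sup>2 - (norm (u x))\<^sup>2) \<le> Re (form_density u u x) + \<omega> * (norm (u x))\<^sup>2
    \<and> v\<^sub>0 * (norm (u x))\<^sup>2 \<le> (norm (J u x))\<^sup>2 - (norm (u x))\<^sup>2"
  using coefficients
proof eventually_elim
  case (elim x)
  interpret coefficients_at_point "Q x" "\<lambda>h k. A h k x" "\<lambda>h. B h x" "\<lambda>h. C h x" "V x" "W x"
    v\<^sub>0 c\<^sub>0 \<kappa>\<^sub>A \<kappa>\<^sub>B \<kappa>\<^sub>C \<kappa>\<^sub>W \<gamma> C\<^sub>\<gamma> by (rule elim)
  have s: "snd (sobolev_jet \<Omega> u x) = u x" by (simp add: sobolev_jet_def)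
  have "norm (form_density u v x) \<le> \<beta> * ((norm (J u x))\<^sup>2 - (norm (u x))\<^sup>2 + ((norm (J v x))\<^sup>2 - (norm (v x))\<^sup>2))"
    unfolding form_density_def energy_le[OF elim, symmetric] by (rule jet_form_le)
  also have "\<dots> \<le> \<beta> * ((norm (J u x))\<^sup>2 + (norm (J v x))\<^sup>2)" by (intro mult_left_mono \<beta>_nonneg) simp
  finally have 1: "norm (form_density u v x) \<le> \<beta> * ((norm (J u x))\<^sup>2 + (norm (J v x))\<^sup>2)" .
  have 2: "norm (form_density u u x) \<le> \<beta> * ((norm (J u x))\<^sup>2 - (norm (u x))\<^sup>2)"
    unfolding form_density_def energy_le[OF elim, symmetric] by (rule jet_form_bound)
  have 3: "\<alpha> * ((norm (J u x))\<^sup>2 - (norm (u x))\<^sup>2) \<le> Re (form_density u u x) + \<omega> * (norm (u x))\<^sup>2"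
    using jet_form_coercive[of "sobolev_jet \<Omega> u x"] unfolding form_density_def energy_le[OF elim] s .
  have 4: "v\<^sub>0 * (norm (u x))\<^sup>2 \<le> (norm (J u x))\<^sup>2 - (norm (u x))\<^sup>2"
    using v0_norm_le_energy[of "sobolev_jet \<Omega> u x"] unfolding energy_le[OF elim] s .
  from 1 2 3 4 show ?case by blast
qed

lemma form_density_integrable:
  assumes u: "u \<in> \<V>" and v: "v \<in> \<V>"
  shows "integrable (lebesgue_on \<Omega>) (form_density u v)"
proof (rule Bochner_Integration.integrable_bound)
  show "integrable (lebesgue_on \<Omega>) (\<lambda>x. \<beta> * ((norm (J u x))\<^sup>2 + (norm (J v x))\<^sup>2))"
    by (intro Bochner_Integration.integrable_add integrable_mult_right integrable_norm2 \<V>_props(4) u v)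
  show "form_density u v \<in> borel_measurable (lebesgue_on \<Omega>)" by (rule form_density_measurable[OF u v])
  show "AE x in lebesgue_on \<Omega>. norm (form_density u v x) \<le> norm (\<beta> * ((norm (J u x))\<^sup>2 + (norm (J v x))\<^sup>2))"
    using form_density_bounds[of u v] by eventually_elim auto
qed

lemma form_add_left:
  assumes u: "u \<in> \<V>" and u': "u' \<in> \<V>" and v: "v \<in> \<V>"
  shows "\<a> (\<lambda>x. u x + u' x) v = \<a> u v + \<a> u' v"
proof -
  have "\<a> (\<lambda>x. u x + u' x) v = (\<integral>x. form_density u v x + form_density u' v x \<partial>lebesgue_on \<Omega>)"
    unfolding form_a_eq
  proof (rule integral_cong_AE[OF form_density_measurable[OF \<V>_add[OF u u'] v] borel_measurable_add[OF form_density_measurable[OF u v] form_density_measurable[OF u' v]]])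
    show "AE x in lebesgue_on \<Omega>. form_density (\<lambda>x. u x + u' x) v x = form_density u v x + form_density u' v x"
      using sobolev_jet_add[OF open_\<Omega> \<V>_props(2)[OF u] \<V>_props(2)[OF u']]
      by eventually_elim (simp only: form_density_def jet_form_sesquilinear)
  qed
  also have "\<dots> = \<a> u v + \<a> u' v"
    unfolding form_a_eq by (rule Bochner_Integration.integral_add[OF form_density_integrable[OF u v] form_density_integrable[OF u' v]])
  finally show ?thesis .
qed

lemma form_add_right:
  assumes u: "u \<in> \<V>" and u': "u' \<in> \<V>" and v: "v \<in> \<V>"
  shows "\<a> v (\<lambda>x. u x + u' x) = \<a> v u + \<a> v u'"
proof -
  have "\<a> v (\<lambda>x. u x + u' x) = (\<integral>x. form_density v u x + form_density v u' x \<partial>lebesgue_on \<Omega>)"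
    unfolding form_a_eq
  proof (rule integral_cong_AE[OF form_density_measurable[OF v \<V>_add[OF u u']] borel_measurable_add[OF form_density_measurable[OF v u] form_density_measurable[OF v u']]])
    show "AE x in lebesgue_on \<Omega>. form_density v (\<lambda>x. u x + u' x) x = form_density v u x + form_density v u' x"
      using sobolev_jet_add[OF open_\<Omega> \<V>_props(2)[OF u] \<V>_props(2)[OF u']]
      by eventually_elim (simp only: form_density_def jet_form_sesquilinear)
  qed
  also have "\<dots> = \<a> v u + \<a> v u'"
    unfolding form_a_eq by (rule Bochner_Integration.integral_add[OF form_density_integrable[OF v u] form_density_integrable[OF v u']])
  finally show ?thesis .
qed

lemma form_scale:
  assumes u: "u \<in> \<V>" and v: "v \<in> \<V>"
  shows "\<a> (\<lambda>x. c *s u x) v = c * \<a> u v" "\<a> v (\<lambda>x. c *s u x) = cnj c * \<a> v u"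
proof -
  note jet = sobolev_jet_scale[OF open_\<Omega> \<V>_props(2)[OF u], of c]
  have "\<a> (\<lambda>x. c *s u x) v = (\<integral>x. c * form_density u v x \<partial>lebesgue_on \<Omega>)"
    unfolding form_a_eq
  proof (rule integral_cong_AE[OF form_density_measurable[OF \<V>_scale[OF u] v] borel_measurable_times[OF borel_measurable_const form_density_measurable[OF u v]]])
    show "AE x in lebesgue_on \<Omega>. form_density (\<lambda>x. c *s u x) v x = c * form_density u v x"
      using jet by eventually_elim (simp only: form_density_def jet_form_sesquilinear)
  qed
  then show "\<a> (\<lambda>x. c *s u x) v = c * \<a> u v" unfolding form_a_eq by simp
  have "\<a> v (\<lambda>x. c *s u x) = (\<integral>x. cnj c * form_density v u x \<partial>lebesgue_on \<Omega>)"
    unfolding form_a_eq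
  proof (rule integral_cong_AE[OF form_density_measurable[OF v \<V>_scale[OF u]] borel_measurable_times[OF borel_measurable_const form_density_measurable[OF v u]]])
    show "AE x in lebesgue_on \<Omega>. form_density v (\<lambda>x. c *s u x) x = cnj c * form_density v u x"
      using jet by eventually_elim (simp only: form_density_def jet_form_sesquilinear)
  qed
  then show "\<a> v (\<lambda>x. c *s u x) = cnj c * \<a> v u" unfolding form_a_eq by simp
qed

lemma form_cong:
  assumes u: "u \<in> \<V>" "u' \<in> \<V>" "AE x in lebesgue_on \<Omega>. u x = u' x"
    and v: "v \<in> \<V>" "v' \<in> \<V>" "AE x in lebesgue_on \<Omega>. v x = v' x"
  shows "\<a> u v = \<a> u' v'"
  unfolding form_a_eq
  by (rule integral_cong_AE[OF form_density_measurable[OF u(1) v(1)] form_density_measurable[OF u(2) v(2)]])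
     (use sobolev_jet_cong[OF open_\<Omega> \<V>_props(2)[OF u(1)] u(3)] sobolev_jet_cong[OF open_\<Omega> \<V>_props(2)[OF v(1)] v(3)] in eventually_elim,
      simp only: form_density_def)

abbreviation "\<epsilon> u \<equiv> extend_l2 \<Omega> u"

lemma integral_norm2: "f \<in> L2 \<Omega> \<Longrightarrow> (\<integral>x. (norm (f x))\<^sup>2 \<partial>lebesgue_on \<Omega>) = (norm (extend_l2 \<Omega> f))\<^sup>2"
  by (simp add: power2_norm_eq_inner inner_extend_l2[OF \<Omega>_sets])

text \<open>The difference of the squared norms of \<open>\<iota> u\<close> and
  \<open>\<epsilon> u\<close> is the squared energy norm of u. The estimates are the pointwise ones,
  integrated.\<close>

lemma form_bounds:
  assumes u: "u \<in> \<V>"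
  shows "v \<in> \<V> \<Longrightarrow> cmod (\<a> u v) \<le> \<beta> * ((norm (\<iota> u))\<^sup>2 + (norm (\<iota> v))\<^sup>2)"
    and "cmod (\<a> u u) \<le> \<beta> * ((norm (\<iota> u))\<^sup>2 - (norm (\<epsilon> u))\<^sup>2)"
    and "\<alpha> * ((norm (\<iota> u))\<^sup>2 - (norm (\<epsilon> u))\<^sup>2) \<le> Re (\<a> u u) + \<omega> * (norm (\<epsilon> u))\<^sup>2"
    and "v\<^sub>0 * (norm (\<epsilon> u))\<^sup>2 \<le> (norm (\<iota> u))\<^sup>2 - (norm (\<epsilon> u))\<^sup>2"
proof -
  note I = integrable_norm2[OF \<V>_props(4)] integrable_norm2[OF \<V>_props(3)[OF u]]
  note N = integral_norm2[OF \<V>_props(4)] integral_norm2[OF \<V>_props(3)[OF u]]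
  note d = Bochner_Integration.integral_diff[OF I(1)[OF u] I(2)]
  show "cmod (\<a> u v) \<le> \<beta> * ((norm (\<iota> u))\<^sup>2 + (norm (\<iota> v))\<^sup>2)" if v: "v \<in> \<V>"
  proof -
    have "cmod (\<a> u v) \<le> (\<integral>x. norm (form_density u v x) \<partial>lebesgue_on \<Omega>)"
      unfolding form_a_eq by (rule Bochner_Integration.integral_norm_bound)
    also have "\<dots> \<le> (\<integral>x. \<beta> * ((norm (J u x))\<^sup>2 + (norm (J v x))\<^sup>2) \<partial>lebesgue_on \<Omega>)"
      by (rule integral_mono_AE[OF integrable_norm[OF form_density_integrable[OF u v]] integrable_mult_right[OF Bochner_Integration.integrable_add[OF I(1)[OF u] I(1)[OF v]]]])
         (use form_density_bounds[of u v] in eventually_elim, blast)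
    also have "\<dots> = \<beta> * ((norm (\<iota> u))\<^sup>2 + (norm (\<iota> v))\<^sup>2)"
      unfolding integral_mult_right_zero Bochner_Integration.integral_add[OF I(1)[OF u] I(1)[OF v]] N(1)[OF u] N(1)[OF v] ..
    finally show ?thesis .
  qed
  note U = form_density_integrable[OF u u]
  have "cmod (\<a> u u) \<le> (\<integral>x. norm (form_density u u x) \<partial>lebesgue_on \<Omega>)"
    unfolding form_a_eq by (rule Bochner_Integration.integral_norm_bound)
  also have "\<dots> \<le> (\<integral>x. \<beta> * ((norm (J u x))\<^sup>2 - (norm (u x))\<^sup>2) \<partial>lebesgue_on \<Omega>)"
    by (rule integral_mono_AE[OF integrable_norm[OF U] integrable_mult_right[OF Bochner_Integration.integrable_diff[OF I(1)[OF u] I(2)]]])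
       (use form_density_bounds[of u u] in eventually_elim, blast)
  also have "\<dots> = \<beta> * ((norm (\<iota> u))\<^sup>2 - (norm (\<epsilon> u))\<^sup>2)"
    unfolding integral_mult_right_zero d N(1)[OF u] N(2) ..
  finally show "cmod (\<a> u u) \<le> \<beta> * ((norm (\<iota> u))\<^sup>2 - (norm (\<epsilon> u))\<^sup>2)" .
  have "\<alpha> * ((norm (\<iota> u))\<^sup>2 - (norm (\<epsilon> u))\<^sup>2) = (\<integral>x. \<alpha> * ((norm (J u x))\<^sup>2 - (norm (u x))\<^sup>2) \<partial>lebesgue_on \<Omega>)"
    unfolding integral_mult_right_zero d N(1)[OF u] N(2) ..
  also have "\<dots> \<le> (\<integral>x. Re (form_density u u x) + \<omega> * (norm (u x))\<^sup>2 \<partial>lebesgue_on \<Omega>)"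
    by (rule integral_mono_AE[OF integrable_mult_right[OF Bochner_Integration.integrable_diff[OF I(1)[OF u] I(2)]]
          Bochner_Integration.integrable_add[OF integrable_Re[OF U] integrable_mult_right[OF I(2)]]])
       (use form_density_bounds[of u u] in eventually_elim, blast)
  also have "\<dots> = Re (\<a> u u) + \<omega> * (norm (\<epsilon> u))\<^sup>2"
    unfolding Bochner_Integration.integral_add[OF integrable_Re[OF U] integrable_mult_right[OF I(2)]] integral_mult_right_zero
      N(2) integral_Re[OF U] form_a_eq ..
  finally show "\<alpha> * ((norm (\<iota> u))\<^sup>2 - (norm (\<epsilon> u))\<^sup>2) \<le> Re (\<a> u u) + \<omega> * (norm (\<epsilon> u))\<^sup>2" .
  have "v\<^sub>0 * (norm (\<epsilon> u))\<^sup>2 = (\<integral>x. v\<^sub>0 * (norm (u x))\<^sup>2 \<partial>lebesgue_on \<Omega>)"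
    unfolding integral_mult_right_zero N(2) ..
  also have "\<dots> \<le> (\<integral>x. (norm (J u x))\<^sup>2 - (norm (u x))\<^sup>2 \<partial>lebesgue_on \<Omega>)"
    by (rule integral_mono_AE[OF integrable_mult_right[OF I(2)] Bochner_Integration.integrable_diff[OF I(1)[OF u] I(2)]])
       (use form_density_bounds[of u u] in eventually_elim, blast)
  also have "\<dots> = (norm (\<iota> u))\<^sup>2 - (norm (\<epsilon> u))\<^sup>2"
    unfolding d N(1)[OF u] N(2) ..
  finally show "v\<^sub>0 * (norm (\<epsilon> u))\<^sup>2 \<le> (norm (\<iota> u))\<^sup>2 - (norm (\<epsilon> u))\<^sup>2" .
qed

end

section \<open>Weak solutions\<close>

text \<open>For unit vectors the sum of squares is 2; homogeneity in both arguments gives the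
  product of norms in general.\<close>

lemma bilinear_bound:
  fixes S :: "'a::real_normed_vector set"
  assumes S: "subspace S"
    and left: "\<And>r x y. x \<in> S \<Longrightarrow> y \<in> S \<Longrightarrow> f (r *\<^sub>R x) y = r * f x y"
    and right: "\<And>r x y. x \<in> S \<Longrightarrow> y \<in> S \<Longrightarrow> f x (r *\<^sub>R y) = r * f x y"
    and bound: "\<And>x y. x \<in> S \<Longrightarrow> y \<in> S \<Longrightarrow> \<bar>f x y\<bar> \<le> K * ((norm x)\<^sup>2 + (norm y)\<^sup>2)"
    and x: "x \<in> S" and y: "y \<in> S"
  shows "\<bar>f x y\<bar> \<le> 2 * K * norm x * norm (y :: 'a)"
proof (cases "x = 0 \<or> y = 0")
  case True
  then have "f x y = 0" using left[OF x y, of 0] right[OF x y, of 0] by auto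
  with True show ?thesis by auto
next
  case False
  let ?x = "(1 / norm x) *\<^sub>R x" and ?y = "(1 / norm y) *\<^sub>R y"
  have S': "?x \<in> S" "?y \<in> S" using S x y by (simp_all add: subspace_scale)
  have "norm ?x = 1" "norm ?y = 1" using False by simp_all
  with bound[OF S'] have "\<bar>f ?x ?y\<bar> \<le> K * (1\<^sup>2 + 1\<^sup>2)" by (simp only:)
  moreover have "f ?x ?y = f x y / (norm x * norm y)" by (simp add: left[OF x S'(2)] right[OF x y])
  ultimately show ?thesis using False by (simp add: abs_mult divide_le_eq mult_ac)
qed

lemma cinner_axis: "cinner x (axis i 1) = x $ i"
proof -
  have "(\<Sum>j\<in>UNIV. x $ j * cnj (axis i 1 $ j)) = (\<Sum>j\<in>UNIV. if j = i then x $ j else 0)"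
    by (rule sum.cong) (simp_all add: axis_def)
  then show ?thesis by (simp add: cinner_def)
qed

context elliptic_form
begin

definition shifted_form :: "(real^'d \<Rightarrow> complex^'m) \<Rightarrow> (real^'d \<Rightarrow> complex^'m) \<Rightarrow> complex" where
  "shifted_form u v = \<a> u v + complex_of_real \<omega> * ip_L2 \<Omega> u v"

text \<open>The upper bound of the shifted form relative to the energy, divided by its coercivity
  constant. It bounds the ratio of imaginary to real part and so fixes the opening of the
  sector.\<close>

definition \<mu> :: real where "\<mu> = (\<beta> + \<omega> / v\<^sub>0) / \<alpha>"

lemma \<mu>_pos: "0 < \<mu>"
proof -
  have "0 < \<beta>" using const_signs v\<^sub>0_pos unfolding form_bound_def
    by (intro add_pos_nonneg mult_nonneg_nonneg add_nonneg_nonneg divide_nonneg_nonneg) auto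
  then have "0 < \<beta> + \<omega> / v\<^sub>0" using \<omega>_nonneg v\<^sub>0_pos by (intro add_pos_nonneg divide_nonneg_nonneg) simp_all
  then show ?thesis unfolding \<mu>_def using \<alpha>_pos by (rule divide_pos_pos)
qed

text \<open>If b is the value of the shifted form, then Re (z b) = Re z Re b - Im z Im b, and |Im b|
  <= \<mu> Re b leaves the factor Re z - \<mu> |Im z|, positive in the sector.\<close>

lemma sector_bound:
  assumes u: "u \<in> \<V>" and z: "z \<in> open_sector \<mu>"
  shows "(Re z - \<mu> * \<bar>Im z\<bar>) * \<alpha> * ((norm (\<iota> u))\<^sup>2 - (norm (\<epsilon> u))\<^sup>2) \<le> Re (z * shifted_form u u)"
proof -
  let ?E = "(norm (\<iota> u))\<^sup>2 - (norm (\<epsilon> u))\<^sup>2" and ?b = "shifted_form u u"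
  note b = form_bounds[OF u]
  have ip: "ip_L2 \<Omega> u u = complex_of_real ((norm (\<epsilon> u))\<^sup>2)" by (rule ip_L2_self[OF \<Omega>_sets \<V>_props(3)[OF u]])
  have Re: "\<alpha> * ?E \<le> Re ?b" using b(3) unfolding shifted_form_def ip by simp
  have "\<omega> * (v\<^sub>0 * (norm (\<epsilon> u))\<^sup>2) \<le> \<omega> * ?E" by (rule mult_left_mono[OF b(4) \<omega>_nonneg])
  then have w: "\<omega> * (norm (\<epsilon> u))\<^sup>2 \<le> \<omega> / v\<^sub>0 * ?E" using v\<^sub>0_pos by (simp add: field_simps)
  have "\<bar>Im ?b\<bar> = \<bar>Im (\<a> u u)\<bar>" unfolding shifted_form_def ip by simp
  also have "\<dots> \<le> cmod (\<a> u u)" by (rule abs_Im_le_cmod)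
  also have "\<dots> \<le> \<beta> * ?E" by (rule b(2))
  also have "\<dots> \<le> (\<beta> + \<omega> / v\<^sub>0) * ?E"
    using w mult_nonneg_nonneg[OF \<omega>_nonneg zero_le_power2[of "norm (\<epsilon> u)"]] by (simp only: distrib_right)
  also have "\<dots> = \<mu> * (\<alpha> * ?E)" using \<alpha>_pos by (simp add: \<mu>_def)
  also have "\<dots> \<le> \<mu> * Re ?b" using \<mu>_pos by (intro mult_left_mono[OF Re]) simp
  finally have Im: "\<bar>Im ?b\<bar> \<le> \<mu> * Re ?b" .
  have "Im z * Im ?b \<le> \<bar>Im z\<bar> * \<bar>Im ?b\<bar>" using abs_ge_self[of "Im z * Im ?b"] by (simp only: abs_mult)
  also have "\<dots> \<le> \<bar>Im z\<bar> * (\<mu> * Re ?b)" by (rule mult_left_mono[OF Im abs_ge_zero])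
  finally have i: "Im z * Im ?b \<le> \<bar>Im z\<bar> * (\<mu> * Re ?b)" .
  have "0 \<le> Re z - \<mu> * \<bar>Im z\<bar>" using z unfolding open_sector_def by simp
  from mult_left_mono[OF Re this]
  have "(Re z - \<mu> * \<bar>Im z\<bar>) * \<alpha> * ?E \<le> (Re z - \<mu> * \<bar>Im z\<bar>) * Re ?b" by (simp only: mult.assoc)
  also have "\<dots> = Re z * Re ?b - \<bar>Im z\<bar> * (\<mu> * Re ?b)" by (simp add: algebra_simps)
  also have "\<dots> \<le> Re z * Re ?b - Im z * Im ?b" using i by linarith
  finally show ?thesis by simp
qed

text \<open>Density of the form domain in L2, in dual form. Plateaus times unit coordinate vectors
  belong to \<open>\<V>\<close> and isolate one component of g at a time.\<close>

lemma AE_zero_if_orthogonal: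
  assumes g: "g \<in> L2 \<Omega>" and orth: "\<And>\<phi>. \<phi> \<in> \<V> \<Longrightarrow> ip_L2 \<Omega> g \<phi> = 0"
  shows "AE x in lebesgue_on \<Omega>. g x = 0"
proof -
  have "AE x in lebesgue_on \<Omega>. g x $ i = 0" for i
  proof (rule test_functions_separate_L1_loc[OF open_\<Omega>])
    show "(\<lambda>x. g x $ i) \<in> L1_loc \<Omega>"
      by (rule L2_loc_L1_loc[OF L2_L2_loc[OF \<Omega>_sets extend_l2_bounded_linear(1)[OF \<Omega>_sets bounded_linear_vec_nth g]]])
    fix a b :: "real^'d" and n :: nat
    assume "cbox a b \<subseteq> \<Omega>"
    then have "(\<lambda>x. box_plateau a b n x *\<^sub>R (axis i 1 :: complex^'m)) \<in> \<V>"
      using test_function_box_plateau(2)[of a b \<Omega> n "axis i 1 :: complex^'m"] \<V>_test by blast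
    from orth[OF this] show "(\<integral>x. box_plateau a b n x *\<^sub>R g x $ i \<partial>lebesgue_on \<Omega>) = 0"
      unfolding ip_L2_def scaleR_eq_cscale cinner_scale_right cinner_axis by (simp add: scaleR_conv_of_real)
  qed
  then have "AE x in lebesgue_on \<Omega>. \<forall>i\<in>UNIV. g x $ i = 0" by (intro AE_finite_allI) simp_all
  then show ?thesis by eventually_elim (simp add: vec_eq_iff)
qed

lemma \<iota>_eq_imp_AE:
  assumes "u \<in> \<V>" "v \<in> \<V>" "\<iota> u = \<iota> v"
  shows "AE x in lebesgue_on \<Omega>. u x = v x"
proof -
  have "AE x in lebesgue_on \<Omega>. J u x = J v x"
    using assms(3) unfolding extend_l2_eq_iff[OF \<Omega>_sets \<V>_props(4)[OF assms(1)] \<V>_props(4)[OF assms(2)]] .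
  then show ?thesis by eventually_elim (simp add: energy_vector_def)
qed

text \<open>Closedness applied to a constant sequence: functions equal almost everywhere have the
  same image under the embedding.\<close>

lemma \<V>_AE_cong:
  assumes u: "u \<in> \<V>" and ae: "AE x in lebesgue_on \<Omega>. u x = v x"
  shows "v \<in> \<V>"
proof -
  have "AE x in lebesgue_on \<Omega>. J u x = J v x"
    using sobolev_jet_cong[OF open_\<Omega> \<V>_props(2)[OF u] ae] by eventually_elim (simp only: energy_vector_eq_jet)
  note E = extend_l2_cong[OF \<Omega>_sets \<V>_props(4)[OF u] this]
  show ?thesis
    by (rule \<V>_limit[of "\<lambda>_. u", OF u W12_loc_AE_cong[OF open_\<Omega> \<V>_props(2)[OF u] ae] E(1)]) (simp add: E(2))
qed

text \<open>Lax--Milgram lives on classes in a real Hilbert space, whereas the form takes functions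
  and complex values. The form is therefore transported through representatives and replaced by its
  real part; the imaginary part is regained at the end.\<close>

lemma weak_solution:
  assumes z: "z \<in> open_sector \<mu>" and f: "f \<in> L2 \<Omega>"
  obtains u where "u \<in> \<V>" "\<And>v. v \<in> \<V> \<Longrightarrow> ip_L2 \<Omega> u v + z * shifted_form u v = ip_L2 \<Omega> f v"
proof -
  let ?S = "\<iota> ` \<V>"
  \<comment> \<open>An arbitrary representative. The choice does not affect the values, since the
    form and the product respect equality almost everywhere (\<open>g_cong\<close>).\<close>
  define \<sigma> where "\<sigma> X = (SOME u. u \<in> \<V> \<and> \<iota> u = X)" for X
  define g where "g u v = ip_L2 \<Omega> u v + z * shifted_form u v" for u v
  have "\<sigma> X \<in> \<V> \<and> \<iota> (\<sigma> X) = X" if "X \<in> ?S" for X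
    unfolding \<sigma>_def by (rule someI_ex[where P="\<lambda>u. u \<in> \<V> \<and> \<iota> u = X"]) (use that in blast)
  then have \<sigma>: "\<sigma> X \<in> \<V>" "\<iota> (\<sigma> X) = X" if "X \<in> ?S" for X using that by blast+
  note L = \<V>_props(3)
  have g_cong: "g u v = g u' v'" if "u \<in> \<V>" "u' \<in> \<V>" "\<iota> u = \<iota> u'" "v \<in> \<V>" "v' \<in> \<V>" "\<iota> v = \<iota> v'" for u u' v v'
    using form_cong[OF that(1,2) \<iota>_eq_imp_AE[OF that(1,2,3)] that(4,5) \<iota>_eq_imp_AE[OF that(4,5,6)]]
      ip_L2_cong[OF L[OF that(1)] L[OF that(4)] L[OF that(2)] L[OF that(5)] \<iota>_eq_imp_AE[OF that(1,2,3)] \<iota>_eq_imp_AE[OF that(4,5,6)]]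
    unfolding g_def shifted_form_def by simp
  have g_scale: "g (\<lambda>x. c *s u x) v = c * g u v" "g v (\<lambda>x. c *s u x) = cnj c * g v u" if "u \<in> \<V>" "v \<in> \<V>" for u v c
    unfolding g_def shifted_form_def form_scale[OF that] ip_L2_scale_left ip_L2_scale_right by (simp_all add: algebra_simps)
  have g_add: "g (\<lambda>x. u x + u' x) v = g u v + g u' v" "g v (\<lambda>x. u x + u' x) = g v u + g v u'" if "u \<in> \<V>" "u' \<in> \<V>" "v \<in> \<V>" for u u' v
    unfolding g_def shifted_form_def form_add_left[OF that] form_add_right[OF that]
      ip_L2_add_left[OF L[OF that(1)] L[OF that(2)] L[OF that(3)]] ip_L2_add_right[OF L[OF that(1)] L[OF that(2)] L[OF that(3)]]
    by (simp_all add: algebra_simps)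
  define b where "b X Y = Re (g (\<sigma> X) (\<sigma> Y))" for X Y
  define l where "l X = Re (ip_L2 \<Omega> f (\<sigma> X))" for X
  have b_eq: "b (\<iota> u) (\<iota> v) = Re (g u v)" if u: "u \<in> \<V>" and v: "v \<in> \<V>" for u v
  proof -
    have "\<iota> u \<in> ?S" "\<iota> v \<in> ?S" using u v by blast+
    note s = \<sigma>[OF this(1)] \<sigma>[OF this(2)]
    show ?thesis unfolding b_def by (rule arg_cong[where f=Re]) (rule g_cong[OF s(1) u s(2) s(3) v s(4)])
  qed
  have l_eq: "l (\<iota> v) = Re (ip_L2 \<Omega> f v)" if v: "v \<in> \<V>" for v
  proof -
    have "\<iota> v \<in> ?S" using v by blast
    note s = \<sigma>[OF this]
    show ?thesis unfolding l_def
      by (rule arg_cong[where f=Re]) (rule ip_L2_cong[OF f L[OF s(1)] f L[OF v] _ \<iota>_eq_imp_AE[OF s(1) v s(2)]], simp)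
  qed
  have add_left: "b (X + Y) Z = b X Z + b Y Z" and add_right: "b Z (X + Y) = b Z X + b Z Y" and l_add: "l (X + Y) = l X + l Y"
    if XYZ: "X \<in> ?S" "Y \<in> ?S" "Z \<in> ?S" for X Y Z
  proof -
    from XYZ obtain u v w where uvw: "u \<in> \<V>" "v \<in> \<V>" "w \<in> \<V>" and eq: "X = \<iota> u" "Y = \<iota> v" "Z = \<iota> w" by blast
    note s = \<V>_add[OF uvw(1,2)]
    show "b (X + Y) Z = b X Z + b Y Z" "b Z (X + Y) = b Z X + b Z Y"
      unfolding eq \<iota>_add[OF uvw(1,2), symmetric] b_eq[OF s uvw(3)] b_eq[OF uvw(3) s] b_eq[OF uvw(1,3)] b_eq[OF uvw(2,3)]
        b_eq[OF uvw(3,1)] b_eq[OF uvw(3,2)] g_add[OF uvw] by simp_all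
    show "l (X + Y) = l X + l Y"
      unfolding eq \<iota>_add[OF uvw(1,2), symmetric] l_eq[OF s] l_eq[OF uvw(1)] l_eq[OF uvw(2)]
        ip_L2_add_right[OF L[OF uvw(1)] L[OF uvw(2)] f] by simp
  qed
  have scale_left: "b (r *\<^sub>R X) Y = r * b X Y" and scale_right: "b Y (r *\<^sub>R X) = r * b Y X" and l_scale: "l (r *\<^sub>R X) = r * l X"
    if XY: "X \<in> ?S" "Y \<in> ?S" for r X Y
  proof -
    from XY obtain u v where uv: "u \<in> \<V>" "v \<in> \<V>" and eq: "X = \<iota> u" "Y = \<iota> v" by blast
    have s: "(\<lambda>x. complex_of_real r *s u x) \<in> \<V>" by (rule \<V>_scale[OF uv(1)])
    have rX: "r *\<^sub>R \<iota> u = \<iota> (\<lambda>x. complex_of_real r *s u x)" using \<iota>_scaleR[OF uv(1), of r] unfolding scaleR_eq_cscale ..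
    show "b (r *\<^sub>R X) Y = r * b X Y" "b Y (r *\<^sub>R X) = r * b Y X"
      unfolding eq rX b_eq[OF s uv(2)] b_eq[OF uv(2) s] b_eq[OF uv] b_eq[OF uv(2,1)] g_scale[OF uv] by simp_all
    show "l (r *\<^sub>R X) = r * l X" unfolding eq rX l_eq[OF s] l_eq[OF uv(1)] ip_L2_scale_right by simp
  qed
  define K where "K = 1 + cmod z * (\<beta> + \<omega>)"
  have bound: "\<bar>b X Y\<bar> \<le> K * ((norm X)\<^sup>2 + (norm Y)\<^sup>2)" if XY: "X \<in> ?S" "Y \<in> ?S" for X Y
  proof -
    from XY obtain u v where uv: "u \<in> \<V>" "v \<in> \<V>" and eq: "X = \<iota> u" "Y = \<iota> v" by blast
    let ?N = "(norm (\<iota> u))\<^sup>2 + (norm (\<iota> v))\<^sup>2"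
    have "cmod (ip_L2 \<Omega> u v) \<le> (\<integral>x. norm (cinner (u x) (v x)) \<partial>lebesgue_on \<Omega>)"
      unfolding ip_L2_def by (rule Bochner_Integration.integral_norm_bound)
    also have "\<dots> \<le> (\<integral>x. (norm (u x))\<^sup>2 + (norm (v x))\<^sup>2 \<partial>lebesgue_on \<Omega>)"
    proof (rule integral_mono[OF integrable_norm[OF integrable_cinner[OF L[OF uv(1)] L[OF uv(2)]]]
          Bochner_Integration.integrable_add[OF integrable_norm2[OF L[OF uv(1)]] integrable_norm2[OF L[OF uv(2)]]]])
      fix x
      show "norm (cinner (u x) (v x)) \<le> (norm (u x))\<^sup>2 + (norm (v x))\<^sup>2"
        using cmod_cinner_le[of "u x" "v x"] sum_squares_bound[of "norm (u x)" "norm (v x)"] by simp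
    qed
    also have "\<dots> = (norm (\<epsilon> u))\<^sup>2 + (norm (\<epsilon> v))\<^sup>2"
      unfolding Bochner_Integration.integral_add[OF integrable_norm2[OF L[OF uv(1)]] integrable_norm2[OF L[OF uv(2)]]]
        integral_norm2[OF L[OF uv(1)]] integral_norm2[OF L[OF uv(2)]] ..
    also have "\<dots> \<le> ?N"
      using norm_extend_le_\<iota>[OF L[OF uv(1)] \<V>_props(4)[OF uv(1)]] norm_extend_le_\<iota>[OF L[OF uv(2)] \<V>_props(4)[OF uv(2)]]
      by (intro add_mono power_mono) simp_all
    finally have ip: "cmod (ip_L2 \<Omega> u v) \<le> ?N" .
    have "cmod (shifted_form u v) \<le> cmod (\<a> u v) + \<omega> * cmod (ip_L2 \<Omega> u v)"
      unfolding shifted_form_def using norm_triangle_ineq[of "\<a> u v" "complex_of_real \<omega> * ip_L2 \<Omega> u v"] \<omega>_nonneg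
      by (simp only: norm_mult norm_of_real abs_of_nonneg)
    also have "\<dots> \<le> \<beta> * ?N + \<omega> * ?N" by (rule add_mono[OF form_bounds(1)[OF uv] mult_left_mono[OF ip \<omega>_nonneg]])
    finally have sf: "cmod (shifted_form u v) \<le> (\<beta> + \<omega>) * ?N" by (simp only: distrib_right)
    have "\<bar>b X Y\<bar> \<le> cmod (g u v)" unfolding eq b_eq[OF uv] by (rule abs_Re_le_cmod)
    also have "\<dots> \<le> cmod (ip_L2 \<Omega> u v) + cmod z * cmod (shifted_form u v)"
      unfolding g_def using norm_triangle_ineq[of "ip_L2 \<Omega> u v" "z * shifted_form u v"] by (simp only: norm_mult)
    also have "\<dots> \<le> ?N + cmod z * ((\<beta> + \<omega>) * ?N)" by (rule add_mono[OF ip mult_left_mono[OF sf norm_ge_zero]])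
    finally show ?thesis unfolding eq K_def by (simp only: distrib_right mult_1 mult.assoc)
  qed
  \<comment> \<open>How far z lies inside the sector. The squared norm of \<open>\<iota> u\<close>
    is the L2 part plus the energy; the first has coefficient 1 and the second k \<alpha>, so their
    minimum is a coercivity constant.\<close>
  define k where "k = Re z - \<mu> * \<bar>Im z\<bar>"
  have k: "k > 0" using z unfolding open_sector_def k_def by simp
  have coercive: "min 1 (k * \<alpha>) * (norm X)\<^sup>2 \<le> b X X" if X: "X \<in> ?S" for X
  proof -
    from X obtain u where u: "u \<in> \<V>" and eq: "X = \<iota> u" by blast
    have le: "(norm (\<epsilon> u))\<^sup>2 \<le> (norm (\<iota> u))\<^sup>2"
      using norm_extend_le_\<iota>[OF L[OF u] \<V>_props(4)[OF u]] by (intro power_mono) simp_all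
    have "min 1 (k * \<alpha>) * (norm (\<iota> u))\<^sup>2
        = min 1 (k * \<alpha>) * (norm (\<epsilon> u))\<^sup>2 + min 1 (k * \<alpha>) * ((norm (\<iota> u))\<^sup>2 - (norm (\<epsilon> u))\<^sup>2)" by (simp only: right_diff_distrib)
    also have "\<dots> \<le> 1 * (norm (\<epsilon> u))\<^sup>2 + k * \<alpha> * ((norm (\<iota> u))\<^sup>2 - (norm (\<epsilon> u))\<^sup>2)"
      using le by (intro add_mono mult_right_mono) simp_all
    also have "\<dots> \<le> (norm (\<epsilon> u))\<^sup>2 + Re (z * shifted_form u u)" using sector_bound[OF u z] unfolding k_def by simp
    also have "\<dots> = b X X" unfolding eq b_eq[OF u u] g_def ip_L2_self[OF \<Omega>_sets L[OF u]] by simp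
    finally show ?thesis unfolding eq .
  qed
  have l_bound: "\<bar>l X\<bar> \<le> norm (\<epsilon> f) * norm X" if X: "X \<in> ?S" for X
  proof -
    from X obtain u where u: "u \<in> \<V>" and eq: "X = \<iota> u" by blast
    have "\<bar>l X\<bar> \<le> norm (\<epsilon> f) * norm (\<epsilon> u)"
      unfolding eq l_eq[OF u] Re_ip_L2[OF \<Omega>_sets f L[OF u]] by (rule Cauchy_Schwarz_ineq2)
    also have "\<dots> \<le> norm (\<epsilon> f) * norm (\<iota> u)"
      using norm_extend_le_\<iota>[OF L[OF u] \<V>_props(4)[OF u]] by (rule mult_left_mono) simp
    finally show ?thesis unfolding eq .
  qed
  have pos: "0 < min 1 (k * \<alpha>)" using mult_pos_pos[OF k \<alpha>_pos] by simp
  have zero: "\<iota> (\<lambda>x. 0) \<in> ?S" by (rule imageI[OF \<V>_zero])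
  have bil: "\<bar>b X Y\<bar> \<le> 2 * K * norm X * norm Y" if "X \<in> ?S" "Y \<in> ?S" for X Y
    by (rule bilinear_bound[where S="?S" and f=b, OF subspace_\<iota> scale_left scale_right bound that])
  obtain X where X: "X \<in> ?S" "\<And>Y. Y \<in> ?S \<Longrightarrow> b X Y = l Y"
    by (rule lax_milgram_on_closed_subspace[where S="?S" and \<beta>=b and l=l,
          OF subspace_\<iota> closed_\<iota> add_left add_right scale_left scale_right bil pos coercive l_add[OF _ _ zero] l_scale[OF _ zero] l_bound]) (assumption | rule that)+
  from X(1) obtain u where u: "u \<in> \<V>" and eq: "X = \<iota> u" by blast
  have Re_eq: "Re (g u v) = Re (ip_L2 \<Omega> f v)" if v: "v \<in> \<V>" for v
    using X(2)[OF imageI[OF v]] unfolding eq b_eq[OF u v] l_eq[OF v] .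
  \<comment> \<open>Testing with i v multiplies both sides by -i, so the equality of real parts
    there is the equality of imaginary parts for v.\<close>
  have "g u v = ip_L2 \<Omega> f v" if v: "v \<in> \<V>" for v
    using Re_eq[OF v] Re_eq[OF \<V>_scale[OF v], of \<i>] unfolding g_scale(2)[OF v u] ip_L2_scale_right by (simp add: complex_eq_iff)
  with u show thesis unfolding g_def by (rule that)
qed

section \<open>The associated operator\<close>

text \<open>Restriction to \<Omega> followed by extension by zero: the orthogonal projection onto
  the classes that vanish outside \<Omega>.\<close>

definition proj_l2 :: "(real^'d, complex^'m) l2 \<Rightarrow> (real^'d, complex^'m) l2" where
  "proj_l2 X = \<epsilon> (rep_l2 X)"

lemma proj_l2_eqI:
  assumes f: "f \<in> L2 \<Omega>" and ae: "AE x in lebesgue. rep_l2 X x = f x"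
  shows "proj_l2 X = \<epsilon> f"
proof -
  have "AE x in lebesgue_on \<Omega>. rep_l2 X x = f x"
    unfolding AE_lebesgue_on_iff[OF \<Omega>_sets] using ae by eventually_elim simp
  then show ?thesis unfolding proj_l2_def by (rule extend_l2_cong(2)[OF \<Omega>_sets rep_l2_in_L2[OF \<Omega>_sets]])
qed

lemma proj_l2_add: "proj_l2 (X + Y) = proj_l2 X + proj_l2 Y"
proof -
  note E = extend_l2_add[OF \<Omega>_sets rep_l2_in_L2[OF \<Omega>_sets, of X] rep_l2_in_L2[OF \<Omega>_sets, of Y]]
  show ?thesis using proj_l2_eqI[OF E(1) rep_l2_add] unfolding E(2) proj_l2_def .
qed

lemma proj_l2_scale: "proj_l2 (scale_l2 c X) = scale_l2 c (proj_l2 X)"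
proof -
  note E = extend_l2_cscale[OF \<Omega>_sets rep_l2_in_L2[OF \<Omega>_sets, of X], of c]
  show ?thesis using proj_l2_eqI[OF E(1) rep_scale_l2] unfolding E(2) proj_l2_def .
qed

lemma proj_l2_extend: "f \<in> L2 \<Omega> \<Longrightarrow> proj_l2 (\<epsilon> f) = \<epsilon> f"
  unfolding proj_l2_def by (rule extend_rep_extend_l2[OF \<Omega>_sets])

lemma proj_l2_proj_l2: "proj_l2 (proj_l2 X) = proj_l2 X"
  using proj_l2_extend[OF rep_l2_in_L2[OF \<Omega>_sets, of X]] unfolding proj_l2_def .

lemma proj_l2_scaleR: "proj_l2 (r *\<^sub>R X) = r *\<^sub>R proj_l2 X"
  using proj_l2_scale[of "complex_of_real r" X] by (simp only: l2.sc_of_real)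

lemma proj_l2_diff: "proj_l2 (X - Y) = proj_l2 X - proj_l2 Y"
  using proj_l2_add[of "X - Y" Y] by (simp add: eq_diff_eq)

lemma inner_extend_proj: "f \<in> L2 \<Omega> \<Longrightarrow> inner (\<epsilon> f) X = inner (\<epsilon> f) (proj_l2 X)"
  unfolding proj_l2_def by (rule inner_extend_l2_left[OF \<Omega>_sets])

abbreviation "\<A> \<equiv> form_operator \<Omega> \<V> \<a>"

lemma form_operator_iff:
  "(u, w) \<in> \<A> \<longleftrightarrow> u \<in> \<V> \<and> w \<in> L2 \<Omega> \<and> (\<forall>\<phi>\<in>\<V>. ip_L2 \<Omega> w \<phi> = \<a> u \<phi>)"
  unfolding form_operator_def ip_L2_def by simp

lemma form_operator_add:
  assumes "(u, w) \<in> \<A>" "(u', w') \<in> \<A>"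
  shows "(\<lambda>x. u x + u' x, \<lambda>x. w x + w' x) \<in> \<A>"
proof -
  have a: "u \<in> \<V>" "w \<in> L2 \<Omega>" "u' \<in> \<V>" "w' \<in> L2 \<Omega>"
    and eq: "\<And>\<phi>. \<phi> \<in> \<V> \<Longrightarrow> ip_L2 \<Omega> w \<phi> = \<a> u \<phi>" "\<And>\<phi>. \<phi> \<in> \<V> \<Longrightarrow> ip_L2 \<Omega> w' \<phi> = \<a> u' \<phi>"
    using assms unfolding form_operator_iff by blast+
  show ?thesis unfolding form_operator_iff
  proof (intro conjI ballI)
    show "(\<lambda>x. u x + u' x) \<in> \<V>" by (rule \<V>_add[OF a(1,3)])
    show "(\<lambda>x. w x + w' x) \<in> L2 \<Omega>" by (rule extend_l2_add(1)[OF \<Omega>_sets a(2,4)])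
    fix \<phi> assume \<phi>: "\<phi> \<in> \<V>"
    show "ip_L2 \<Omega> (\<lambda>x. w x + w' x) \<phi> = \<a> (\<lambda>x. u x + u' x) \<phi>"
      unfolding ip_L2_add_left[OF a(2,4) \<V>_props(3)[OF \<phi>]] form_add_left[OF a(1,3) \<phi>] eq[OF \<phi>] ..
  qed
qed

lemma form_operator_scale:
  assumes "(u, w) \<in> \<A>"
  shows "(\<lambda>x. c *s u x, \<lambda>x. c *s w x) \<in> \<A>"
proof -
  have a: "u \<in> \<V>" "w \<in> L2 \<Omega>" and eq: "\<And>\<phi>. \<phi> \<in> \<V> \<Longrightarrow> ip_L2 \<Omega> w \<phi> = \<a> u \<phi>"
    using assms unfolding form_operator_iff by blast+
  show ?thesis unfolding form_operator_iff
  proof (intro conjI ballI)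
    show "(\<lambda>x. c *s u x) \<in> \<V>" by (rule \<V>_scale[OF a(1)])
    show "(\<lambda>x. c *s w x) \<in> L2 \<Omega>" by (rule extend_l2_cscale(1)[OF \<Omega>_sets a(2)])
    fix \<phi> assume \<phi>: "\<phi> \<in> \<V>"
    show "ip_L2 \<Omega> (\<lambda>x. c *s w x) \<phi> = \<a> (\<lambda>x. c *s u x) \<phi>"
      unfolding ip_L2_scale_left form_scale(1)[OF a(1) \<phi>] eq[OF \<phi>] ..
  qed
qed

lemma form_operator_AE_cong:
  assumes uw: "(u, w) \<in> \<A>" and u: "AE x in lebesgue_on \<Omega>. u x = u' x" and w: "AE x in lebesgue_on \<Omega>. w x = w' x"
  shows "(u', w') \<in> \<A>"
proof -
  have a: "u \<in> \<V>" "w \<in> L2 \<Omega>" and eq: "\<And>\<phi>. \<phi> \<in> \<V> \<Longrightarrow> ip_L2 \<Omega> w \<phi> = \<a> u \<phi>"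
    using uw unfolding form_operator_iff by blast+
  show ?thesis unfolding form_operator_iff
  proof (intro conjI ballI)
    show u': "u' \<in> \<V>" by (rule \<V>_AE_cong[OF a(1) u])
    show w': "w' \<in> L2 \<Omega>" by (rule extend_l2_cong(1)[OF \<Omega>_sets a(2) w])
    fix \<phi> assume \<phi>: "\<phi> \<in> \<V>"
    have "ip_L2 \<Omega> w' \<phi> = ip_L2 \<Omega> w \<phi>"
      by (rule ip_L2_cong[OF a(2) \<V>_props(3)[OF \<phi>] w' \<V>_props(3)[OF \<phi>] w, symmetric]) simp
    also have "\<dots> = \<a> u' \<phi>" unfolding eq[OF \<phi>] by (rule form_cong[OF a(1) u' u \<phi> \<phi>]) simp
    finally show "ip_L2 \<Omega> w' \<phi> = \<a> u' \<phi>" .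
  qed
qed

text \<open>Two values at the same class differ by a function orthogonal to \<open>\<V>\<close>,
  which is zero almost everywhere. This makes the relation a function on classes.\<close>

lemma form_operator_unique:
  assumes uw: "(u, w) \<in> \<A>" "(u', w') \<in> \<A>" and eq: "\<epsilon> u = \<epsilon> u'"
  shows "\<epsilon> w = \<epsilon> w'"
proof -
  have a: "u \<in> \<V>" "w \<in> L2 \<Omega>" "u' \<in> \<V>" "w' \<in> L2 \<Omega>" using uw unfolding form_operator_iff by blast+
  have ae: "AE x in lebesgue_on \<Omega>. u' x = u x"
    using eq[symmetric] unfolding extend_l2_eq_iff[OF \<Omega>_sets \<V>_props(3)[OF a(3)] \<V>_props(3)[OF a(1)]] .
  have u: "(u, w') \<in> \<A>" by (rule form_operator_AE_cong[OF uw(2) ae]) simp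
  have "AE x in lebesgue_on \<Omega>. w x - w' x = 0"
  proof (rule AE_zero_if_orthogonal[OF extend_l2_diff(1)[OF \<Omega>_sets a(2,4)]])
    fix \<phi> assume \<phi>: "\<phi> \<in> \<V>"
    have "ip_L2 \<Omega> w \<phi> = \<a> u \<phi>" "ip_L2 \<Omega> w' \<phi> = \<a> u \<phi>" using uw(1) u \<phi> unfolding form_operator_iff by blast+
    then show "ip_L2 \<Omega> (\<lambda>x. w x - w' x) \<phi> = 0" unfolding ip_L2_diff_left[OF a(2,4) \<V>_props(3)[OF \<phi>]] by simp
  qed
  then have "AE x in lebesgue_on \<Omega>. w x = w' x" by eventually_elim simp
  then show ?thesis by (rule extend_l2_cong(2)[OF \<Omega>_sets a(2)])
qed

text \<open>The operator lives on the whole space; it vanishes on functions supported outside \<open>\<Omega>\<close>.\<close>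

definition op_dom :: "(real^'d, complex^'m) l2 set" where
  "op_dom = {X. \<exists>u w. (u, w) \<in> \<A> \<and> proj_l2 X = \<epsilon> u}"

definition op_shift :: "(real^'d, complex^'m) l2 \<Rightarrow> (real^'d, complex^'m) l2" where
  "op_shift X = (SOME Y. \<exists>u w. (u, w) \<in> \<A> \<and> proj_l2 X = \<epsilon> u \<and> Y = \<epsilon> w + \<omega> *\<^sub>R \<epsilon> u)"

text \<open>The choice in \<open>op_shift\<close> is harmless by
  \<open>form_operator_unique\<close>: every admissible pair (u, w) yields the same value.\<close>

lemma op_eq:
  assumes uw: "(u, w) \<in> \<A>" and X: "proj_l2 X = \<epsilon> u"
  shows "X \<in> op_dom" "op_shift X = \<epsilon> w + \<omega> *\<^sub>R \<epsilon> u"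
proof -
  show "X \<in> op_dom" unfolding op_dom_def using assms by blast
  have "\<exists>u w. (u, w) \<in> \<A> \<and> proj_l2 X = \<epsilon> u \<and> op_shift X = \<epsilon> w + \<omega> *\<^sub>R \<epsilon> u"
    unfolding op_shift_def by (rule someI_ex) (use assms in blast)
  then obtain u' w' where uw': "(u', w') \<in> \<A>" "proj_l2 X = \<epsilon> u'" "op_shift X = \<epsilon> w' + \<omega> *\<^sub>R \<epsilon> u'" by blast
  have "\<epsilon> u' = \<epsilon> u" using X uw'(2) by simp
  then show "op_shift X = \<epsilon> w + \<omega> *\<^sub>R \<epsilon> u" unfolding uw'(3) using form_operator_unique[OF uw'(1) uw] by simp
qed

lemma op_domE:
  assumes "X \<in> op_dom"
  obtains u w where "(u, w) \<in> \<A>" "u \<in> \<V>" "u \<in> L2 \<Omega>" "w \<in> L2 \<Omega>" "proj_l2 X = \<epsilon> u" "op_shift X = \<epsilon> w + \<omega> *\<^sub>R \<epsilon> u"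
proof -
  obtain u w where uw: "(u, w) \<in> \<A>" "proj_l2 X = \<epsilon> u" using assms unfolding op_dom_def by blast
  have a: "u \<in> \<V>" "w \<in> L2 \<Omega>" using uw(1) unfolding form_operator_iff by blast+
  show thesis by (rule that[OF uw(1) a(1) \<V>_props(3)[OF a(1)] a(2) uw(2) op_eq(2)[OF uw]])
qed

lemma op_add:
  assumes "X \<in> op_dom" "Y \<in> op_dom"
  shows "X + Y \<in> op_dom" "op_shift (X + Y) = op_shift X + op_shift Y"
proof -
  obtain u w where uw: "(u, w) \<in> \<A>" "u \<in> \<V>" "u \<in> L2 \<Omega>" "w \<in> L2 \<Omega>" "proj_l2 X = \<epsilon> u" "op_shift X = \<epsilon> w + \<omega> *\<^sub>R \<epsilon> u"
    by (rule op_domE[OF assms(1)])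
  obtain u' w' where uw': "(u', w') \<in> \<A>" "u' \<in> \<V>" "u' \<in> L2 \<Omega>" "w' \<in> L2 \<Omega>" "proj_l2 Y = \<epsilon> u'" "op_shift Y = \<epsilon> w' + \<omega> *\<^sub>R \<epsilon> u'"
    by (rule op_domE[OF assms(2)])
  have p: "proj_l2 (X + Y) = \<epsilon> (\<lambda>x. u x + u' x)"
    unfolding proj_l2_add uw(5) uw'(5) extend_l2_add(2)[OF \<Omega>_sets uw(3) uw'(3)] ..
  note E = op_eq[OF form_operator_add[OF uw(1) uw'(1)] p]
  show "X + Y \<in> op_dom" by (rule E(1))
  show "op_shift (X + Y) = op_shift X + op_shift Y"
    unfolding E(2) uw(6) uw'(6) extend_l2_add(2)[OF \<Omega>_sets uw(3) uw'(3)] extend_l2_add(2)[OF \<Omega>_sets uw(4) uw'(4)]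
    by (simp only: scaleR_add_right add_ac)
qed

lemma op_scale:
  assumes "X \<in> op_dom"
  shows "scale_l2 c X \<in> op_dom" "op_shift (scale_l2 c X) = scale_l2 c (op_shift X)"
proof -
  obtain u w where uw: "(u, w) \<in> \<A>" "u \<in> \<V>" "u \<in> L2 \<Omega>" "w \<in> L2 \<Omega>" "proj_l2 X = \<epsilon> u" "op_shift X = \<epsilon> w + \<omega> *\<^sub>R \<epsilon> u"
    by (rule op_domE[OF assms])
  have p: "proj_l2 (scale_l2 c X) = \<epsilon> (\<lambda>x. c *s u x)"
    unfolding proj_l2_scale uw(5) extend_l2_cscale(2)[OF \<Omega>_sets uw(3)] ..
  note E = op_eq[OF form_operator_scale[OF uw(1)] p]
  show "scale_l2 c X \<in> op_dom" by (rule E(1))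
  show "op_shift (scale_l2 c X) = scale_l2 c (op_shift X)"
    unfolding E(2) uw(6) extend_l2_cscale(2)[OF \<Omega>_sets uw(3)] extend_l2_cscale(2)[OF \<Omega>_sets uw(4)]
    by (simp only: l2.sc_add_right l2.sc_scaleR)
qed

lemma form_operator_zero: "(\<lambda>x. 0, \<lambda>x. 0) \<in> \<A>"
proof -
  have z: "(\<lambda>x. 0 :: complex^'m) \<in> L2 \<Omega>" by (rule \<V>_props(3)[OF \<V>_zero])
  have "\<a> (\<lambda>x. 0) \<phi> = 0" if "\<phi> \<in> \<V>" for \<phi> :: "real^'d \<Rightarrow> complex^'m"
    using form_scale(1)[OF \<V>_zero that, of 0] by simp
  moreover have "ip_L2 \<Omega> (\<lambda>x. 0) \<phi> = 0" for \<phi> :: "real^'d \<Rightarrow> complex^'m" using ip_L2_scale_left[of \<Omega> 0 "\<lambda>x. 0" \<phi>] by simp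
  ultimately show ?thesis unfolding form_operator_iff using z \<V>_zero by simp
qed

text \<open>\<open>op_shift X\<close> is extended by zero, so the product sees only the part of X in
  \<Omega>, which is u. What remains is the real part of z times the shifted form at u.\<close>

lemma op_accretive:
  assumes z: "z \<in> open_sector \<mu>" and X: "X \<in> op_dom"
  shows "0 \<le> inner (scale_l2 z (op_shift X)) X"
proof -
  obtain u w where uw: "(u, w) \<in> \<A>" "u \<in> \<V>" "u \<in> L2 \<Omega>" "w \<in> L2 \<Omega>" "proj_l2 X = \<epsilon> u" "op_shift X = \<epsilon> w + \<omega> *\<^sub>R \<epsilon> u"
    by (rule op_domE[OF X])
  have wu: "(\<lambda>x. complex_of_real \<omega> *s u x) \<in> L2 \<Omega>" by (rule extend_l2_cscale(1)[OF \<Omega>_sets uw(3)])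
  let ?v = "\<lambda>x. w x + complex_of_real \<omega> *s u x"
  note add = extend_l2_add[OF \<Omega>_sets uw(4) wu]
  have v: "?v \<in> L2 \<Omega>" "\<epsilon> ?v = op_shift X"
    unfolding add(2) extend_l2_cscale(2)[OF \<Omega>_sets uw(3)] uw(6) l2.sc_of_real by (rule add(1), rule refl)
  note zv = extend_l2_cscale[OF \<Omega>_sets v(1), of z]
  have "ip_L2 \<Omega> w u = \<a> u u" using uw(1,2) unfolding form_operator_iff by blast
  then have "ip_L2 \<Omega> ?v u = shifted_form u u"
    unfolding ip_L2_add_left[OF uw(4) wu uw(3)] ip_L2_scale_left shifted_form_def by simp
  then have "inner (scale_l2 z (op_shift X)) X = Re (z * shifted_form u u)"
    unfolding v(2)[symmetric] zv(2)[symmetric] inner_extend_proj[OF zv(1), of X] uw(5) Re_ip_L2[OF \<Omega>_sets zv(1) uw(3), symmetric]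
      ip_L2_scale_left by simp
  moreover have "0 \<le> (Re z - \<mu> * \<bar>Im z\<bar>) * \<alpha> * ((norm (\<iota> u))\<^sup>2 - (norm (\<epsilon> u))\<^sup>2)"
  proof (intro mult_nonneg_nonneg)
    show "0 \<le> Re z - \<mu> * \<bar>Im z\<bar>" using z unfolding open_sector_def by simp
    show "0 \<le> (norm (\<iota> u))\<^sup>2 - (norm (\<epsilon> u))\<^sup>2"
      using power_mono[OF norm_extend_le_\<iota>[OF uw(3) \<V>_props(4)[OF uw(2)]] norm_ge_zero, of 2] by simp
  qed (use \<alpha>_pos in simp)
  ultimately show ?thesis using sector_bound[OF uw(2) z] by simp
qed

text \<open>Inside \<Omega> the equation is the weak one; outside, the operator vanishes and X has
  to coincide with Y. Hence the solution is \<open>\<epsilon> u\<close> plus the part Y -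
  \<open>proj_l2 Y\<close> of Y outside \<Omega>.\<close>

lemma op_range:
  assumes z: "z \<in> open_sector \<mu>"
  shows "\<exists>X\<in>op_dom. X + scale_l2 z (op_shift X) = Y"
proof -
  have z0: "z \<noteq> 0" by (rule open_sector_nonzero[OF z])
  note f = rep_l2_in_L2[OF \<Omega>_sets, of Y]
  obtain u where u: "u \<in> \<V>" "\<And>v. v \<in> \<V> \<Longrightarrow> ip_L2 \<Omega> u v + z * shifted_form u v = ip_L2 \<Omega> (rep_l2 Y) v"
    by (rule weak_solution[OF z f]) (assumption | rule that)+
  note uL = \<V>_props(3)[OF u(1)]
  define d where "d x = rep_l2 Y x - u x" for x
  have d: "d \<in> L2 \<Omega>" "\<epsilon> d = proj_l2 Y - \<epsilon> u"
    unfolding d_def[abs_def] proj_l2_def by (rule extend_l2_diff[OF \<Omega>_sets f uL])+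
  note zd = extend_l2_cscale[OF \<Omega>_sets d(1), of "1 / z"] and wu = extend_l2_cscale[OF \<Omega>_sets uL, of "complex_of_real \<omega>"]
  \<comment> \<open>The value of the unshifted operator at u, obtained by solving u + z (w +
    \<omega> u) = Y on \<Omega> for w.\<close>
  define w where "w x = (1 / z) *s d x - complex_of_real \<omega> *s u x" for x
  note diff = extend_l2_diff[OF \<Omega>_sets zd(1) wu(1)]
  have w: "w \<in> L2 \<Omega>" "\<epsilon> w = scale_l2 (1 / z) (\<epsilon> d) - \<omega> *\<^sub>R \<epsilon> u"
    unfolding w_def[abs_def] by (rule diff(1), unfold diff(2) zd(2) wu(2) l2.sc_of_real, rule refl)
  have "(u, w) \<in> \<A>"
    unfolding form_operator_iff
  proof (intro conjI ballI u(1) w(1))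
    fix \<phi> assume \<phi>: "\<phi> \<in> \<V>"
    note \<phi>L = \<V>_props(3)[OF \<phi>]
    have "ip_L2 \<Omega> w \<phi> = (1 / z) * (ip_L2 \<Omega> (rep_l2 Y) \<phi> - ip_L2 \<Omega> u \<phi>) - complex_of_real \<omega> * ip_L2 \<Omega> u \<phi>"
      unfolding w_def[abs_def] ip_L2_diff_left[OF zd(1) wu(1) \<phi>L] ip_L2_scale_left
      unfolding d_def[abs_def] ip_L2_diff_left[OF f uL \<phi>L] ..
    also have "ip_L2 \<Omega> (rep_l2 Y) \<phi> - ip_L2 \<Omega> u \<phi> = z * shifted_form u \<phi>" using u(2)[OF \<phi>] by (simp add: algebra_simps)
    finally show "ip_L2 \<Omega> w \<phi> = \<a> u \<phi>" using z0 by (simp add: shifted_form_def)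
  qed
  moreover have "proj_l2 (\<epsilon> u + (Y - proj_l2 Y)) = \<epsilon> u"
    unfolding proj_l2_add proj_l2_diff proj_l2_proj_l2 proj_l2_extend[OF uL] by simp
  ultimately have X: "\<epsilon> u + (Y - proj_l2 Y) \<in> op_dom" "op_shift (\<epsilon> u + (Y - proj_l2 Y)) = \<epsilon> w + \<omega> *\<^sub>R \<epsilon> u" by (rule op_eq)+
  have "scale_l2 z (\<epsilon> w + \<omega> *\<^sub>R \<epsilon> u) = \<epsilon> d"
    unfolding w(2) using z0 by (simp flip: l2.sc_mult)
  then have "\<epsilon> u + (Y - proj_l2 Y) + scale_l2 z (op_shift (\<epsilon> u + (Y - proj_l2 Y))) = Y"
    unfolding X(2) d(2) by simp
  with X(1) show ?thesis by blast
qed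

text \<open>An accretive operator with full range is densely defined in a Hilbert space: if Y is
  orthogonal to the domain and Y = X + B X with B the operator, then 0 = (Y, X) >= |X|^2, so X and
  with it Y vanish.\<close>

lemma op_dense: "closure op_dom = UNIV"
proof (rule subspace_dense_if_orthogonal_trivial)
  have z: "(0 :: (real^'d, complex^'m) l2) \<in> op_dom"
  proof -
    have "proj_l2 0 = 0" using proj_l2_scaleR[of 0 0] by simp
    also have "0 = \<epsilon> (\<lambda>x. 0 :: complex^'m)"
      using extend_l2_scaleR[OF \<Omega>_sets \<V>_props(3)[OF \<V>_zero], of 0] by simp
    finally show ?thesis by (rule op_eq(1)[OF form_operator_zero])
  qed
  show "subspace op_dom"
  proof (rule subspaceI[OF z op_add(1)])
    fix r :: real and X assume "X \<in> op_dom"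
    from op_scale(1)[OF this, of "complex_of_real r"] show "r *\<^sub>R X \<in> op_dom" unfolding l2.sc_of_real .
  qed
  fix Y assume orth: "\<And>X. X \<in> op_dom \<Longrightarrow> inner Y X = 0"
  have one: "complex_of_real 1 \<in> open_sector \<mu>" by (rule of_real_in_open_sector) simp
  obtain X where X: "X \<in> op_dom" "X + scale_l2 (complex_of_real 1) (op_shift X) = Y" using op_range[OF one, of Y] by blast
  have "0 = inner X X + inner (scale_l2 (complex_of_real 1) (op_shift X)) X"
    using orth[OF X(1)] unfolding X(2)[symmetric] inner_add_left by simp
  then have "inner X X \<le> 0" using op_accretive[OF one X(1)] by simp
  then have "inner X X = 0" using inner_ge_zero by (rule antisym)
  then have X0: "X = 0" by (simp only: inner_eq_zero_iff)
  have "op_shift 0 = 0" using op_add(2)[OF z z] by simp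
  then show "Y = 0" using X(2) unfolding X0 by simp
qed

end

sublocale elliptic_form \<subseteq> sem: m_sectorial scale_l2 op_dom op_shift \<mu>
proof
  show "0 \<in> op_dom"
  proof -
    obtain X where X: "X \<in> op_dom" using op_dense by (metis all_not_in_conv closure_empty UNIV_not_empty)
    from op_scale(1)[OF X, of 0] show ?thesis by simp
  qed
qed (use \<mu>_pos in \<open>simp_all add: op_add op_scale op_accretive op_range op_dense\<close>)

section \<open>The semigroup\<close>

context elliptic_form
begin

lemma norm_proj_l2_le: "norm (proj_l2 X) \<le> norm X"
proof -
  have "(norm (proj_l2 X))\<^sup>2 = inner (proj_l2 X) X"
    using inner_extend_proj[OF rep_l2_in_L2[OF \<Omega>_sets, of X], of X] unfolding power2_norm_eq_inner proj_l2_def by simp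
  also have "\<dots> \<le> norm (proj_l2 X) * norm X" by (rule norm_cauchy_schwarz)
  finally have "norm (proj_l2 X) * norm (proj_l2 X) \<le> norm (proj_l2 X) * norm X" by (simp only: power2_eq_square)
  then show ?thesis by (cases "proj_l2 X = 0") simp_all
qed

lemma bounded_linear_proj_l2: "bounded_linear proj_l2"
  by (rule bounded_linear_intro[where K=1]) (simp_all only: proj_l2_add proj_l2_scaleR mult_1_right norm_proj_l2_le)

lemma L2_norm_rep: "L2_norm \<Omega> (rep_l2 X) = norm (proj_l2 X)"
  unfolding proj_l2_def norm_extend_l2[OF \<Omega>_sets rep_l2_in_L2[OF \<Omega>_sets]] ..

lemma bounded_op_rep:
  fixes L :: "(real^'d, complex^'m) l2 \<Rightarrow> (real^'d, complex^'m) l2"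
  assumes L: "linear L" and sc: "\<And>c X. L (scale_l2 c X) = scale_l2 c (L X)" and bound: "\<And>X. norm (L X) \<le> K * norm X"
  shows "bounded_op \<Omega> (\<lambda>f. rep_l2 (L (\<epsilon> f)))"
  unfolding bounded_op_def
proof (intro conjI ballI allI exI[of _ K])
  fix f :: "real^'d \<Rightarrow> complex^'m" assume f: "f \<in> L2 \<Omega>"
  show "rep_l2 (L (\<epsilon> f)) \<in> L2 \<Omega>" by (rule rep_l2_in_L2[OF \<Omega>_sets])
  show "L2_norm \<Omega> (rep_l2 (L (\<epsilon> f))) \<le> K * L2_norm \<Omega> f"
    unfolding L2_norm_rep norm_extend_l2[OF \<Omega>_sets f, symmetric] by (rule order_trans[OF norm_proj_l2_le bound])
  show "AE x in lebesgue_on \<Omega>. rep_l2 (L (\<epsilon> (\<lambda>y. c *s f y))) x = c *s rep_l2 (L (\<epsilon> f)) x" for c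
    unfolding extend_l2_cscale(2)[OF \<Omega>_sets f] sc AE_lebesgue_on_iff[OF \<Omega>_sets]
    using rep_scale_l2[of c "L (\<epsilon> f)"] by eventually_elim simp
  fix g :: "real^'d \<Rightarrow> complex^'m" assume g: "g \<in> L2 \<Omega>"
  show "AE x in lebesgue_on \<Omega>. rep_l2 (L (\<epsilon> (\<lambda>y. f y + g y))) x = rep_l2 (L (\<epsilon> f)) x + rep_l2 (L (\<epsilon> g)) x"
    unfolding extend_l2_add(2)[OF \<Omega>_sets f g] linear_add[OF L] AE_lebesgue_on_iff[OF \<Omega>_sets]
    using rep_l2_add[of "L (\<epsilon> f)" "L (\<epsilon> g)"] by eventually_elim simp
qed

text \<open>\<open>op_norm\<close> is a supremum of reals and only meaningful for a nonempty set
  bounded above. The zero function supplies the element and K the upper bound.\<close>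

lemma op_norm_bounds:
  fixes T :: "(real^'d \<Rightarrow> complex^'m) \<Rightarrow> real^'d \<Rightarrow> complex^'m"
  assumes "\<And>f. f \<in> L2 \<Omega> \<Longrightarrow> L2_norm \<Omega> f \<le> 1 \<Longrightarrow> L2_norm \<Omega> (T f) \<le> K"
  shows "0 \<le> op_norm \<Omega> T" "op_norm \<Omega> T \<le> K"
proof -
  define N where "N = {L2_norm \<Omega> (T f) | f. f \<in> L2 \<Omega> \<and> L2_norm \<Omega> f \<le> 1}"
  have z: "(\<lambda>x. 0 :: complex^'m) \<in> L2 \<Omega>" "L2_norm \<Omega> (\<lambda>x. 0 :: complex^'m) \<le> 1"
    by (rule \<V>_props(3)[OF \<V>_zero]) (simp add: L2_norm_def)
  have mem: "L2_norm \<Omega> (T (\<lambda>x. 0)) \<in> N"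
    unfolding N_def by (rule CollectI, rule exI[of _ "\<lambda>x. 0"]) (simp only: z simp_thms)
  have le: "x \<le> K" if "x \<in> N" for x
    using that unfolding N_def by (elim CollectE exE conjE) (simp only: assms)
  have bdd: "bdd_above N" by (rule bdd_aboveI[OF le])
  have "0 \<le> L2_norm \<Omega> (T (\<lambda>x. 0))" unfolding L2_norm_def by simp
  also have "\<dots> \<le> Sup N" by (rule cSup_upper[OF mem bdd])
  finally show "0 \<le> op_norm \<Omega> T" unfolding op_norm_def N_def .
  have "N \<noteq> {}" using mem by blast
  then show "op_norm \<Omega> T \<le> K" unfolding op_norm_def N_def[symmetric] by (rule cSup_least[OF _ le])
qed

abbreviation "\<U> \<equiv> sem.U \<omega>"

text \<open>\<open>op_shift\<close> takes values that vanish outside \<Omega>, so the resolvents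
  preserve this closed subspace and hence so does the semigroup. Passing to functions on \<Omega>
  and back therefore loses nothing when operators are composed.\<close>

lemma proj_U:
  assumes z: "z \<in> insert 0 (open_sector \<mu>)" and f: "f \<in> L2 \<Omega>"
  shows "proj_l2 (\<U> z (\<epsilon> f)) = \<U> z (\<epsilon> f)"
proof -
  have "\<U> z (\<epsilon> f) \<in> {X. proj_l2 X = X}"
  proof (rule sem.U_in_closed[OF _ _ _ z])
    show "closed {X. proj_l2 X = X}"
      by (rule closed_Collect_eq[OF linear_continuous_on[OF bounded_linear_proj_l2] continuous_on_id])
    show "\<epsilon> f \<in> {X. proj_l2 X = X}" using proj_l2_extend[OF f] by simp
    show "scale_l2 a X \<in> {X. proj_l2 X = X}" if "X \<in> {X. proj_l2 X = X}" for a X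
      using that by (simp add: proj_l2_scale)
    fix w X assume w: "w \<in> open_sector \<mu>" and X: "X \<in> {X. proj_l2 X = X}"
    let ?Y = "sem.F w X"
    obtain u v where uv: "(u, v) \<in> \<A>" "u \<in> \<V>" "u \<in> L2 \<Omega>" "v \<in> L2 \<Omega>" "proj_l2 ?Y = \<epsilon> u" "op_shift ?Y = \<epsilon> v + \<omega> *\<^sub>R \<epsilon> u"
      by (rule op_domE[OF sem.F_in[OF w]])
    have shift: "proj_l2 (op_shift ?Y) = op_shift ?Y"
      unfolding uv(6) proj_l2_add proj_l2_scaleR proj_l2_extend[OF uv(3)] proj_l2_extend[OF uv(4)] ..
    have eq: "?Y = X - scale_l2 w (op_shift ?Y)" using sem.F_eq[OF w, of X] by (simp add: eq_diff_eq)
    have "proj_l2 ?Y = proj_l2 X - scale_l2 w (proj_l2 (op_shift ?Y))"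
      using arg_cong[OF eq, of proj_l2] unfolding proj_l2_diff proj_l2_scale .
    also have "\<dots> = ?Y" unfolding shift using X eq by simp
    finally show "?Y \<in> {X. proj_l2 X = X}" by simp
  qed
  then show ?thesis by simp
qed

definition form_semigroup :: "complex \<Rightarrow> (real^'d \<Rightarrow> complex^'m) \<Rightarrow> real^'d \<Rightarrow> complex^'m" where
  "form_semigroup z f = rep_l2 (\<U> z (\<epsilon> f))"

lemma semigroup_in_L2: "form_semigroup z f \<in> L2 \<Omega>"
  unfolding form_semigroup_def by (rule rep_l2_in_L2[OF \<Omega>_sets])

lemma extend_semigroup:
  assumes "z \<in> insert 0 (open_sector \<mu>)" "f \<in> L2 \<Omega>"
  shows "\<epsilon> (form_semigroup z f) = \<U> z (\<epsilon> f)"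
  using proj_U[OF assms] unfolding form_semigroup_def proj_l2_def .

text \<open>Equality holds at every point, since both sides are the fixed representative of one and
  the same class.\<close>

lemma semigroup_add:
  assumes "z \<in> insert 0 (open_sector \<mu>)" "w \<in> insert 0 (open_sector \<mu>)" "f \<in> L2 \<Omega>"
  shows "form_semigroup (z + w) f = form_semigroup z (form_semigroup w f)"
  unfolding form_semigroup_def[of z] extend_semigroup[OF assms(2,3)] unfolding form_semigroup_def sem.U_semigroup[OF assms(1,2)] ..

lemma bounded_op_semigroup:
  assumes "z \<in> insert 0 (open_sector \<mu>)"
  shows "bounded_op \<Omega> (form_semigroup z)"
  using bounded_op_rep[OF sem.linear_U[OF assms] sem.U_sc[OF assms] sem.norm_U_le[OF assms]]
  unfolding form_semigroup_def[abs_def] .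

lemma L2_norm_semigroup_diff:
  assumes z: "z \<in> insert 0 (open_sector \<mu>)" and f: "f \<in> L2 \<Omega>" and g: "g \<in> L2 \<Omega>"
  shows "L2_norm \<Omega> (\<lambda>x. form_semigroup z f x - g x) = norm (\<U> z (\<epsilon> f) - \<epsilon> g)"
  using norm_extend_l2[OF \<Omega>_sets extend_l2_diff(1)[OF \<Omega>_sets semigroup_in_L2[of z f] g]]
  unfolding extend_l2_diff(2)[OF \<Omega>_sets semigroup_in_L2[of z f] g] extend_semigroup[OF z f] by simp

lemma U_tendsto:
  assumes z: "z \<in> open_sector \<mu>"
  shows "((\<lambda>w. \<U> w X) \<longlongrightarrow> \<U> z X) (at z)"
proof -
  obtain D' K \<delta> where D: "linear D'" "\<And>a X. D' (scale_l2 a X) = scale_l2 a (D' X)" "\<And>X. norm (D' X) \<le> K * norm X"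
    and \<delta>: "(\<delta> \<longlongrightarrow> 0) (at z)"
    and ev: "\<forall>\<^sub>F w in at z. w \<in> open_sector \<mu> \<and> (\<forall>X. norm (scale_l2 (1 / (w - z)) (\<U> w X - \<U> z X) - D' X) \<le> \<delta> w * norm X)"
    by (rule sem.U_differentiable[OF z, of \<omega>]) (rule that)
  show ?thesis
  proof (rule LIM_zero_cancel, rule Lim_null_comparison)
    show "\<forall>\<^sub>F w in at z. norm (\<U> w X - \<U> z X) \<le> cmod (w - z) * (\<delta> w * norm X + norm (D' X))"
      using ev eventually_neq_at_within[of z]
    proof eventually_elim
      case (elim w)
      let ?d = "\<U> w X - \<U> z X"
      have "?d = scale_l2 (w - z) (scale_l2 (1 / (w - z)) ?d)" using elim(2) by (simp flip: l2.sc_mult)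
      then have n1: "norm ?d = cmod (w - z) * norm (scale_l2 (1 / (w - z)) ?d)" using l2.norm_sc by metis
      have n2: "norm (scale_l2 (1 / (w - z)) ?d) \<le> \<delta> w * norm X + norm (D' X)"
        using elim(1) norm_triangle_sub[of "scale_l2 (1 / (w - z)) ?d" "D' X"] by (smt (verit))
      show ?case by (subst n1) (rule mult_left_mono[OF n2 norm_ge_zero])
    qed
    have "((\<lambda>w. cmod (w - z) * (\<delta> w * norm X + norm (D' X))) \<longlongrightarrow> cmod (z - z) * (0 * norm X + norm (D' X))) (at z)"
      by (intro tendsto_intros \<delta>)
    then show "((\<lambda>w. cmod (w - z) * (\<delta> w * norm X + norm (D' X))) \<longlongrightarrow> 0) (at z)" by simp
  qed
qed

lemma of_real_in_sector: "0 \<le> t \<Longrightarrow> complex_of_real t \<in> insert 0 (open_sector \<mu>)"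
  by (cases "t = 0") (simp_all add: of_real_in_open_sector)

lemma C0_semigroup: "C0_semigroup \<Omega> (\<lambda>t. form_semigroup (complex_of_real t))"
  unfolding C0_semigroup_def
proof (intro conjI allI impI ballI)
  show "bounded_op \<Omega> (form_semigroup (complex_of_real t))" if "0 \<le> t" for t
    by (rule bounded_op_semigroup[OF of_real_in_sector[OF that]])
  fix f :: "real^'d \<Rightarrow> complex^'m" assume f: "f \<in> L2 \<Omega>"
  show "AE x in lebesgue_on \<Omega>. form_semigroup (complex_of_real 0) f x = f x"
    unfolding form_semigroup_def of_real_0 sem.U_0 by (rule rep_extend_l2_on[OF \<Omega>_sets f])
  show "AE x in lebesgue_on \<Omega>. form_semigroup (complex_of_real (s + t)) f x
      = form_semigroup (complex_of_real s) (form_semigroup (complex_of_real t) f) x" if "0 \<le> s" "0 \<le> t" for s t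
    unfolding of_real_add semigroup_add[OF of_real_in_sector[OF that(1)] of_real_in_sector[OF that(2)] f] by simp
  fix t :: real assume t: "0 \<le> t"
  have lim: "((\<lambda>s. \<U> (complex_of_real s) (\<epsilon> f)) \<longlongrightarrow> \<U> (complex_of_real t) (\<epsilon> f)) (at t within {0..})"
  \<comment> \<open>At the vertex only limits from within the sector are available; at t > 0 the
    semigroup is differentiable in a full complex neighbourhood.\<close>
  proof (cases "t = 0")
    case True
    have "filterlim complex_of_real (at 0 within open_sector \<mu>) (at 0 within {0..})"
      unfolding filterlim_at
    proof
      show "\<forall>\<^sub>F s in at 0 within {0..}. complex_of_real s \<in> open_sector \<mu> \<and> complex_of_real s \<noteq> 0"
        unfolding eventually_at_filter by (rule always_eventually) (auto simp: less_le intro!: of_real_in_open_sector)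
      show "(complex_of_real \<longlongrightarrow> 0) (at 0 within {0..})"
        using tendsto_of_real[OF tendsto_ident_at, of "0 :: real" "{0..}"] by simp
    qed
    from filterlim_compose[OF sem.U_tendsto_id this] show ?thesis using True by simp
  next
    case False
    have "filterlim complex_of_real (at (complex_of_real t)) (at t within {0..})"
      unfolding filterlim_at
    proof
      show "\<forall>\<^sub>F s in at t within {0..}. complex_of_real s \<in> UNIV \<and> complex_of_real s \<noteq> complex_of_real t"
        unfolding eventually_at_filter by (rule always_eventually) simp
      show "(complex_of_real \<longlongrightarrow> complex_of_real t) (at t within {0..})" by (rule tendsto_of_real[OF tendsto_ident_at])
    qed
    from filterlim_compose[OF U_tendsto[OF of_real_in_open_sector] this] show ?thesis using False t by simp
  qed
  have ev: "\<forall>\<^sub>F s in at t within {0..}. norm (\<U> (complex_of_real s) (\<epsilon> f) - \<U> (complex_of_real t) (\<epsilon> f))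
      = L2_norm \<Omega> (\<lambda>x. form_semigroup (complex_of_real s) f x - form_semigroup (complex_of_real t) f x)"
    unfolding eventually_at_filter
    by (rule always_eventually)
       (simp add: L2_norm_semigroup_diff[OF of_real_in_sector f semigroup_in_L2] extend_semigroup[OF of_real_in_sector[OF t] f])
  show "((\<lambda>s. L2_norm \<Omega> (\<lambda>x. form_semigroup (complex_of_real s) f x - form_semigroup (complex_of_real t) f x)) \<longlongrightarrow> 0) (at t within {0..})"
    by (rule Lim_transform_eventually[OF tendsto_norm_zero[OF LIM_zero[OF lim]] ev])
qed

text \<open>In polar form tan |Arg z| < 1/\<mu> says \<mu> |sin (Arg z)| < cos (Arg z), the
  inequality of \<open>open_sector\<close> divided by the modulus.\<close>

lemma sector_subset: "sector (arctan (1 / \<mu>)) \<subseteq> open_sector \<mu>"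
proof
  fix z assume "z \<in> sector (arctan (1 / \<mu>))"
  then have z: "z \<noteq> 0" and A: "\<bar>Arg z\<bar> < arctan (1 / \<mu>)" unfolding sector_def by auto
  let ?A = "\<bar>Arg z\<bar>"
  have A2: "?A < pi / 2" using A arctan_ubound[of "1 / \<mu>"] by linarith
  have c: "0 < cos ?A" by (rule cos_gt_zero_pi) (use A2 in linarith)+
  have "tan ?A < tan (arctan (1 / \<mu>))"
    by (rule tan_monotone[OF _ A arctan_ubound]) (use A2 in linarith)
  then have "sin ?A / cos ?A < 1 / \<mu>" unfolding tan_arctan unfolding tan_def .
  then have "\<mu> * sin ?A < cos ?A" using c \<mu>_pos by (simp add: pos_divide_less_eq pos_less_divide_eq mult.commute)
  moreover have "sin ?A = \<bar>sin (Arg z)\<bar>"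
  proof -
    have "0 \<le> sin ?A" by (rule sin_ge_zero) (use A2 pi_gt_zero in linarith)+
    moreover have "sin ?A = sin (Arg z) \<or> sin ?A = - sin (Arg z)" by (auto simp: abs_if)
    ultimately show ?thesis by auto
  qed
  moreover have "cos ?A = cos (Arg z)" by (auto simp: abs_if)
  ultimately have "cmod z * (\<mu> * \<bar>sin (Arg z)\<bar>) < cmod z * cos (Arg z)" using z by (intro mult_strict_left_mono) simp_all
  moreover have "Re z = cmod z * cos (Arg z)" "Im z = cmod z * sin (Arg z)"
    using Re_rcis[of "cmod z" "Arg z"] Im_rcis[of "cmod z" "Arg z"] unfolding rcis_cmod_Arg by simp_all
  ultimately have "\<mu> * \<bar>Im z\<bar> < Re z" by (simp add: abs_mult mult_ac)
  then show "z \<in> open_sector \<mu>" unfolding open_sector_def by simp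
qed

lemma analytic_semigroup: "analytic_semigroup \<Omega> (\<lambda>t. form_semigroup (complex_of_real t))"
  unfolding analytic_semigroup_def
proof (rule exI[of _ "arctan (1 / \<mu>)"], rule exI[of _ form_semigroup], intro conjI allI impI ballI)
  let ?\<theta> = "arctan (1 / \<mu>)"
  have in_sector: "z \<in> insert 0 (open_sector \<mu>)" if "z \<in> insert 0 (sector ?\<theta>)" for z using that sector_subset by blast
  show "0 < ?\<theta>" using \<mu>_pos by simp
  show "?\<theta> \<le> pi / 2" using arctan_ubound[of "1 / \<mu>"] by linarith
  show "bounded_op \<Omega> (form_semigroup z)" if "z \<in> insert 0 (sector ?\<theta>)" for z by (rule bounded_op_semigroup[OF in_sector[OF that]])
  show "AE x in lebesgue_on \<Omega>. form_semigroup (z + w) f x = form_semigroup z (form_semigroup w f) x"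
    if "z \<in> insert 0 (sector ?\<theta>)" "w \<in> insert 0 (sector ?\<theta>)" "f \<in> L2 \<Omega>" for z w f
    unfolding semigroup_add[OF in_sector[OF that(1)] in_sector[OF that(2)] that(3)] by simp
  show "AE x in lebesgue_on \<Omega>. form_semigroup (complex_of_real t) f x = form_semigroup (complex_of_real t) f x" for t f by simp
next
  fix z assume "z \<in> sector (arctan (1 / \<mu>))"
  then have z: "z \<in> open_sector \<mu>" using sector_subset by blast
  then have z0: "z \<in> insert 0 (open_sector \<mu>)" by blast
  obtain D' K \<delta> where D: "linear D'" "\<And>a X. D' (scale_l2 a X) = scale_l2 a (D' X)" "\<And>X. norm (D' X) \<le> K * norm X"
    and \<delta>: "(\<delta> \<longlongrightarrow> 0) (at z)"
    and ev: "\<forall>\<^sub>F w in at z. w \<in> open_sector \<mu> \<and> (\<forall>X. norm (scale_l2 (1 / (w - z)) (\<U> w X - \<U> z X) - D' X) \<le> \<delta> w * norm X)"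
    by (rule sem.U_differentiable[OF z, of \<omega>]) (rule that)
  define D where "D f = rep_l2 (D' (\<epsilon> f))" for f :: "real^'d \<Rightarrow> complex^'m"
  have bD: "bounded_op \<Omega> D" unfolding D_def[abs_def] by (rule bounded_op_rep[OF D])
  have DL: "D f \<in> L2 \<Omega>" "\<epsilon> (D f) = proj_l2 (D' (\<epsilon> f))" for f
    unfolding D_def proj_l2_def by (rule rep_l2_in_L2[OF \<Omega>_sets], rule refl)
  let ?T = "\<lambda>w f x. (1 / (w - z)) *s (form_semigroup w f x - form_semigroup z f x) - D f x"
  have "\<forall>\<^sub>F w in at z. 0 \<le> op_norm \<Omega> (?T w) \<and> op_norm \<Omega> (?T w) \<le> \<bar>\<delta> w\<bar>"
    using ev
  proof eventually_elim
    case (elim w)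
    then have w: "w \<in> insert 0 (open_sector \<mu>)" by blast
    have "L2_norm \<Omega> (?T w f) \<le> \<bar>\<delta> w\<bar>" if f: "f \<in> L2 \<Omega>" "L2_norm \<Omega> f \<le> 1" for f
    proof -
      note d = extend_l2_diff[OF \<Omega>_sets semigroup_in_L2[of w f] semigroup_in_L2[of z f]]
      note s = extend_l2_cscale[OF \<Omega>_sets d(1), of "1 / (w - z)"]
      note t = extend_l2_diff[OF \<Omega>_sets s(1) DL(1)[of f]]
      \<comment> \<open>The error of the difference quotient in the Hilbert space. The function on
        \<Omega> corresponds to its projection, whose norm is no larger, so the bound \<delta> w
        carries over.\<close>
      let ?Y = "scale_l2 (1 / (w - z)) (\<U> w (\<epsilon> f) - \<U> z (\<epsilon> f)) - D' (\<epsilon> f)"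
      have "\<epsilon> (?T w f) = proj_l2 ?Y"
        unfolding t(2) s(2) d(2) DL(2) extend_semigroup[OF w f(1)] extend_semigroup[OF z0 f(1)]
          proj_l2_diff proj_l2_scale proj_U[OF w f(1)] proj_U[OF z0 f(1)] ..
      then have "L2_norm \<Omega> (?T w f) = norm (proj_l2 ?Y)" using norm_extend_l2[OF \<Omega>_sets t(1)] by simp
      also have "\<dots> \<le> norm ?Y" by (rule norm_proj_l2_le)
      also have "\<dots> \<le> \<delta> w * norm (\<epsilon> f)" using elim by blast
      also have "\<dots> \<le> \<bar>\<delta> w\<bar> * 1"
        unfolding norm_extend_l2[OF \<Omega>_sets f(1)] using f(2) by (intro mult_mono) (simp_all add: L2_norm_def)
      finally show ?thesis by simp
    qed
    then show ?case using op_norm_bounds[of "?T w" "\<bar>\<delta> w\<bar>"] by blast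
  qed
  then have "\<forall>\<^sub>F w in at z. 0 \<le> op_norm \<Omega> (?T w)" "\<forall>\<^sub>F w in at z. op_norm \<Omega> (?T w) \<le> \<bar>\<delta> w\<bar>"
    by (eventually_elim, simp)+
  from tendsto_sandwich[OF this tendsto_const tendsto_rabs_zero[OF \<delta>]]
  have "((\<lambda>w. op_norm \<Omega> (?T w)) \<longlongrightarrow> 0) (at z)" .
  with bD show "\<exists>D. bounded_op \<Omega> D \<and>
      ((\<lambda>w. op_norm \<Omega> (\<lambda>f x. (1 / (w - z)) *s (form_semigroup w f x - form_semigroup z f x) - D f x)) \<longlongrightarrow> 0) (at z)" by blast
next
  fix \<theta>' :: real and f :: "real^'d \<Rightarrow> complex^'m" assume \<theta>': "0 < \<theta>' \<and> \<theta>' < arctan (1 / \<mu>)" and f: "f \<in> L2 \<Omega>"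
  have sub: "sector \<theta>' \<subseteq> open_sector \<mu>"
    using \<theta>' sector_subset unfolding sector_def by fastforce
  have "\<forall>\<^sub>F z in at 0 within sector \<theta>'. norm (\<U> z (\<epsilon> f) - \<epsilon> f) = L2_norm \<Omega> (\<lambda>x. form_semigroup z f x - f x)"
    unfolding eventually_at_filter
    by (rule always_eventually) (use L2_norm_semigroup_diff[OF _ f f] sub in auto)
  then show "((\<lambda>z. L2_norm \<Omega> (\<lambda>x. form_semigroup z f x - f x)) \<longlongrightarrow> 0) (at 0 within sector \<theta>')"
    by (rule Lim_transform_eventually[OF tendsto_norm_zero[OF LIM_zero[OF tendsto_within_subset[OF sem.U_tendsto_id sub]]]])
qed

lemma generator_iff:
  assumes u: "u \<in> L2 \<Omega>" and w: "w \<in> L2 \<Omega>"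
  shows "(u, w) \<in> generator \<Omega> (\<lambda>t. form_semigroup (complex_of_real t)) \<longleftrightarrow> \<epsilon> u \<in> op_dom \<and> \<epsilon> w = \<omega> *\<^sub>R \<epsilon> u - op_shift (\<epsilon> u)"
proof -
  let ?q = "\<lambda>t. (1 / t) *\<^sub>R (\<U> (complex_of_real t) (\<epsilon> u) - \<epsilon> u)"
  have eq: "L2_norm \<Omega> (\<lambda>x. (1 / t) *\<^sub>R (form_semigroup (complex_of_real t) u x - u x) - w x) = norm (?q t - \<epsilon> w)" if t: "0 < t" for t
  proof -
    note d = extend_l2_diff[OF \<Omega>_sets semigroup_in_L2[of "complex_of_real t" u] u]
    note s = extend_l2_bounded_linear(1)[OF \<Omega>_sets bounded_linear_scaleR_right[of "1 / t"] d(1)] extend_l2_scaleR[OF \<Omega>_sets d(1), of "1 / t"]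
    note r = extend_l2_diff[OF \<Omega>_sets s(1) w]
    show ?thesis
      unfolding norm_extend_l2[OF \<Omega>_sets r(1), symmetric] r(2) s(2) d(2) extend_semigroup[OF of_real_in_sector[OF less_imp_le[OF t]] u] ..
  qed
  have "(u, w) \<in> generator \<Omega> (\<lambda>t. form_semigroup (complex_of_real t))
      \<longleftrightarrow> ((\<lambda>t. L2_norm \<Omega> (\<lambda>x. (1 / t) *\<^sub>R (form_semigroup (complex_of_real t) u x - u x) - w x)) \<longlongrightarrow> 0) (at_right 0)"
    unfolding generator_def using u w by simp
  also have "\<dots> \<longleftrightarrow> ((\<lambda>t. norm (?q t - \<epsilon> w)) \<longlongrightarrow> 0) (at_right 0)"
  proof (rule tendsto_cong)
    show "\<forall>\<^sub>F t in at_right 0. L2_norm \<Omega> (\<lambda>x. (1 / t) *\<^sub>R (form_semigroup (complex_of_real t) u x - u x) - w x) = norm (?q t - \<epsilon> w)"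
      unfolding eventually_at_filter by (rule always_eventually) (use eq in auto)
  qed
  also have "\<dots> \<longleftrightarrow> (?q \<longlongrightarrow> \<epsilon> w) (at_right 0)" unfolding tendsto_norm_zero_iff LIM_zero_iff ..
  also have "\<dots> \<longleftrightarrow> \<epsilon> u \<in> op_dom \<and> \<epsilon> w = \<omega> *\<^sub>R \<epsilon> u - op_shift (\<epsilon> u)" by (rule sem.U_generator)
  finally show ?thesis .
qed

text \<open>The multiple of u contributed by the exponential factor cancels the shift inside
  \<open>op_shift\<close>, leaving minus the form operator. Membership is then freed from
  representatives, because the form operator respects equality almost everywhere.\<close>

lemma generator_eq:
  "generator \<Omega> (\<lambda>t. form_semigroup (complex_of_real t)) = {(u, \<lambda>x. - w x) | u w. (u, w) \<in> \<A>}"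
proof -
  have neg: "(\<lambda>x. - w x) \<in> L2 \<Omega>" "\<epsilon> (\<lambda>x. - w x) = - \<epsilon> w" if "w \<in> L2 \<Omega>" for w :: "real^'d \<Rightarrow> complex^'m"
    using extend_l2_bounded_linear(1)[OF \<Omega>_sets bounded_linear_scaleR_right[of "-1"] that] extend_l2_scaleR[OF \<Omega>_sets that, of "-1"]
    by simp_all
  show ?thesis
  proof (intro set_eqI iffI)
    fix p assume p: "p \<in> generator \<Omega> (\<lambda>t. form_semigroup (complex_of_real t))"
    obtain u w where uw: "p = (u, w)" by (cases p)
    have L: "u \<in> L2 \<Omega>" "w \<in> L2 \<Omega>" using p unfolding uw generator_def by auto
    have g: "\<epsilon> u \<in> op_dom" "\<epsilon> w = \<omega> *\<^sub>R \<epsilon> u - op_shift (\<epsilon> u)" using p unfolding uw generator_iff[OF L] by blast+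
    obtain u' w' where a: "(u', w') \<in> \<A>" "u' \<in> \<V>" "u' \<in> L2 \<Omega>" "w' \<in> L2 \<Omega>" "proj_l2 (\<epsilon> u) = \<epsilon> u'" "op_shift (\<epsilon> u) = \<epsilon> w' + \<omega> *\<^sub>R \<epsilon> u'"
      by (rule op_domE[OF g(1)])
    have eu: "\<epsilon> u' = \<epsilon> u" using a(5) unfolding proj_l2_extend[OF L(1)] ..
    have ew: "\<epsilon> w' = \<epsilon> (\<lambda>x. - w x)" unfolding neg(2)[OF L(2)] g(2) a(6) eu by simp
    have A: "(u, \<lambda>x. - w x) \<in> \<A>"
      by (rule form_operator_AE_cong[OF a(1) eu[unfolded extend_l2_eq_iff[OF \<Omega>_sets a(3) L(1)]]
            ew[unfolded extend_l2_eq_iff[OF \<Omega>_sets a(4) neg(1)[OF L(2)]]]])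
    have p_eq: "p = (u, \<lambda>x. - (- w x))" unfolding uw by simp
    show "p \<in> {(u, \<lambda>x. - w x) | u w. (u, w) \<in> \<A>}"
      by (rule CollectI, rule exI[of _ u], rule exI[of _ "\<lambda>x. - w x"], rule conjI[OF p_eq A])
  next
    fix p assume "p \<in> {(u, \<lambda>x. - w x) | u w. (u, w) \<in> \<A>}"
    then obtain u w where uw: "p = (u, \<lambda>x. - w x)" "(u, w) \<in> \<A>" by blast
    have a: "u \<in> \<V>" "w \<in> L2 \<Omega>" using uw(2) unfolding form_operator_iff by blast+
    note u = \<V>_props(3)[OF a(1)]
    note E = op_eq[OF uw(2) proj_l2_extend[OF u]]
    show "p \<in> generator \<Omega> (\<lambda>t. form_semigroup (complex_of_real t))"
      unfolding uw(1) generator_iff[OF u neg(1)[OF a(2)]] neg(2)[OF a(2)] E(2) using E(1) by simp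
  qed
qed

lemma op_norm_semigroup_le:
  assumes t: "0 \<le> t"
  shows "op_norm \<Omega> (form_semigroup (complex_of_real t)) \<le> exp (\<omega> * t)"
proof (rule op_norm_bounds(2))
  fix f :: "real^'d \<Rightarrow> complex^'m" assume f: "f \<in> L2 \<Omega>" "L2_norm \<Omega> f \<le> 1"
  have "L2_norm \<Omega> (form_semigroup (complex_of_real t) f) = norm (\<U> (complex_of_real t) (\<epsilon> f))"
    unfolding norm_extend_l2[OF \<Omega>_sets semigroup_in_L2, symmetric] extend_semigroup[OF of_real_in_sector[OF t] f(1)] ..
  also have "\<dots> \<le> exp (\<omega> * Re (complex_of_real t)) * norm (\<epsilon> f)" by (rule sem.norm_U_le[OF of_real_in_sector[OF t]])
  also have "\<dots> \<le> exp (\<omega> * t) * 1" unfolding norm_extend_l2[OF \<Omega>_sets f(1)] Re_complex_of_real using f(2) by (rule mult_left_mono) simp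
  finally show "L2_norm \<Omega> (form_semigroup (complex_of_real t) f) \<le> exp (\<omega> * t)" by simp
qed

end

text \<open>The essential infimum is an extended real and may be infinite, for instance over a null
  set, so a positive real below it takes its place in the estimates.\<close>

lemma ess_inf_posD:
  assumes "0 < ess_inf M f"
  obtains r where "0 < r" "AE x in M. r \<le> f x"
proof -
  obtain r where r: "0 < ereal r" "ereal r < ess_inf M f" using ereal_dense2[OF assms] by blast
  have "AE x in M. r \<le> f x"
    using esssup_AE[of "\<lambda>x. - ereal (f x)" M]
  proof eventually_elim
    case (elim x)
    then have "ess_inf M f \<le> ereal (f x)" unfolding ess_inf_def using ereal_uminus_le_reorder by blast
    from less_le_trans[OF r(2) this] show ?case by simp
  qed
  with r(1) show thesis by (intro that) simp_all
qed

theorem proposition3p1: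
  fixes \<Omega> :: "(real^'d) set"
    and Q :: "real^'d \<Rightarrow> real^'d^'d"
    and A :: "'d \<Rightarrow> 'd \<Rightarrow> real^'d \<Rightarrow> real^'m^'m"
    and B C :: "'d \<Rightarrow> real^'d \<Rightarrow> real^'m^'m"
    and V W :: "real^'d \<Rightarrow> real^'m^'m"
    and \<V> :: "(real^'d \<Rightarrow> complex^'m) set"
    and c\<^sub>0 \<kappa>\<^sub>A \<kappa>\<^sub>B \<kappa>\<^sub>C \<kappa>\<^sub>W \<gamma> C\<^sub>\<gamma> :: real
  assumes \<Omega>: "open \<Omega>"
    and Q_bdd: "\<And>h k. (\<lambda>x. Q x $ h $ k) \<in> Linf_loc \<Omega>"
    and Q_sym: "AE x in lebesgue_on \<Omega>. transpose (Q x) = Q x \<and> 0 < min_eigenvalue (Q x)"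
    and Q_pos: "\<And>K. compact K \<Longrightarrow> K \<subseteq> \<Omega> \<Longrightarrow>
                  0 < ess_inf (lebesgue_on K) (\<lambda>x. min_eigenvalue (Q x))"
    and V_bdd: "V \<in> Linf_loc \<Omega>"
    and V_pos: "0 < ess_inf (lebesgue_on \<Omega>) (\<lambda>x. min_eigenvalue (sym_part (V x)))"
    and c0: "0 < c\<^sub>0"
    and V_sector: "AE x in lebesgue_on \<Omega>. \<forall>\<xi>.
          \<bar>Im (cinner (cmat (V x) *v \<xi>) \<xi>)\<bar> \<le> c\<^sub>0 * Re (cinner (cmat (V x) *v \<xi>) \<xi>)"
    and A_bdd: "\<And>h k. A h k \<in> Linf_loc \<Omega>"
    and \<kappa>A: "0 < \<kappa>\<^sub>A"
    and A_Re: "AE x in lebesgue_on \<Omega>. \<forall>\<theta> :: 'd \<Rightarrow> complex^'m.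
          0 \<le> Re (\<Sum>h\<in>UNIV. \<Sum>k\<in>UNIV. cinner (cmat (A h k x) *v \<theta> k) (\<theta> h)) \<and>
          Re (\<Sum>h\<in>UNIV. \<Sum>k\<in>UNIV. cinner (cmat (A h k x) *v \<theta> k) (\<theta> h))
            \<le> \<kappa>\<^sub>A * Re (qform (Q x) \<theta>)"
    and A_Im: "AE x in lebesgue_on \<Omega>. \<forall>\<theta> :: 'd \<Rightarrow> complex^'m.
          \<bar>Im (\<Sum>h\<in>UNIV. \<Sum>k\<in>UNIV. cinner (cmat (A h k x) *v \<theta> k) (\<theta> h))\<bar>
            \<le> \<kappa>\<^sub>A * Re (qform (Q x) \<theta>)"
    and B_bdd: "\<And>h. B h \<in> Linf_loc \<Omega>"
    and C_bdd: "\<And>h. C h \<in> Linf_loc \<Omega>"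
    and W_bdd: "W \<in> Linf_loc \<Omega>"
    and const_signs: "0 \<le> \<kappa>\<^sub>B" "0 \<le> \<kappa>\<^sub>C" "0 \<le> \<kappa>\<^sub>W" "0 < \<gamma>" "0 < C\<^sub>\<gamma>"
    and B_bound: "AE x in lebesgue_on \<Omega>. \<forall>(\<theta> :: 'd \<Rightarrow> complex^'m) \<eta>.
          cmod (\<Sum>h\<in>UNIV. cinner (cmat (B h x) *v \<theta> h) \<eta>)
            \<le> \<kappa>\<^sub>B * sqrt (Re (qform (Q x) \<theta>))
               * sqrt (\<gamma> * Re (cinner (cmat (sym_part (V x)) *v \<eta>) \<eta>) + C\<^sub>\<gamma> * (norm \<eta>)\<^sup>2)"
    and C_bound: "AE x in lebesgue_on \<Omega>. \<forall>(\<theta> :: 'd \<Rightarrow> complex^'m) \<eta>.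
          cmod (\<Sum>h\<in>UNIV. cinner (cmat (C h x) *v \<eta>) (\<theta> h))
            \<le> \<kappa>\<^sub>C * sqrt (Re (qform (Q x) \<theta>))
               * sqrt (\<gamma> * Re (cinner (cmat (sym_part (V x)) *v \<eta>) \<eta>) + C\<^sub>\<gamma> * (norm \<eta>)\<^sup>2)"
    and W_bound: "AE x in lebesgue_on \<Omega>. \<forall>\<xi> \<eta>.
          cmod (cinner (cmat (W x) *v \<xi>) \<eta>)
            \<le> \<kappa>\<^sub>W * sqrt (\<gamma> * Re (cinner (cmat (sym_part (V x)) *v \<xi>) \<xi>) + C\<^sub>\<gamma> * (norm \<xi>)\<^sup>2)
               * sqrt (\<gamma> * Re (cinner (cmat (sym_part (V x)) *v \<eta>) \<eta>) + C\<^sub>\<gamma> * (norm \<eta>)\<^sup>2)"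
    and K_pos: "4 * (1 / \<gamma> - \<kappa>\<^sub>W) - (\<kappa>\<^sub>B + \<kappa>\<^sub>C)\<^sup>2 > 0"
    and \<V>_closed: "closed_subspace_QV \<Omega> Q V \<V>"
    and \<V>_test: "test_functions \<Omega> \<subseteq> \<V>"
    and \<V>_trunc: "\<And>u. u \<in> \<V> \<Longrightarrow> (\<lambda>x. min 1 (norm (u x)) *\<^sub>R sgn (u x)) \<in> \<V>"
  shows "\<exists>T :: real \<Rightarrow> (real^'d \<Rightarrow> complex^'m) \<Rightarrow> (real^'d \<Rightarrow> complex^'m).
           C0_semigroup \<Omega> T \<and>
           analytic_semigroup \<Omega> T \<and>
           generator \<Omega> T
             = {(u, \<lambda>x. - w x) | u w. (u, w) \<in> form_operator \<Omega> \<V> (form_a \<Omega> Q A B C V W)} \<and>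
           (\<forall>t\<ge>0. op_norm \<Omega> (T t) \<le> exp (C\<^sub>\<gamma> * (\<kappa>\<^sub>W + (\<kappa>\<^sub>B + \<kappa>\<^sub>C)\<^sup>2 / 4) * t))"
proof -
  obtain v\<^sub>0 where v0: "0 < v\<^sub>0" "AE x in lebesgue_on \<Omega>. v\<^sub>0 \<le> min_eigenvalue (sym_part (V x))"
    by (rule ess_inf_posD[OF V_pos])
  have "AE x in lebesgue_on \<Omega>. coefficients_at_point (Q x) (\<lambda>h k. A h k x) (\<lambda>h. B h x) (\<lambda>h. C h x) (V x) (W x)
      v\<^sub>0 c\<^sub>0 \<kappa>\<^sub>A \<kappa>\<^sub>B \<kappa>\<^sub>C \<kappa>\<^sub>W \<gamma> C\<^sub>\<gamma>"
    using Q_sym v0(2) V_sector A_Re A_Im B_bound C_bound W_bound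
  proof eventually_elim
    case (elim x)
    show ?case
      by unfold_locales (use elim v0(1) c0 \<kappa>A const_signs K_pos in simp_all)
  qed
  moreover have "\<exists>l>0. AE x in lebesgue_on K. l \<le> min_eigenvalue (Q x)" if "compact K" "K \<subseteq> \<Omega>" for K
    using ess_inf_posD[OF Q_pos[OF that]] by blast
  ultimately interpret elliptic_form \<Omega> Q A B C V W \<V> v\<^sub>0 c\<^sub>0 \<kappa>\<^sub>A \<kappa>\<^sub>B \<kappa>\<^sub>C \<kappa>\<^sub>W \<gamma> C\<^sub>\<gamma>
    using \<Omega> Q_bdd A_bdd B_bdd C_bdd V_bdd W_bdd \<V>_closed \<V>_test v0(1) c0 \<kappa>A const_signs K_pos
    by unfold_locales (simp_all add: Linf_loc_def)
  show ?thesis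
    by (rule exI[of _ "\<lambda>t. form_semigroup (complex_of_real t)"])
       (intro conjI allI impI C0_semigroup analytic_semigroup generator_eq op_norm_semigroup_le)
qed

end
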